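(* Let $\Omega\subset\mathbb R^N$ be open and bounded with Lipschitz boundary. Let $W_0,W_1:\mathbb R^{d\times N\times N}_s\to[0,+\infty)$ be continuous functions for which there exist $\alpha,\beta>0$ such that $\alpha|\xi|\le W_i(\xi)\le\beta(1+|\xi|)$ for all $\xi$, $i=0,1$, and let $f(q,\xi):=qW_1(\xi)+(1-q)W_0(\xi)$, $q\in\{0,1\}$. Assume that $f$ is 2-quasiconvex in the second variable and that there exist $0<\gamma\le1$ and $C_0,L>0$ such that, for every $q\in\{0,1\}$, $\xi\in\mathbb R^{d\times N\times N}_s$ and $t>0$, $$t|\xi|>L\ \Longrightarrow\ \Big|f^\infty(q,\xi)-\frac{f(q,t\xi)}{t}\Big|\le C_0\frac{|\xi|^{1-\gamma}}{t^\gamma}.$$ Given $\chi\in BV(\Omega;\{0,1\})$ and $u\in BH(\Omega;\mathbb R^d)$, for $\mathcal H^{N-1}$-a.e. $x_0\in\Omega\cap(S_\chi\cup S_{\nabla u})$ we have $$g\big(\chi^+(x_0),\chi^-(x_0),(\nabla u)^+(x_0),(\nabla u)^-(x_0),\nu(x_0)\big)\ge K\big(\chi^+(x_0),\chi^-(x_0),(\nabla u)^+(x_0),(\nabla u)^-(x_0),\nu(x_0)\big),$$ where $\chi^+(x_0)=\chi^-(x_0)=\widetilde\chi(x_0)$ if $x_0\in S_{\nabla u}\setminus S_\chi$ and $(\nabla u)^+(x_0)=(\nabla u)^-(x_0)=\widetilde{\nabla u}(x_0)$ if $x_0\in S_\chi\setminus S_{\nabla u}$ (tilde denoting the approximate limit).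 Here, for $(a,b,C,D,\nu)\in\{0,1\}\times\{0,1\}\times\mathbb R^{d\times N}\times\mathbb R^{d\times N}\times\mathbb S^{N-1}$ with $C-D=P\otimes\nu$ for some $P\in\mathbb R^d$, $$K(a,b,C,D,\nu):=\inf\Big\{\int_{Q_\nu}(Q^2f)^\infty(\chi(x),\nabla^2u(x))\,dx+|D\chi|(Q_\nu):(\chi,u)\in\mathcal A(a,b,C,D,\nu)\Big\},$$ $$\mathcal A(a,b,C,D,\nu):=\{(\chi,u)\in BV(Q_\nu;\{0,1\})\times W^{2,1}(Q_\nu;\mathbb R^d):\chi=\chi_{a,b,\nu}\text{ on }\partial Q_\nu,\ u=u_{C,D,\nu}\text{ on }\partial Q_\nu\}.$$
   Context: $\mathbb R^{d\times N\times N}_s$ is the space of tensors $(\xi_{ijk})$ with $\xi_{ijk}=\xi_{ikj}$. $BV(A;\{0,1\})$: $BV$ functions with values in $\{0,1\}$. $BH(A;\mathbb R^d)$: functions $u\in W^{1,1}(A;\mathbb R^d)$ with $D^2u:=D(\nabla u)$ a bounded Radon measure. For $h(q,\xi)$, $h^\infty(q,\xi):=\limsup_{t\to+\infty}h(q,t\xi)/t$. With $Q$ the open unit cube centred at $0$, $Q^2f(q,\xi):=\inf\{\int_Qf(q,\xi+\nabla^2\varphi)\,dx:\varphi\in C_c^\infty(Q;\mathbb R^d)\}$; $f$ is 2-quasiconvex in the second variable if $f(q,\xi)\le\int_Qf(q,\xi+\nabla^2\varphi)\,dx$ for all $q,\xi$ and $\varphi\in C_c^\infty(Q;\mathbb R^d)$.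 $Q_\nu(x,\varepsilon)$ is the open cube with centre $x$, side-length $\varepsilon$ and two faces orthogonal to $\nu$; $Q_\nu:=Q_\nu(0,1)$. $\chi_{a,b,\nu}(y):=a$ if $y\cdot\nu\ge0$, $:=b$ if $y\cdot\nu<0$; $u_{C,D,\nu}(y):=Cy$ if $y\cdot\nu\ge0$, $:=Dy$ if $y\cdot\nu<0$. Boundary equalities are in the sense of traces. $S_w$ is the set of non-Lebesgue points of $w$; $w^\pm,\nu_w$ are the one-sided approximate limits and the normal at jump points. $\nu(x)=\nu_\chi(x)$ on $S_\chi\setminus S_{\nabla u}$, $\nu(x)=\nu_{\nabla u}(x)$ on $S_{\nabla u}\setminus S_\chi$, and $\mathcal H^{N-1}$-a.e. on $S_\chi\cap S_{\nabla u}$ it is the common normal, oriented so that $\chi^+=1$, $\chi^-=0$, with $(\nabla u)^\pm$ chosen accordingly. For an open set $A$, $F(\chi,u;A):=\int_Af(\chi,\nabla^2u)\,dx+|D\chi|(A)$ if $\chi\in BV(A;\{0,1\})$ and $u\in W^{2,1}(A;\mathbb R^d)$, $+\infty$ otherwise. $\mathcal F(\chi,u;A)$ is the infimum of $\liminf_nF(\chi_n,u_n;A)$ over $\{\chi_n\}\subset BV(A;\{0,1\})$, $\{u_n\}\subset W^{2,1}(A;\mathbb R^d)$ with $\chi_n\to\chi$ in $L^1(A;\{0,1\})$, $u_n\to u$ in $W^{1,1}(A;\mathbb R^d)$. For $A$ open with Lipschitz boundary, $$m(\chi,u;A):=\inf\{\mathcal F(\theta,v;A):\theta\in BV(\Omega;\{0,1\}),\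 v\in BH(\Omega;\mathbb R^d),\ \theta\equiv\chi\text{ on }\partial A,\ \operatorname{supp}(v-u)\Subset A\}$$ (for $A=Q_\nu(0,\varepsilon)$, $\Omega$ is replaced here by any bounded open Lipschitz set containing the closed cube), and $$g(a,b,C,D,\nu):=\limsup_{\varepsilon\to0^+}\varepsilon^{1-N}\,m(\chi_{a,b,\nu},u_{C,D,\nu};Q_\nu(0,\varepsilon)).$$ *)

theory Defs
  imports "HOL-Analysis.Analysis"
begin

text \<open>
  Conventions. \<open>\<real>\<^sup>N\<close> is \<^typ>\<open>real^'n\<close> and \<open>\<real>\<^sup>d\<close> is \<^typ>\<open>real^'d\<close>.  A gradient has type
  \<^typ>\<open>real^'n^'d\<close> with \<open>G $ i $ j = \<partial>\<^sub>j u\<^sub>i\<close>, a Hessian has type \<^typ>\<open>real^'n^'n^'d\<close> with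
  \<open>H $ i $ j $ k = \<partial>\<^sub>k \<partial>\<^sub>j u\<^sub>i\<close>; the norms of these types are the Euclidean ones.  Elements of
  \<open>L\<^sup>1(A)\<close> and of its subspaces are total functions of which only the values almost everywhere
  on \<open>A\<close> matter.  Energies are extended nonnegative reals.
  The \<open>{0,1}\<close>-valued function usually called \<open>\<chi>\<close> is written \<open>\<eta>\<close>, since \<open>\<chi>\<close> is the
  vector binder of \<^theory>\<open>HOL-Analysis.Finite_Cartesian_Product\<close>.
\<close>

definition sym_tensors :: "(real^'n^'n^'d) set" where
  "sym_tensors = {\<xi>. \<forall>i j k. \<xi> $ i $ j $ k = \<xi> $ i $ k $ j}"

subsection \<open>Test functions, weak derivatives, total variation\<close>

primrec C_k :: "nat \<Rightarrow> ('a::euclidean_space \<Rightarrow> 'b::real_normed_vector) \<Rightarrow> bool" where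
  "C_k 0 f \<longleftrightarrow> continuous_on UNIV f"
| "C_k (Suc k) f \<longleftrightarrow> (\<forall>x. f differentiable (at x)) \<and>
     (\<forall>v\<in>Basis. C_k k (\<lambda>x. frechet_derivative f (at x) v))"

definition test_functions :: "'a::euclidean_space set \<Rightarrow> ('a \<Rightarrow> 'b::real_normed_vector) set" where
  "test_functions A = {\<phi>. (\<forall>k. C_k k \<phi>) \<and>
     compact (closure {x. \<phi> x \<noteq> 0}) \<and> closure {x. \<phi> x \<noteq> 0} \<subseteq> A}"

definition pderiv_at :: "'n \<Rightarrow> (real^'n \<Rightarrow> 'b::real_normed_vector) \<Rightarrow> real^'n \<Rightarrow> 'b" where
  "pderiv_at j \<phi> x = frechet_derivative \<phi> (at x) (axis j 1)"

definition hessian :: "(real^'n \<Rightarrow> real^'d) \<Rightarrow> real^'n \<Rightarrow> real^'n^'n^'d" where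
  "hessian \<phi> x = (\<chi> i j k. pderiv_at k (pderiv_at j \<phi>) x $ i)"

definition weak_partial ::
  "(real^'n) set \<Rightarrow> 'n \<Rightarrow> (real^'n \<Rightarrow> 'b::euclidean_space) \<Rightarrow> (real^'n \<Rightarrow> 'b) \<Rightarrow> bool" where
  "weak_partial A j w g \<longleftrightarrow> (\<forall>\<phi>\<in>test_functions A.
     (LINT x:A|lebesgue. pderiv_at j \<phi> x *\<^sub>R w x) = - (LINT x:A|lebesgue. \<phi> x *\<^sub>R g x))"

definition is_weak_gradient ::
  "(real^'n) set \<Rightarrow> (real^'n \<Rightarrow> real^'d) \<Rightarrow> (real^'n \<Rightarrow> real^'n^'d) \<Rightarrow> bool" where
  "is_weak_gradient A u G \<longleftrightarrow> set_integrable lebesgue A G \<and>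
     (\<forall>j. weak_partial A j u (\<lambda>x. column j (G x)))"

definition W11 :: "(real^'n) set \<Rightarrow> (real^'n \<Rightarrow> real^'d) set" where
  "W11 A = {u. set_integrable lebesgue A u \<and> (\<exists>G. is_weak_gradient A u G)}"

definition weak_gradient :: "(real^'n) set \<Rightarrow> (real^'n \<Rightarrow> real^'d) \<Rightarrow> real^'n \<Rightarrow> real^'n^'d" where
  "weak_gradient A u = (SOME G. is_weak_gradient A u G)"

definition is_weak_hessian ::
  "(real^'n) set \<Rightarrow> (real^'n \<Rightarrow> real^'d) \<Rightarrow> (real^'n \<Rightarrow> real^'n^'n^'d) \<Rightarrow> bool" where
  "is_weak_hessian A u H \<longleftrightarrow> set_integrable lebesgue A H \<and>
     (\<forall>k. weak_partial A k (weak_gradient A u) (\<lambda>x. \<chi> i j. H x $ i $ j $ k))"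

definition W21 :: "(real^'n) set \<Rightarrow> (real^'n \<Rightarrow> real^'d) set" where
  "W21 A = {u \<in> W11 A. \<exists>H. is_weak_hessian A u H}"

definition weak_hessian :: "(real^'n) set \<Rightarrow> (real^'n \<Rightarrow> real^'d) \<Rightarrow> real^'n \<Rightarrow> real^'n^'n^'d" where
  "weak_hessian A u = (SOME H. is_weak_hessian A u H)"

text \<open>
  \<open>|Dw|(A)\<close> for open \<open>A\<close>, by duality: the supremum of \<open>\<integral>\<^sub>A \<Sum>\<^sub>j w \<bullet> \<partial>\<^sub>j \<Phi>\<^sub>j\<close> over test
  fields with \<open>|\<Phi>| \<le> 1\<close>.  It is finite iff \<open>Dw\<close> is a bounded Radon measure on \<open>A\<close>.
\<close>

definition total_variation :: "(real^'n) set \<Rightarrow> (real^'n \<Rightarrow> 'b::euclidean_space) \<Rightarrow> ennreal" where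
  "total_variation A w =
     (SUP \<Phi>\<in>{\<Phi> :: real^'n \<Rightarrow> 'b^'n. \<Phi> \<in> test_functions A \<and> (\<forall>x. norm (\<Phi> x) \<le> 1)}.
        ennreal (LINT x:A|lebesgue. (\<Sum>j\<in>UNIV. w x \<bullet> (pderiv_at j \<Phi> x $ j))))"

definition BV :: "(real^'n) set \<Rightarrow> (real^'n \<Rightarrow> 'b::euclidean_space) set" where
  "BV A = {w. set_integrable lebesgue A w \<and> total_variation A w < \<infinity>}"

definition BV01 :: "(real^'n) set \<Rightarrow> (real^'n \<Rightarrow> real) set" where
  "BV01 A = {\<eta> \<in> BV A. AE x in lebesgue. x \<in> A \<longrightarrow> \<eta> x \<in> {0, 1}}"

definition BH :: "(real^'n) set \<Rightarrow> (real^'n \<Rightarrow> real^'d) set" where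
  "BH A = {u \<in> W11 A. weak_gradient A u \<in> BV A}"

definition L1_tendsto ::
  "'a::euclidean_space set \<Rightarrow> (nat \<Rightarrow> 'a \<Rightarrow> 'b::euclidean_space) \<Rightarrow> ('a \<Rightarrow> 'b) \<Rightarrow> bool" where
  "L1_tendsto A W w \<longleftrightarrow> set_integrable lebesgue A w \<and> (\<forall>n. set_integrable lebesgue A (W n)) \<and>
     (\<lambda>n. LINT x:A|lebesgue. norm (W n x - w x)) \<longlonglongrightarrow> 0"

definition W11_tendsto ::
  "(real^'n) set \<Rightarrow> (nat \<Rightarrow> real^'n \<Rightarrow> real^'d) \<Rightarrow> (real^'n \<Rightarrow> real^'d) \<Rightarrow> bool" where
  "W11_tendsto A U u \<longleftrightarrow> u \<in> W11 A \<and> (\<forall>n. U n \<in> W11 A) \<and> L1_tendsto A U u \<and>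
     L1_tendsto A (\<lambda>n. weak_gradient A (U n)) (weak_gradient A u)"

definition ess_support :: "(real^'n) set \<Rightarrow> (real^'n \<Rightarrow> 'b::zero) \<Rightarrow> (real^'n) set" where
  "ess_support A w = A - \<Union>{V. open V \<and> (AE x in lebesgue. x \<in> A \<inter> V \<longrightarrow> w x = 0)}"

subsection \<open>Hausdorff measure, Lipschitz boundaries, approximate limits, traces\<close>

definition hausdorff_pre :: "nat \<Rightarrow> real \<Rightarrow> 'a::metric_space set \<Rightarrow> ennreal" where
  "hausdorff_pre s \<delta> E =
     (INF C\<in>{C :: nat \<Rightarrow> 'a set. E \<subseteq> \<Union>(range C) \<and> (\<forall>n. bounded (C n) \<and> diameter (C n) \<le> \<delta>)}.
        \<Sum>n. if C n = {} then 0
             else ennreal (unit_ball_vol (real s) * (diameter (C n) / 2) ^ s))"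

definition hausdorff_measure :: "nat \<Rightarrow> 'a::metric_space set \<Rightarrow> ennreal" where
  "hausdorff_measure s E = (SUP \<delta>\<in>{0<..}. hausdorff_pre s \<delta> E)"

definition hausdorff_ae :: "nat \<Rightarrow> 'a::metric_space set \<Rightarrow> ('a \<Rightarrow> bool) \<Rightarrow> bool" where
  "hausdorff_ae s E P \<longleftrightarrow> hausdorff_measure s {x\<in>E. \<not> P x} = 0"

text \<open>
  Near each boundary point the set is the strict subgraph, in some direction \<open>e\<close>, of a
  Lipschitz function on the hyperplane orthogonal to \<open>e\<close>.
\<close>

definition lipschitz_boundary :: "(real^'n) set \<Rightarrow> bool" where
  "lipschitz_boundary A \<longleftrightarrow> (\<forall>x\<in>frontier A. \<exists>r>0. \<exists>e h L. norm e = 1 \<and>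
     L-lipschitz_on {z. z \<bullet> e = 0} h \<and>
     A \<inter> ball x r = {y \<in> ball x r. y \<bullet> e < h (y - (y \<bullet> e) *\<^sub>R e)})"

text \<open>
  The approximate limit of \<open>w\<close> at \<open>x\<close> along \<open>A\<close>, \<open>r\<^sup>-\<^sup>N \<integral>\<^bsub>A \<inter> B(x,r)\<^esub> |w - z| \<rightarrow> 0\<close>.  For \<open>x\<close> in the
  interior of \<open>A\<close> it is the approximate limit, with \<open>A\<close> cut by a half space it is a one-sided
  limit, and for \<open>A\<close> with Lipschitz boundary and \<open>x\<close> on that boundary it is the trace.
\<close>

definition approx_limit ::
  "(real^'n) set \<Rightarrow> (real^'n \<Rightarrow> 'b::euclidean_space) \<Rightarrow> real^'n \<Rightarrow> 'b \<Rightarrow> bool" where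
  "approx_limit A w x z \<longleftrightarrow>
     ((\<lambda>r. (\<integral>\<^sup>+y\<in>A \<inter> ball x r. ennreal (norm (w y - z)) \<partial>lebesgue) / ennreal (r ^ CARD('n)))
        \<longlongrightarrow> 0) (at_right 0)"

definition non_lebesgue :: "(real^'n) set \<Rightarrow> (real^'n \<Rightarrow> 'b::euclidean_space) \<Rightarrow> (real^'n) set" where
  "non_lebesgue A w = {x\<in>A. \<nexists>z. approx_limit A w x z}"

definition jump_at ::
  "(real^'n) set \<Rightarrow> (real^'n \<Rightarrow> 'b::euclidean_space) \<Rightarrow> real^'n \<Rightarrow> 'b \<Rightarrow> 'b \<Rightarrow> real^'n \<Rightarrow> bool" where
  "jump_at A w x wp wm \<nu> \<longleftrightarrow> norm \<nu> = 1 \<and> wp \<noteq> wm \<and>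
     approx_limit (A \<inter> {y. (y - x) \<bullet> \<nu> > 0}) w x wp \<and>
     approx_limit (A \<inter> {y. (y - x) \<bullet> \<nu> < 0}) w x wm"

definition trace_eq ::
  "(real^'n) set \<Rightarrow> (real^'n \<Rightarrow> 'b::euclidean_space) \<Rightarrow> (real^'n \<Rightarrow> 'b) \<Rightarrow> bool" where
  "trace_eq A w w' \<longleftrightarrow> hausdorff_ae (CARD('n) - 1) (frontier A)
     (\<lambda>x. \<exists>z. approx_limit A w x z \<and> approx_limit A w' x z)"

text \<open>
  \<open>a = \<eta>\<^sup>+(x)\<close>, \<open>b = \<eta>\<^sup>-(x)\<close>, \<open>C = G\<^sup>+(x)\<close>, \<open>D = G\<^sup>-(x)\<close>, \<open>\<nu> = \<nu>(x)\<close>, where \<open>G = \<nabla>u\<close>.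
  The triple \<open>(w\<^sup>+, w\<^sup>-, \<nu>\<^sub>w)\<close> at a jump point is determined up to exchanging it
  for \<open>(w\<^sup>-, w\<^sup>+, -\<nu>\<^sub>w)\<close>; both are admitted where only one of \<open>\<eta>\<close>, \<open>G\<close> is discontinuous.
\<close>

definition blowup_data ::
  "(real^'n) set \<Rightarrow> (real^'n \<Rightarrow> real) \<Rightarrow> (real^'n \<Rightarrow> real^'n^'d) \<Rightarrow> real^'n \<Rightarrow>
   real \<Rightarrow> real \<Rightarrow> real^'n^'d \<Rightarrow> real^'n^'d \<Rightarrow> real^'n \<Rightarrow> bool" where
  "blowup_data A \<eta> G x a b C D \<nu> \<longleftrightarrow>
     (x \<in> non_lebesgue A \<eta> - non_lebesgue A G \<and>
        jump_at A \<eta> x a b \<nu> \<and> C = D \<and> approx_limit A G x C) \<or>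
     (x \<in> non_lebesgue A G - non_lebesgue A \<eta> \<and>
        jump_at A G x C D \<nu> \<and> a = b \<and> approx_limit A \<eta> x a) \<or>
     (x \<in> non_lebesgue A \<eta> \<inter> non_lebesgue A G \<and>
        a = 1 \<and> b = 0 \<and> jump_at A \<eta> x a b \<nu> \<and> jump_at A G x C D \<nu>)"

subsection \<open>Energies\<close>

definition mixture ::
  "(real^'n^'n^'d \<Rightarrow> real) \<Rightarrow> (real^'n^'n^'d \<Rightarrow> real) \<Rightarrow> real \<Rightarrow> real^'n^'n^'d \<Rightarrow> real" where
  "mixture W0 W1 q \<xi> = q * W1 \<xi> + (1 - q) * W0 \<xi>"

definition recession :: "(real \<Rightarrow> 'b::real_vector \<Rightarrow> real) \<Rightarrow> real \<Rightarrow> 'b \<Rightarrow> ereal" where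
  "recession h q \<xi> = Limsup at_top (\<lambda>t::real. ereal (h q (t *\<^sub>R \<xi>) / t))"

definition std_cube :: "(real^'n) set" where
  "std_cube = box (\<chi> i. - 1/2) (\<chi> i. 1/2)"

definition quasiconvex2 :: "(real \<Rightarrow> real^'n^'n^'d \<Rightarrow> real) \<Rightarrow> bool" where
  "quasiconvex2 f \<longleftrightarrow> (\<forall>q\<in>{0, 1}. \<forall>\<xi>\<in>sym_tensors. \<forall>\<phi>\<in>test_functions std_cube.
     f q \<xi> \<le> (LINT x:std_cube|lebesgue. f q (\<xi> + hessian \<phi> x)))"

definition Q2 :: "(real \<Rightarrow> real^'n^'n^'d \<Rightarrow> real) \<Rightarrow> real \<Rightarrow> real^'n^'n^'d \<Rightarrow> real" where
  "Q2 f q \<xi> = (INF \<phi>\<in>test_functions std_cube. LINT x:std_cube|lebesgue. f q (\<xi> + hessian \<phi> x))"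

definition energy ::
  "(real \<Rightarrow> real^'n^'n^'d \<Rightarrow> real) \<Rightarrow> (real^'n) set \<Rightarrow> (real^'n \<Rightarrow> real) \<Rightarrow> (real^'n \<Rightarrow> real^'d) \<Rightarrow> ennreal"
  where
  "energy f A \<eta> u = (if \<eta> \<in> BV01 A \<and> u \<in> W21 A
     then (\<integral>\<^sup>+x\<in>A. ennreal (f (\<eta> x) (weak_hessian A u x)) \<partial>lebesgue) + total_variation A \<eta>
     else \<infinity>)"

definition relaxed_energy ::
  "(real \<Rightarrow> real^'n^'n^'d \<Rightarrow> real) \<Rightarrow> (real^'n) set \<Rightarrow> (real^'n \<Rightarrow> real) \<Rightarrow> (real^'n \<Rightarrow> real^'d) \<Rightarrow> ennreal"
  where
  "relaxed_energy f A \<eta> u =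
     (INF (X, U)\<in>{(X, U). (\<forall>n. X n \<in> BV01 A) \<and> (\<forall>n. U n \<in> W21 A) \<and>
          L1_tendsto A X \<eta> \<and> W11_tendsto A U u}.
        liminf (\<lambda>n. energy f A (X n) (U n)))"

definition dirichlet_inf ::
  "(real \<Rightarrow> real^'n^'n^'d \<Rightarrow> real) \<Rightarrow> (real^'n) set \<Rightarrow>
   (real^'n \<Rightarrow> real) \<Rightarrow> (real^'n \<Rightarrow> real^'d) \<Rightarrow> (real^'n) set \<Rightarrow> ennreal"
  where
  "dirichlet_inf f \<Omega> \<eta> u A =
     (INF (\<theta>, v)\<in>{(\<theta>, v). \<theta> \<in> BV01 \<Omega> \<and> v \<in> BH \<Omega> \<and> trace_eq A \<theta> \<eta> \<and>
          compact (closure (ess_support \<Omega> (\<lambda>x. v x - u x))) \<and>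
          closure (ess_support \<Omega> (\<lambda>x. v x - u x)) \<subseteq> A}.
        relaxed_energy f A \<theta> v)"

definition step_fun :: "real \<Rightarrow> real \<Rightarrow> real^'n \<Rightarrow> real^'n \<Rightarrow> real" where
  "step_fun a b \<nu> y = (if y \<bullet> \<nu> \<ge> 0 then a else b)"

definition wedge_fun :: "real^'n^'d \<Rightarrow> real^'n^'d \<Rightarrow> real^'n \<Rightarrow> real^'n \<Rightarrow> real^'d" where
  "wedge_fun C D \<nu> y = (if y \<bullet> \<nu> \<ge> 0 then C *v y else D *v y)"

text \<open>
  A unit cube \<open>Q\<^sub>\<nu>\<close> centred at the origin with two faces orthogonal to \<open>\<nu>\<close> is not unique; the
  quantities below take the chosen cube \<open>Q\<close> as a parameter, with \<open>Q\<^sub>\<nu>(0,\<epsilon>) = \<epsilon> Q\<close>.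
\<close>

definition is_unit_cube :: "real^'n \<Rightarrow> (real^'n) set \<Rightarrow> bool" where
  "is_unit_cube \<nu> Q \<longleftrightarrow> (\<exists>T :: real^'n \<Rightarrow> real^'n.
     orthogonal_transformation T \<and> (\<exists>i. T (axis i 1) = \<nu>) \<and> Q = T ` std_cube)"

abbreviation scaled_cube :: "(real^'n) set \<Rightarrow> real \<Rightarrow> (real^'n) set" where
  "scaled_cube Q \<epsilon> \<equiv> (\<lambda>y. \<epsilon> *\<^sub>R y) ` Q"

text \<open>
  \<open>E \<epsilon>\<close> is the set on which the competitors for the cube \<open>Q\<^sub>\<nu>(0,\<epsilon>)\<close> are defined: any bounded
  open set with Lipschitz boundary that contains the closed cube.
\<close>

definition ambient_sets :: "(real^'n) set \<Rightarrow> (real \<Rightarrow> (real^'n) set) \<Rightarrow> bool" where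
  "ambient_sets Q E \<longleftrightarrow> (\<forall>\<epsilon>>0. open (E \<epsilon>) \<and> bounded (E \<epsilon>) \<and> lipschitz_boundary (E \<epsilon>) \<and>
     closure (scaled_cube Q \<epsilon>) \<subseteq> E \<epsilon>)"

definition surface_g ::
  "(real \<Rightarrow> real^'n^'n^'d \<Rightarrow> real) \<Rightarrow> (real^'n) set \<Rightarrow> (real \<Rightarrow> (real^'n) set) \<Rightarrow>
   real \<Rightarrow> real \<Rightarrow> real^'n^'d \<Rightarrow> real^'n^'d \<Rightarrow> real^'n \<Rightarrow> ennreal"
  where
  "surface_g f Q E a b C D \<nu> = Limsup (at_right 0) (\<lambda>\<epsilon>. ennreal (\<epsilon> powr (1 - real CARD('n))) *
     dirichlet_inf f (E \<epsilon>) (step_fun a b \<nu>) (wedge_fun C D \<nu>) (scaled_cube Q \<epsilon>))"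

definition surface_K ::
  "(real \<Rightarrow> real^'n^'n^'d \<Rightarrow> real) \<Rightarrow> (real^'n) set \<Rightarrow>
   real \<Rightarrow> real \<Rightarrow> real^'n^'d \<Rightarrow> real^'n^'d \<Rightarrow> real^'n \<Rightarrow> ennreal"
  where
  "surface_K f Q a b C D \<nu> =
     (INF (\<eta>, u)\<in>{(\<eta>, u). \<eta> \<in> BV01 Q \<and> u \<in> W21 Q \<and>
          trace_eq Q \<eta> (step_fun a b \<nu>) \<and> trace_eq Q u (wedge_fun C D \<nu>)}.
        (\<integral>\<^sup>+x\<in>Q. e2ennreal (recession (Q2 f) (\<eta> x) (weak_hessian Q u x)) \<partial>lebesgue) +
        total_variation Q \<eta>)"

end

theory Submission
 imports Defs
begin

text \<open>
  Near-optimal fields for the cell problem on a small cube are forced to take the boundary values of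
  the jump profile. For the set one cuts along a cube whose perimeter trace is small, which the trace
  condition provides; for the deformation one interpolates with an explicit smoothing of the wedge
  \<open>D y + max 0 (y \<bullet> \<nu>) P\<close> whose regularisation vanishes at the frontier, so that its Hessian has
  small mass in a boundary layer. Rescaling by \<open>\<epsilon>\<close> gives competitors for \<open>K\<close>; the quantitative
  recession estimate at \<open>t = 1/\<epsilon>\<close> and coercivity bound the error by \<open>O(\<epsilon>\<^sup>\<gamma> + \<epsilon>)\<close>. The inequality
  holds at every point with blow-up data, since these force \<open>a, b \<in> {0,1}\<close> and \<open>C - D = P \<otimes> \<nu>\<close>.
\<close>

text \<open>A recovery sequence for the relaxed energy converges only in L1 and W11 and ignores the
  frontier, while \<open>surface_K\<close> asks for exact traces. The jump profile cannot be pasted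
  in directly: where its gradient jumps it is not in W21, and a smoothing must have small Hessian
  mass near the frontier uniformly in its width. The smoothing weight is therefore the square of a
  polynomial vanishing on the faces; being a square, it dominates its squared gradient up to a
  constant, and integration by parts along the normal bounds what remains. The traces agree only
  almost everywhere for the Hausdorff measure, which is converted into a mass o(rho) of the
  difference in the layer of width rho; this leaves room for a radius at which the L1 distance grows
  slowly and the cut is cheap. The deformation is cut in one of many shells, selected by averaging,
  where the recovery sequence has little Hessian mass. A field \<open>V\<close> on the cube of size
  eps becomes \<open>V (eps y) / eps\<close>, whose Hessian carries a factor eps; hence
  \<open>eps * f (xi / eps)\<close> meets the recession function at \<open>xi\<close>, and
  \<open>Q2 f = f\<close> by quasiconvexity.\<close>

abbreviation leb :: "'a::euclidean_space measure" where "leb \<equiv> lebesgue"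
abbreviation lbm :: "('a::euclidean_space \<Rightarrow> 'b::topological_space) set" where "lbm \<equiv> borel_measurable lebesgue"
abbreviation sint where "sint A w \<equiv> set_integrable lebesgue A w"
abbreviation "idc \<equiv> indicator"
abbreviation "fdv \<equiv> frechet_derivative"
abbreviation "pdv \<equiv> pderiv_at"
abbreviation "tfs \<equiv> test_functions"

section \<open>Closure properties of the recursively defined smoothness classes
  \<open>C_k\<close>\<close>

lemma C_k_SucD:
 fixes f :: "'a::euclidean_space => 'b::real_normed_vector"
 shows "C_k (Suc k) f ==> C_k k f"
proof (induction k arbitrary: f)
 case 0
 thus ?case
  by (auto intro!: continuous_at_imp_continuous_on differentiable_imp_continuous_within)
next
 case (Suc k)
 thus ?case by (metis C_k.simps(2))
qed

lemma C_k_le: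
 fixes f :: "'a::euclidean_space => 'b::real_normed_vector"
 assumes "m <= n" "C_k n f" shows "C_k m f"
 using assms by (induction n rule: dec_induct) (auto dest: C_k_SucD simp del: C_k.simps)

lemma C_k_SucI:
 fixes f :: "'a::euclidean_space => 'b::real_normed_vector"
 assumes "!!x. (f has_derivative f' x) (at x)" "!!v. v : Basis ==> C_k k (%x. f' x v)"
 shows "C_k (Suc k) f"
proof -
 have "fdv f (at x) = f' x" for x
  using assms(1) frechet_derivative_at by metis
 thus ?thesis using assms by (auto simp: differentiable_def)
qed

lemma C_k_Suc_hasd:
 fixes f :: "'a::euclidean_space => 'b::real_normed_vector"
 shows "C_k (Suc k) f ==> (f has_derivative fdv f (at x)) (at x)"
 by (auto simp: frechet_derivative_works)

lemma C_k_const: "C_k k (%x::'a::euclidean_space. c::'b::real_normed_vector)"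
 by (induction k arbitrary: c) auto

lemma C_k_add:
 fixes f g :: "'a::euclidean_space => 'b::real_normed_vector"
 shows "C_k k f ==> C_k k g ==> C_k k (%x. f x + g x)"
proof (induction k arbitrary: f g)
 case 0 thus ?case by (auto intro: continuous_intros)
next
 case (Suc k)
 show ?case
 proof (rule C_k_SucI)
  show "((%x. f x + g x) has_derivative (%v. fdv f (at x) v + fdv g (at x) v)) (at x)" for x
  using Suc.prems by (intro has_derivative_add C_k_Suc_hasd)
 qed (use Suc in auto)
qed

lemma C_k_blin_comp:
 fixes f :: "'a::euclidean_space => 'b::real_normed_vector"
 assumes "bounded_linear h"
 shows "C_k k f ==> C_k k (%x. h (f x))"
proof (induction k arbitrary: f)
 case 0 thus ?case
  using bounded_linear.continuous_on[OF assms] by simp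
next
 case (Suc k)
 show ?case
 proof (rule C_k_SucI)
  show "((%x. h (f x)) has_derivative (%v. h (fdv f (at x) v))) (at x)" for x
  by (rule bounded_linear.has_derivative[OF assms C_k_Suc_hasd[OF Suc.prems]])
 qed (use Suc in auto)
qed

lemma C_k_scaleR:
 fixes f :: "'a::euclidean_space => real" and g :: "'a::euclidean_space => 'b::real_normed_vector"
 shows "C_k k f ==> C_k k g ==> C_k k (%x. f x *\<^sub>R g x)"
proof (induction k arbitrary: f g)
 case 0 thus ?case by (auto intro: continuous_intros)
next
 case (Suc k)
 show ?case
 proof (rule C_k_SucI)
  show "((%x. f x *\<^sub>R g x) has_derivative (%v. f x *\<^sub>R fdv g (at x) v + fdv f (at x) v *\<^sub>R g x)) (at x)" for x
  using Suc.prems by (intro has_derivative_scaleR C_k_Suc_hasd)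
  show "C_k k (%x. f x *\<^sub>R fdv g (at x) v + fdv f (at x) v *\<^sub>R g x)"
  if "v : Basis" for v
  using Suc that C_k_SucD[OF Suc.prems(1)] C_k_SucD[OF Suc.prems(2)] by (intro C_k_add Suc.IH) auto
 qed
qed

lemma C_k_mult:
 fixes f g :: "'a::euclidean_space => real"
 shows "C_k k f ==> C_k k g ==> C_k k (%x. f x * g x)"
 using C_k_scaleR[of k f g] by simp

lemma C_k_minus:
 fixes f :: "'a::euclidean_space => 'b::real_normed_vector"
 shows "C_k k f ==> C_k k (%x. - f x)"
 by (rule C_k_blin_comp[OF bounded_linear_minus[OF bounded_linear_ident]])

lemma C_k_diff:
 fixes f g :: "'a::euclidean_space => 'b::real_normed_vector"
 shows "C_k k f ==> C_k k g ==> C_k k (%x. f x - g x)"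
 using C_k_add[OF _ C_k_minus, of k f g] by simp

lemma C_k_sum:
 fixes f :: "'i => 'a::euclidean_space => 'b::real_normed_vector"
 shows "(!!i. i : I ==> C_k k (f i)) ==> C_k k (%x. \<Sum>i\<in>I. f i x)"
 by (induction I rule: infinite_finite_induct) (auto intro: C_k_const C_k_add)

lemma C_k_prod:
 fixes f :: "'i => 'a::euclidean_space => real"
 shows "(!!i. i : I ==> C_k k (f i)) ==> C_k k (%x. \<Prod>i\<in>I. f i x)"
 by (induction I rule: infinite_finite_induct) (auto intro: C_k_const C_k_mult)

lemma C_k_blin:
 fixes f :: "'a::euclidean_space => 'b::real_normed_vector"
 assumes "bounded_linear f" shows "C_k k f"
proof (cases k)
 case 0 thus ?thesis using assms by (simp add: linear_continuous_on)
next
 case (Suc n)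
 show ?thesis unfolding Suc
  by (rule C_k_SucI[OF bounded_linear_imp_has_derivative[OF assms] C_k_const])
qed

lemma C_k_ident: "C_k k (%x. x::'a::euclidean_space)"
 by (rule C_k_blin[OF bounded_linear_ident])

lemma C_k_inner_left: "C_k k (%x. x \<bullet> (e::'a::euclidean_space))"
 by (rule C_k_blin[OF bounded_linear_inner_left])

lemma C_k_deriv:
 fixes f :: "'a::euclidean_space => 'b::real_normed_vector"
 assumes "C_k (Suc k) f"
 shows "C_k k (%x. fdv f (at x) v)"
proof -
 have "fdv f (at x) v = (\<Sum>b\<in>Basis. (v \<bullet> b) *\<^sub>R fdv f (at x) b)" for x
 proof -
  have l: "linear (fdv f (at x))"
  using assms by (intro linear_frechet_derivative) auto
  show ?thesis
  by (subst euclidean_representation[of v, symmetric])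
  (simp add: linear_sum[OF l] linear_cmul[OF l])
 qed
 thus ?thesis
  using assms by (auto intro!: C_k_sum C_k_scaleR C_k_const)
qed

text \<open>The derivative of the composite is \<open>fdv g (at x) v\<close> times
  \<open>fdv f (at (g x)) 1\<close>, because a linear map on the reals is multiplication by its
  value at 1. The second factor is again a composite, of lower order, so the induction closes over
  all \<open>f\<close>.\<close>

lemma C_k_compose_real:
 fixes f :: "real => real" and g :: "'a::euclidean_space => real"
 shows "C_k k f ==> C_k k g ==> C_k k (%x. f (g x))"
proof (induction k arbitrary: f)
 case 0
 hence "continuous_on UNIV (f \<circ> g)"
  by (intro continuous_on_compose) (auto intro: continuous_on_subset)
 thus ?case by (simp add: o_def)
next
 case (Suc k)
 show ?case
 proof (rule C_k_SucI)
  fix x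
  have comp: "((f \<circ> g) has_derivative (fdv f (at (g x)) \<circ> fdv g (at x))) (at x)"
  using Suc.prems by (intro diff_chain_at C_k_Suc_hasd)
  have lin: "fdv f (at y) v = v * fdv f (at y) 1" for y v
  proof -
  have "linear (fdv f (at y))"
  using Suc.prems by (intro linear_frechet_derivative) auto
  from linear_cmul[OF this, of v 1] show ?thesis by simp
  qed
  have "fdv f (at (g x)) \<circ> fdv g (at x) =
  (%v. fdv g (at x) v * fdv f (at (g x)) 1)"
  by (rule ext) (simp only: o_def, rule lin)
  thus "((%x. f (g x)) has_derivative
  (%v. fdv g (at x) v * fdv f (at (g x)) 1)) (at x)"
  using comp by (simp only: o_def)
  show "C_k k (%x. fdv g (at x) v * fdv f (at (g x)) 1)"
  if "v : Basis" for v
  by (rule C_k_mult[OF C_k_deriv[OF Suc.prems(2)]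
  Suc.IH[OF C_k_deriv[OF Suc.prems(1)] C_k_SucD[OF Suc.prems(2)]]])
 qed
qed

lemma C_k_compose_affine:
 fixes f :: "'a::euclidean_space => 'b::real_normed_vector"
 shows "C_k k f ==> C_k k (%x. f (c *\<^sub>R x + t))"
proof (induction k arbitrary: f)
 case 0
 hence "continuous_on UNIV (f \<circ> (%x. c *\<^sub>R x + t))"
  by (intro continuous_on_compose continuous_intros) (auto intro: continuous_on_subset)
 thus ?case by (simp add: o_def)
next
 case (Suc k)
 show ?case
 proof (rule C_k_SucI)
  fix x
  have "((%x. c *\<^sub>R x + t) has_derivative (%v. c *\<^sub>R v)) (at x)"
  by (auto intro!: derivative_eq_intros)
  from diff_chain_at[OF this C_k_Suc_hasd[OF Suc.prems]]
  show "((%x. f (c *\<^sub>R x + t)) has_derivative (%v. fdv f (at (c *\<^sub>R x + t)) (c *\<^sub>R v))) (at x)"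
  by (simp add: o_def)
  show "C_k k (%x. fdv f (at (c *\<^sub>R x + t)) (c *\<^sub>R v))" if "v : Basis" for v
  using Suc.IH[OF C_k_deriv[OF Suc.prems]] .
 qed
qed

lemma C_k_inverse:
 fixes f :: "'a::euclidean_space => real"
 assumes nz: "!!x. f x ~= 0"
 shows "C_k k f ==> C_k k (%x. inverse (f x))"
proof (induction k)
 case 0 thus ?case using nz by (auto intro!: continuous_intros)
next
 case (Suc k)
 note IH = Suc.IH[OF C_k_SucD[OF Suc.prems]]
 show ?case
 proof (rule C_k_SucI)
  show "((%x. inverse (f x)) has_derivative
  (%v. - (inverse (f x) * fdv f (at x) v * inverse (f x)))) (at x)" for x
  using Suc.prems nz by (intro Deriv.has_derivative_inverse C_k_Suc_hasd)
  show "C_k k (%x. - (inverse (f x) * fdv f (at x) v * inverse (f x)))" if "v : Basis" for v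
  by (rule C_k_minus[OF C_k_mult[OF C_k_mult[OF IH C_k_deriv[OF Suc.prems]] IH]])
 qed
qed

lemma cont_on_C_k: "C_k k f ==> continuous_on A f"
 using C_k_le[of 0 k f] by (auto intro: continuous_on_subset)

section \<open>Smooth steps on the real line\<close>

text \<open>The powers of \<open>inverse x\<close> make the family closed under differentiation up
  to linear combinations: the derivative of member n involves members n + 1 and n + 2. Smoothness is
  then proved for all n in one induction on the order.\<close>

definition exp_bump :: "nat => real => real" where
 "exp_bump n x = (if x > 0 then inverse x ^ n * exp (- inverse x) else 0)"

lemma exp_bump_nonneg: "exp_bump n x >= 0"
 by (simp add: exp_bump_def)

lemma exp_bump_lim_0: "(exp_bump n \<longlongrightarrow> 0) (at_right 0)"
proof -
 have "((%x::real. inverse x ^ n / exp (inverse x)) \<longlongrightarrow> 0) (at_right 0)"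
  by (rule filterlim_compose[OF tendsto_power_div_exp_0 filterlim_inverse_at_top_right])
 thus ?thesis
  by (rule Lim_transform_eventually)
  (auto simp: eventually_at_filter exp_bump_def exp_minus divide_inverse)
qed

lemma exp_bump_hasd:
 "(exp_bump n has_real_derivative exp_bump (n + 2) x - real n * exp_bump (Suc n) x) (at x)"
proof -
 consider "x > 0" | "x < 0" | "x = 0" by linarith
 thus ?thesis
 proof cases
  case 1
  have inv: "(inverse has_real_derivative - (inverse x * inverse x)) (at x)"
  using DERIV_inverse'[OF DERIV_ident, of x] 1 by simp
  have "((%x. inverse x ^ n * exp (- inverse x)) has_real_derivative
  (real n * (- (inverse x * inverse x) * inverse x ^ (n - Suc 0))) * exp (- inverse x) +
  (exp (- inverse x) * - (- (inverse x * inverse x))) * inverse x ^ n) (at x)"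
  by (rule DERIV_mult[OF DERIV_power[OF inv] DERIV_chain2[OF DERIV_exp DERIV_minus[OF inv]]])
  moreover have "(real n * (- (inverse x * inverse x) * inverse x ^ (n - Suc 0))) * exp (- inverse x) +
  (exp (- inverse x) * - (- (inverse x * inverse x))) * inverse x ^ n
  = exp_bump (n + 2) x - real n * exp_bump (Suc n) x"
  using 1 by (cases n) (simp_all add: exp_bump_def)
  ultimately have "((%x. inverse x ^ n * exp (- inverse x)) has_real_derivative
  exp_bump (n + 2) x - real n * exp_bump (Suc n) x) (at x)"
  by simp
  thus ?thesis
  by (rule has_field_derivative_transform_within_open[where S="{0<..}"])
  (use 1 in "auto simp: exp_bump_def")
 next
  case 2
  have "((%x. 0) has_real_derivative exp_bump (n + 2) x - real n * exp_bump (Suc n) x) (at x)"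
  using 2 by (auto simp: exp_bump_def)
  thus ?thesis
  by (rule has_field_derivative_transform_within_open[where S="{..<0}"])
  (use 2 in "auto simp: exp_bump_def")
 next
  case 3
  \<comment> \<open>To the right of 0 the difference quotient at 0 is the next member of the family,
    which tends to 0; to the left it is identically 0.\<close>
  have r: "((%y. (exp_bump n y - exp_bump n 0) / (y - 0)) \<longlongrightarrow> 0) (at_right 0)"
  by (rule Lim_transform_eventually[OF exp_bump_lim_0[of "Suc n"]])
  (auto simp: eventually_at_filter exp_bump_def divide_inverse)
  have l: "((%y. (exp_bump n y - exp_bump n 0) / (y - 0)) \<longlongrightarrow> 0) (at_left 0)"
  by (rule Lim_transform_eventually[OF tendsto_const])
  (auto simp: eventually_at_filter exp_bump_def)
  have "exp_bump (n + 2) x - real n * exp_bump (Suc n) x = 0" using 3 by (simp add: exp_bump_def)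
  thus ?thesis unfolding has_field_derivative_iff 3
  using filterlim_split_at[OF l r] by simp
 qed
qed

lemma C_k_real_SucI:
 fixes f :: "real => real"
 assumes "!!x. (f has_real_derivative f' x) (at x)" "C_k k f'"
 shows "C_k (Suc k) f"
proof (rule C_k_SucI)
 show "(f has_derivative (*) (f' x)) (at x)" for x
  using assms(1) by (simp add: has_field_derivative_def)
qed (use assms(2) in auto)

lemma C_k_exp_bump: "C_k k (exp_bump n)"
proof (induction k arbitrary: n)
 case 0
 show ?case
  using exp_bump_hasd
  by (auto intro!: continuous_at_imp_continuous_on DERIV_isCont)
next
 case (Suc k)
 show ?case
  by (rule C_k_real_SucI[OF exp_bump_hasd])
  (rule C_k_diff[OF Suc C_k_mult[OF C_k_const Suc]])
qed

text \<open>The denominator never vanishes, since \<open>x\<close> and \<open>1 - x\<close> are not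
  both nonpositive; outside the unit interval one of the two bumps is zero, so the quotient is
  constant there.\<close>

definition sst :: "real => real" where
 "sst x = exp_bump 0 x * inverse (exp_bump 0 x + exp_bump 0 (1 - x))"

lemma C_k_sst: "C_k k sst"
proof -
 have "exp_bump 0 x + exp_bump 0 (1 - x) ~= 0" for x
 proof -
  have "exp_bump 0 x > 0 | exp_bump 0 (1 - x) > 0" by (simp add: exp_bump_def)
  thus ?thesis
  using exp_bump_nonneg[of 0 x] exp_bump_nonneg[of 0 "1 - x"] by linarith
 qed
 moreover have "C_k k (%x. exp_bump 0 (1 - x))"
  by (rule C_k_compose_real[OF C_k_exp_bump C_k_diff[OF C_k_const C_k_ident]])
 ultimately show ?thesis unfolding sst_def[abs_def]
  by (intro C_k_mult[OF C_k_exp_bump] C_k_inverse C_k_add[OF C_k_exp_bump])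
qed

lemma sst_eq_0: "x <= 0 ==> sst x = 0"
 by (simp add: sst_def exp_bump_def)

lemma sst_eq_1: "x >= 1 ==> sst x = 1"
 by (simp add: sst_def exp_bump_def)

lemma sst_bounds: "0 <= sst x" "sst x <= 1"
proof -
 have "exp_bump 0 x >= 0" "exp_bump 0 (1 - x) >= 0" by (auto simp: exp_bump_nonneg)
 thus "0 <= sst x" "sst x <= 1"
  unfolding sst_def by (auto simp: divide_inverse[symmetric] divide_le_eq_1)
qed

lemma sst_differentiable: "(sst has_real_derivative deriv sst x) (at x)"
proof -
 have "C_k (Suc 0) sst" by (rule C_k_sst)
 hence "sst differentiable at x" by auto
 thus ?thesis
  by (metis DERIV_deriv_iff_real_differentiable)
qed

lemma deriv_sst_cont: "continuous_on A (deriv sst)"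
proof -
 have "C_k (Suc 0) sst" by (rule C_k_sst)
 hence "continuous_on UNIV (%x. fdv sst (at x) 1)" by auto
 moreover have "fdv sst (at x) 1 = deriv sst x" for x
  using frechet_derivative_at[OF sst_differentiable[of x, unfolded has_field_derivative_def]]
  by (metis mult.right_neutral)
 ultimately show ?thesis by (auto intro: continuous_on_subset)
qed

lemma deriv_sst_eq_0:
 assumes "x < 0 | x > 1" shows "deriv sst x = 0"
proof -
 have "(sst has_real_derivative 0) (at x)"
 proof (cases "x < 0")
  case True
  show ?thesis
  by (rule has_field_derivative_transform_within_open[where S="{..<0}" and f="%x. 0"])
  (use True in "auto simp: sst_eq_0")
 next
  case False
  show ?thesis
  by (rule has_field_derivative_transform_within_open[where S="{1<..}" and f="%x. 1"])
  (use False assms in "auto simp: sst_eq_1")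
 qed
 thus ?thesis by (rule DERIV_imp_deriv)
qed

lemma deriv_sst_bdd: "\<exists>c>0. ALL x. \<bar>deriv sst x\<bar> <= c"
proof -
 have "compact (deriv sst ` {0..1})"
  by (intro compact_continuous_image deriv_sst_cont compact_Icc)
 hence "bounded (deriv sst ` {0..1})" by (rule compact_imp_bounded)
 then obtain c where c: "!!x. x : {0..1} ==> \<bar>deriv sst x\<bar> <= c"
  unfolding bounded_iff by (metis imageI real_norm_def)
 have "\<bar>deriv sst x\<bar> <= max c 1" for x
  using c[of x] deriv_sst_eq_0[of x] by (cases "x : {0..1}") auto
 thus ?thesis by (intro exI[of _ "max c 1"]) auto
qed

subsection \<open>Test functions\<close>

lemma tfI:
 fixes ph :: "'a::euclidean_space => 'b::real_normed_vector"
 assumes "!!k. C_k k ph" "compact K" "K <= A" "!!x. x ~: K ==> ph x = 0"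
 shows "ph : tfs A"
proof -
 have "closure {x. ph x ~= 0} <= K"
  using assms(2,4) by (intro closure_minimal compact_imp_closed) auto
 moreover from this have "compact (closure {x. ph x ~= 0})"
  using assms(2) by (metis closed_closure compact_Int_closed inf.absorb2)
 ultimately show ?thesis using assms by (auto simp: test_functions_def)
qed

lemma tfD:
 fixes ph :: "'a::euclidean_space => 'b::real_normed_vector"
 assumes "ph : tfs A"
 shows "C_k k ph" "compact (closure {x. ph x ~= 0})" "closure {x. ph x ~= 0} <= A"
  "x ~: A ==> ph x = 0"
 using assms closure_subset[of "{x. ph x ~= 0}"] by (auto simp: test_functions_def)

lemma tfE:
 fixes ph :: "'a::euclidean_space => 'b::real_normed_vector"
 assumes "ph : tfs A"
 obtains K where "compact K" "K <= A" "!!x. x ~: K ==> ph x = 0"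
 using tfD[OF assms] closure_subset[of "{x. ph x ~= 0}"] by blast

lemma tf_mono: "A <= B ==> ph : tfs A ==> ph : tfs B"
 by (auto simp: test_functions_def)

lemma hasd_0_if_locally_0:
 assumes "closed K" "!!x. x ~: K ==> f x = 0" "x ~: K"
 shows "(f has_derivative (%_. 0)) (at x)"
proof -
 have "((%_. 0) has_derivative (%_. 0)) (at x)" by simp
 thus ?thesis
  by (rule has_derivative_transform_within_open[of _ _ _ _ "- K"]) (use assms in auto)
qed

lemma fdv_0_if_locally_0:
 assumes "closed K" "!!x. x ~: K ==> f x = 0" "x ~: K"
 shows "fdv f (at x) v = 0"
 using fun_cong[where x=v, OF frechet_derivative_at[OF hasd_0_if_locally_0[OF assms]]] by simp

lemma tf_deriv:
 fixes ph :: "'a::euclidean_space => 'b::real_normed_vector"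
 assumes "ph : tfs A"
 shows "(%x. fdv ph (at x) v) : tfs A"
proof (rule tfE[OF assms])
 fix K assume K: "compact K" "K <= A" "!!x. x ~: K ==> ph x = 0"
 show ?thesis
 proof (rule tfI[OF _ K(1,2)])
  show "C_k k (%x. fdv ph (at x) v)" for k
  by (rule C_k_deriv[OF tfD(1)[OF assms]])
  show "fdv ph (at x) v = 0" if "x ~: K" for x
  by (rule fdv_0_if_locally_0[OF compact_imp_closed[OF K(1)] K(3) that])
 qed
qed

lemma tf_pderiv: "ph : tfs A ==> pdv j ph : tfs A"
 unfolding pderiv_at_def[abs_def] by (rule tf_deriv)

lemma C_k_pderiv: "C_k (Suc k) ph ==> C_k k (pdv j ph)"
 unfolding pderiv_at_def[abs_def] by (rule C_k_deriv)

lemma tf_scaleR: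
 fixes Fi :: "'a::euclidean_space => 'b::real_normed_vector"
 assumes "!!k. C_k k psi" "Fi : tfs A"
 shows "(%x. psi x *\<^sub>R Fi x) : tfs A"
proof (rule tfE[OF assms(2)])
 fix K assume K: "compact K" "K <= A" "!!x. x ~: K ==> Fi x = 0"
 show ?thesis
  by (rule tfI[OF _ K(1,2)])
  (use K C_k_scaleR[OF assms(1) tfD(1)[OF assms(2)]] in auto)
qed

lemma tf_mult:
 fixes Fi :: "'a::euclidean_space => real"
 assumes "!!k. C_k k psi" "Fi : tfs A"
 shows "(%x. psi x * Fi x) : tfs A"
 using tf_scaleR[OF assms] by simp

lemma C_k_1_pderiv_scaleR:
 assumes "C_k (Suc 0) f" "C_k (Suc 0) g"
 shows "pdv j (%x. f x *\<^sub>R g x) x = f x *\<^sub>R pdv j g x + pdv j f x *\<^sub>R g x"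
 unfolding pderiv_at_def
 using fun_cong[where x="axis j 1", OF frechet_derivative_at[OF has_derivative_scaleR[OF C_k_Suc_hasd[OF assms(1)]
  C_k_Suc_hasd[OF assms(2)]]]] by simp

lemma C_k_1_pderiv_mult:
 fixes f g :: "real^'n => real"
 assumes "C_k (Suc 0) f" "C_k (Suc 0) g"
 shows "pdv j (%x. f x * g x) x = f x * pdv j g x + pdv j f x * g x"
 using C_k_1_pderiv_scaleR[OF assms] by simp

text \<open>Applied to a cut-off with values in the unit interval, it gives a vanishing gradient
  wherever the value is 0 or 1, including the edge of a plateau, where the function is not locally
  constant.\<close>

lemma pderiv_at_eq_0_at_extremum:
 fixes f :: "real^'n => real"
 assumes "C_k (Suc 0) f" "(ALL y. f y <= f x) | (ALL y. f x <= f y)"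
 shows "pdv j f x = 0"
proof -
 have d: "(f has_derivative fdv f (at x)) (at x)"
  by (rule C_k_Suc_hasd[OF assms(1)])
 have "fdv f (at x) = (%h. 0)"
  using assms(2) has_derivative_local_min[OF d] has_derivative_local_max[OF d] by auto
 thus ?thesis by (simp add: pderiv_at_def)
qed

text \<open>It bounds the gradient of a product cut-off through the Lipschitz constant, so that the
  product itself never has to be differentiated.\<close>

lemma pderiv_at_le_lipschitz:
 fixes f :: "real^'n => real"
 assumes "C_k (Suc 0) f" "!!y z. \<bar>f y - f z\<bar> <= B * norm (y - z)"
 shows "\<bar>pdv j f x\<bar> <= B"
proof -
 have d: "(f has_derivative fdv f (at x)) (at x)"
  by (rule C_k_Suc_hasd[OF assms(1)])
 have l: "((%t. x + t *\<^sub>R axis j 1) has_derivative (%t. t *\<^sub>R axis j (1::real))) (at 0)"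
  by (auto intro!: derivative_eq_intros)
 have "((f \<circ> (%t. x + t *\<^sub>R axis j 1)) has_derivative
  (fdv f (at x) \<circ> (%t. t *\<^sub>R axis j 1))) (at 0)"
  by (rule diff_chain_at[OF l]) (use d in simp)
 moreover have "fdv f (at x) \<circ> (%t. t *\<^sub>R axis j 1) = (*) (pdv j f x)"
 proof -
  have "linear (fdv f (at x))"
  using assms by (intro linear_frechet_derivative) auto
  thus ?thesis by (auto simp: linear_cmul pderiv_at_def fun_eq_iff)
 qed
 ultimately have "((%t. f (x + t *\<^sub>R axis j 1)) has_real_derivative pdv j f x) (at 0)"
  by (simp add: has_field_derivative_def o_def)
 hence "((%t. (f (x + t *\<^sub>R axis j 1) - f x) / t) \<longlongrightarrow> pdv j f x) (at 0)"
  by (simp add: has_field_derivative_iff)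
 from tendsto_rabs[OF this] show ?thesis
 proof (rule tendsto_upperbound)
  have "\<bar>(f (x + t *\<^sub>R axis j 1) - f x) / t\<bar> <= B" if "t ~= 0" for t
  using assms(2)[of "x + t *\<^sub>R axis j 1" x] that by (simp add: norm_axis_1 field_simps)
  thus "\<forall>\<^sub>F t in at 0. \<bar>(f (x + t *\<^sub>R axis j 1) - f x) / t\<bar> <= B"
  by (auto simp: eventually_at_filter)
 qed simp
qed

subsection \<open>Integration by parts\<close>

lemma cont_csupp_bdd:
 fixes f :: "'a::topological_space => 'b::real_normed_vector"
 assumes "continuous_on UNIV f" "compact K" "!!x. x ~: K ==> f x = 0"
 shows "\<exists>B\<ge>0. ALL x. norm (f x) <= B"
proof -
 have "bounded (f ` K)"
  by (intro compact_imp_bounded compact_continuous_image assms(2) continuous_on_subset[OF assms(1)]) simp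
 then obtain B where "!!x. x : K ==> norm (f x) <= B" by (auto simp: bounded_iff)
 hence "norm (f x) <= max B 0" for x
  using assms(3)[of x] by (cases "x : K") (auto simp: le_max_iff_disj)
 thus ?thesis by (intro exI[of _ "max B 0"]) auto
qed

lemma intg_cont_csupp:
 fixes f :: "'a::euclidean_space => 'b::euclidean_space"
 assumes "continuous_on UNIV f" "compact K" "!!x. x ~: K ==> f x = 0"
 shows "integrable lborel f"
proof -
 have "integrable lborel (%x. idc K x *\<^sub>R f x)"
  by (intro borel_integrable_compact assms(2) continuous_on_subset[OF assms(1)]) simp
 also have "(%x. idc K x *\<^sub>R f x) = f" using assms(3) by (auto simp: indicator_def)
 finally show ?thesis .
qed

text \<open>Difference quotients have integral zero by translation invariance.\<close>

lemma int_dirder_eq_0_real: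
 fixes F :: "'a::euclidean_space => real"
 assumes der: "!!x. (F has_derivative F' x) (at x)" and cont: "continuous_on UNIV (%x. F' x v)"
  and K: "compact K" "!!x. x ~: K ==> F x = 0"
 shows "integral\<^sup>L lborel (%x. F' x v) = 0"
proof -
 have F'0: "F' x v = 0" if "x ~: K" for x
 proof -
  have "(F has_derivative (%_. 0)) (at x)"
  by (rule hasd_0_if_locally_0[OF compact_imp_closed[OF K(1)] K(2) that])
  from has_derivative_unique[OF der this] show ?thesis by simp
 qed
 obtain B where B: "B >= 0" "!!x. norm (F' x v) <= B"
  using cont_csupp_bdd[OF cont K(1) F'0] by auto
 have contF: "continuous_on UNIV F"
  by (rule continuous_at_imp_continuous_on) (use der has_derivative_continuous in blast)
 have intF: "integrable lborel F"
  by (rule intg_cont_csupp[OF contF K])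
 obtain R where R: "!!x. x : K ==> norm x <= R"
  using compact_imp_bounded[OF K(1)] by (auto simp: bounded_iff)
 have line: "((%t. F (t *\<^sub>R v + x)) has_real_derivative F' (t *\<^sub>R v + x) v) (at t within S)" for x t S
 proof -
  have l: "((%t. t *\<^sub>R v + x) has_derivative (%t. t *\<^sub>R v)) (at t)"
  by (auto intro!: derivative_eq_intros)
  have "((F \<circ> (%t. t *\<^sub>R v + x)) has_derivative (F' (t *\<^sub>R v + x) \<circ> (%t. t *\<^sub>R v))) (at t)"
  by (rule diff_chain_at[OF l der])
  moreover have "F' (t *\<^sub>R v + x) \<circ> (%t. t *\<^sub>R v) = (*) (F' (t *\<^sub>R v + x) v)"
  using linear_cmul[OF has_derivative_linear[OF der]] by (auto simp: fun_eq_iff)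
  ultimately have "((%t. F (t *\<^sub>R v + x)) has_real_derivative F' (t *\<^sub>R v + x) v) (at t)"
  by (simp add: has_field_derivative_def o_def)
  thus ?thesis by (rule has_field_derivative_at_within)
 qed
 define q where "q = (%n x. (F (inverse (real (Suc n)) *\<^sub>R v + x) - F x) / inverse (real (Suc n)))"
 have lim: "(%n. q n x) \<longlonglongrightarrow> F' x v" for x
 proof -
  have "((%t. (F (t *\<^sub>R v + x) - F x) / t) \<longlongrightarrow> F' x v) (at 0)"
  using line[of x 0 UNIV] by (simp add: has_field_derivative_iff)
  moreover have "filterlim (%n. inverse (real (Suc n))) (at 0) sequentially"
  using LIMSEQ_inverse_real_of_nat by (auto simp: filterlim_at)
  ultimately show ?thesis
  unfolding q_def by (rule filterlim_compose)
 qed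
 \<comment> \<open>The increments are at most \<open>norm v\<close> long, so every difference
   quotient vanishes outside the ball of radius \<open>R + norm v\<close>; inside, the mean value
   inequality gives \<open>B\<close>.\<close>
 have bound: "norm (q n x) <= B * idc (cball 0 (R + norm v)) x" for n x
 proof (cases "x : cball 0 (R + norm v)")
  case True
  have "norm (F (inverse (real (Suc n)) *\<^sub>R v + x) - F (0 *\<^sub>R v + x)) <= B * norm (inverse (real (Suc n)) - 0)"
  by (rule field_differentiable_bound[of UNIV "%t. F (t *\<^sub>R v + x)" "%t. F' (t *\<^sub>R v + x) v"])
  (use line B in auto)
  thus ?thesis using True by (simp add: q_def norm_mult abs_mult divide_simps del: of_nat_Suc)
 next
  case False
  have "x ~: K" using R[of x] False norm_ge_zero[of v] unfolding mem_cball dist_0_norm by linarith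
  moreover have "inverse (real (Suc n)) *\<^sub>R v + x ~: K"
  proof
  assume "inverse (real (Suc n)) *\<^sub>R v + x : K"
  hence "norm (inverse (real (Suc n)) *\<^sub>R v + x) <= R" by (rule R)
  moreover have "norm x <= norm (inverse (real (Suc n)) *\<^sub>R v + x) + norm (inverse (real (Suc n)) *\<^sub>R v)"
  using norm_triangle_ineq4[of "inverse (real (Suc n)) *\<^sub>R v + x" "inverse (real (Suc n)) *\<^sub>R v"] by simp
  moreover have "norm (inverse (real (Suc n)) *\<^sub>R v) <= 1 * norm v"
  unfolding norm_scaleR by (intro mult_right_mono) (auto simp: divide_simps)
  ultimately show False using False by (simp add: dist_norm)
  qed
  ultimately show ?thesis using K(2) False by (simp add: q_def)
 qed
 have "(%n. integral\<^sup>L lborel (q n)) \<longlonglongrightarrow> integral\<^sup>L lborel (%x. F' x v)"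
 proof (rule integral_dominated_convergence)
  show "(%x. F' x v) : borel_measurable lborel" using cont by (simp add: borel_measurable_continuous_onI)
  show "q n : borel_measurable lborel" for n
  unfolding q_def using contF
  by (simp, intro borel_measurable_continuous_onI continuous_intros continuous_on_compose2[OF contF]) auto
  show "integrable lborel (%x. B * idc (cball 0 (R + norm v)) x)"
  by (intro integrable_mult_right integrable_real_indicator) (auto simp: emeasure_bounded_finite[OF bounded_cball, unfolded infinity_ennreal_def])
 qed (use lim bound in auto)
 moreover have "integral\<^sup>L lborel (q n) = 0" for n
 proof -
  define c where "c = inverse (real (Suc n)) *\<^sub>R v"
  have mF: "F : borel_measurable borel" using contF by (rule borel_measurable_continuous_onI)
  have "integrable (distr lborel borel ((+) c)) F" using intF by (simp add: lborel_distr_plus)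
  hence i: "integrable lborel (%x. F (c + x))"
  by (subst (asm) integrable_distr_eq) (use mF in auto)
  have "integral\<^sup>L lborel F = integral\<^sup>L (distr lborel borel ((+) c)) F" by (simp add: lborel_distr_plus)
  also have "\<dots> = integral\<^sup>L lborel (%x. F (c + x))" by (rule integral_distr) (use mF in auto)
  finally show ?thesis using i intF by (simp add: q_def c_def)
 qed
 ultimately show ?thesis by (simp add: LIMSEQ_const_iff)
qed

lemma int_dirder_eq_0:
 fixes F :: "'a::euclidean_space => 'b::euclidean_space"
 assumes der: "!!x. (F has_derivative F' x) (at x)" and cont: "continuous_on UNIV (%x. F' x v)"
  and K: "compact K" "!!x. x ~: K ==> F x = 0"
 shows "integral\<^sup>L lborel (%x. F' x v) = 0"
proof (rule euclidean_eqI)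
 fix b :: 'b assume "b : Basis"
 have F'0: "F' x v = 0" if "x ~: K" for x
 proof -
  have "(F has_derivative (%_. 0)) (at x)"
  by (rule hasd_0_if_locally_0[OF compact_imp_closed[OF K(1)] K(2) that])
  from has_derivative_unique[OF der this] show ?thesis by simp
 qed
 have "integral\<^sup>L lborel (%x. F' x v) \<bullet> b = integral\<^sup>L lborel (%x. F' x v \<bullet> b)"
  using intg_cont_csupp[OF cont K(1) F'0] by simp
 also have "\<dots> = 0"
 proof (rule int_dirder_eq_0_real[OF _ _ K(1)])
  show "((%x. F x \<bullet> b) has_derivative (%v. F' x v \<bullet> b)) (at x)" for x
  by (rule has_derivative_inner_left[OF der])
  show "continuous_on UNIV (%x. F' x v \<bullet> b)"
  using cont by (intro continuous_intros)
 qed (use K in auto)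
 finally show "integral\<^sup>L lborel (%x. F' x v) \<bullet> b = 0 \<bullet> b" by simp
qed

subsection \<open>Volume of rotated boxes\<close>

text \<open>The change of variables theorems of the library need a well-ordered index type; a copy of an
 arbitrary finite index type can be well-ordered.\<close>

typedef 'a wo = "UNIV :: 'a::finite set" ..

instance wo :: (finite) finite
proof
 have "(UNIV :: 'a wo set) = range Abs_wo"
  by (metis Rep_wo_inverse surjI)
 thus "finite (UNIV :: 'a wo set)" by (metis finite finite_imageI)
qed

instantiation wo :: (finite) wellorder
begin

definition less_eq_wo :: "'a wo => 'a wo => bool" where
 "less_eq_wo x y \<longleftrightarrow> to_nat (Rep_wo x) <= to_nat (Rep_wo y)"

definition less_wo :: "'a wo => 'a wo => bool" where
 "less_wo x y \<longleftrightarrow> to_nat (Rep_wo x) < to_nat (Rep_wo y)"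

instance
proof
 fix P :: "'a wo => bool" and a
 assume step: "!!x. (!!y. y < x ==> P y) ==> P x"
 have "to_nat (Rep_wo x) = n ==> P x" for n x
  by (induction n arbitrary: x rule: less_induct) (auto intro: step simp: less_wo_def)
 thus "P a" by blast
qed (auto simp: less_eq_wo_def less_wo_def Rep_wo_inject)

end

lemma prod_Basis_cart: "(\<Prod>b\<in>Basis. (x::real^'n) \<bullet> b) = (\<Prod>j\<in>UNIV. x $ j)"
proof -
 have B: "(Basis :: (real^'n) set) = range (%j. axis j 1)" by (auto simp: Basis_vec_def)
 have "inj (%j. axis j (1::real) :: real^'n)" by (auto simp: inj_on_def axis_eq_axis)
 thus ?thesis by (simp add: B prod.reindex inner_axis)
qed

lemma distr_lborel_reindex:
 "distr lborel borel (%x::real^'n. (\<chi> i. x $ Rep_wo i)) = lborel"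
proof (rule lborel_eqI[symmetric])
 let ?r = "%x::real^'n. (\<chi> i. x $ Rep_wo i)"
 let ?s = "%x::real^'n wo. (\<chi> i. x $ Abs_wo i)"
 have m: "?r : borel_measurable borel"
  by (intro borel_measurable_continuous_onI continuous_intros)
 fix l u :: "real^'n wo" assume "!!b. b : Basis ==> l \<bullet> b <= u \<bullet> b"
 from this[of "axis j 1" for j] have le: "l $ j <= u $ j" for j by (simp add: inner_axis axis_in_Basis_iff)
 have "?r -` box l u = box (?s l) (?s u)"
  by (auto simp: mem_box_cart) (metis Abs_wo_inverse UNIV_I Rep_wo_inverse)+
 hence "emeasure (distr lborel borel ?r) (box l u) = emeasure lborel (box (?s l) (?s u))"
  using m by (simp add: emeasure_distr)
 also have "\<dots> = ennreal (\<Prod>b\<in>Basis. (?s u - ?s l) \<bullet> b)"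
  using le by (subst emeasure_lborel_box) (auto simp: Basis_vec_def inner_axis)
 also have "(\<Prod>b\<in>Basis. (?s u - ?s l) \<bullet> b) = (\<Prod>j\<in>UNIV. (u - l) $ j)"
  unfolding prod_Basis_cart
  by (rule prod.reindex_bij_witness[of _ Rep_wo Abs_wo]) (auto simp: Rep_wo_inverse Abs_wo_inverse)
 finally show "emeasure (distr lborel borel ?r) (box l u) = ennreal (\<Prod>b\<in>Basis. (u - l) \<bullet> b)"
  by (simp only: prod_Basis_cart)
qed simp

text \<open>Relabelling the coordinates by \<open>r\<close> preserves Lebesgue measure and scalar
  products, so \<open>f\<close> is conjugate to an orthogonal transformation \<open>F\<close> over
  the well-ordered copy of the index type, and the volume of images of boxes is computed
  there.\<close>

lemma measure_orthogonal_image_box: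
 fixes f :: "real^'n => real^'n"
 assumes f: "orthogonal_transformation f"
 shows "emeasure lborel (f ` box l u) = emeasure lborel (box l u)"
proof -
 define r where "r = (%x::real^'n. (\<chi> i. x $ Rep_wo i) :: real^'n wo)"
 define s where "s = (%x::real^'n wo. (\<chi> i. x $ Abs_wo i) :: real^'n)"
 have rs: "r (s x) = x" and sr: "s (r y) = y" for x y
  by (auto simp: r_def s_def vec_eq_iff Abs_wo_inverse Rep_wo_inverse)
 have lr: "linear r" "linear s" by (auto simp: r_def s_def linear_iff vec_eq_iff)
 have inn: "s x \<bullet> s y = x \<bullet> y" "r x' \<bullet> r y' = x' \<bullet> y'" for x y x' y'
  unfolding s_def r_def inner_vec_def
  apply (rule sum.reindex_bij_witness[of _ Rep_wo Abs_wo]; simp add: Rep_wo_inverse Abs_wo_inverse)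
  apply (rule sum.reindex_bij_witness[of _ Abs_wo Rep_wo]; simp add: Rep_wo_inverse Abs_wo_inverse)
  done
 have m: "r : borel_measurable borel" unfolding r_def
  by (intro borel_measurable_continuous_onI continuous_intros)
 have em: "emeasure lborel (r -` X) = emeasure lborel X" if "X : sets borel" for X
 proof -
  have "emeasure lborel X = emeasure (distr lborel borel r) X"
  unfolding r_def by (simp add: distr_lborel_reindex)
  also have "\<dots> = emeasure lborel (r -` X)" using m that by (simp add: emeasure_distr)
  finally show ?thesis by simp
 qed
 define F where "F = r \<circ> f \<circ> s"
 have F: "orthogonal_transformation F"
  using f lr unfolding orthogonal_transformation_def F_def
  by (auto intro!: linear_compose simp: inn)
 have eq: "f ` box l u = r -` (F ` box (r l) (r u))"
 proof -
  have b: "s ` box (r l) (r u) = box l u"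
  proof -
  have "x : box (r l) (r u) \<longleftrightarrow> s x : box l u" for x
  by (auto simp: mem_box_cart r_def s_def) (metis Abs_wo_inverse UNIV_I Rep_wo_inverse)+
  thus ?thesis using sr by (metis (no_types) image_eqI rs subsetI subset_antisym image_subsetI)
  qed
  have "f ` box l u = s ` (F ` box (r l) (r u))"
  unfolding F_def b[symmetric] image_comp by (simp add: o_def sr)
  also have "\<dots> = r -` (F ` box (r l) (r u))" by (auto simp: rs image_iff) (metis sr)
  finally show ?thesis .
 qed
 have oF: "open (F ` box (r l) (r u))"
  using orthogonal_transformation_surj[OF F] orthogonal_transformation_linear[OF F]
  by (intro open_surjective_linear_image) auto
 have lm: "F ` box (r l) (r u) : lmeasurable" by (rule measurable_orthogonal_image[OF F]) simp
 have "emeasure lborel (f ` box l u) = emeasure lborel (F ` box (r l) (r u))"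
  unfolding eq using oF by (intro em) auto
 also have "\<dots> = emeasure leb (F ` box (r l) (r u))" using oF by (simp add: emeasure_completion)
 also have "\<dots> = emeasure leb (box (r l) (r u))"
  using lm measure_orthogonal_image[OF F, of "box (r l) (r u)"] by (simp add: emeasure_eq_measure2)
 also have "\<dots> = emeasure lborel (r -` box (r l) (r u))"
  by (simp add: emeasure_completion em)
 also have "r -` box (r l) (r u) = box l u"
  by (auto simp: mem_box_cart r_def) (metis Abs_wo_inverse UNIV_I)+
 finally show ?thesis .
qed

subsection \<open>Orthonormal frames and rectangular cut-off functions\<close>

text \<open>The vectors \<open>e j\<close> are the axes of a cube with two faces orthogonal to a
  given direction. Working with scalar products against them keeps all functions on the original
  space, so that only volumes have to be rotated.\<close>

locale frame =
 fixes e :: "'n::finite => real^'n"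
 assumes orthonormal: "e j \<bullet> e k = (if j = k then 1 else 0)"
begin

definition rot :: "real^'n => real^'n" where "rot x = (\<Sum>j\<in>UNIV. x $ j *\<^sub>R e j)"

lemma rot_inner: "rot x \<bullet> e k = x $ k"
 by (simp add: rot_def inner_sum_left orthonormal if_distrib cong: if_cong)

lemma orthogonal_rot: "orthogonal_transformation rot"
proof -
 have "linear rot"
  by (rule linearI) (auto simp: rot_def algebra_simps sum.distrib scaleR_sum_right)
 moreover have "rot x \<bullet> rot y = x \<bullet> y" for x y
 proof -
  have "rot x \<bullet> rot y = rot x \<bullet> (\<Sum>k\<in>UNIV. y $ k *\<^sub>R e k)" by (simp only: rot_def[of y])
  also have "\<dots> = x \<bullet> y"
  by (simp only: inner_sum_right inner_scaleR_right rot_inner) (simp add: inner_vec_def mult.commute)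
  finally show ?thesis .
 qed
 ultimately show ?thesis by (simp add: orthogonal_transformation_def)
qed

lemma rot_surj: "EX x. y = rot x"
 using orthogonal_transformation_surj[OF orthogonal_rot] by (metis surjD)

lemma frame_expansion: "y = (\<Sum>j\<in>UNIV. (y \<bullet> e j) *\<^sub>R e j)"
 using rot_surj[of y] by (auto simp: rot_inner) (simp add: rot_def)

lemma norm_frame [simp]: "norm (e j) = 1"
 by (simp add: norm_eq_sqrt_inner orthonormal)

lemma abs_inner_frame_le: "\<bar>y \<bullet> e j\<bar> <= norm y"
 using Cauchy_Schwarz_ineq2[of y "e j"] by simp

lemma norm_le_sum_frame: "norm y <= (\<Sum>j\<in>UNIV. \<bar>y \<bullet> e j\<bar>)"
proof -
 have "norm y = norm (\<Sum>j\<in>UNIV. (y \<bullet> e j) *\<^sub>R e j)" using frame_expansion[of y] by simp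
 also have "\<dots> <= (\<Sum>j\<in>UNIV. \<bar>y \<bullet> e j\<bar>)"
  by (rule order_trans[OF norm_sum]) simp
 finally show ?thesis .
qed

definition slab :: "('n => real) => ('n => real) => (real^'n) set" where
 "slab l u = {y. ALL j. l j < y \<bullet> e j & y \<bullet> e j < u j}"

lemma open_slab: "open (slab l u)"
proof -
 have "slab l u = (\<Inter>j\<in>UNIV. {y. l j < y \<bullet> e j & y \<bullet> e j < u j})"
  by (auto simp: slab_def)
 also have "open \<dots>"
  by (intro open_INT finite ballI open_Collect_conj open_Collect_less continuous_intros)
 finally show ?thesis .
qed

lemma closed_cslab: "closed {y. ALL j. l j <= y \<bullet> e j & y \<bullet> e j <= u j}"
 by (intro closed_Collect_all closed_Collect_conj closed_Collect_le continuous_intros)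

lemma compact_cslab: "compact {y. ALL j. l j <= y \<bullet> e j & y \<bullet> e j <= u j}"
proof -
 have "norm y <= (\<Sum>j\<in>UNIV. \<bar>l j\<bar> + \<bar>u j\<bar>)" if "ALL j. l j <= y \<bullet> e j & y \<bullet> e j <= u j" for y
 proof -
  have "\<bar>y \<bullet> e j\<bar> <= \<bar>l j\<bar> + \<bar>u j\<bar>" for j using that[rule_format, of j] by linarith
  thus ?thesis by (intro order_trans[OF norm_le_sum_frame] sum_mono)
 qed
 thus ?thesis
  using closed_cslab by (auto simp: compact_eq_bounded_closed bounded_iff)
qed

lemma slab_eq_image: "slab l u = rot ` box (\<chi> j. l j) (\<chi> j. u j)"
proof (intro set_eqI iffI)
 fix y assume "y : slab l u"
 thus "y : rot ` box (\<chi> j. l j) (\<chi> j. u j)"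
  using rot_surj[of y] by (auto simp: slab_def rot_inner mem_box_cart)
qed (auto simp: slab_def rot_inner mem_box_cart)

lemma em_slab:
 assumes "!!j. l j <= u j"
 shows "emeasure lborel (slab l u) = ennreal (\<Prod>j\<in>UNIV. u j - l j)"
proof -
 have "emeasure lborel (slab l u) = emeasure lborel (box (\<chi> j. l j) (\<chi> j. u j))"
  unfolding slab_eq_image by (rule measure_orthogonal_image_box[OF orthogonal_rot])
 also have "\<dots> = ennreal (\<Prod>b\<in>Basis. ((\<chi> j. u j) - (\<chi> j. l j)) \<bullet> b)"
  using assms by (subst emeasure_lborel_box) (auto simp: Basis_vec_def inner_axis)
 finally show ?thesis by (simp add: prod_Basis_cart)
qed

lemma negligible_frame_hyperplane: "negligible {y. y \<bullet> e j = c}"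
proof -
 have "e j ~= 0" using norm_frame[of j] by force
 thus ?thesis using negligible_hyperplane[of "e j" c] by (simp add: inner_commute)
qed

text \<open>The parameter \<open>m\<close> is the reciprocal width of the transition layer: the
  value is 1 once every face is at distance at least \<open>1 / m\<close>, and 0 outside the
  slab.\<close>

definition cutoff :: "real => ('n => real) => ('n => real) => real^'n => real" where
 "cutoff m l u y = (\<Prod>j\<in>UNIV. sst (m * (y \<bullet> e j - l j)) * sst (m * (u j - y \<bullet> e j)))"

lemma C_k_cutoff: "C_k k (cutoff m l u)"
 unfolding cutoff_def[abs_def]
 by (intro C_k_prod C_k_mult C_k_compose_real[OF C_k_sst]
  C_k_mult[OF C_k_const] C_k_diff[OF C_k_inner_left C_k_const] C_k_diff[OF C_k_const C_k_inner_left])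

lemma cutoff_bounds: "0 <= cutoff m l u y" "cutoff m l u y <= 1"
 unfolding cutoff_def
 by (auto intro!: prod_nonneg prod_le_1 mult_nonneg_nonneg mult_le_one simp: sst_bounds)

lemma cutoff_eq_0: "m > 0 ==> y ~: slab l u ==> cutoff m l u y = 0"
 by (auto simp: cutoff_def slab_def not_less intro!: sst_eq_0 mult_nonneg_nonpos)

lemma cutoff_eq_1:
 assumes "!!j. m * (y \<bullet> e j - l j) >= 1" "!!j. m * (u j - y \<bullet> e j) >= 1"
 shows "cutoff m l u y = 1"
 using assms by (simp add: cutoff_def sst_eq_1)

lemma cutoff_in_tf:
 assumes "m > 0" "{y. ALL j. l j <= y \<bullet> e j & y \<bullet> e j <= u j} <= A"
 shows "cutoff m l u : tfs A"
proof (rule tfI[OF C_k_cutoff compact_cslab assms(2)])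
 fix y assume "y ~: {y. ALL j. l j <= y \<bullet> e j & y \<bullet> e j <= u j}"
 hence "y ~: slab l u" by (auto simp: slab_def intro: less_imp_le)
 thus "cutoff m l u y = 0" using cutoff_eq_0 assms by auto
qed

lemma cutoff_lim_indicator: "(%n. cutoff (real (Suc n)) l u y) \<longlonglongrightarrow> idc (slab l u) y"
proof (cases "y : slab l u")
 case True
 have "\<forall>\<^sub>F n in sequentially. cutoff (real (Suc n)) l u y = 1"
 proof -
  have ev: "\<forall>\<^sub>F n in sequentially. real (Suc n) * a >= 1" if "a > 0" for a
  proof -
  obtain N where N: "1 / a <= real N" using real_arch_simple by blast
  have "real (Suc n) * a >= 1" if "n >= N" for n
  proof -
  have "1 / a <= real (Suc n)" using N that by linarith
  thus ?thesis using \<open>a > 0\<close> by (simp add: divide_simps mult.commute)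
  qed
  thus ?thesis by (auto simp: eventually_sequentially)
  qed
  have "\<forall>\<^sub>F n in sequentially. \<forall>j\<in>UNIV. real (Suc n) * (y \<bullet> e j - l j) >= 1 & real (Suc n) * (u j - y \<bullet> e j) >= 1"
  using True by (intro eventually_ball_finite finite ballI eventually_conj ev) (auto simp: slab_def)
  thus ?thesis by eventually_elim (auto intro!: cutoff_eq_1)
 qed
 thus ?thesis using True by (simp add: tendsto_eventually)
qed (simp add: cutoff_eq_0)

text \<open>All factors lie in the unit interval, so the difference of the products is at most the
  sum of the differences of the factors; each direction contributes two steps of slope at most
  \<open>c * m\<close>.\<close>

lemma cutoff_lipschitz:
 assumes "m > 0" "!!x. \<bar>deriv sst x\<bar> <= c"
 shows "\<bar>cutoff m l u y - cutoff m l u z\<bar> <= (2 * real CARD('n) * c * m) * norm (y - z)"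
proof -
 have lip: "\<bar>sst s - sst t\<bar> <= c * \<bar>s - t\<bar>" for s t
  using field_differentiable_bound[of UNIV sst "deriv sst" c s t]
  sst_differentiable assms(2) by (auto simp: has_field_derivative_at_within)
 have c: "c >= 0" using assms(2)[of 0] by linarith
 have "\<bar>cutoff m l u y - cutoff m l u z\<bar> \<le>
  (\<Sum>j\<in>UNIV. \<bar>sst (m * (y \<bullet> e j - l j)) * sst (m * (u j - y \<bullet> e j)) -
  sst (m * (z \<bullet> e j - l j)) * sst (m * (u j - z \<bullet> e j))\<bar>)"
  unfolding cutoff_def real_norm_def[symmetric]
  by (rule norm_prod_diff) (auto simp: sst_bounds abs_mult intro!: mult_le_one)
 also have "\<dots> <= (\<Sum>j\<in>(UNIV::'n set). 2 * c * m * norm (y - z))"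
 proof (rule sum_mono)
  fix j
  define a b a' b' where "a = sst (m * (y \<bullet> e j - l j))" "b = sst (m * (u j - y \<bullet> e j))"
  "a' = sst (m * (z \<bullet> e j - l j))" "b' = sst (m * (u j - z \<bullet> e j))"
  have d: "\<bar>m * (y \<bullet> e j - z \<bullet> e j)\<bar> <= m * norm (y - z)"
  using abs_inner_frame_le[of "y - z" j] assms(1) by (simp add: abs_mult inner_diff_left)
  have "\<bar>a - a'\<bar> <= c * \<bar>m * (y \<bullet> e j - z \<bullet> e j)\<bar>" "\<bar>b - b'\<bar> <= c * \<bar>m * (y \<bullet> e j - z \<bullet> e j)\<bar>"
  using lip[of "m * (y \<bullet> e j - l j)" "m * (z \<bullet> e j - l j)"]
  lip[of "m * (u j - y \<bullet> e j)" "m * (u j - z \<bullet> e j)"]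
  unfolding a_b_a'_b'_def by (auto simp: algebra_simps abs_minus_commute)
  hence 1: "\<bar>a - a'\<bar> <= c * (m * norm (y - z))" "\<bar>b - b'\<bar> <= c * (m * norm (y - z))"
  using mult_left_mono[OF d c] by linarith+
  have "\<bar>a * b - a' * b'\<bar> = \<bar>(a - a') * b + a' * (b - b')\<bar>" by (simp add: algebra_simps)
  also have "\<dots> <= \<bar>a - a'\<bar> * \<bar>b\<bar> + \<bar>a'\<bar> * \<bar>b - b'\<bar>"
  using abs_triangle_ineq by (auto simp: abs_mult[symmetric])
  also have "\<dots> <= \<bar>a - a'\<bar> * 1 + 1 * \<bar>b - b'\<bar>"
  by (intro add_mono mult_mono) (auto simp: a_b_a'_b'_def sst_bounds)
  also have "\<dots> <= 2 * c * m * norm (y - z)" using 1 by simp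
  finally show "\<bar>sst (m * (y \<bullet> e j - l j)) * sst (m * (u j - y \<bullet> e j)) -
  sst (m * (z \<bullet> e j - l j)) * sst (m * (u j - z \<bullet> e j))\<bar> <= 2 * c * m * norm (y - z)"
  by (simp add: a_b_a'_b'_def)
 qed
 also have "\<dots> = (2 * real CARD('n) * c * m) * norm (y - z)" by simp
 finally show ?thesis .
qed

lemma pderiv_cutoff_bound:
 assumes "m > 0" "!!x. \<bar>deriv sst x\<bar> <= c"
 shows "\<bar>pdv j (cutoff m l u) y\<bar> <= 2 * real CARD('n) * c * m"
 by (rule pderiv_at_le_lipschitz[OF C_k_cutoff cutoff_lipschitz[OF assms]])

lemma pderiv_cutoff_eq_0:
 assumes "cutoff m l u y = 0 | cutoff m l u y = 1"
 shows "pdv j (cutoff m l u) y = 0"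
 by (rule pderiv_at_eq_0_at_extremum[OF C_k_cutoff]) (use assms cutoff_bounds in auto)

end

subsection \<open>Symmetry of second derivatives\<close>

lemma directional_mvt:
 fixes f :: "'a::euclidean_space => real"
 assumes "C_k (Suc 0) f" "h > 0"
 shows "\<exists>s\<in>{0<..<h}. f (x + h *\<^sub>R v) - f x = h * fdv f (at (x + s *\<^sub>R v)) v"
proof -
 have d: "((%t. f (x + t *\<^sub>R v)) has_real_derivative fdv f (at (x + t *\<^sub>R v)) v) (at t)" for t
 proof -
  have l: "((%t. x + t *\<^sub>R v) has_derivative (%t. t *\<^sub>R v)) (at t)"
  by (auto intro!: derivative_eq_intros)
  have "((f \<circ> (%t. x + t *\<^sub>R v)) has_derivative (fdv f (at (x + t *\<^sub>R v)) \<circ> (%t. t *\<^sub>R v))) (at t)"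
  by (rule diff_chain_at[OF l C_k_Suc_hasd[OF assms(1)]])
  moreover have "fdv f (at (x + t *\<^sub>R v)) \<circ> (%t. t *\<^sub>R v) =
  (*) (fdv f (at (x + t *\<^sub>R v)) v)"
  proof -
  have "linear (fdv f (at (x + t *\<^sub>R v)))"
  using assms by (intro linear_frechet_derivative) auto
  thus ?thesis by (auto simp: linear_cmul fun_eq_iff)
  qed
  ultimately show ?thesis by (simp add: has_field_derivative_def o_def)
 qed
 obtain s where "s > 0" "s < h" "f (x + h *\<^sub>R v) - f (x + 0 *\<^sub>R v) = (h - 0) * fdv f (at (x + s *\<^sub>R v)) v"
  using MVT2[OF assms(2), of "%t. f (x + t *\<^sub>R v)" "%t. fdv f (at (x + t *\<^sub>R v)) v"] d by blast
 thus ?thesis by (intro bexI[of _ s]) auto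
qed

lemma fdv_diff_shift:
 fixes f :: "'a::euclidean_space => real"
 assumes "C_k (Suc 0) f"
 shows "fdv (%y. f (y + c) - f y) (at y) v = fdv f (at (y + c)) v - fdv f (at y) v"
proof -
 have l: "((%y. y + c) has_derivative (%v. v)) (at y)" by (auto intro!: derivative_eq_intros)
 have "((%y. f (y + c)) has_derivative fdv f (at (y + c))) (at y)"
  using diff_chain_at[OF l C_k_Suc_hasd[OF assms]] by (simp add: o_def)
 from has_derivative_diff[OF this C_k_Suc_hasd[OF assms, of y]]
 have "(%v. fdv f (at (y + c)) v - fdv f (at y) v) =
  fdv (%y. f (y + c) - f y) (at y)"
  by (rule frechet_derivative_at)
 from fun_cong[OF this, where x=v] show ?thesis by simp
qed

lemma second_difference:
 fixes f :: "'a::euclidean_space => real"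
 assumes f: "C_k (Suc (Suc 0)) f" and "h > 0"
 shows "\<exists>s\<in>{0<..<h}. \<exists>t\<in>{0<..<h}. f (x + h *\<^sub>R v + h *\<^sub>R w) - f (x + h *\<^sub>R v) - f (x + h *\<^sub>R w) + f x =
  h * (h * fdv (%y. fdv f (at y) v) (at (x + s *\<^sub>R v + t *\<^sub>R w)) w)"
proof -
 have f1: "C_k (Suc 0) f" by (rule C_k_SucD[OF f])
 have sh: "C_k (Suc 0) (%y. f (y + h *\<^sub>R w))"
  using C_k_compose_affine[OF f1, of 1 "h *\<^sub>R w"] by simp
 obtain s where s: "s : {0<..<h}" "(f (x + h *\<^sub>R v + h *\<^sub>R w) - f (x + h *\<^sub>R v)) - (f (x + h *\<^sub>R w) - f x) =
  h * (fdv f (at (x + s *\<^sub>R v + h *\<^sub>R w)) v - fdv f (at (x + s *\<^sub>R v)) v)"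
  using directional_mvt[OF C_k_diff[OF sh f1] \<open>h > 0\<close>, of x v]
  unfolding fdv_diff_shift[OF f1] by auto
 obtain t where t: "t : {0<..<h}" "fdv f (at (x + s *\<^sub>R v + h *\<^sub>R w)) v - fdv f (at (x + s *\<^sub>R v)) v =
  h * fdv (%y. fdv f (at y) v) (at (x + s *\<^sub>R v + t *\<^sub>R w)) w"
  using directional_mvt[OF C_k_deriv[OF f, of v] \<open>h > 0\<close>, of "x + s *\<^sub>R v" w] by auto
 show ?thesis using s t by (intro bexI[of _ s] bexI[of _ t]) (auto simp: algebra_simps)
qed

text \<open>The second difference of \<open>f\<close> is symmetric in \<open>v\<close> and
  \<open>w\<close>. Written as an intermediate value of the mixed derivative in each of the two
  orders, it gives equal values at two points \<open>p n\<close> and \<open>q n\<close> that tend to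
  \<open>x\<close>, and continuity concludes.\<close>

lemma second_der_symmetric:
 fixes f :: "'a::euclidean_space => real"
 assumes f: "C_k (Suc (Suc 0)) f"
 shows "fdv (%y. fdv f (at y) v) (at x) w =
  fdv (%y. fdv f (at y) w) (at x) v"
proof -
 define A where "A = (%v w y. fdv (%y. fdv f (at y) v) (at y) w)"
 have cont: "continuous_on UNIV (A v w)" for v w
  unfolding A_def using C_k_deriv[OF C_k_deriv[OF f, of v], of w] by simp
 have "EX p q. dist p x <= inverse (Suc n) * (norm v + norm w) & dist q x <= inverse (Suc n) * (norm v + norm w) \<and>
  A v w p = A w v q" for n :: nat
 proof -
  define h where "h = inverse (real (Suc n))"
  have h: "h > 0" by (simp add: h_def)
  obtain s t where st: "s : {0<..<h}" "t : {0<..<h}"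
  "f (x + h *\<^sub>R v + h *\<^sub>R w) - f (x + h *\<^sub>R v) - f (x + h *\<^sub>R w) + f x = h * (h * A v w (x + s *\<^sub>R v + t *\<^sub>R w))"
  unfolding A_def using second_difference[OF f h] by blast
  obtain s' t' where st': "s' : {0<..<h}" "t' : {0<..<h}"
  "f (x + h *\<^sub>R w + h *\<^sub>R v) - f (x + h *\<^sub>R w) - f (x + h *\<^sub>R v) + f x = h * (h * A w v (x + s' *\<^sub>R w + t' *\<^sub>R v))"
  unfolding A_def using second_difference[OF f h] by blast
  have "h * (h * A v w (x + s *\<^sub>R v + t *\<^sub>R w)) = h * (h * A w v (x + s' *\<^sub>R w + t' *\<^sub>R v))"
  unfolding st(3)[symmetric] st'(3)[symmetric] by (simp add: add_ac)
  hence "A v w (x + s *\<^sub>R v + t *\<^sub>R w) = A w v (x + s' *\<^sub>R w + t' *\<^sub>R v)" using h by simp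
  moreover have "dist (x + a *\<^sub>R y + b *\<^sub>R z) x <= h * (norm y + norm z)" if "a : {0<..<h}" "b : {0<..<h}" for a b y z
  proof -
  have "dist (x + a *\<^sub>R y + b *\<^sub>R z) x = norm (a *\<^sub>R y + b *\<^sub>R z)" by (simp add: dist_norm add.assoc)
  also have "\<dots> <= a * norm y + b * norm z" using norm_triangle_ineq[of "a *\<^sub>R y" "b *\<^sub>R z"] that by simp
  also have "\<dots> <= h * norm y + h * norm z" using that by (intro add_mono mult_right_mono) auto
  finally show ?thesis by (simp add: algebra_simps)
  qed
  ultimately show ?thesis using st(1,2) st'(1,2) unfolding h_def[symmetric]
  by (metis add.commute)
 qed
 then obtain p q where pq: "!!n. dist (p n) x <= inverse (Suc n) * (norm v + norm w)"
  "!!n. dist (q n) x <= inverse (Suc n) * (norm v + norm w)" "!!n. A v w (p n) = A w v (q n)"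
  by metis
 have z: "(%n. inverse (Suc n) * (norm v + norm w)) \<longlonglongrightarrow> 0"
  using tendsto_mult_left_zero[OF LIMSEQ_inverse_real_of_nat] by simp
 have "(%n. dist (p n) x) \<longlonglongrightarrow> 0" "(%n. dist (q n) x) \<longlonglongrightarrow> 0"
  by (rule tendsto_sandwich[OF _ _ tendsto_const z]; use pq(1,2) in simp)+
 hence "p \<longlonglongrightarrow> x" "q \<longlonglongrightarrow> x"
  by (simp_all only: tendsto_dist_iff[symmetric])
 hence "(%n. A v w (p n)) \<longlonglongrightarrow> A v w x" "(%n. A w v (q n)) \<longlonglongrightarrow> A w v x"
  using continuous_on_tendsto_compose[OF cont] by auto
 hence "A v w x = A w v x" unfolding pq(3) by (rule LIMSEQ_unique)
 thus ?thesis by (simp add: A_def)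
qed

lemma pderiv_at_commute:
 fixes ph :: "real^'n => real"
 assumes "C_k (Suc (Suc 0)) ph"
 shows "pdv j (pdv k ph) x = pdv k (pdv j ph) x"
 using second_der_symmetric[OF assms] by (simp add: pderiv_at_def[abs_def])

subsection \<open>Integrability on sets\<close>

lemma sintl_AE_cong:
 fixes w :: "'a::euclidean_space => 'b::euclidean_space"
 assumes "sint A w" "AE x in leb. x : A --> w x = w' x"
 shows "(LINT x:A|leb. w x) = (LINT x:A|leb. w' x)"
proof -
 have ae: "AE x in leb. idc A x *\<^sub>R w x = idc A x *\<^sub>R w' x"
  using assms(2) by eventually_elim (auto simp: indicator_def)
 have m: "(%x. idc A x *\<^sub>R w x) : lbm"
  using assms(1) by (auto simp: set_integrable_def)
 show ?thesis
  unfolding set_lebesgue_integral_def by (rule integral_cong_AE[OF m borel_measurable_AE[OF m ae] ae])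
qed

lemma sint_blin:
 assumes "bounded_linear T" "set_integrable M A w"
 shows "set_integrable M A (%x. T (w x))"
  "T (LINT x:A|M. w x) = (LINT x:A|M. T (w x))"
proof -
 interpret bounded_linear T by fact
 have eq: "idc A x *\<^sub>R T (w x) = T (idc A x *\<^sub>R w x)" for x
  by (simp add: scaleR)
 show "set_integrable M A (%x. T (w x))"
  using assms(2) unfolding set_integrable_def eq by (rule integrable_bounded_linear[OF assms(1)])
 show "T (LINT x:A|M. w x) = (LINT x:A|M. T (w x))"
  unfolding set_lebesgue_integral_def eq
  by (rule integral_bounded_linear[symmetric, OF assms(1)]) (use assms(2) in \<open>simp add: set_integrable_def\<close>)
qed

lemma sint_scaleR_bdd:
 fixes w :: "'a::euclidean_space => 'b::euclidean_space"
 assumes "sint A w" "psi : lbm"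
  "!!x. x : A ==> \<bar>psi x\<bar> <= B"
 shows "sint A (%x. psi x *\<^sub>R w x)"
 unfolding set_integrable_def
proof (rule Bochner_Integration.integrable_bound)
 have m: "(%x. idc A x *\<^sub>R w x) : lbm"
  using assms(1) by (auto simp: set_integrable_def)
 show "integrable leb (%x. B *\<^sub>R (idc A x *\<^sub>R w x))"
  using assms(1) unfolding set_integrable_def by (intro integrable_scaleR_right)
 have "(%x. psi x *\<^sub>R (idc A x *\<^sub>R w x)) : lbm"
  using assms(2) m by (rule borel_measurable_scaleR)
 thus "(%x. idc A x *\<^sub>R psi x *\<^sub>R w x) : lbm"
  by (simp add: mult.commute)
 show "AE x in leb. norm (idc A x *\<^sub>R psi x *\<^sub>R w x) <= norm (B *\<^sub>R idc A x *\<^sub>R w x)"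
  using assms(3) by (intro AE_I2) (force simp: indicator_def intro!: mult_right_mono)
qed

lemma bm_C_k:
 fixes psi :: "'a::euclidean_space => 'b::euclidean_space"
 shows "C_k k psi ==> psi : lbm"
 using cont_on_C_k[of k psi UNIV]
 by (auto intro!: measurable_completion borel_measurable_continuous_onI)

lemma tf_bdd:
 fixes ph :: "'a::euclidean_space => 'b::euclidean_space"
 assumes "ph : tfs A"
 shows "\<exists>B\<ge>0. ALL x. norm (ph x) <= B"
proof (rule tfE[OF assms])
 fix K assume "compact K" "!!x. x ~: K ==> ph x = 0"
 thus ?thesis
  using cont_csupp_bdd[OF cont_on_C_k[OF tfD(1)[OF assms]]] by blast
qed

lemma sint_test_scaleR:
 fixes w :: "'a::euclidean_space => 'b::euclidean_space" and ph :: "'a => real"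
 assumes "sint A w" "ph : tfs B"
 shows "sint A (%x. ph x *\<^sub>R w x)"
proof -
 obtain B where "!!x. norm (ph x) <= B" using tf_bdd[OF assms(2)] by auto
 thus ?thesis
  by (intro sint_scaleR_bdd[OF assms(1) bm_C_k[OF tfD(1)[OF assms(2)]]]) auto
qed

lemma blin_axis: "bounded_linear (%y::'b::euclidean_space. axis i y :: 'b^'n)"
 by (intro linear_conv_bounded_linear[THEN iffD1] linearI) (auto simp: axis_def vec_eq_iff)

lemma sint_vec:
 fixes w :: "'a => 'b::euclidean_space^'n"
 assumes "!!i. set_integrable M A (%x. w x $ i)"
 shows "set_integrable M A w"
proof -
 have "w x = (\<Sum>i\<in>UNIV. axis i (w x $ i))" for x
  by (simp add: vec_eq_iff axis_def if_distrib cong: if_cong)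
 hence eq: "(%x. idc A x *\<^sub>R w x) = (%x. \<Sum>i\<in>UNIV. idc A x *\<^sub>R axis i (w x $ i))"
  by (metis (no_types) scaleR_sum_right)
 have "set_integrable M A (%x. axis i (w x $ i) :: 'b^'n)" for i
  using sint_blin(1)[OF blin_axis assms] .
 thus ?thesis unfolding set_integrable_def eq by (rule Bochner_Integration.integrable_sum)
qed

lemma sint_vec_nth:
 fixes w :: "'a => 'b::euclidean_space^'n"
 assumes "set_integrable M A w"
 shows "set_integrable M A (%x. w x $ i)" "(LINT x:A|M. w x) $ i = (LINT x:A|M. w x $ i)"
 using sint_blin[OF bounded_linear_vec_nth assms] by auto

lemma sint_bdd_meas:
 fixes w :: "'a::euclidean_space => 'b::euclidean_space"
 assumes "A : sets leb" "bounded A" "w : lbm" "!!x. x : A ==> norm (w x) <= B"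
 shows "sint A w"
 unfolding set_integrable_def
proof (rule Bochner_Integration.integrable_bound)
 have "A : lmeasurable" using assms by (intro bounded_set_imp_lmeasurable)
 hence "integrable leb (idc A :: 'a => real)" by (auto simp: fmeasurable_def)
 thus "integrable leb (%x. B * idc A x)" by simp
 show "(%x. idc A x *\<^sub>R w x) : lbm"
  using assms by (intro borel_measurable_scaleR borel_measurable_indicator)
 show "AE x in leb. norm (idc A x *\<^sub>R w x) <= norm (B * idc A x)"
  using assms(4) by (intro AE_I2) (force simp: indicator_def)
qed

subsection \<open>The fundamental lemma of the calculus of variations\<close>

lemma frame_axis: "frame (%j. axis j (1::real))"
 by unfold_locales (auto simp: inner_axis_axis)

text \<open>Cut-off functions converge to indicators of boxes, so a Borel version \<open>h\<close>
  of \<open>g\<close> has integral 0 over every open box whose closure lies in \<open>A\<close>. The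
  positive and negative parts of \<open>h\<close> on such a box are then densities of finite
  measures that agree on all boxes, hence equal; countably many closed boxes fill
  \<open>A\<close>.\<close>

lemma fundamental_lemma_real:
 fixes g :: "real^'n => real"
 assumes A: "open A" and g: "sint A g"
  and test: "!!ph. ph : tfs A ==> (LINT x:A|leb. ph x * g x) = 0"
 shows "AE x in leb. x : A --> g x = 0"
proof -
 interpret frame "%j::'n. axis j (1::real)" by (rule frame_axis)
 have slab: "slab (%j. c $ j) (%j. d $ j) = box c d" for c d :: "real^'n"
  by (auto simp: slab_def mem_box_cart inner_axis)
 have im: "integrable leb (%x. idc A x * g x)"
  using g by (simp add: set_integrable_def)
 then obtain h where h [measurable]: "h : borel_measurable lborel" and ae: "AE x in lborel. idc A x * g x = h x"
  using completion_ex_borel_measurable_real[of "%x. idc A x * g x" lborel] by blast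
 have ae': "AE x in leb. idc A x * g x = h x" using ae by (rule AE_completion)
 have ih': "integrable leb h"
  using integrable_cong_AE[OF _ _ ae'] im h by (simp add: measurable_completion)
 hence ih: "integrable lborel h" using h by (simp add: integrable_completion)
 have zero: "(\<integral>x. idc (box c d) x * h x \<partial>lborel) = 0" if "cbox c d <= A" for c d
 proof -
  define ph where "ph = (%n. cutoff (real (Suc n)) (%j. c $ j) (%j. d $ j))"
  have "{y. ALL j. c $ j <= y \<bullet> axis j 1 & y \<bullet> axis j 1 <= d $ j} = cbox c d"
  by (auto simp: mem_box_cart inner_axis)
  hence ph: "ph n : tfs A" for n
  unfolding ph_def by (intro cutoff_in_tf) (use that in auto)
  have m: "ph n : borel_measurable borel" for n
  by (rule borel_measurable_continuous_onI[OF cont_on_C_k[OF tfD(1)[OF ph]]])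
  have "(\<integral>x. ph n x * h x \<partial>lborel) = 0" for n
  proof -
  have "(\<integral>x. ph n x * h x \<partial>lborel) = (\<integral>x. ph n x * h x \<partial>leb)"
  using m h by (intro integral_completion[symmetric]) simp
  also have "\<dots> = (\<integral>x. idc A x * (ph n x * g x) \<partial>leb)"
  proof (rule integral_cong_AE)
  show *: "(%x. ph n x * h x) : lbm"
  using m h by (intro measurable_completion) simp
  show "AE x in leb. ph n x * h x = idc A x * (ph n x * g x)"
  using ae' by eventually_elim (simp add: mult.left_commute flip: mult.assoc)
  from borel_measurable_AE[OF * this] show "(%x. idc A x * (ph n x * g x)) : lbm" .
  qed
  also have "\<dots> = 0" using test[OF ph] by (simp add: set_lebesgue_integral_def)
  finally show ?thesis .
  qed
  moreover have "(%n. \<integral>x. ph n x * h x \<partial>lborel) \<longlonglongrightarrow> (\<integral>x. idc (box c d) x * h x \<partial>lborel)"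
  proof (rule integral_dominated_convergence)
  show "AE x in lborel. (%n. ph n x * h x) \<longlonglongrightarrow> idc (box c d) x * h x"
  unfolding ph_def slab[symmetric] by (intro AE_I2 tendsto_intros cutoff_lim_indicator)
  show "AE x in lborel. norm (ph n x * h x) <= norm (h x)" for n
  using cutoff_bounds by (auto simp: ph_def abs_mult intro!: AE_I2 mult_left_le_one_le)
  show "integrable lborel (%x. norm (h x))" using ih by simp
  qed (use m h in auto)
  ultimately show ?thesis by (simp add: LIMSEQ_const_iff)
 qed
 have box0: "AE x in lborel. x : box c d --> h x = 0" if cd: "cbox c d <= A" for c d
 proof -
  define P where "P = (%s x. ennreal (idc (box c d) x * max 0 (s * h x)))"
  have m [measurable]: "P s : borel_measurable lborel" for s unfolding P_def by measurable
  have eq: "emeasure (density lborel (P 1)) (box a b) = emeasure (density lborel (P (-1))) (box a b)" for a b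
  proof -
  have B: "EX a' b'. box a b \<inter> box c d = box a' b' & cbox a' b' <= cbox c d"
  unfolding box_Int_box by (intro exI conjI refl) (auto simp: mem_box)
  then obtain a' b' where ab: "box a b \<inter> box c d = box a' b'" "cbox a' b' <= A" using cd by blast
  have i: "integrable lborel (%x. idc (box a' b') x * max 0 (s * h x))" for s
  proof -
  have "integrable lborel (%x. max 0 (s * h x))"
  using ih by (intro integrable_max) auto
  from integrable_mult_indicator[OF _ this, of "box a' b'"] show ?thesis by simp
  qed
  have "emeasure (density lborel (P s)) (box a b) = ennreal (\<integral>x. idc (box a' b') x * max 0 (s * h x) \<partial>lborel)" for s
  proof -
  have "emeasure (density lborel (P s)) (box a b) = (\<integral>\<^sup>+x. P s x * idc (box a b) x \<partial>lborel)"
  by (rule emeasure_density) auto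
  also have "\<dots> = (\<integral>\<^sup>+x. ennreal (idc (box a' b') x * max 0 (s * h x)) \<partial>lborel)"
  unfolding ab(1)[symmetric] by (intro nn_integral_cong) (auto simp: P_def indicator_def)
  also have "\<dots> = ennreal (\<integral>x. idc (box a' b') x * max 0 (s * h x) \<partial>lborel)"
  by (intro nn_integral_eq_integral i) auto
  finally show ?thesis .
  qed
  moreover have "(\<integral>x. idc (box a' b') x * max 0 (1 * h x) \<partial>lborel) - (\<integral>x. idc (box a' b') x * max 0 (-1 * h x) \<partial>lborel) =
  (\<integral>x. idc (box a' b') x * h x \<partial>lborel)"
  by (subst Bochner_Integration.integral_diff[OF i i, symmetric])
  (auto intro!: Bochner_Integration.integral_cong simp: indicator_def max_def)
  ultimately show ?thesis using zero[OF ab(2)] by simp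
  qed
  have "density lborel (P 1) = density lborel (P (-1))"
  proof (rule measure_eqI_generator_eq[where E="range (%(a, b). box a b)" and \<Omega>=UNIV
  and A="%n::nat. box (- (real n *\<^sub>R One)) (real n *\<^sub>R One)"])
  show "Int_stable (range (%(a, b). box a b :: (real^'n) set))"
  by (auto simp: Int_stable_def box_Int_box)
  show "(\<Union>i::nat. box (- (real i *\<^sub>R One)) (real i *\<^sub>R One)) = (UNIV :: (real^'n) set)"
  by (rule UN_box_eq_UNIV)
  fix i :: nat
  have "emeasure (density lborel (P 1)) (box (- (real i *\<^sub>R One)) (real i *\<^sub>R One)) <= (\<integral>\<^sup>+x. P 1 x \<partial>lborel)"
  by (subst emeasure_density) (auto intro!: nn_integral_mono simp: indicator_def)
  also have "\<dots> <= (\<integral>\<^sup>+x. ennreal (norm (h x)) \<partial>lborel)"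
  by (intro nn_integral_mono) (auto simp: P_def indicator_def)
  also have "\<dots> < \<infinity>" using ih by (simp add: integrable_iff_bounded)
  finally show "emeasure (density lborel (P 1)) (box (- (real i *\<^sub>R One)) (real i *\<^sub>R One)) ~= \<infinity>" by simp
  qed (use eq in "auto simp: borel_eq_box")
  hence "AE x in lborel. P 1 x = P (-1) x"
  by (intro sigma_finite_measure.density_unique[OF sigma_finite_lborel]) auto
  thus ?thesis
  by eventually_elim (auto simp: P_def max_def split: if_splits)
 qed
 obtain D where D': "countable D" "D <= Pow A" and D2: "!!X. X : D ==> EX a b. X = cbox a b" and D4: "\<Union>D = A"
  using open_countable_Union_open_cbox[OF A] by metis
 hence D: "countable D" "!!X. X : D ==> EX a b. X = cbox a b" "!!X. X : D ==> X <= A" "\<Union>D = A"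
  by auto
 have "AE x in lborel. x : X --> h x = 0" if X: "X : D" for X
 proof -
  obtain a b where ab: "X = cbox a b" using D(2)[OF X] by blast
  have "AE x in leb. x ~: cbox a b - box a b"
  using negligible_frontier_interval[of a b] unfolding negligible_iff_null_sets by (rule AE_not_in)
  hence "AE x in lborel. x ~: cbox a b - box a b" by (simp add: AE_completion_iff)
  with box0[of a b] D(3)[OF X] ab show ?thesis by auto
 qed
 hence "AE x in lborel. \<forall>X\<in>D. x : X --> h x = 0"
  unfolding AE_ball_countable[OF D(1)] by blast
 hence "AE x in lborel. x : A --> h x = 0"
  by (rule eventually_mono) (use D(4) in auto)
 hence "AE x in leb. x : A --> h x = 0" by (rule AE_completion)
 with ae' show ?thesis by eventually_elim auto
qed


lemma fundamental_lemma:
 fixes g :: "real^'n => 'b::euclidean_space"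
 assumes A: "open A" and g: "sint A g"
  and test: "!!ph. ph : tfs A ==> (LINT x:A|leb. ph x *\<^sub>R g x) = 0"
 shows "AE x in leb. x : A --> g x = 0"
proof -
 have "AE x in leb. x : A --> g x \<bullet> b = 0" for b
 proof (rule fundamental_lemma_real[OF A])
  show "sint A (%x. g x \<bullet> b)"
  by (rule sint_blin(1)[OF bounded_linear_inner_left g])
  fix ph :: "real^'n => real" assume ph: "ph : tfs A"
  have "(LINT x:A|leb. ph x *\<^sub>R g x) \<bullet> b = (LINT x:A|leb. (ph x *\<^sub>R g x) \<bullet> b)"
  by (rule sint_blin(2)[OF bounded_linear_inner_left sint_test_scaleR[OF g ph]])
  thus "(LINT x:A|leb. ph x * (g x \<bullet> b)) = 0" using test[OF ph] by simp
 qed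
 hence "AE x in leb. \<forall>b\<in>Basis. x : A --> g x \<bullet> b = 0"
  by (intro AE_finite_allI) auto
 thus ?thesis by eventually_elim (auto intro: euclidean_eqI)
qed

subsection \<open>Weak derivatives\<close>

lemma wpD:
 "weak_partial A j w g ==> ph : tfs A ==>
  (LINT x:A|leb. pdv j ph x *\<^sub>R w x) = - (LINT x:A|leb. ph x *\<^sub>R g x)"
 by (simp add: weak_partial_def)

lemma wp_unique:
 assumes "open A" "weak_partial A j w g" "weak_partial A j w g'"
  "sint A g" "sint A g'"
 shows "AE x in leb. x : A --> g x = g' x"
proof -
 have "AE x in leb. x : A --> g x - g' x = 0"
 proof (rule fundamental_lemma[OF assms(1)])
  fix ph :: "real^'a => real" assume ph: "ph : tfs A"
  show "(LINT x:A|leb. ph x *\<^sub>R (g x - g' x)) = 0"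
  using wpD[OF assms(2) ph] wpD[OF assms(3) ph]
  set_integral_diff(2)[OF sint_test_scaleR[OF assms(4) ph] sint_test_scaleR[OF assms(5) ph]]
  by (simp add: scaleR_diff_right)
 qed (use assms in auto)
 thus ?thesis by simp
qed

lemma wp_cong_AE:
 assumes "weak_partial A j w g" "sint A w" "sint A g"
  "AE x in leb. x : A --> w x = w' x" "AE x in leb. x : A --> g x = g' x"
 shows "weak_partial A j w' g'"
 unfolding weak_partial_def
proof
 fix ph :: "real^'a => real" assume ph: "ph : tfs A"
 have "(LINT x:A|leb. pdv j ph x *\<^sub>R w x) = (LINT x:A|leb. pdv j ph x *\<^sub>R w' x)"
  by (rule sintl_AE_cong[OF sint_test_scaleR[OF assms(2) tf_pderiv[OF ph]]])
  (use assms(4) in eventually_elim, auto)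
 moreover have "(LINT x:A|leb. ph x *\<^sub>R g x) = (LINT x:A|leb. ph x *\<^sub>R g' x)"
  by (rule sintl_AE_cong[OF sint_test_scaleR[OF assms(3) ph]])
  (use assms(5) in eventually_elim, auto)
 ultimately show "(LINT x:A|leb. pdv j ph x *\<^sub>R w' x) = - (LINT x:A|leb. ph x *\<^sub>R g' x)"
  using wpD[OF assms(1) ph] by simp
qed

lemma wp_add:
 assumes "weak_partial A j w g" "weak_partial A j w' g'"
  "sint A w" "sint A g"
  "sint A w'" "sint A g'"
 shows "weak_partial A j (%x. w x + w' x) (%x. g x + g' x)"
 unfolding weak_partial_def
proof
 fix ph :: "real^'a => real" assume ph: "ph : tfs A"
 note dph = tf_pderiv[OF ph]
 show "(LINT x:A|leb. pdv j ph x *\<^sub>R (w x + w' x)) = - (LINT x:A|leb. ph x *\<^sub>R (g x + g' x))"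
  using wpD[OF assms(1) ph] wpD[OF assms(2) ph] assms(3-6)
  by (simp add: scaleR_add_right set_integral_add(2) sint_test_scaleR[OF _ ph] sint_test_scaleR[OF _ dph])
qed

lemma wp_blin:
 assumes "weak_partial A j w g" "sint A w" "sint A g" "bounded_linear T"
 shows "weak_partial A j (%x. T (w x)) (%x. T (g x))"
 unfolding weak_partial_def
proof
 fix ph :: "real^'a => real" assume ph: "ph : tfs A"
 interpret T: bounded_linear T by fact
 have "T (LINT x:A|leb. pdv j ph x *\<^sub>R w x) = T (- (LINT x:A|leb. ph x *\<^sub>R g x))"
  using wpD[OF assms(1) ph] by simp
 thus "(LINT x:A|leb. pdv j ph x *\<^sub>R T (w x)) = - (LINT x:A|leb. ph x *\<^sub>R T (g x))"
  unfolding linear_neg[OF T.linear]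
  sint_blin(2)[OF assms(4) sint_test_scaleR[OF assms(2) tf_pderiv[OF ph]]]
  sint_blin(2)[OF assms(4) sint_test_scaleR[OF assms(3) ph]]
  by (simp add: T.scaleR)
qed

lemma wp_scaleR:
 fixes w :: "real^'n => 'b::euclidean_space"
 assumes "weak_partial A j w g" "sint A w" "sint A g" "!!k. C_k k psi"
 shows "weak_partial A j (%x. psi x *\<^sub>R w x) (%x. psi x *\<^sub>R g x + pdv j psi x *\<^sub>R w x)"
 unfolding weak_partial_def
proof
 fix ph :: "real^'n => real" assume ph: "ph : tfs A"
 have 1: "(%x. psi x * ph x) : tfs A" by (rule tf_mult[OF assms(4) ph])
 have 2: "(%x. pdv j psi x * ph x) : tfs A"
  by (rule tf_mult[OF C_k_pderiv[OF assms(4)] ph])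
 have 3: "(%x. psi x * pdv j ph x) : tfs A"
  by (rule tf_mult[OF assms(4) tf_pderiv[OF ph]])
 have i: "sint A (%x. (psi x * ph x) *\<^sub>R g x)" "sint A (%x. (pdv j psi x * ph x) *\<^sub>R w x)"
  "sint A (%x. (psi x * pdv j ph x) *\<^sub>R w x)"
  using sint_test_scaleR[OF _ 1] sint_test_scaleR[OF _ 2] sint_test_scaleR[OF _ 3] assms by auto
 have p: "pdv j (%x. psi x * ph x) x = psi x * pdv j ph x + pdv j psi x * ph x" for x
  by (rule C_k_1_pderiv_mult[OF assms(4) tfD(1)[OF ph]])
 have h1: "(LINT x:A|leb. (psi x * pdv j ph x) *\<^sub>R w x) + (LINT x:A|leb. (pdv j psi x * ph x) *\<^sub>R w x)
  = - (LINT x:A|leb. (psi x * ph x) *\<^sub>R g x)"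
  unfolding set_integral_add(2)[OF i(3,2), symmetric]
  using wpD[OF assms(1) 1] by (simp add: p scaleR_add_left)
 have h2: "(LINT x:A|leb. ph x *\<^sub>R (psi x *\<^sub>R g x + pdv j psi x *\<^sub>R w x)) =
  (LINT x:A|leb. (psi x * ph x) *\<^sub>R g x) + (LINT x:A|leb. (pdv j psi x * ph x) *\<^sub>R w x)"
  unfolding set_integral_add(2)[OF i(1,2), symmetric]
  by (simp add: scaleR_add_right mult.commute)
 have h3: "(LINT x:A|leb. pdv j ph x *\<^sub>R psi x *\<^sub>R w x) =
  (LINT x:A|leb. (psi x * pdv j ph x) *\<^sub>R w x)"
  by (simp add: mult.commute)
 have h4: "a = - d" if "a + b = - c" "d = c + b" for a b c d :: 'b
 proof -
  have "a = - c - b" using that(1) by (simp only: eq_diff_eq)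
  thus ?thesis using that(2) by simp
 qed
 show "(LINT x:A|leb. pdv j ph x *\<^sub>R psi x *\<^sub>R w x) =
  - (LINT x:A|leb. ph x *\<^sub>R (psi x *\<^sub>R g x + pdv j psi x *\<^sub>R w x))"
  unfolding h3 by (rule h4[OF h1 h2])
qed

lemma sintl_test_eq_lborel:
 fixes w :: "'a::euclidean_space => 'b::euclidean_space"
 assumes "open A" "ph : tfs A" "continuous_on A w"
 shows "(LINT x:A|leb. ph x *\<^sub>R w x) = (\<integral>x. (if x : A then ph x *\<^sub>R w x else 0) \<partial>lborel)"
  "continuous_on UNIV (%x. if x : A then ph x *\<^sub>R w x else 0)"
proof -
 obtain K where K: "compact K" "K <= A" "!!x. x ~: K ==> ph x = 0"
  using tfE[OF assms(2)] by blast
 have "continuous_on (A \<union> - K) (%x. if x : A then ph x *\<^sub>R w x else 0)"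
 proof (rule continuous_on_open_Un)
  show "continuous_on A (%x. if x : A then ph x *\<^sub>R w x else 0)"
  using continuous_on_scaleR[OF cont_on_C_k[OF tfD(1)[OF assms(2)]] assms(3)] by simp
  show "continuous_on (- K) (%x. if x : A then ph x *\<^sub>R w x else 0)"
  by (rule continuous_on_cong[THEN iffD1, OF refl _ continuous_on_const[of _ 0]]) (use K in auto)
 qed (use assms K compact_imp_closed in auto)
 moreover have "A \<union> - K = UNIV" using K by auto
 ultimately show c: "continuous_on UNIV (%x. if x : A then ph x *\<^sub>R w x else 0)" by simp
 have "(LINT x:A|leb. ph x *\<^sub>R w x) = (\<integral>x. (if x : A then ph x *\<^sub>R w x else 0) \<partial>leb)"
  unfolding set_lebesgue_integral_def by (rule Bochner_Integration.integral_cong) auto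
 also have "\<dots> = (\<integral>x. (if x : A then ph x *\<^sub>R w x else 0) \<partial>lborel)"
  by (rule integral_completion) (use c in "simp add: borel_measurable_continuous_onI")
 finally show "(LINT x:A|leb. ph x *\<^sub>R w x) = (\<integral>x. (if x : A then ph x *\<^sub>R w x else 0) \<partial>lborel)" .
qed

text \<open>The product of \<open>w\<close> with a test function, extended by 0 off
  \<open>A\<close>, is differentiable everywhere and has compact support. Its directional derivative
  therefore has integral 0, and the product rule turns this into the claim.\<close>

lemma classical_wp:
 fixes w :: "real^'n => 'b::euclidean_space"
 assumes A: "open A" and der: "!!x. x : A ==> (w has_derivative w' x) (at x)"
  and cont: "continuous_on A (%x. w' x (axis j 1))"
 shows "weak_partial A j w (%x. w' x (axis j 1))"
 unfolding weak_partial_def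
proof
 fix ph :: "real^'n => real" assume ph: "ph : tfs A"
 obtain K where K: "compact K" "K <= A" "!!x. x ~: K ==> ph x = 0" using tfE[OF ph] by blast
 have contw: "continuous_on A w"
  by (rule continuous_at_imp_continuous_on) (use der has_derivative_continuous in blast)
 define F where "F = (%x. if x : A then ph x *\<^sub>R w x else 0)"
 define F' where "F' = (%x v. if x : A then ph x *\<^sub>R w' x v + fdv ph (at x) v *\<^sub>R w x else 0)"
 have F: "(F has_derivative F' x) (at x)" for x
 proof (cases "x : A")
  case True
  have "((%x. ph x *\<^sub>R w x) has_derivative (%v. ph x *\<^sub>R w' x v + fdv ph (at x) v *\<^sub>R w x)) (at x)"
  by (rule has_derivative_scaleR[OF C_k_Suc_hasd[OF tfD(1)[OF ph]] der[OF True]])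
  hence "(F has_derivative (%v. ph x *\<^sub>R w' x v + fdv ph (at x) v *\<^sub>R w x)) (at x)"
  by (rule has_derivative_transform_within_open[OF _ A True]) (simp add: F_def)
  thus ?thesis using True by (simp add: F'_def)
 next
  case False
  have "(F has_derivative (%_. 0)) (at x)"
  by (rule hasd_0_if_locally_0[OF compact_imp_closed[OF K(1)]]) (use K False in "auto simp: F_def")
  thus ?thesis using False by (simp add: F'_def)
 qed
 have eq: "F' x (axis j 1) = (if x : A then ph x *\<^sub>R w' x (axis j 1) else 0) +
  (if x : A then pdv j ph x *\<^sub>R w x else 0)" for x
  by (simp add: F'_def pderiv_at_def)
 note dph = tf_pderiv[OF ph]
 have c: "continuous_on UNIV (%x. if x : A then ph x *\<^sub>R w' x (axis j 1) else 0)"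
  "continuous_on UNIV (%x. if x : A then pdv j ph x *\<^sub>R w x else 0)"
  using sintl_test_eq_lborel(2)[OF A ph cont] sintl_test_eq_lborel(2)[OF A dph contw] .
 have d0: "pdv j ph x = 0" if "x ~: K" for x
  unfolding pderiv_at_def by (rule fdv_0_if_locally_0[OF compact_imp_closed[OF K(1)] K(3) that])
 have "(\<integral>x. F' x (axis j 1) \<partial>lborel) = 0"
  by (rule int_dirder_eq_0[OF F _ K(1)])
  (use K in "auto simp: F_def eq intro!: continuous_on_add c")
 moreover have "(\<integral>x. F' x (axis j 1) \<partial>lborel) = (\<integral>x. (if x : A then ph x *\<^sub>R w' x (axis j 1) else 0) \<partial>lborel)
  + (\<integral>x. (if x : A then pdv j ph x *\<^sub>R w x else 0) \<partial>lborel)"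
  unfolding eq
  by (intro Bochner_Integration.integral_add intg_cont_csupp[OF c(1) K(1)]
  intg_cont_csupp[OF c(2) K(1)]) (use K d0 in auto)
 ultimately show "(LINT x:A|leb. pdv j ph x *\<^sub>R w x) = - (LINT x:A|leb. ph x *\<^sub>R w' x (axis j 1))"
  unfolding sintl_test_eq_lborel(1)[OF A ph cont] sintl_test_eq_lborel(1)[OF A dph contw]
  by (simp add: add_eq_0_iff)
qed

lemma sintl_lim:
 fixes w :: "real^'n => 'b::euclidean_space"
 assumes "L1_tendsto A W w" "ph : tfs B"
 shows "(%n. LINT x:A|leb. ph x *\<^sub>R W n x) \<longlonglongrightarrow> (LINT x:A|leb. ph x *\<^sub>R w x)"
proof -
 have i: "sint A w" "!!n. sint A (W n)"
  and l: "(%n. LINT x:A|leb. norm (W n x - w x)) \<longlonglongrightarrow> 0"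
  using assms(1) by (auto simp: L1_tendsto_def)
 obtain C where C: "C >= 0" "!!x. norm (ph x) <= C" using tf_bdd[OF assms(2)] by auto
 note phi = sint_test_scaleR[OF _ assms(2)]
 have idiff: "sint A (%x. W n x - w x)" for n using i by auto
 have bd: "norm ((LINT x:A|leb. ph x *\<^sub>R W n x) - (LINT x:A|leb. ph x *\<^sub>R w x)) \<le>
  C * (LINT x:A|leb. norm (W n x - w x))" for n
 proof -
  have "(LINT x:A|leb. ph x *\<^sub>R W n x) - (LINT x:A|leb. ph x *\<^sub>R w x) =
  (LINT x:A|leb. ph x *\<^sub>R (W n x - w x))"
  using set_integral_diff(2)[OF phi[OF i(2)] phi[OF i(1)]] by (simp add: scaleR_diff_right)
  also have "norm \<dots> <= (LINT x:A|leb. norm (ph x *\<^sub>R (W n x - w x)))"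
  by (rule set_integral_norm_bound[OF phi[OF idiff]])
  also have "\<dots> <= (LINT x:A|leb. C * norm (W n x - w x))"
  proof (rule set_integral_mono)
  show "sint A (%x. norm (ph x *\<^sub>R (W n x - w x)))"
  by (rule set_integrable_norm[OF phi[OF idiff]])
  show "sint A (%x. C * norm (W n x - w x))"
  using set_integrable_norm[OF idiff] by simp
  show "norm (ph x *\<^sub>R (W n x - w x)) <= C * norm (W n x - w x)" for x
  using C(2)[of x] by (simp add: mult_right_mono)
  qed
  finally show ?thesis by simp
 qed
 have z: "(%n. C * (LINT x:A|leb. norm (W n x - w x))) \<longlonglongrightarrow> 0"
  using tendsto_mult_right_zero[OF l] .
 have "(%n. (LINT x:A|leb. ph x *\<^sub>R W n x) - (LINT x:A|leb. ph x *\<^sub>R w x)) \<longlonglongrightarrow> 0"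
  by (rule Lim_null_comparison[OF _ z]) (rule always_eventually, rule allI, rule bd)
 thus ?thesis by (rule LIM_zero_cancel)
qed

text \<open>Both sides of the defining identity pass to the limit because test functions and their
  derivatives are bounded. The wedge obtains its weak gradient in this way from its smooth
  approximations.\<close>

lemma wp_limit:
 assumes "!!n. weak_partial A j (W n) (G n)" "L1_tendsto A W w" "L1_tendsto A G g"
 shows "weak_partial A j w g"
 unfolding weak_partial_def
proof
 fix ph :: "real^'a => real" assume ph: "ph : tfs A"
 have "(%n. LINT x:A|leb. pdv j ph x *\<^sub>R W n x) \<longlonglongrightarrow> - (LINT x:A|leb. ph x *\<^sub>R g x)"
  unfolding wpD[OF assms(1) ph] by (intro tendsto_minus sintl_lim[OF assms(3) ph])
 with sintl_lim[OF assms(2) tf_pderiv[OF ph]]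
 show "(LINT x:A|leb. pdv j ph x *\<^sub>R w x) = - (LINT x:A|leb. ph x *\<^sub>R g x)"
  by (rule LIMSEQ_unique)
qed

lemma sintl_test_subset:
 assumes "B <= A" "ph : tfs B"
 shows "(LINT x:A|leb. ph x *\<^sub>R w x) = (LINT x:B|leb. ph x *\<^sub>R w x)"
proof -
 have "idc A x *\<^sub>R ph x *\<^sub>R w x = idc B x *\<^sub>R ph x *\<^sub>R w x" for x
  using assms(1) tfD(4)[OF assms(2), of x] by (auto simp: indicator_def)
 thus ?thesis unfolding set_lebesgue_integral_def by presburger
qed

lemma wp_subset:
 assumes "weak_partial A j w g" "B <= A"
 shows "weak_partial B j w g"
 unfolding weak_partial_def
proof
 fix ph :: "real^'a => real" assume ph: "ph : tfs B"
 show "(LINT x:B|leb. pdv j ph x *\<^sub>R w x) = - (LINT x:B|leb. ph x *\<^sub>R g x)"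
  using wpD[OF assms(1) tf_mono[OF assms(2) ph]]
  sintl_test_subset[OF assms(2) ph, of g]
  sintl_test_subset[OF assms(2) tf_pderiv[OF ph], of j w]
  by simp
qed

lemma blin_column: "bounded_linear (%G::real^'n^'d. column j G)"
 by (intro linear_conv_bounded_linear[THEN iffD1] linearI) (auto simp: column_def vec_eq_iff)

lemma iwg_unique:
 assumes "open A" "is_weak_gradient A u G" "is_weak_gradient A u G'"
 shows "AE x in leb. x : A --> G x = G' x"
proof -
 have i: "sint A (%x. column j (G x))" "sint A (%x. column j (G' x))" for j
  using assms(2,3) sint_blin(1)[OF blin_column] by (auto simp: is_weak_gradient_def)
 have "AE x in leb. x : A --> column j (G x) = column j (G' x)" for j
  using assms by (intro wp_unique[OF assms(1) _ _ i]) (auto simp: is_weak_gradient_def)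
 hence "AE x in leb. \<forall>j\<in>UNIV. x : A --> column j (G x) = column j (G' x)"
  by (intro AE_finite_allI) auto
 thus ?thesis by eventually_elim (auto simp: column_def vec_eq_iff)
qed

lemma iwg_wgr:
 "is_weak_gradient A u G ==> is_weak_gradient A u (weak_gradient A u)"
 unfolding weak_gradient_def by (rule someI[where P="is_weak_gradient A u"])

lemma wgr_AE:
 assumes "open A" "is_weak_gradient A u G"
 shows "AE x in leb. x : A --> weak_gradient A u x = G x"
 by (rule iwg_unique[OF assms(1) iwg_wgr[OF assms(2)] assms(2)])

lemma W11D:
 "u : W11 A ==> sint A u"
 "u : W11 A ==> is_weak_gradient A u (weak_gradient A u)"
 by (auto simp: W11_def intro: iwg_wgr)

lemma iwg_subset:
 assumes "is_weak_gradient A u G" "B <= A" "open B"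
 shows "is_weak_gradient B u G"
 unfolding is_weak_gradient_def
proof (intro conjI allI)
 show "sint B G"
  using assms set_integrable_subset[of leb A G B] by (auto simp: is_weak_gradient_def)
 show "weak_partial B j u (%x. column j (G x))" for j
  using assms(1) by (intro wp_subset[OF _ assms(2)]) (simp add: is_weak_gradient_def)
qed

lemma blin_slice: "bounded_linear (%H::real^'n^'n^'d. (\<chi> i j. H $ i $ j $ k) :: real^'n^'d)"
 by (intro linear_conv_bounded_linear[THEN iffD1] linearI) (auto simp: vec_eq_iff)

lemma whs_unique:
 assumes "open A"
  "!!k. weak_partial A k G (%x. \<chi> i j. H x $ i $ j $ k)" "!!k. weak_partial A k G (%x. \<chi> i j. H' x $ i $ j $ k)"
  "sint A H" "sint A (H' :: real^'n => real^'n^'n^'d)"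
 shows "AE x in leb. x : A --> H x = H' x"
proof -
 have "AE x in leb. x : A --> (\<chi> i j. H x $ i $ j $ k) = (\<chi> i j. H' x $ i $ j $ k)" for k
  by (rule wp_unique[OF assms(1-3) sint_blin(1)[OF blin_slice assms(4)]
  sint_blin(1)[OF blin_slice assms(5)]])
 hence "AE x in leb. \<forall>k\<in>UNIV. x : A --> (\<chi> i j. H x $ i $ j $ k) = (\<chi> i j. H' x $ i $ j $ k)"
  by (intro AE_finite_allI) auto
 thus ?thesis by eventually_elim (auto simp: vec_eq_iff)
qed

text \<open>A weak Hessian is defined as the weak derivative of the selected gradient
  \<open>weak_gradient A u\<close>; almost everywhere uniqueness lets any representative
  \<open>G\<close> replace it.\<close>

lemma iwhI:
 fixes H :: "real^'n => real^'n^'n^'d"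
 assumes "open A" "is_weak_gradient A u G" "sint A H"
  "!!k. weak_partial A k G (%x. \<chi> i j. H x $ i $ j $ k)"
 shows "is_weak_hessian A u H"
 unfolding is_weak_hessian_def
proof (intro conjI allI assms(3))
 have "AE x in leb. x : A --> G x = weak_gradient A u x"
  using wgr_AE[OF assms(1,2)] by eventually_elim auto
 thus "weak_partial A k (weak_gradient A u) (%x. \<chi> i j. H x $ i $ j $ k)" for k
  using assms(2)
  by (intro wp_cong_AE[OF assms(4) _ sint_blin(1)[OF blin_slice assms(3)]])
  (auto simp: is_weak_gradient_def)
qed

lemma W21I:
 assumes "open A" "sint A u" "is_weak_gradient A u G" "sint A H"
  "!!k. weak_partial A k G (%x. \<chi> i j. H x $ i $ j $ k)"
 shows "u : W21 A" "AE x in leb. x : A --> weak_hessian A u x = H x"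
proof -
 have h: "is_weak_hessian A u H" by (rule iwhI[OF assms(1,3,4,5)])
 thus "u : W21 A" using assms(2,3) by (auto simp: W21_def W11_def)
 have h': "is_weak_hessian A u (weak_hessian A u)" unfolding weak_hessian_def using h by (rule someI[where P="is_weak_hessian A u"])
 show "AE x in leb. x : A --> weak_hessian A u x = H x"
  using h h' by (intro whs_unique[OF assms(1), where G="weak_gradient A u"]) (auto simp: is_weak_hessian_def)
qed

lemma W21D:
 assumes "u : W21 A"
 shows "sint A u" "is_weak_gradient A u (weak_gradient A u)"
  "sint A (weak_hessian A u)"
  "weak_partial A k (weak_gradient A u) (%x. \<chi> i j. weak_hessian A u x $ i $ j $ k)"
proof -
 obtain H where "is_weak_hessian A u H" using assms by (auto simp: W21_def)
 hence "is_weak_hessian A u (weak_hessian A u)"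
  unfolding weak_hessian_def by (rule someI[where P="is_weak_hessian A u"])
 thus "sint A (weak_hessian A u)"
  "weak_partial A k (weak_gradient A u) (%x. \<chi> i j. weak_hessian A u x $ i $ j $ k)"
  by (auto simp: is_weak_hessian_def)
qed (use assms W11D[of u A] in "auto simp: W21_def")

text \<open>Both sides are minus the integral of the component \<open>i\<close> of \<open>u\<close>
  against a mixed second derivative of \<open>ph\<close>, in which the order does not matter. It
  yields the symmetry of weak Hessians and, after blow-up, the rank-one form of a gradient
  jump.\<close>

lemma wgr_curl_free:
 fixes u :: "real^'n => real^'d"
 assumes "is_weak_gradient A u G" "sint A u" "ph : tfs A"
 shows "(LINT x:A|leb. pdv k ph x * G x $ i $ j) = (LINT x:A|leb. pdv j ph x * G x $ i $ k)"
proof -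
 have iG: "sint A (%x. column j (G x))" for j
  using assms(1) sint_blin(1)[OF blin_column] by (auto simp: is_weak_gradient_def)
 have "(LINT x:A|leb. pdv k ph x * G x $ i $ j) =
  - (LINT x:A|leb. pdv j (pdv k ph) x *\<^sub>R u x) $ i" for j k
 proof -
  have "(LINT x:A|leb. pdv k ph x *\<^sub>R column j (G x)) $ i =
  (LINT x:A|leb. (pdv k ph x *\<^sub>R column j (G x)) $ i)"
  by (rule sint_vec_nth(2)[OF sint_test_scaleR[OF iG tf_pderiv[OF assms(3)]]])
  moreover have "(LINT x:A|leb. pdv j (pdv k ph) x *\<^sub>R u x) =
  - (LINT x:A|leb. pdv k ph x *\<^sub>R column j (G x))"
  using assms(1) by (intro wpD tf_pderiv assms(3)) (auto simp: is_weak_gradient_def)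
  ultimately show ?thesis by (simp add: column_def)
 qed
 note this[of k j] this[of j k]
 moreover have "pdv j (pdv k ph) = pdv k (pdv j ph)"
  by (rule ext) (rule pderiv_at_commute[OF tfD(1)[OF assms(3)]])
 ultimately show ?thesis by simp
qed

text \<open>Growth, quasiconvexity and the recession estimate speak of symmetric tensors, so every
  weak Hessian inserted into the energy must be symmetric almost everywhere. Testing moves the last
  derivative to the test function, after which \<open>wgr_curl_free\<close> exchanges
  \<open>j\<close> and \<open>k\<close>.\<close>

lemma whs_symmetric:
 fixes H :: "real^'n => real^'n^'n^'d"
 assumes "open A" "sint A u" "is_weak_gradient A u G" "sint A H"
  "!!k. weak_partial A k G (%x. \<chi> i j. H x $ i $ j $ k)"
 shows "AE x in leb. x : A --> H x : sym_tensors"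
proof -
 have iH: "sint A (%x. H x $ i $ j $ k)" for i j k
  by (intro sint_vec_nth(1)) (rule assms(4))
 have iG: "sint A G" using assms(3) by (simp add: is_weak_gradient_def)
 have "AE x in leb. x : A --> H x $ i $ j $ k - H x $ i $ k $ j = 0" for i j k
 proof (rule fundamental_lemma_real[OF assms(1)])
  fix ph :: "real^'n => real" assume ph: "ph : tfs A"
  have i: "sint A (%x. ph x * H x $ i $ j $ k)" for j k
  using sint_test_scaleR[OF iH ph] by simp
  have "(LINT x:A|leb. ph x * H x $ i $ j $ k) = - (LINT x:A|leb. pdv k ph x * G x $ i $ j)" for j k
  proof -
  have sl: "sint A (%x. (\<chi> i j. H x $ i $ j $ k) :: real^'n^'d)"
  by (rule sint_blin(1)[OF blin_slice assms(4)])
  have T: "bounded_linear (%M::real^'n^'d. M $ i $ j)"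
  by (rule bounded_linear_compose[OF bounded_linear_vec_nth bounded_linear_vec_nth])
  have "(LINT x:A|leb. pdv k ph x *\<^sub>R G x) $ i $ j = - (LINT x:A|leb. ph x *\<^sub>R (\<chi> i j. H x $ i $ j $ k)) $ i $ j"
  using wpD[OF assms(5) ph, of k] by simp
  thus ?thesis
  unfolding sint_blin(2)[OF T sint_test_scaleR[OF sl ph]]
  sint_blin(2)[OF T sint_test_scaleR[OF iG tf_pderiv[OF ph]]]
  by simp
  qed
  thus "(LINT x:A|leb. ph x * (H x $ i $ j $ k - H x $ i $ k $ j)) = 0"
  using set_integral_diff(2)[OF i[of j k] i[of k j]] wgr_curl_free[OF assms(3,2) ph, of k i j]
  by (simp add: right_diff_distrib)
 qed (use iH in auto)
 hence "AE x in leb. \<forall>i\<in>UNIV. \<forall>j\<in>UNIV. \<forall>k\<in>UNIV. x : A --> H x $ i $ j $ k - H x $ i $ k $ j = 0"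
  by (intro AE_finite_allI) auto
 thus ?thesis by eventually_elim (auto simp: sym_tensors_def)
qed

subsection \<open>Cubes\<close>

context frame begin

definition cube :: "real => (real^'n) set" where
 "cube r = {y. ALL j. \<bar>y \<bullet> e j\<bar> < r}"

lemma cube_eq_slab: "cube r = slab (%_. - r) (%_. r)"
proof -
 have "\<bar>a\<bar> < r \<longleftrightarrow> - r < a & a < r" for a by linarith
 thus ?thesis by (simp add: cube_def slab_def)
qed

lemma open_cube: "open (cube r)"
 by (simp add: cube_eq_slab open_slab)

lemma cube_mono: "r <= s ==> cube r <= cube s"
 by (auto simp: cube_def intro: less_le_trans)

lemma cube_leb [measurable, simp]: "cube r : sets leb"
 using open_cube by (simp add: borel_open sets_completionI_sets)

lemma scaled_in_cube:
 assumes "!!j. \<bar>y \<bullet> e j\<bar> <= s" "0 < s" "0 <= t" "t < 1"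
 shows "t *\<^sub>R y : cube s"
proof -
 have "t * \<bar>y \<bullet> e j\<bar> < s" for j
 proof -
  have "t * \<bar>y \<bullet> e j\<bar> <= t * s" using assms by (intro mult_left_mono) auto
  also have "\<dots> < 1 * s" using assms by (intro mult_strict_right_mono) auto
  finally show ?thesis by simp
 qed
 thus ?thesis using assms(3) by (simp add: cube_def abs_mult)
qed

lemma closure_cube:
 assumes "s > 0"
 shows "closure (cube s) = {y. ALL j. \<bar>y \<bullet> e j\<bar> <= s}"
proof
 have "{y. ALL j. \<bar>y \<bullet> e j\<bar> <= s} = {y. ALL j. - s <= y \<bullet> e j & y \<bullet> e j <= s}"
  by (auto simp: abs_le_iff) (metis minus_le_iff)+
 hence "closed {y. ALL j. \<bar>y \<bullet> e j\<bar> <= s}" using closed_cslab by simp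
 thus "closure (cube s) <= {y. ALL j. \<bar>y \<bullet> e j\<bar> <= s}"
  by (intro closure_minimal) (auto simp: cube_def less_imp_le)
 show "{y. ALL j. \<bar>y \<bullet> e j\<bar> <= s} <= closure (cube s)"
 proof
  fix y assume y: "y : {y. ALL j. \<bar>y \<bullet> e j\<bar> <= s}"
  define x where "x = (%n. (1 - inverse (real (Suc n))) *\<^sub>R y)"
  have "inverse (real (Suc n)) <= 1" "0 < inverse (real (Suc n))" for n
  by (auto simp: divide_simps)
  hence "x n : cube s" for n
  unfolding x_def using y assms by (intro scaled_in_cube) auto
  moreover have "x \<longlonglongrightarrow> (1 - 0) *\<^sub>R y"
  unfolding x_def by (intro tendsto_intros LIMSEQ_inverse_real_of_nat)
  ultimately show "y : closure (cube s)" by (auto simp: closure_sequential)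
 qed
qed

lemma fr_cube:
 assumes "s > 0"
 shows "frontier (cube s) = {y. (ALL j. \<bar>y \<bullet> e j\<bar> <= s) & (EX j. \<bar>y \<bullet> e j\<bar> = s)}"
 unfolding frontier_def closure_cube[OF assms] interior_open[OF open_cube]
 by (auto simp: cube_def not_less) (metis order_antisym)

lemma bdd_cube: "bounded (cube s)"
proof -
 have "cube s <= {y. ALL j. - s <= y \<bullet> e j & y \<bullet> e j <= s}"
  by (auto simp: cube_def abs_less_iff less_imp_le) (metis less_imp_le minus_less_iff)+
 thus ?thesis
  using compact_imp_bounded[OF compact_cslab[of "%_. - s" "%_. s"]] bounded_subset by blast
qed

lemma em_cslab:
 assumes "!!j. l j <= u j"
 shows "emeasure leb {y. ALL j. l j <= y \<bullet> e j & y \<bullet> e j <= u j} = ennreal (\<Prod>j\<in>UNIV. u j - l j)"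
proof -
 let ?C = "{y. ALL j. l j <= y \<bullet> e j & y \<bullet> e j <= u j}"
 let ?H = "\<Union>j\<in>UNIV. {y. y \<bullet> e j = l j} \<union> {y. y \<bullet> e j = u j}"
 have "negligible ?H"
  by (rule negligible_Union) (auto intro: negligible_Un negligible_frame_hyperplane)
 moreover have "?C - slab l u <= ?H" by (auto simp: slab_def) (metis order.strict_iff_order)+
 ultimately have "negligible (?C - slab l u)" by (rule negligible_subset)
 hence n: "?C - slab l u : null_sets leb" by (simp add: negligible_iff_null_sets)
 have "slab l u \<union> (?C - slab l u) = ?C" by (auto simp: slab_def less_imp_le)
 moreover have "emeasure leb (slab l u \<union> (?C - slab l u)) = emeasure leb (slab l u)"
  by (rule emeasure_Un_null_set[OF _ n]) (simp add: open_slab borel_open sets_completionI_sets)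
 moreover have "emeasure leb (slab l u) = emeasure lborel (slab l u)"
  by (simp add: open_slab)
 ultimately show ?thesis using em_slab[OF assms] by simp
qed

lemma prod_frame_remove:
 "(\<Prod>j\<in>(UNIV::'n set). if j = i then a else (f j::real)) = a * (\<Prod>j\<in>UNIV - {i}. f j)"
proof -
 have "(\<Prod>j\<in>UNIV - {i}. if j = i then a else f j) = (\<Prod>j\<in>UNIV - {i}. f j)"
  by (rule prod.cong) auto
 thus ?thesis using prod.remove[of UNIV i "%j. if j = i then a else f j"] by simp
qed

end

subsection \<open>Boundary traces of bounded functions\<close>

context frame begin

definition to_face :: "'n => real => real^'n => real^'n" where
 "to_face i c x = x + (c - x \<bullet> e i) *\<^sub>R e i"

lemma to_face_inner: "to_face i c x \<bullet> e k = (if k = i then c else x \<bullet> e k)"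
 by (simp add: to_face_def inner_add_left orthonormal)

text \<open>A set of diameter d in a cover of \<open>Z\<close> is replaced by a box of length
  \<open>2 * s\<close> along \<open>e i\<close> and \<open>2 * d\<close> in the remaining
  directions. Its volume is a fixed multiple of the Hausdorff weight of the set, so the boxes have
  arbitrarily small total volume, and they cover the points that project into
  \<open>Z\<close>.\<close>

lemma null_cylinder:
 assumes Z: "hausdorff_measure (CARD('n) - 1) Z = 0" and s: "s > 0"
 shows "negligible {x. \<bar>x \<bullet> e i\<bar> < s & to_face i c x : Z}"
proof (subst negligible_outer_le, intro allI impI)
 fix kp :: real assume "kp > 0"
 define m where "m = CARD('n) - 1"
 define \<omega> where "\<omega> = unit_ball_vol (real m)"
 have \<omega>: "\<omega> > 0" unfolding \<omega>_def by (rule unit_ball_vol_pos) simp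
 \<comment> \<open>\<open>K\<close> is the quotient of the box volume
   \<open>2 * s * (2 * d) ^ m\<close> by the Hausdorff weight
   \<open>\<omega> * (d / 2) ^ m\<close>.\<close>
 define K where "K = 2 * s * 4 ^ m / \<omega>"
 have K: "K > 0" using s \<omega> by (simp add: K_def)
 have "hausdorff_pre m 1 Z <= hausdorff_measure m Z"
  unfolding hausdorff_measure_def by (rule SUP_upper) simp
 hence "hausdorff_pre m 1 Z = 0" using Z by (simp add: m_def)
 also have "0 < ennreal (kp / K)" using \<open>kp > 0\<close> K by simp
 finally obtain C :: "nat => (real^'n) set" where C: "Z <= \<Union>(range C)" "!!n. bounded (C n)"
  and sum: "(\<Sum>n. if C n = {} then 0 else ennreal (unit_ball_vol (real m) * (diameter (C n) / 2) ^ m)) < ennreal (kp / K)"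
  unfolding hausdorff_pre_def INF_less_iff by auto
 define d where "d = (%n. diameter (C n))"
 have d: "d n >= 0" for n unfolding d_def by (rule diameter_ge_0[OF C(2)])
 define z where "z = (%n. SOME z. z : C n)"
 have z: "z n : C n" if "C n ~= {}" for n
  unfolding z_def using that by (simp add: some_in_eq)
 \<comment> \<open>An empty member of the cover has weight 0 and no point \<open>z n\<close>, so its
   box is empty as well.\<close>
 define R where "R = (%n. if C n = {} then {} else
  {y. ALL j. (if j = i then - s else z n \<bullet> e j - d n) <= y \<bullet> e j & y \<bullet> e j <= (if j = i then s else z n \<bullet> e j + d n)})"
 have Rm: "R n : sets leb" for n
  unfolding R_def using closed_cslab[of "%j. if j = i then - s else z n \<bullet> e j - d n" "%j. if j = i then s else z n \<bullet> e j + d n"]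
  by (auto intro: sets_completionI_sets)
 have Re: "emeasure leb (R n) = ennreal K * (if C n = {} then 0 else ennreal (unit_ball_vol (real m) * (diameter (C n) / 2) ^ m))" for n
 proof (cases "C n = {}")
  case False
  have "emeasure leb (R n) = ennreal (\<Prod>j\<in>UNIV. (if j = i then s else z n \<bullet> e j + d n) - (if j = i then - s else z n \<bullet> e j - d n))"
  unfolding R_def using False s d[of n] by (simp only: if_False) (rule em_cslab, auto)
  also have "(\<Prod>j\<in>UNIV. (if j = i then s else z n \<bullet> e j + d n) - (if j = i then - s else z n \<bullet> e j - d n)) =
  (\<Prod>j\<in>UNIV. if j = i then 2 * s else 2 * d n)" by (intro prod.cong) auto
  also have "\<dots> = 2 * s * (2 * d n) ^ m" unfolding prod_frame_remove by (simp add: m_def card_Diff_singleton)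
  also have "2 * d n = 4 * (d n / 2)" by simp
  also have "(4 * (d n / 2)) ^ m = 4 ^ m * (d n / 2) ^ m" by (rule power_mult_distrib)
  also have "2 * s * (4 ^ m * (d n / 2) ^ m) = K * (\<omega> * (d n / 2) ^ m)"
  proof -
  have "K * \<omega> = 2 * s * 4 ^ m" using \<omega> by (simp add: K_def)
  thus ?thesis by (metis mult.assoc)
  qed
  finally have "emeasure leb (R n) = ennreal (K * (\<omega> * (d n / 2) ^ m))" .
  also have "\<dots> = ennreal K * ennreal (\<omega> * (d n / 2) ^ m)" using K by (intro ennreal_mult') simp
  finally show ?thesis using False by (simp only: d_def \<omega>_def if_False)
 qed (simp add: R_def)
 have sub: "{x. \<bar>x \<bullet> e i\<bar> < s & to_face i c x : Z} <= (\<Union>n. R n)"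
 proof
  fix x assume x: "x : {x. \<bar>x \<bullet> e i\<bar> < s & to_face i c x : Z}"
  then obtain n where n: "to_face i c x : C n" using C(1) by auto
  hence ne: "C n ~= {}" by auto
  have "\<bar>x \<bullet> e k - z n \<bullet> e k\<bar> <= d n" if "k ~= i" for k
  proof -
  have "x \<bullet> e k - z n \<bullet> e k = (to_face i c x - z n) \<bullet> e k"
  using that by (simp add: inner_diff_left to_face_inner)
  also have "\<bar>\<dots>\<bar> <= dist (to_face i c x) (z n)" by (simp add: abs_inner_frame_le dist_norm)
  also have "\<dots> <= d n" unfolding d_def by (rule diameter_bounded_bound[OF C(2) n z[OF ne]])
  finally show ?thesis .
  qed
  hence "x : R n" using ne x by (force simp: R_def abs_le_iff abs_less_iff)
  thus "x : (\<Union>n. R n)" by blast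
 qed
 have "emeasure leb (\<Union>n. R n) <= (\<Sum>n. emeasure leb (R n))"
  using Rm by (intro emeasure_subadditive_countably) auto
 also have "\<dots> = ennreal K * (\<Sum>n. if C n = {} then 0 else ennreal (unit_ball_vol (real m) * (diameter (C n) / 2) ^ m))"
  unfolding Re by (rule ennreal_suminf_cmult)
 also have "\<dots> <= ennreal K * ennreal (kp / K)" using sum by (intro mult_left_mono) auto
 also have "\<dots> = ennreal kp" using K \<open>kp > 0\<close> by (simp add: ennreal_mult'[symmetric])
 finally have le: "emeasure leb (\<Union>n. R n) <= ennreal kp" .
 have fin: "(\<Union>n. R n) : lmeasurable"
 proof (rule fmeasurableI)
  show "(\<Union>n. R n) : sets leb" using Rm by blast
  show "emeasure leb (\<Union>n. R n) < \<infinity>" by (rule order_le_less_trans[OF le]) simp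
 qed
 moreover have "measure leb (\<Union>n. R n) <= kp"
  using le fin \<open>kp > 0\<close> by (simp add: emeasure_eq_measure2)
 ultimately show "EX T. {x. \<bar>x \<bullet> e i\<bar> < s & to_face i c x : Z} <= T & T : lmeasurable & measure leb T <= kp"
  using sub by blast
qed

lemma face_point_fr:
 assumes "x : cube s" "s > 0" "\<bar>c\<bar> = s"
 shows "to_face i c x : frontier (cube s)"
 using assms unfolding fr_cube[OF assms(2)]
 by (auto simp: to_face_inner cube_def less_imp_le intro!: exI[of _ i])

text \<open>The points whose projection to the face is near \<open>y\<close> contain a box of full
  length \<open>2 * s\<close> along \<open>e i\<close>; in each other direction the interval of
  half-length \<open>dl\<close> about a coordinate of \<open>y\<close> meets the cube in length at
  least \<open>dl\<close>. This lower bound allows the mass near a face to be recovered from ball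
  averages centred on the face.\<close>

lemma em_near_face:
 assumes y: "y : cube s" and s: "s > 0" and c: "\<bar>c\<bar> = s" and near: "\<bar>c - y \<bullet> e i\<bar> <= dl" and dl: "0 < dl" "dl <= s"
 shows "ennreal (2 * s * dl ^ (CARD('n) - 1)) \<le>
  emeasure lborel {x : cube s. dist (to_face i c x) y < 2 * real CARD('n) * dl}"
proof -
 define l where "l = (%k. if k = i then - s else max (- s) (y \<bullet> e k - dl))"
 define u where "u = (%k. if k = i then s else min s (y \<bullet> e k + dl))"
 have yk: "\<bar>y \<bullet> e k\<bar> < s" for k using y by (simp add: cube_def)
 have w: "dl <= u k - l k" if "k ~= i" for k
  using yk[of k] dl that by (auto simp: u_def l_def max_def min_def abs_less_iff)
 have lu: "l k <= u k" for k using w[of k] dl s by (cases "k = i") (auto simp: u_def l_def)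
 have "slab l u <= {x : cube s. dist (to_face i c x) y < 2 * real CARD('n) * dl}"
 proof
  fix x assume x: "x : slab l u"
  have b: "l k < x \<bullet> e k" "x \<bullet> e k < u k" for k using x by (auto simp: slab_def)
  have "\<bar>x \<bullet> e k\<bar> < s" for k using b[of k] by (auto simp: l_def u_def abs_less_iff split: if_splits)
  hence xc: "x : cube s" by (simp add: cube_def)
  have "\<bar>(to_face i c x - y) \<bullet> e k\<bar> <= dl" for k
  using b[of k] near by (auto simp: inner_diff_left to_face_inner l_def u_def abs_le_iff)
  hence "norm (to_face i c x - y) <= (\<Sum>k\<in>(UNIV::'n set). dl)"
  by (intro order_trans[OF norm_le_sum_frame] sum_mono)
  moreover have "0 < real CARD('n) * dl" using dl by simp
  ultimately have "dist (to_face i c x) y < 2 * real CARD('n) * dl" by (simp add: dist_norm)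
  thus "x : {x : cube s. dist (to_face i c x) y < 2 * real CARD('n) * dl}" using xc by simp
 qed
 moreover have "open {x : cube s. dist (to_face i c x) y < 2 * real CARD('n) * dl}"
  unfolding to_face_def Collect_conj_eq
  by (intro open_Int open_Collect_less continuous_intros) (simp add: open_cube)
 ultimately have "emeasure lborel (slab l u) <= emeasure lborel {x : cube s. dist (to_face i c x) y < 2 * real CARD('n) * dl}"
  by (intro emeasure_mono) auto
 moreover have "2 * s * dl ^ (CARD('n) - 1) <= (\<Prod>k\<in>UNIV. u k - l k)"
 proof -
  have "2 * s * dl ^ (CARD('n) - 1) = 2 * s * (\<Prod>k\<in>UNIV - {i}. dl)" by (simp add: card_Diff_singleton)
  also have "\<dots> <= 2 * s * (\<Prod>k\<in>UNIV - {i}. u k - l k)"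
  using w s dl by (intro mult_left_mono prod_mono) auto
  also have "\<dots> = (u i - l i) * (\<Prod>k\<in>UNIV - {i}. u k - l k)" by (simp add: u_def l_def)
  also have "\<dots> = (\<Prod>k\<in>UNIV. u k - l k)" by (subst prod.remove[of UNIV i]) auto
  finally show ?thesis .
 qed
 ultimately show ?thesis
  unfolding em_slab[OF lu] by (meson ennreal_leI order_trans)
qed


text \<open>If \<open>w\<close> is bounded and has trace zero, then \<open>w\<close> is small on average near each face: integrate
 the averages of \<open>w\<close> over balls centred on the face and apply dominated convergence and Tonelli.\<close>

lemma face_layer_lim:
 fixes W :: "real^'n => ennreal"
 assumes s: "s > 0" and c: "\<bar>c\<bar> = s" and W [measurable]: "W : borel_measurable borel"
  and W1: "AE x in lborel. W x <= 1"
  and Z: "hausdorff_measure (CARD('n) - 1) Z = 0"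
  and lim: "!!p. p : frontier (cube s) ==> p ~: Z ==>
  ((%r. (\<integral>\<^sup>+y. W y * idc (ball p r) y \<partial>lborel) / ennreal (r ^ CARD('n))) \<longlongrightarrow> 0) (at_right 0)"
 shows "(%n. (\<integral>\<^sup>+y. W y * idc {y : cube s. \<bar>c - y \<bullet> e i\<bar> <= inverse (real (Suc n))} y \<partial>lborel) /
  ennreal (inverse (real (Suc n)))) \<longlonglongrightarrow> 0"
proof -
 define N where "N = CARD('n)"
 have N: "N > 0" by (simp add: N_def)
 define dl where "dl = (%n. inverse (real (Suc n)))"
 have dl: "dl n > 0" for n by (simp add: dl_def)
 \<comment> \<open>A point in the layer of width \<open>dl n\<close> differs from the projections
   under consideration by at most \<open>dl n\<close> in each of the N frame directions; the factor
   2 makes the distance bound strict.\<close>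
 define r where "r = (%n. 2 * real N * dl n)"
 have r: "r n > 0" for n using dl N by (simp add: r_def)
 have dl0: "dl \<longlonglongrightarrow> 0" unfolding dl_def by (rule LIMSEQ_inverse_real_of_nat)
 have r0: "filterlim r (at_right 0) sequentially"
 proof -
  have "r \<longlonglongrightarrow> 2 * real N * 0" unfolding r_def by (intro tendsto_intros dl0)
  moreover have "r n ~= 0" for n using r[of n] by linarith
  ultimately show ?thesis using r by (simp add: filterlim_at)
 qed
 define psi where "psi = (%n x. (\<integral>\<^sup>+y. W y * idc (ball (to_face i c x) (r n)) y \<partial>lborel) / ennreal (r n ^ N))"
 have ptw: "AE x in lborel. x : cube s --> (%n. psi n x) \<longlonglongrightarrow> 0"
 proof -
  have "{x. \<bar>x \<bullet> e i\<bar> < s & to_face i c x : Z} : null_sets leb"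
  using null_cylinder[OF Z s] by (simp add: negligible_iff_null_sets)
  hence "AE x in leb. x ~: {x. \<bar>x \<bullet> e i\<bar> < s & to_face i c x : Z}" by (rule AE_not_in)
  hence "AE x in lborel. x ~: {x. \<bar>x \<bullet> e i\<bar> < s & to_face i c x : Z}" by (simp only: AE_completion_iff)
  thus ?thesis
  proof (rule eventually_mono, intro impI)
  fix x assume x: "x ~: {x. \<bar>x \<bullet> e i\<bar> < s & to_face i c x : Z}" "x : cube s"
  have "to_face i c x ~: Z" using x by (auto simp: cube_def)
  from filterlim_compose[OF lim[OF face_point_fr[OF x(2) s c] this] r0]
  show "(%n. psi n x) \<longlonglongrightarrow> 0" by (simp add: psi_def N_def)
  qed
 qed
 have [measurable]: "(%(x, y). idc (ball (to_face i c x) (r n)) y :: ennreal) : borel_measurable (borel \<Otimes>\<^sub>M borel)" for n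
 proof -
  have "open {p :: (real^'n) \<times> (real^'n). dist (to_face i c (fst p)) (snd p) < r n}"
  unfolding to_face_def by (intro open_Collect_less continuous_intros)
  hence "{p :: (real^'n) \<times> (real^'n). dist (to_face i c (fst p)) (snd p) < r n} : sets (borel \<Otimes>\<^sub>M borel)"
  unfolding borel_prod by (rule borel_open)
  hence "(%p. idc {p :: (real^'n) \<times> (real^'n). dist (to_face i c (fst p)) (snd p) < r n} p :: ennreal) : borel_measurable (borel \<Otimes>\<^sub>M borel)"
  by (rule borel_measurable_indicator)
  moreover have "(%p. idc {p :: (real^'n) \<times> (real^'n). dist (to_face i c (fst p)) (snd p) < r n} p :: ennreal) =
  (%(x, y). idc (ball (to_face i c x) (r n)) y)"
  by (auto simp: fun_eq_iff indicator_def)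
  ultimately show ?thesis by simp
 qed
 have mpsi [measurable]: "psi n : borel_measurable borel" for n
 proof -
  have "(%x. \<integral>\<^sup>+y. W y * idc (ball (to_face i c x) (r n)) y \<partial>lborel) : borel_measurable lborel"
  by (rule lborel.borel_measurable_nn_integral) measurable
  thus ?thesis unfolding psi_def by simp
 qed
 have cm [measurable]: "cube s : sets borel" using open_cube by (rule borel_open)
 define B where "B = unit_ball_vol (real N)"
 have B: "B >= 0" unfolding B_def by simp
 have bd: "psi n x <= ennreal B" for n x
 proof -
  have "(\<integral>\<^sup>+y. W y * idc (ball (to_face i c x) (r n)) y \<partial>lborel) <= (\<integral>\<^sup>+y. idc (ball (to_face i c x) (r n)) y \<partial>lborel)"
  by (rule nn_integral_mono_AE) (use W1 in eventually_elim, auto simp: indicator_def)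
  also have "\<dots> = emeasure lborel (ball (to_face i c x) (r n))" by (rule nn_integral_indicator) simp
  also have "\<dots> = ennreal (B * r n ^ N)"
  using r[of n] by (simp add: emeasure_ball B_def N_def)
  finally have "psi n x <= ennreal (B * r n ^ N) / ennreal (r n ^ N)"
  unfolding psi_def by (rule divide_right_mono_ennreal)
  also have "\<dots> = ennreal B" using r[of n] B by (simp add: divide_ennreal)
  finally show ?thesis .
 qed
 \<comment> \<open>The averages are bounded by the volume of the unit ball because \<open>W\<close>
   is at most 1, and they tend to 0 off the null cylinder over \<open>Z\<close>.\<close>
 have dct: "(%n. \<integral>\<^sup>+x. psi n x * idc (cube s) x \<partial>lborel) \<longlonglongrightarrow> (\<integral>\<^sup>+x. 0 \<partial>(lborel :: (real^'n) measure))"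
 proof (rule nn_integral_dominated_convergence[where w="%x. ennreal B * idc (cube s) x"])
  show "AE x in lborel. psi n x * idc (cube s) x <= ennreal B * idc (cube s) x" for n
  using bd by (intro AE_I2 mult_right_mono) auto
  have "emeasure lborel (cube s) < \<infinity>" using bdd_cube by (rule emeasure_bounded_finite)
  thus "(\<integral>\<^sup>+x. ennreal B * idc (cube s) x \<partial>lborel) < \<infinity>"
  by (simp add: nn_integral_cmult ennreal_mult_less_top)
  show "AE x in lborel. (%n. psi n x * idc (cube s) x) \<longlonglongrightarrow> 0"
  using ptw by eventually_elim (auto simp: indicator_def)
 qed auto
 define I where "I = (%n. \<integral>\<^sup>+y. W y * idc {y : cube s. \<bar>c - y \<bullet> e i\<bar> <= dl n} y \<partial>lborel)"
 \<comment> \<open>\<open>k\<close> compares the normalisation \<open>r n ^ N\<close> of the ball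
   averages with \<open>dl n\<close> times the lower bound
   \<open>2 * s * dl n ^ (N - 1)\<close>.\<close>
 define k where "k = (2 * real N) ^ N / (2 * s)"
 have k: "k > 0" using s N by (simp add: k_def)
 have main: "I n / ennreal (dl n) <= ennreal k * (\<integral>\<^sup>+x. psi n x * idc (cube s) x \<partial>lborel)" if "dl n <= s" for n
 proof -
  have [measurable]: "{x : cube s. dist (to_face i c x) y < r n} : sets borel" for y
  proof -
  have "open {x : cube s. dist (to_face i c x) y < r n}"
  unfolding to_face_def Collect_conj_eq
  by (intro open_Int open_Collect_less continuous_intros) (simp add: open_cube)
  thus ?thesis by (rule borel_open)
  qed
  have "ennreal (2 * s * dl n ^ (N - 1)) * I n =
  (\<integral>\<^sup>+y. ennreal (2 * s * dl n ^ (N - 1)) * (W y * idc {y : cube s. \<bar>c - y \<bullet> e i\<bar> <= dl n} y) \<partial>lborel)"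
  proof -
  have "closed {y. \<bar>c - y \<bullet> e i\<bar> <= dl n}" by (intro closed_Collect_le continuous_intros)
  hence "cube s \<inter> {y. \<bar>c - y \<bullet> e i\<bar> <= dl n} : sets borel" by (intro sets.Int cm borel_closed)
  moreover have "cube s \<inter> {y. \<bar>c - y \<bullet> e i\<bar> <= dl n} = {y : cube s. \<bar>c - y \<bullet> e i\<bar> <= dl n}" by auto
  ultimately have [measurable]: "{y : cube s. \<bar>c - y \<bullet> e i\<bar> <= dl n} : sets borel" by simp
  show ?thesis unfolding I_def by (rule nn_integral_cmult[symmetric]) measurable
  qed
  also have "\<dots> <= (\<integral>\<^sup>+y. W y * emeasure lborel {x : cube s. dist (to_face i c x) y < r n} \<partial>lborel)"
  proof (rule nn_integral_mono)
  fix y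
  show "ennreal (2 * s * dl n ^ (N - 1)) * (W y * idc {y : cube s. \<bar>c - y \<bullet> e i\<bar> <= dl n} y) \<le>
  W y * emeasure lborel {x : cube s. dist (to_face i c x) y < r n}"
  proof (cases "y : cube s & \<bar>c - y \<bullet> e i\<bar> <= dl n")
  case True
  have "ennreal (2 * s * dl n ^ (N - 1)) <= emeasure lborel {x : cube s. dist (to_face i c x) y < r n}"
  unfolding N_def r_def using True that by (intro em_near_face s c dl) auto
  hence "W y * ennreal (2 * s * dl n ^ (N - 1)) <= W y * emeasure lborel {x : cube s. dist (to_face i c x) y < r n}"
  by (rule mult_left_mono) simp
  thus ?thesis using True by (simp add: mult.commute)
  qed auto
  qed
  also have "\<dots> = (\<integral>\<^sup>+y. (\<integral>\<^sup>+x. W y * idc (ball (to_face i c x) (r n)) y * idc (cube s) x \<partial>lborel) \<partial>lborel)"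
  proof (rule nn_integral_cong)
  fix y
  have "(\<integral>\<^sup>+x. W y * idc (ball (to_face i c x) (r n)) y * idc (cube s) x \<partial>lborel) =
  (\<integral>\<^sup>+x. W y * idc {x : cube s. dist (to_face i c x) y < r n} x \<partial>lborel)"
  by (intro nn_integral_cong) (auto simp: indicator_def)
  also have "\<dots> = W y * emeasure lborel {x : cube s. dist (to_face i c x) y < r n}"
  by (rule nn_integral_cmult_indicator) simp
  finally show "W y * emeasure lborel {x : cube s. dist (to_face i c x) y < r n} =
  (\<integral>\<^sup>+x. W y * idc (ball (to_face i c x) (r n)) y * idc (cube s) x \<partial>lborel)" ..
  qed
  also have "\<dots> = (\<integral>\<^sup>+x. (\<integral>\<^sup>+y. W y * idc (ball (to_face i c x) (r n)) y * idc (cube s) x \<partial>lborel) \<partial>lborel)"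
  by (rule lborel_pair.Fubini'[symmetric]) measurable
  also have "\<dots> = (\<integral>\<^sup>+x. ennreal (r n ^ N) * (psi n x * idc (cube s) x) \<partial>lborel)"
  proof (rule nn_integral_cong)
  fix x
  have "open (ball (to_face i c x) (r n))" by simp
  hence "(\<integral>\<^sup>+y. W y * idc (ball (to_face i c x) (r n)) y * idc (cube s) x \<partial>lborel) =
  (\<integral>\<^sup>+y. W y * idc (ball (to_face i c x) (r n)) y \<partial>lborel) * idc (cube s) x"
  by (intro nn_integral_multc) (auto intro!: borel_measurable_times_ennreal borel_measurable_indicator)
  moreover have "ennreal (r n ^ N) * psi n x = (\<integral>\<^sup>+y. W y * idc (ball (to_face i c x) (r n)) y \<partial>lborel)"
  proof -
  have "0 < r n ^ N" using r[of n] by simp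
  moreover from this have "r n ^ N * inverse (r n ^ N) = 1" by (intro right_inverse) linarith
  ultimately have one: "ennreal (r n ^ N) * inverse (ennreal (r n ^ N)) = 1"
  by (simp add: inverse_ennreal ennreal_mult'[symmetric])
  have "a * (I * b) = I" if "a * b = 1" for a b I :: ennreal
  proof -
  have "a * (I * b) = (a * b) * I" by (simp only: mult_ac)
  thus ?thesis by (simp add: that)
  qed
  from this[OF one] show ?thesis unfolding psi_def divide_ennreal_def .
  qed
  ultimately show "(\<integral>\<^sup>+y. W y * idc (ball (to_face i c x) (r n)) y * idc (cube s) x \<partial>lborel) =
  ennreal (r n ^ N) * (psi n x * idc (cube s) x)"
  by (simp only: mult.assoc[symmetric])
  qed
  also have "\<dots> = ennreal (r n ^ N) * (\<integral>\<^sup>+x. psi n x * idc (cube s) x \<partial>lborel)"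
  by (rule nn_integral_cmult) measurable
  finally have le: "ennreal (2 * s * dl n ^ (N - 1)) * I n <= ennreal (r n ^ N) * (\<integral>\<^sup>+x. psi n x * idc (cube s) x \<partial>lborel)" .
  have e1: "ennreal (1 / (2 * s * dl n ^ N)) * ennreal (2 * s * dl n ^ (N - 1)) = ennreal (1 / dl n)"
  proof -
  have "dl n ^ N = dl n ^ (N - 1) * dl n" using N by (metis Suc_diff_1 power_Suc2)
  hence "1 / (2 * s * dl n ^ N) * (2 * s * dl n ^ (N - 1)) = 1 / dl n"
  using s dl[of n] by simp
  thus ?thesis using s dl[of n] by (simp add: ennreal_mult'[symmetric] del: ennreal_1)
  qed
  have e2: "ennreal (1 / (2 * s * dl n ^ N)) * ennreal (r n ^ N) = ennreal k"
  proof -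
  have "1 / (2 * s * dl n ^ N) * (r n ^ N) = k"
  using s dl[of n] unfolding k_def r_def power_mult_distrib[of "2 * real N" "dl n"] by simp
  thus ?thesis using s dl[of n] r[of n] by (simp add: ennreal_mult'[symmetric])
  qed
  have "ennreal (1 / (2 * s * dl n ^ N)) * (ennreal (2 * s * dl n ^ (N - 1)) * I n) \<le>
  ennreal (1 / (2 * s * dl n ^ N)) * (ennreal (r n ^ N) * (\<integral>\<^sup>+x. psi n x * idc (cube s) x \<partial>lborel))"
  using le by (rule mult_left_mono) simp
  hence "ennreal (1 / dl n) * I n <= ennreal k * (\<integral>\<^sup>+x. psi n x * idc (cube s) x \<partial>lborel)"
  by (simp only: e1 e2 mult.assoc[symmetric])
  moreover have "ennreal (1 / dl n) * I n = I n / ennreal (dl n)"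
  proof -
  have "ennreal (1 / dl n) = inverse (ennreal (dl n))" using dl[of n] by (simp add: inverse_ennreal divide_inverse)
  thus ?thesis by (simp add: divide_ennreal_def mult.commute)
  qed
  ultimately show ?thesis by simp
 qed
 have lim0: "(%n. ennreal k * (\<integral>\<^sup>+x. psi n x * idc (cube s) x \<partial>lborel)) \<longlonglongrightarrow> ennreal k * 0"
  using dct by (intro ennreal_tendsto_cmult) auto
 have "(%n. I n / ennreal (dl n)) \<longlonglongrightarrow> 0"
 proof (rule tendsto_sandwich[OF _ _ tendsto_const])
  show "\<forall>\<^sub>F n in sequentially. 0 <= I n / ennreal (dl n)" by simp
  have "\<forall>\<^sub>F n in sequentially. dl n < s" using order_tendstoD(2)[OF dl0 s] .
  thus "\<forall>\<^sub>F n in sequentially. I n / ennreal (dl n) <= ennreal k * (\<integral>\<^sup>+x. psi n x * idc (cube s) x \<partial>lborel)"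
  by eventually_elim (rule main, simp)
  show "(%n. ennreal k * (\<integral>\<^sup>+x. psi n x * idc (cube s) x \<partial>lborel)) \<longlonglongrightarrow> 0" using lim0 by simp
 qed
 thus ?thesis by (simp add: I_def dl_def)
qed


text \<open>The two functions share an approximate limit at Hausdorff-almost every frontier point,
  so the ball averages of their distance tend to 0 there, and the bound by 1 provides the
  domination. Each of the 2N faces then carries mass o(rho) in a layer of width rho, and a common
  width serves all of them.\<close>

lemma trace_layer:
 fixes tht sg :: "real^'n => real"
 assumes s: "s > 0" and tht: "sint (cube s) tht" and sg: "sint (cube s) sg"
  and bd: "AE x in leb. x : cube s --> \<bar>tht x - sg x\<bar> <= 1"
  and tr: "trace_eq (cube s) tht sg"
  and kp: "kp > 0" and rho1: "rho1 > 0"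
 shows "\<exists>rho. 0 < rho & rho < rho1 \<and>
  (\<integral>\<^sup>+y\<in>cube s - cube (s - rho). ennreal \<bar>tht y - sg y\<bar> \<partial>leb) <= ennreal (kp * rho)"
proof -
 define N where "N = CARD('n)"
 define w where "w = (%y. ennreal \<bar>tht y - sg y\<bar> * idc (cube s) y)"
 have m1: "(%y. idc (cube s) y *\<^sub>R tht y) : lbm"
  "(%y. idc (cube s) y *\<^sub>R sg y) : lbm"
  using tht sg by (auto simp: set_integrable_def)
 have weq: "w = (%y. ennreal \<bar>idc (cube s) y *\<^sub>R tht y - idc (cube s) y *\<^sub>R sg y\<bar>)"
  by (auto simp: w_def indicator_def fun_eq_iff)
 have mw: "w : lbm"
  unfolding weq using m1 by measurable
 then obtain W where W: "W : borel_measurable lborel" and Wae: "AE x in lborel. w x = W x"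
  using completion_ex_borel_measurable by blast
 have Wb: "W : borel_measurable borel" using W by simp
 have Wae': "AE x in leb. w x = W x" using Wae by (rule AE_completion)
 have W1: "AE x in lborel. W x <= 1"
 proof -
  have "AE x in leb. W x <= 1"
  using bd Wae'
  proof eventually_elim
  case (elim x)
  have "w x <= 1" using elim(1) by (auto simp: w_def indicator_def)
  thus ?case using elim(2) by simp
  qed
  thus ?thesis by (simp only: AE_completion_iff)
 qed
 define Z where "Z = {x : frontier (cube s). ~ (EX z. approx_limit (cube s) tht x z & approx_limit (cube s) sg x z)}"
 have Z: "hausdorff_measure (CARD('n) - 1) Z = 0"
  using tr by (simp add: trace_eq_def hausdorff_ae_def Z_def)
 have int_W: "(\<integral>\<^sup>+y. W y * idc S y \<partial>lborel) = (\<integral>\<^sup>+y\<in>S \<inter> cube s. ennreal \<bar>tht y - sg y\<bar> \<partial>leb)" for S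
 proof -
  have "(\<integral>\<^sup>+y. W y * idc S y \<partial>lborel) = (\<integral>\<^sup>+y. W y * idc S y \<partial>leb)"
  by (rule nn_integral_completion[symmetric])
  also have "\<dots> = (\<integral>\<^sup>+y. w y * idc S y \<partial>leb)"
  by (rule nn_integral_cong_AE) (use Wae' in eventually_elim, simp)
  also have "\<dots> = (\<integral>\<^sup>+y\<in>S \<inter> cube s. ennreal \<bar>tht y - sg y\<bar> \<partial>leb)"
  by (rule nn_integral_cong) (auto simp: w_def indicator_def)
  finally show ?thesis .
 qed
 have lim: "((%r. (\<integral>\<^sup>+y. W y * idc (ball p r) y \<partial>lborel) / ennreal (r ^ CARD('n))) \<longlongrightarrow> 0) (at_right 0)"
  if p: "p : frontier (cube s)" "p ~: Z" for p
 proof -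
  obtain z where z: "approx_limit (cube s) tht p z" "approx_limit (cube s) sg p z"
  using p by (auto simp: Z_def)
  define F where "F = (%v r. (\<integral>\<^sup>+y\<in>cube s \<inter> ball p r. ennreal (norm (v y - z)) \<partial>leb) / ennreal (r ^ CARD('n)))"
  have "((%r. F tht r + F sg r) \<longlongrightarrow> 0 + 0) (at_right 0)"
  by (intro tendsto_add) (use z in "simp_all add: approx_limit_def F_def")
  hence l: "((%r. F tht r + F sg r) \<longlongrightarrow> 0) (at_right 0)" by simp
  have le: "(\<integral>\<^sup>+y. W y * idc (ball p r) y \<partial>lborel) / ennreal (r ^ CARD('n)) <= F tht r + F sg r" for r
  proof -
  have mz: "(%y. ennreal (norm (v y - z)) * idc (cube s \<inter> ball p r) y) : lbm"
  if "(%y. idc (cube s) y *\<^sub>R v y) : lbm" for v :: "real^'n => real"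
  proof -
  have "(%y. ennreal (norm (v y - z)) * idc (cube s \<inter> ball p r) y) =
  (%y. ennreal (norm (idc (cube s) y *\<^sub>R v y - z)) * idc (cube s \<inter> ball p r) y)"
  by (auto simp: indicator_def fun_eq_iff)
  moreover have "cube s \<inter> ball p r : sets leb" by (intro sets.Int) auto
  ultimately show ?thesis using that by simp
  qed
  have "(\<integral>\<^sup>+y. W y * idc (ball p r) y \<partial>lborel) = (\<integral>\<^sup>+y. ennreal \<bar>tht y - sg y\<bar> * idc (cube s \<inter> ball p r) y \<partial>leb)"
  unfolding int_W by (simp add: Int_commute)
  also have "\<dots> <= (\<integral>\<^sup>+y. ennreal (norm (tht y - z)) * idc (cube s \<inter> ball p r) y +
  ennreal (norm (sg y - z)) * idc (cube s \<inter> ball p r) y \<partial>leb)"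
  by (intro nn_integral_mono) (auto simp: indicator_def ennreal_plus[symmetric] simp del: ennreal_plus intro!: ennreal_leI)
  also have "\<dots> = (\<integral>\<^sup>+y\<in>cube s \<inter> ball p r. ennreal (norm (tht y - z)) \<partial>leb) +
  (\<integral>\<^sup>+y\<in>cube s \<inter> ball p r. ennreal (norm (sg y - z)) \<partial>leb)"
  by (rule nn_integral_add[OF mz[OF m1(1)] mz[OF m1(2)]])
  finally have "(\<integral>\<^sup>+y. W y * idc (ball p r) y \<partial>lborel) / ennreal (r ^ CARD('n)) \<le>
  ((\<integral>\<^sup>+y\<in>cube s \<inter> ball p r. ennreal (norm (tht y - z)) \<partial>leb) +
  (\<integral>\<^sup>+y\<in>cube s \<inter> ball p r. ennreal (norm (sg y - z)) \<partial>leb)) / ennreal (r ^ CARD('n))"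
  by (rule divide_right_mono_ennreal)
  thus ?thesis by (simp add: F_def add_divide_distrib_ennreal)
  qed
  show ?thesis
  by (rule tendsto_sandwich[OF _ _ tendsto_const l]) (use le in auto)
 qed
 define L where "L = (%c i n. {y : cube s. \<bar>c - y \<bullet> e i\<bar> <= inverse (real (Suc n))})"
 have face: "(%n. (\<integral>\<^sup>+y. W y * idc (L c i n) y \<partial>lborel) / ennreal (inverse (real (Suc n)))) \<longlonglongrightarrow> 0"
  if "\<bar>c\<bar> = s" for c i
  unfolding L_def by (rule face_layer_lim[OF s that Wb W1 Z lim])
 define kp' where "kp' = kp / (2 * real N)"
 have N: "N > 0" by (simp add: N_def)
 have kp': "kp' > 0" using kp N by (simp add: kp'_def)
 have "\<forall>\<^sub>F n in sequentially. \<forall>p\<in>{s, -s} \<times> UNIV. (\<integral>\<^sup>+y. W y * idc (L (fst p) (snd p) n) y \<partial>lborel) / ennreal (inverse (real (Suc n))) < ennreal kp'"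
  using kp' s by (intro eventually_ball_finite ballI order_tendstoD(2)[OF face]) auto
 moreover have "\<forall>\<^sub>F n in sequentially. inverse (real (Suc n)) < rho1"
  using order_tendstoD(2)[OF LIMSEQ_inverse_real_of_nat rho1] .
 ultimately have "\<forall>\<^sub>F n in sequentially. inverse (real (Suc n)) < rho1 \<and>
  (\<forall>p\<in>{s, -s} \<times> UNIV. (\<integral>\<^sup>+y. W y * idc (L (fst p) (snd p) n) y \<partial>lborel) / ennreal (inverse (real (Suc n))) < ennreal kp')"
  by eventually_elim auto
 then obtain n where n: "inverse (real (Suc n)) < rho1"
  "!!p. p : {s, -s} \<times> UNIV ==> (\<integral>\<^sup>+y. W y * idc (L (fst p) (snd p) n) y \<partial>lborel) / ennreal (inverse (real (Suc n))) < ennreal kp'"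
  unfolding eventually_sequentially by blast
 define rho where "rho = inverse (real (Suc n))"
 have rho: "rho > 0" by (simp add: rho_def)
 have each: "(\<integral>\<^sup>+y. W y * idc (L (fst p) (snd p) n) y \<partial>lborel) <= ennreal (kp' * rho)" if "p : {s, -s} \<times> UNIV" for p
 proof -
  have "(\<integral>\<^sup>+y. W y * idc (L (fst p) (snd p) n) y \<partial>lborel) / ennreal rho <= ennreal kp'"
  using n(2)[OF that] by (simp add: rho_def less_imp_le)
  hence "(\<integral>\<^sup>+y. W y * idc (L (fst p) (snd p) n) y \<partial>lborel) / ennreal rho * ennreal rho <= ennreal kp' * ennreal rho"
  by (rule mult_right_mono) simp
  thus ?thesis using rho kp' by (simp add: ennreal_divide_times divide_ennreal_def mult.assoc ennreal_mult' inverse_ennreal flip: ennreal_mult')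
 qed
 have Lm: "L c i n : sets borel" for c i
 proof -
  have "closed {y. \<bar>c - y \<bullet> e i\<bar> <= inverse (real (Suc n))}" by (intro closed_Collect_le continuous_intros)
  hence "cube s \<inter> {y. \<bar>c - y \<bullet> e i\<bar> <= inverse (real (Suc n))} : sets borel"
  by (intro sets.Int borel_open[OF open_cube]) (rule borel_closed)
  moreover have "cube s \<inter> {y. \<bar>c - y \<bullet> e i\<bar> <= inverse (real (Suc n))} = L c i n" by (auto simp: L_def)
  ultimately show ?thesis by simp
 qed
 have "(\<integral>\<^sup>+y\<in>cube s - cube (s - rho). ennreal \<bar>tht y - sg y\<bar> \<partial>leb) = (\<integral>\<^sup>+y. W y * idc (cube s - cube (s - rho)) y \<partial>lborel)"
  unfolding int_W by (intro nn_integral_cong) (auto simp: indicator_def)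
 also have "\<dots> <= (\<integral>\<^sup>+y. (\<Sum>p\<in>{s, -s} \<times> UNIV. W y * idc (L (fst p) (snd p) n) y) \<partial>lborel)"
 proof (rule nn_integral_mono)
  fix y
  show "W y * idc (cube s - cube (s - rho)) y <= (\<Sum>p\<in>{s, -s} \<times> UNIV. W y * idc (L (fst p) (snd p) n) y)"
  proof (cases "y : cube s - cube (s - rho)")
  case True
  then obtain j where j: "s - rho <= \<bar>y \<bullet> e j\<bar>" "\<bar>y \<bullet> e j\<bar> < s" by (auto simp: cube_def not_less)
  define p where "p = (if y \<bullet> e j >= 0 then s else - s, j)"
  have pin: "p : {s, -s} \<times> UNIV" by (auto simp: p_def)
  have "\<bar>fst p - y \<bullet> e (snd p)\<bar> <= rho" using j by (auto simp: p_def)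
  hence "y : L (fst p) (snd p) n" using True by (simp add: L_def rho_def del: of_nat_Suc)
  hence "W y * idc (cube s - cube (s - rho)) y = W y * idc (L (fst p) (snd p) n) y" using True by simp
  also have "\<dots> <= (\<Sum>p\<in>{s, -s} \<times> UNIV. W y * idc (L (fst p) (snd p) n) y)"
  by (rule member_le_sum[OF pin]) auto
  finally show ?thesis .
  qed auto
 qed
 also have "\<dots> = (\<Sum>p\<in>{s, -s} \<times> UNIV. \<integral>\<^sup>+y. W y * idc (L (fst p) (snd p) n) y \<partial>lborel)"
  using Wb Lm by (intro nn_integral_sum) auto
 also have "\<dots> <= (\<Sum>p\<in>{s, -s} \<times> (UNIV::'n set). ennreal (kp' * rho))"
  by (rule sum_mono) (rule each)
 also have "\<dots> = ennreal (kp * rho)"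
 proof -
  have "card ({s, -s} \<times> (UNIV::'n set)) = 2 * N" using s by (simp add: card_cartesian_product N_def)
  moreover have "real (2 * N) * (kp' * rho) = kp * rho" using N by (simp add: kp'_def)
  ultimately show ?thesis using kp' rho
  by (simp only: sum_constant ennreal_of_nat_eq_real_of_nat ennreal_mult'[symmetric] of_nat_0_le_iff)
 qed
 finally have "(\<integral>\<^sup>+y\<in>cube s - cube (s - rho). ennreal \<bar>tht y - sg y\<bar> \<partial>leb) <= ennreal (kp * rho)" .
 thus ?thesis using rho n(1) by (intro exI[of _ rho]) (simp add: rho_def)
qed

end

subsection \<open>Divergence and total variation of real functions\<close>

definition dvg :: "(real^'n => real^'n) => real^'n => real" where
 "dvg Fi x = (\<Sum>j\<in>UNIV. pdv j Fi x $ j)"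

lemma leb_intg_cont_csupp:
 fixes f :: "'a::euclidean_space => 'b::euclidean_space"
 assumes "continuous_on UNIV f" "compact K" "!!x. x ~: K ==> f x = 0"
 shows "integrable leb f"
 using intg_cont_csupp[OF assms] borel_measurable_continuous_onI[OF assms(1)]
 by (simp add: integrable_completion)

lemma intg_tf:
 fixes ph :: "'a::euclidean_space => 'b::euclidean_space"
 assumes "ph : tfs A"
 shows "integrable leb ph"
proof (rule tfE[OF assms])
 fix K assume "compact K" "!!x. x ~: K ==> ph x = 0"
 thus ?thesis
  by (rule leb_intg_cont_csupp[OF cont_on_C_k[OF tfD(1)[OF assms]]])
qed

lemma int_pderiv_tf:
 fixes ph :: "real^'n => real"
 assumes "ph : tfs A"
 shows "(\<integral>x. pdv j ph x \<partial>leb) = 0"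
proof (rule tfE[OF assms])
 fix K assume K: "compact K" "!!x. x ~: K ==> ph x = 0"
 have c: "continuous_on UNIV (%x. fdv ph (at x) (axis j 1))"
  by (rule cont_on_C_k[OF C_k_deriv[OF tfD(1)[OF assms]]])
 have "(\<integral>x. fdv ph (at x) (axis j 1) \<partial>lborel) = 0"
  by (rule int_dirder_eq_0[OF C_k_Suc_hasd[OF tfD(1)[OF assms]] c K])
 thus ?thesis
  using borel_measurable_continuous_onI[OF c] by (simp add: pderiv_at_def integral_completion)
qed

lemma tf_nth:
 fixes Fi :: "real^'n => real^'m"
 assumes "Fi : tfs A"
 shows "(%x. Fi x $ j) : tfs A" "pdv k (%x. Fi x $ j) x = pdv k Fi x $ j"
proof -
 obtain K where K: "compact K" "K <= A" "!!x. x ~: K ==> Fi x = 0" using tfE[OF assms] by blast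
 show "(%x. Fi x $ j) : tfs A"
  by (rule tfI[OF C_k_blin_comp[OF bounded_linear_vec_nth tfD(1)[OF assms]] K(1,2)])
  (simp add: K(3))
 have "((%x. Fi x $ j) has_derivative (%v. fdv Fi (at x) v $ j)) (at x)"
  by (rule bounded_linear.has_derivative[OF bounded_linear_vec_nth C_k_Suc_hasd[OF tfD(1)[OF assms]]])
 from fun_cong[where x="axis k 1", OF frechet_derivative_at[OF this]]
 show "pdv k (%x. Fi x $ j) x = pdv k Fi x $ j" by (simp add: pderiv_at_def)
qed

lemma intg_dvg:
 assumes "Fi : tfs A"
 shows "integrable leb (dvg Fi)" "(\<integral>x. dvg Fi x \<partial>leb) = 0"
proof -
 have i: "integrable leb (%x. pdv j Fi x $ j)" for j
 proof -
  have "(%x. pdv j Fi x $ j) = pdv j (%x. Fi x $ j)"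
  by (rule ext) (simp add: tf_nth(2)[OF assms])
  thus ?thesis
  using intg_tf[OF tf_pderiv[OF tf_nth(1)[OF assms, of j]], of j] by simp
 qed
 show "integrable leb (dvg Fi)"
  unfolding dvg_def[abs_def] by (rule Bochner_Integration.integrable_sum) (rule i)
 have "(\<integral>x. dvg Fi x \<partial>leb) = (\<Sum>j\<in>UNIV. \<integral>x. pdv j Fi x $ j \<partial>leb)"
  unfolding dvg_def by (rule Bochner_Integration.integral_sum) (rule i)
 also have "\<dots> = 0"
  using int_pderiv_tf[OF tf_nth(1)[OF assms]]
  by (simp add: tf_nth(2)[OF assms])
 finally show "(\<integral>x. dvg Fi x \<partial>leb) = 0" .
qed

lemma dvg_bdd:
 assumes "Fi : tfs A"
 shows "\<exists>B\<ge>0. ALL x. \<bar>dvg Fi x\<bar> <= B" "dvg Fi : lbm" "x ~: A ==> dvg Fi x = 0"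
proof -
 obtain K where K: "compact K" "K <= A" "!!x. x ~: K ==> Fi x = 0" using tfE[OF assms] by blast
 have z: "dvg Fi x = 0" if "x ~: K" for x
  using fdv_0_if_locally_0[OF compact_imp_closed[OF K(1)] K(3) that]
  by (simp add: dvg_def pderiv_at_def)
 thus "x ~: A ==> dvg Fi x = 0" using K(2) by auto
 have c: "C_k 0 (dvg Fi)"
  unfolding dvg_def[abs_def]
  by (rule C_k_sum[OF C_k_blin_comp[OF bounded_linear_vec_nth C_k_pderiv[OF tfD(1)[OF assms]]]])
 hence "continuous_on UNIV (dvg Fi)" by simp
 from cont_csupp_bdd[OF this K(1) z] show "\<exists>B\<ge>0. ALL x. \<bar>dvg Fi x\<bar> <= B" by auto
 show "dvg Fi : lbm" by (rule bm_C_k[OF c])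
qed

lemma sint_mult_dvg:
 fixes w :: "real^'n => real"
 assumes "sint A w" "Fi : tfs B"
 shows "sint A (%x. w x * dvg Fi x)"
proof -
 obtain B where B: "!!x. \<bar>dvg Fi x\<bar> <= B" using dvg_bdd(1)[OF assms(2)] by blast
 have "sint A (%x. dvg Fi x *\<^sub>R w x)"
  by (rule sint_scaleR_bdd[OF assms(1) dvg_bdd(2)[OF assms(2)] B])
 thus ?thesis by (simp add: mult.commute)
qed

lemma dvg_scaleR:
 assumes "!!k. C_k k K" "Fi : tfs A"
 shows "dvg (%x. K x *\<^sub>R Fi x) x = K x * dvg Fi x + (\<Sum>j\<in>UNIV. pdv j K x * Fi x $ j)"
 unfolding dvg_def C_k_1_pderiv_scaleR[OF assms(1) tfD(1)[OF assms(2)]]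
 by (simp add: sum.distrib sum_distrib_left)

lemma tv_upper:
 fixes w :: "real^'n => real"
 assumes "Fi : tfs A" "!!x. norm (Fi x) <= 1"
 shows "ennreal (LINT x:A|leb. w x * dvg Fi x) <= total_variation A w"
proof -
 have "ennreal (LINT x:A|leb. (\<Sum>j\<in>UNIV. w x \<bullet> (pdv j Fi x $ j))) <= total_variation A w"
  unfolding total_variation_def by (rule SUP_upper) (use assms in auto)
 thus ?thesis by (simp add: dvg_def sum_distrib_left)
qed

lemma tv_least:
 fixes w :: "real^'n => real"
 assumes "!!Fi. Fi : tfs A ==> (!!x. norm (Fi x) <= 1) ==> ennreal (LINT x:A|leb. w x * dvg Fi x) <= c"
 shows "total_variation A w <= c"
 unfolding total_variation_def
proof (rule SUP_least)
 fix Fi :: "real^'n => real^'n" assume "Fi : {Fi. Fi : tfs A & (ALL x. norm (Fi x) <= 1)}"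
 thus "ennreal (LINT x:A|leb. (\<Sum>j\<in>UNIV. w x \<bullet> (pdv j Fi x $ j))) <= c"
  using assms[of Fi] by (simp add: dvg_def sum_distrib_left)
qed

subsection \<open>Integration by parts on half spaces\<close>

lemma C_k_sst_inner: "C_k k (%y. sst (m * (y \<bullet> (v::'a::euclidean_space))))"
 by (rule C_k_compose_real[OF C_k_sst C_k_mult[OF C_k_const C_k_inner_left]])

lemma pderiv_sst_inner:
 fixes v :: "real^'n"
 shows "pdv j (%y. sst (m * (y \<bullet> v))) y = deriv sst (m * (y \<bullet> v)) * (m * v $ j)"
proof -
 have l: "((%y. m * (y \<bullet> v)) has_derivative (%h. m * (h \<bullet> v))) (at y)"
  by (auto intro!: derivative_eq_intros)
 have "((sst \<circ> (%y. m * (y \<bullet> v))) has_derivative ((*) (deriv sst (m * (y \<bullet> v))) \<circ> (%h. m * (h \<bullet> v)))) (at y)"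
  by (rule diff_chain_at[OF l]) (rule sst_differentiable[unfolded has_field_derivative_def])
 from fun_cong[where x="axis j 1", OF frechet_derivative_at[OF this]]
 show ?thesis by (simp add: pderiv_at_def o_def inner_axis')
qed

lemma meas_sst_inner: "(%y. sst (m * (y \<bullet> (v::'a::euclidean_space)))) : lbm"
 by (rule bm_C_k[where k=0]) (rule C_k_sst_inner)

lemma sst_lim:
 assumes "t ~= 0"
 shows "(%k. sst (real (Suc k) * t)) \<longlonglongrightarrow> (if t > 0 then 1 else 0)"
proof (cases "t > 0")
 case True
 obtain N where N: "1 / t <= real N" using real_arch_simple by blast
 have "sst (real (Suc k) * t) = 1" if "k >= N" for k
 proof -
  have "1 / t <= real (Suc k)" using N that by linarith
  hence "1 <= real (Suc k) * t" using True by (simp add: divide_simps mult.commute)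
  thus ?thesis by (rule sst_eq_1)
 qed
 hence "\<forall>\<^sub>F k in sequentially. sst (real (Suc k) * t) = 1"
  unfolding eventually_sequentially by blast
 thus ?thesis using True by (simp add: tendsto_eventually)
next
 case False
 hence "sst (real (Suc k) * t) = 0" for k
  using assms by (intro sst_eq_0 mult_nonneg_nonpos) auto
 thus ?thesis using False by simp
qed

text \<open>The field multiplied by the smooth step is again a test field, so its divergence has
  integral 0.\<close>

lemma int_sst_dvg:
 fixes v :: "real^'n"
 assumes "Fi : tfs A"
 shows "(\<integral>y. sst (m * (y \<bullet> v)) * dvg Fi y \<partial>leb) =
  - (\<integral>y. deriv sst (m * (y \<bullet> v)) * m * (Fi y \<bullet> v) \<partial>leb)"
proof -
 let ?k = "%y. sst (m * (y \<bullet> v))"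
 have sum: "(\<Sum>j\<in>UNIV. pdv j ?k y * Fi y $ j) = deriv sst (m * (y \<bullet> v)) * m * (Fi y \<bullet> v)" for y
 proof -
  have "Fi y \<bullet> v = (\<Sum>j\<in>UNIV. Fi y $ j * v $ j)" by (simp add: inner_vec_def)
  thus ?thesis by (simp only: pderiv_sst_inner sum_distrib_left mult_ac)
 qed
 have t: "(%x. ?k x *\<^sub>R Fi x) : tfs A"
  by (rule tf_scaleR[OF C_k_sst_inner assms])
 have eq: "dvg (%x. ?k x *\<^sub>R Fi x) = (%y. ?k y * dvg Fi y + deriv sst (m * (y \<bullet> v)) * m * (Fi y \<bullet> v))"
  by (rule ext) (simp only: dvg_scaleR[OF C_k_sst_inner assms] sum)
 have i1: "integrable leb (%y. ?k y * dvg Fi y)"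
 proof (rule Bochner_Integration.integrable_bound[OF intg_dvg(1)[OF assms]])
  show "(%y. ?k y * dvg Fi y) : lbm"
  by (rule borel_measurable_times[OF meas_sst_inner dvg_bdd(2)[OF assms]])
  show "AE y in leb. norm (?k y * dvg Fi y) <= norm (dvg Fi y)"
  using sst_bounds by (intro AE_I2) (simp add: abs_mult mult_left_le_one_le)
 qed
 have i2: "integrable leb (%y. deriv sst (m * (y \<bullet> v)) * m * (Fi y \<bullet> v))"
  using Bochner_Integration.integrable_diff[OF intg_dvg(1)[OF t] i1] unfolding eq by simp
 show ?thesis
  using intg_dvg(2)[OF t] Bochner_Integration.integral_add[OF i1 i2] unfolding eq by simp
qed

text \<open>The smooth steps tend to the indicator of the half space off the bounding hyperplane.
  The flux through the hyperplane thus appears as a limit of volume integrals over thin layers, and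
  no surface integral has to be introduced.\<close>

lemma int_half_space_dvg:
 fixes v :: "real^'n"
 assumes "Fi : tfs A" "v ~= 0"
 shows "(%k. - (\<integral>y. deriv sst (real (Suc k) * (y \<bullet> v)) * real (Suc k) * (Fi y \<bullet> v) \<partial>leb))
  \<longlonglongrightarrow> (\<integral>y. (if y \<bullet> v >= 0 then 1 else 0) * dvg Fi y \<partial>leb)"
 unfolding int_sst_dvg[OF assms(1), symmetric]
proof (rule integral_dominated_convergence)
 have "{y. v \<bullet> y = 0} : null_sets leb"
  using negligible_hyperplane[of v 0] assms(2) by (simp add: negligible_iff_null_sets)
 hence "AE y in leb. y ~: {y. v \<bullet> y = 0}" by (rule AE_not_in)
 thus "AE y in leb. (%k. sst (real (Suc k) * (y \<bullet> v)) * dvg Fi y) \<longlonglongrightarrow> (if y \<bullet> v >= 0 then 1 else 0) * dvg Fi y"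
 proof eventually_elim
  case (elim y)
  hence nz: "y \<bullet> v ~= 0" by (simp add: inner_commute)
  have "(%k. sst (real (Suc k) * (y \<bullet> v)) * dvg Fi y) \<longlonglongrightarrow> (if y \<bullet> v > 0 then 1 else 0) * dvg Fi y"
  by (rule tendsto_mult[OF sst_lim[OF nz] tendsto_const])
  thus ?case using nz by (simp add: le_less)
 qed
 have "{y. y \<bullet> v >= 0} : sets leb"
 proof -
  have "closed {y. y \<bullet> v >= 0}" by (intro closed_Collect_le continuous_intros)
  thus ?thesis by (intro sets_completionI_sets) simp
 qed
 hence "(%y. idc {y. y \<bullet> v >= 0} y :: real) : lbm" by (rule borel_measurable_indicator)
 moreover have "(%y. idc {y. y \<bullet> v >= 0} y :: real) = (%y. if y \<bullet> v >= 0 then 1 else 0)"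
  by (auto simp: indicator_def fun_eq_iff)
 ultimately show "(%y. (if y \<bullet> v >= 0 then 1 else 0) * dvg Fi y) : lbm"
  using borel_measurable_times[OF _ dvg_bdd(2)[OF assms(1)]] by auto
 show "(%y. sst (real (Suc k) * (y \<bullet> v)) * dvg Fi y) : lbm" for k
  by (rule borel_measurable_times[OF meas_sst_inner dvg_bdd(2)[OF assms(1)]])
 show "AE y in leb. norm (sst (real (Suc k) * (y \<bullet> v)) * dvg Fi y) <= \<bar>dvg Fi y\<bar>" for k
  using sst_bounds by (intro AE_I2) (simp add: abs_mult mult_left_le_one_le)
 show "integrable leb (%y. \<bar>dvg Fi y\<bar>)" using intg_dvg(1)[OF assms(1)] by simp
qed

subsection \<open>Gluing functions of bounded variation across a cube\<close>

text \<open>If near every interior point all left difference quotients exceeded \<open>M\<close>,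
  then going left from a point \<open>b'\<close> the increase of \<open>G\<close> would stay above
  slope \<open>M\<close> down to \<open>a\<close>, against the bound on the mean slope. The descent
  is carried out at an infimum, where monotonicity replaces continuity.\<close>

lemma mono_small_left_slope:
 fixes G :: "real => real"
 assumes mono: "!!x y. a <= x ==> x <= y ==> y <= b ==> G x <= G y" and ab: "a < b" and M: "G b - G a < M * (b - a)"
 shows "EX t. a < t & t < b & (\<forall>eps>0. \<exists>dl. 0 < dl & dl < eps & G t - G (t - dl) <= M * dl)"
proof (rule ccontr)
 assume "~ ?thesis"
 hence neg: "\<exists>eps>0. \<forall>dl. 0 < dl & dl < eps --> G t - G (t - dl) > M * dl" if "a < t" "t < b" for t
  using that by (metis not_le)
 have "0 <= G b - G a" using mono[of a b] ab by simp
 hence M0: "M > 0" using M ab by (metis diff_gt_0_iff_gt le_less_trans zero_less_mult_pos2)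
 define q where "q = (G b - G a) / M"
 have lt: "q < b - a" unfolding q_def using M M0 by (simp add: divide_less_eq mult.commute)
 \<comment> \<open>The negated claim says nothing at \<open>b\<close> itself. A point
   \<open>b' < b\<close> is used instead, so close to \<open>b\<close> that
   \<open>M * (b' - a)\<close> still exceeds \<open>G b - G a\<close>.\<close>
 define b' where "b' = max ((a + b) / 2) (a + (q + (b - a)) / 2)"
 have m: "b' >= (a + b) / 2" "b' >= a + (q + (b - a)) / 2" "b' = (a + b) / 2 | b' = a + (q + (b - a)) / 2"
  unfolding b'_def by linarith+
 have "(a + b) / 2 < b" "a + (q + (b - a)) / 2 < b" using ab lt by (simp_all add: field_simps)
 hence "b' < b" using m(3) by metis
 moreover have h: "a < (a + b) / 2" "q + a < a + (q + (b - a)) / 2" using ab lt by (simp_all add: field_simps)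
 have "a < b'" by (rule less_le_trans[OF h(1) m(1)])
 moreover have "q + a < b'" by (rule less_le_trans[OF h(2) m(2)])
 ultimately have "a < b'" "b' < b" "q < b' - a" by simp_all
 hence b': "a < b'" "b' < b" "q < b' - a" by blast+
 have M': "G b - G a < M * (b' - a)"
 proof -
  show ?thesis using b'(3) M0 unfolding q_def by (simp add: divide_less_eq mult.commute)
 qed
 define S where "S = {\<tau>. a <= \<tau> & \<tau> <= b' & G b' - G \<tau> >= M * (b' - \<tau>)}"
 have bS: "b' : S" using b' by (simp add: S_def)
 have bdd: "bdd_below S" by (rule bdd_belowI[of _ a]) (simp add: S_def)
 define \<tau> where "\<tau> = Inf S"
 have \<tau>: "a <= \<tau>" "\<tau> <= b'"
  unfolding \<tau>_def using bS bdd by (auto intro!: cInf_greatest cInf_lower simp: S_def)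
 \<comment> \<open>The infimum satisfies the slope inequality: an element of \<open>S\<close>
   slightly to its right has at least as large a value of \<open>G\<close>, so passing to the
   infimum loses only a small multiple of \<open>M\<close>.\<close>
 have \<tau>S: "M * (b' - \<tau>) <= G b' - G \<tau>"
 proof (rule field_le_epsilon)
  fix eps :: real assume "eps > 0"
  hence "\<tau> < \<tau> + eps / M" using M0 by simp
  then obtain x where x: "x : S" "x < \<tau> + eps / M"
  unfolding \<tau>_def using cInf_less_iff[of S] bS bdd by blast
  have "\<tau> <= x" unfolding \<tau>_def using x(1) bdd by (rule cInf_lower)
  hence "G \<tau> <= G x" using x(1) \<tau> b' by (intro mono) (auto simp: S_def)
  moreover have "M * (b' - \<tau>) <= M * (b' - x) + eps"
  proof -
  have "M * (x - \<tau>) <= M * (eps / M)" using x(2) M0 by (intro mult_left_mono) auto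
  thus ?thesis using M0 by (simp add: algebra_simps)
  qed
  ultimately show "M * (b' - \<tau>) <= G b' - G \<tau> + eps" using x(1) by (simp add: S_def)
 qed
 show False
 proof (cases "\<tau> = a")
  case True
  have "G b' <= G b" using b' ab by (intro mono) auto
  thus False using \<tau>S True M' by simp
 next
  case False
  then obtain eps where eps: "eps > 0" "!!dl. 0 < dl ==> dl < eps ==> G \<tau> - G (\<tau> - dl) > M * dl"
  using neg[of \<tau>] \<tau> b' by auto
  define dl where "dl = min (eps / 2) (\<tau> - a)"
  have dl: "0 < dl" "dl < eps" "a <= \<tau> - dl" using eps(1) False \<tau> by (auto simp: dl_def)
  have "\<tau> - dl : S" using dl eps(2)[OF dl(1,2)] \<tau>S \<tau> by (simp add: S_def algebra_simps)
  hence "\<tau> <= \<tau> - dl" unfolding \<tau>_def using bdd by (intro cInf_lower) (simp_all add: \<tau>_def)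
  thus False using dl by simp
 qed
qed

context frame begin

definition ccube :: "real => (real^'n) set" where
 "ccube r = {y. ALL j. \<bar>y \<bullet> e j\<bar> <= r}"

lemma closed_ccube: "closed (ccube r)"
 unfolding ccube_def by (intro closed_Collect_all closed_Collect_le continuous_intros)

lemma cube_ccube: "cube r <= ccube r" "r < s ==> ccube r <= cube s"
 by (auto simp: cube_def ccube_def intro: less_imp_le le_less_trans)

lemma ccube_eq_cslab: "ccube r = {y. ALL j. - r <= y \<bullet> e j & y \<bullet> e j <= r}"
proof -
 have "\<bar>a\<bar> <= r \<longleftrightarrow> - r <= a & a <= r" for a by linarith
 thus ?thesis by (simp add: ccube_def)
qed

lemma step_fun_intg:
 assumes "A : sets leb" "bounded A"
 shows "sint A (step_fun a b v)" "step_fun a b v : lbm"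
proof -
 have "{y. y \<bullet> v >= 0} : sets leb"
 proof -
  have "closed {y. y \<bullet> v >= 0}" by (intro closed_Collect_le continuous_intros)
  thus ?thesis by (intro sets_completionI_sets) simp
 qed
 hence "(%y. idc {y. y \<bullet> v >= 0} y :: real) : lbm" by (rule borel_measurable_indicator)
 hence "(%y. b + (a - b) * idc {y. y \<bullet> v >= 0} y) : lbm" by simp
 moreover have "(%y. b + (a - b) * idc {y. y \<bullet> v >= 0} y) = step_fun a b v"
  by (auto simp: step_fun_def indicator_def fun_eq_iff)
 ultimately show m: "step_fun a b v : lbm" by simp
 show "sint A (step_fun a b v)"
  by (rule sint_bdd_meas[OF assms m, of "max \<bar>a\<bar> \<bar>b\<bar>"]) (simp add: step_fun_def)
qed

text \<open>The flux through the part of the hyperplane between the two cubes is a limit of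
  integrals over slabs of thickness \<open>dl\<close>, whose volume is \<open>dl\<close> times the
  difference of the areas of the two cross-sections. The constant \<open>c\<close> bounds the slope
  of \<open>sst\<close>; the bound tends to 0 as \<open>r\<close> tends to \<open>s\<close>, which
  is what the gluing of the sets relies on.\<close>

lemma tv_step:
 assumes rs: "0 < r" "r < s" and c: "!!x. \<bar>deriv sst x\<bar> <= c"
 shows "total_variation (cube s - ccube r) (step_fun a b (e i)) \<le>
  ennreal (\<bar>a - b\<bar> * (c * ((2 * s) ^ (CARD('n) - 1) - (2 * r) ^ (CARD('n) - 1))))"
proof (rule tv_least)
 fix Fi :: "real^'n => real^'n" assume Fi: "Fi : tfs (cube s - ccube r)" and Fi1: "!!x. norm (Fi x) <= 1"
 let ?m = "CARD('n) - 1"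
 let ?A = "cube s - ccube r"
 define D where "D = (2 * s) ^ ?m - (2 * r) ^ ?m"
 have c0: "c >= 0" using c[of 0] by linarith
 have D0: "D >= 0" unfolding D_def using rs by (simp add: power_mono)
 define H where "H = (\<integral>y. (if y \<bullet> e i >= 0 then 1 else 0) * dvg Fi y \<partial>leb)"
 have e0: "e i ~= 0" using norm_frame[of i] by force
 have Hi: "integrable leb (%y. (if y \<bullet> e i >= 0 then 1 else 0) * dvg Fi y)"
 proof -
  have "sint (cube s) (%y. step_fun 1 0 (e i) y * dvg Fi y)"
  by (rule sint_mult_dvg[OF step_fun_intg(1)[OF _ bdd_cube] Fi]) simp
  moreover have "(%y. idc (cube s) y *\<^sub>R (step_fun 1 0 (e i) y * dvg Fi y)) = (%y. (if y \<bullet> e i >= 0 then 1 else 0) * dvg Fi y)"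
  using dvg_bdd(3)[OF Fi] by (auto simp: step_fun_def indicator_def fun_eq_iff)
  ultimately show ?thesis by (simp add: set_integrable_def)
 qed
 have eq: "(LINT x:?A|leb. step_fun a b (e i) x * dvg Fi x) = (a - b) * H"
 proof -
  have "(LINT x:?A|leb. step_fun a b (e i) x * dvg Fi x) =
  (\<integral>y. b * dvg Fi y + (a - b) * ((if y \<bullet> e i >= 0 then 1 else 0) * dvg Fi y) \<partial>leb)"
  unfolding set_lebesgue_integral_def
  by (rule Bochner_Integration.integral_cong)
  (use dvg_bdd(3)[OF Fi] in \<open>auto simp: step_fun_def indicator_def algebra_simps\<close>)
  also have "\<dots> = b * (\<integral>y. dvg Fi y \<partial>leb) + (a - b) * H"
  unfolding H_def using intg_dvg(1)[OF Fi] Hi by (subst Bochner_Integration.integral_add) auto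
  finally show ?thesis using intg_dvg(2)[OF Fi] by simp
 qed
 have "\<bar>H\<bar> <= c * D"
 proof (rule tendsto_upperbound)
  show "(%k. \<bar>- (\<integral>y. deriv sst (real (Suc k) * (y \<bullet> e i)) * real (Suc k) * (Fi y \<bullet> e i) \<partial>leb)\<bar>) \<longlonglongrightarrow> \<bar>H\<bar>"
  unfolding H_def by (rule tendsto_rabs[OF int_half_space_dvg[OF Fi e0]])
  obtain N where N: "1 / r <= real N" using real_arch_simple by blast
  have "\<bar>- (\<integral>y. deriv sst (real (Suc k) * (y \<bullet> e i)) * real (Suc k) * (Fi y \<bullet> e i) \<partial>leb)\<bar> <= c * D" if "k >= N" for k
  proof -
  define dl where "dl = 1 / real (Suc k)"
  have dl: "dl > 0" "real (Suc k) = 1 / dl" by (simp_all add: dl_def)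
  have "1 / r <= real (Suc k)" using N that by linarith
  \<comment> \<open>In the slab the normal coordinate is then at most \<open>r\<close>, so a point
    outside the inner cube must leave it through another coordinate.\<close>
  hence dlr: "dl <= r" unfolding dl(2) using dl(1) rs by (simp add: divide_simps)
  define T where "T = {y : ?A. 0 <= y \<bullet> e i & y \<bullet> e i <= dl}"
  let ?C = "%q. {y. ALL j. (if j = i then 0 else - q) <= y \<bullet> e j & y \<bullet> e j <= (if j = i then dl else q)}"
  have em: "emeasure leb (?C q) = ennreal (dl * (2 * q) ^ ?m)" if "q > 0" for q
  proof -
  have "emeasure leb (?C q) = ennreal (\<Prod>j\<in>UNIV. (if j = i then dl else q) - (if j = i then 0 else - q))"
  by (rule em_cslab) (use that dl in auto)
  also have "(\<Prod>j\<in>UNIV. (if j = i then dl else q) - (if j = i then 0 else - q)) = (\<Prod>j\<in>UNIV. if j = i then dl else 2 * q)"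
  by (intro prod.cong) auto
  also have "\<dots> = dl * (2 * q) ^ ?m" unfolding prod_frame_remove by (simp add: card_Diff_singleton)
  finally show ?thesis .
  qed
  have Cs: "?C q : sets leb" for q
  by (intro sets_completionI_sets) (simp add: borel_closed closed_cslab)
  have "?C r <= ?C s" using rs by (auto intro: order_trans[where y="- r"] order_trans[where y=r])
  hence d: "emeasure leb (?C s - ?C r) = ennreal (dl * D)"
  using em[of s] em[of r] Cs rs dl by (subst emeasure_Diff) (auto simp: ennreal_minus D_def right_diff_distrib)
  have TC: "T <= ?C s - ?C r"
  proof
  fix y assume y: "y : T"
  have "\<bar>y \<bullet> e j\<bar> < s" for j using y by (auto simp: T_def cube_def)
  hence "- s <= y \<bullet> e j & y \<bullet> e j <= s" for j by (metis abs_le_D1 abs_le_D2 less_imp_le minus_le_iff)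
  hence 1: "y : ?C s" using y by (auto simp: T_def)
  obtain j where j: "~ \<bar>y \<bullet> e j\<bar> <= r" using y by (auto simp: T_def ccube_def)
  have "j ~= i" using j y dlr by (auto simp: T_def)
  hence "y ~: ?C r" using j by (auto simp: abs_le_iff intro!: exI[of _ j])
  thus "y : ?C s - ?C r" using 1 by simp
  qed
  have ptw: "norm (deriv sst (real (Suc k) * (y \<bullet> e i)) * real (Suc k) * (Fi y \<bullet> e i)) <= (c / dl) * idc (?C s - ?C r) y" for y
  proof (cases "y : T")
  case True
  have "\<bar>Fi y \<bullet> e i\<bar> <= 1" using abs_inner_frame_le[of "Fi y" i] Fi1[of y] by linarith
  hence "\<bar>deriv sst (real (Suc k) * (y \<bullet> e i))\<bar> * real (Suc k) * \<bar>Fi y \<bullet> e i\<bar> <= c * real (Suc k) * 1"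
  using c c0 by (intro mult_mono) auto
  moreover have "y : ?C s - ?C r" using True TC by blast
  hence ind: "idc (?C s - ?C r) y = (1::real)" by (rule indicator_simps(1))
  have "c / dl = c * real (Suc k)" unfolding dl(2) by simp
  ultimately show ?thesis unfolding ind real_norm_def abs_mult by simp
  next
  case False
  have zero: "deriv sst (real (Suc k) * (y \<bullet> e i)) * real (Suc k) * (Fi y \<bullet> e i) = 0"
  proof (cases "y : ?A")
  case True
  hence "y \<bullet> e i < 0 | y \<bullet> e i > dl" using False by (auto simp: T_def)
  hence "real (Suc k) * (y \<bullet> e i) < 0 | real (Suc k) * (y \<bullet> e i) > 1"
  unfolding dl(2) using dl(1) by (auto simp: field_simps mult_neg_pos)
  thus ?thesis using deriv_sst_eq_0 by auto
  qed (use tfD(4)[OF Fi] in simp)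
  have "0 <= (c / dl) * idc (?C s - ?C r) y" using c0 dl(1) by (intro mult_nonneg_nonneg) auto
  thus ?thesis unfolding zero norm_zero .
  qed
  have fm: "?C s - ?C r : lmeasurable" using d Cs by (intro fmeasurableI) auto
  have "\<bar>\<integral>y. deriv sst (real (Suc k) * (y \<bullet> e i)) * real (Suc k) * (Fi y \<bullet> e i) \<partial>leb\<bar> \<le>
  (\<integral>y. (c / dl) * idc (?C s - ?C r) y \<partial>leb)"
  proof (rule order_trans[OF integral_abs_bound integral_mono'])
  show "integrable leb (%y. (c / dl) * idc (?C s - ?C r) y)"
  using fm by (intro integrable_mult_right integrable_real_indicator) (auto simp: fmeasurable_def)
  show "0 <= (c / dl) * idc (?C s - ?C r) y" for y using c0 dl(1) by (intro mult_nonneg_nonneg) auto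
  show "\<bar>deriv sst (real (Suc k) * (y \<bullet> e i)) * real (Suc k) * (Fi y \<bullet> e i)\<bar> <= (c / dl) * idc (?C s - ?C r) y" for y
  using ptw[of y] unfolding real_norm_def .
  qed
  also have "\<dots> = (c / dl) * measure leb (?C s - ?C r)" using fm by simp
  also have "measure leb (?C s - ?C r) = dl * D"
  unfolding measure_def d using dl D0 by simp
  finally show ?thesis using dl by simp
  qed
  thus "\<forall>\<^sub>F k in sequentially. \<bar>- (\<integral>y. deriv sst (real (Suc k) * (y \<bullet> e i)) * real (Suc k) * (Fi y \<bullet> e i) \<partial>leb)\<bar> <= c * D"
  unfolding eventually_sequentially by blast
 qed simp
 hence le: "\<bar>a - b\<bar> * \<bar>H\<bar> <= \<bar>a - b\<bar> * (c * D)" by (rule mult_left_mono) simp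
 have "(a - b) * H <= \<bar>a - b\<bar> * \<bar>H\<bar>" unfolding abs_mult[symmetric] by (rule abs_ge_self)
 hence "(a - b) * H <= \<bar>a - b\<bar> * (c * D)" using le by (rule order_trans)
 thus "ennreal (LINT x:?A|leb. step_fun a b (e i) x * dvg Fi x) \<le>
  ennreal (\<bar>a - b\<bar> * (c * ((2 * s) ^ ?m - (2 * r) ^ ?m)))"
  unfolding eq D_def by (rule ennreal_leI)
qed


text \<open>A test field is split by the cut-off \<open>K k\<close>: the inner part tests
  \<open>X\<close>, the outer part is supported off \<open>ccube r\<close> and tests
  \<open>sg\<close>, and what is left is the gradient of \<open>K k\<close> against
  \<open>sg - X\<close>. That gradient is of order \<open>1 / dl k\<close> on a shell where the L1
  distance is at most \<open>M * dl k\<close>, so the product stays bounded while the shell shrinks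
  to the surface of the cut.\<close>

lemma tv_glue:
 fixes X sg :: "real^'n => real"
 assumes r: "0 <= r" "r < t" "t < s" and X: "sint (cube s) X" and sg: "sint (cube s) sg"
  and c: "!!x. \<bar>deriv sst x\<bar> <= c"
  and dl0: "dl \<longlonglongrightarrow> 0" and dl: "!!k. 0 < dl k" "!!k. dl k < t - r"
  and slope: "!!k. (LINT x:cube t - cube (t - dl k)|leb. \<bar>X x - sg x\<bar>) <= M * dl k"
 shows "total_variation (cube s) (%x. if x : cube t then X x else sg x) \<le>
  total_variation (cube s) X + total_variation (cube s - ccube r) sg + ennreal (2 * (real CARD('n))\<^sup>2 * c * M)"
proof (rule tv_least)
 fix Fi :: "real^'n => real^'n" assume Fi: "Fi : tfs (cube s)" and Fi1: "!!x. norm (Fi x) <= 1"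
 define V1 where "V1 = total_variation (cube s) X"
 define V2 where "V2 = total_variation (cube s - ccube r) sg"
 define b where "b = 2 * (real CARD('n))\<^sup>2 * c * M"
 have c0: "c >= 0" using c[of 0] by linarith
 have M0: "M >= 0"
 proof -
  have "0 <= (LINT x:cube t - cube (t - dl 0)|leb. \<bar>X x - sg x\<bar>)"
  unfolding set_lebesgue_integral_def by (rule Bochner_Integration.integral_nonneg) simp
  hence "0 <= M * dl 0" using slope[of 0] by linarith
  thus ?thesis using dl(1)[of 0] by (simp add: zero_le_mult_iff)
 qed
 have b0: "b >= 0" using c0 M0 by (simp add: b_def)
 define K where "K = (%k. cutoff (1 / dl k) (%_. - t) (%_. t))"
 have CK: "C_k m (K k)" for m k unfolding K_def by (rule C_k_cutoff)
 have K01: "0 <= K k y" "K k y <= 1" for k y unfolding K_def by (rule cutoff_bounds)+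
 have K1: "K k y = 1" if "y : cube (t - dl k)" for k y
  unfolding K_def
 proof (rule cutoff_eq_1)
  fix j
  have "\<bar>y \<bullet> e j\<bar> < t - dl k" using that by (simp add: cube_def)
  thus "1 <= 1 / dl k * (y \<bullet> e j - - t)" "1 <= 1 / dl k * (t - y \<bullet> e j)"
  using dl(1)[of k] by (auto simp: le_divide_eq)
 qed
 have K0: "K k y = 0" if "y ~: cube t" for k y
  unfolding K_def using dl(1)[of k] that by (intro cutoff_eq_0) (simp_all add: cube_eq_slab)
 have limK: "(%k. K k y) \<longlonglongrightarrow> idc (cube t) y" for y
 proof (cases "y : cube t")
  case True
  define d where "d = Min ((%j. t - \<bar>y \<bullet> e j\<bar>) ` UNIV)"
  have "d > 0" unfolding d_def using True by (subst Min_gr_iff) (auto simp: cube_def)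
  have dj: "d <= t - \<bar>y \<bullet> e j\<bar>" for j unfolding d_def by (rule Min_le) auto
  have "\<forall>\<^sub>F k in sequentially. dl k < d" using order_tendstoD(2)[OF dl0 \<open>d > 0\<close>] .
  hence "\<forall>\<^sub>F k in sequentially. K k y = 1"
  proof eventually_elim
  case (elim k)
  have "\<bar>y \<bullet> e j\<bar> < t - dl k" for j using dj[of j] elim by linarith
  thus ?case by (intro K1) (simp add: cube_def)
  qed
  thus ?thesis using True by (simp add: tendsto_eventually)
 qed (simp add: K0)
 define g where "g = (%k y. \<Sum>j\<in>UNIV. pdv j (K k) y * Fi y $ j)"
 have g0: "g k y = 0" if "y ~: cube t - cube (t - dl k)" for k y
 proof -
  have "K k y = 0 | K k y = 1" using that K0 K1 by blast
  hence "pdv j (K k) y = 0" for j unfolding K_def by (intro pderiv_cutoff_eq_0)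
  thus ?thesis by (simp add: g_def)
 qed
 \<comment> \<open>Each of the N partial derivatives of \<open>K k\<close> is at most
   \<open>2 * N * c / dl k\<close>; their sum produces the square of N.\<close>
 define C where "C = 2 * (real CARD('n))\<^sup>2 * c"
 have gb: "\<bar>g k y\<bar> <= C / dl k" for k y
 proof -
  have "\<bar>g k y\<bar> <= (\<Sum>j\<in>UNIV. \<bar>pdv j (K k) y * Fi y $ j\<bar>)" unfolding g_def by (rule sum_abs)
  also have "\<dots> <= (\<Sum>j\<in>(UNIV::'n set). (2 * real CARD('n) * c * (1 / dl k)) * 1)"
  unfolding abs_mult
  proof (intro sum_mono mult_mono)
  fix j
  show "\<bar>pdv j (K k) y\<bar> <= 2 * real CARD('n) * c * (1 / dl k)"
  unfolding K_def by (rule pderiv_cutoff_bound[OF _ c]) (use dl(1)[of k] in simp)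
  show "\<bar>Fi y $ j\<bar> <= 1" using component_le_norm_cart[of "Fi y" j] Fi1[of y] by linarith
  show "0 <= 2 * real CARD('n) * c * (1 / dl k)" using c0 dl(1)[of k] by simp
  qed simp
  also have "\<dots> = C / dl k" by (simp add: C_def power2_eq_square)
  finally show ?thesis .
 qed
 have C0: "C >= 0" using c0 by (simp add: C_def)
 let ?Z = "%x. if x : cube t then X x else sg x"
 have Xd: "sint (cube s) (%x. X x * dvg Fi x)" by (rule sint_mult_dvg[OF X Fi])
 have sgd: "sint (cube s) (%x. sg x * dvg Fi x)" by (rule sint_mult_dvg[OF sg Fi])
 \<comment> \<open>Since \<open>dl k\<close> tends to 0, the cut-offs converge everywhere to the
   indicator of the open cube, so the interpolated integrand tends to that of the glued
   function.\<close>
 have lim: "(%k. LINT x:cube s|leb. K k x * (X x * dvg Fi x) + (1 - K k x) * (sg x * dvg Fi x)) \<longlonglongrightarrow>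
  (LINT x:cube s|leb. ?Z x * dvg Fi x)"
  unfolding set_lebesgue_integral_def
 proof (rule integral_dominated_convergence)
  have m: "(%x. idc (cube s) x *\<^sub>R (X x * dvg Fi x)) : lbm"
  "(%x. idc (cube s) x *\<^sub>R (sg x * dvg Fi x)) : lbm"
  using Xd sgd by (auto simp: set_integrable_def)
  have mi: "(idc (cube t) :: real^'n => real) : lbm"
  by (rule borel_measurable_indicator) simp
  have mK: "K k : lbm" for k by (rule bm_C_k[where k=0]) (rule CK)
  have "(%x. K k x * (idc (cube s) x *\<^sub>R (X x * dvg Fi x)) + (1 - K k x) * (idc (cube s) x *\<^sub>R (sg x * dvg Fi x)))
  : lbm" for k using m mK[of k] by measurable
  moreover have eqk: "(%x. K k x * (idc (cube s) x *\<^sub>R (X x * dvg Fi x)) + (1 - K k x) * (idc (cube s) x *\<^sub>R (sg x * dvg Fi x)))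
  = (%x. idc (cube s) x *\<^sub>R (K k x * (X x * dvg Fi x) + (1 - K k x) * (sg x * dvg Fi x)))" for k
  by (auto simp: fun_eq_iff indicator_def)
  ultimately show "(%x. idc (cube s) x *\<^sub>R (K k x * (X x * dvg Fi x) + (1 - K k x) * (sg x * dvg Fi x))) : lbm" for k
  by simp
  have "(%x. idc (cube t) x * (idc (cube s) x *\<^sub>R (X x * dvg Fi x)) + (1 - idc (cube t) x) * (idc (cube s) x *\<^sub>R (sg x * dvg Fi x)))
  : lbm" using m mi by measurable
  moreover have "(%x. idc (cube t) x * (idc (cube s) x *\<^sub>R (X x * dvg Fi x)) + (1 - idc (cube t) x) * (idc (cube s) x *\<^sub>R (sg x * dvg Fi x)))
  = (%x. idc (cube s) x *\<^sub>R (?Z x * dvg Fi x))"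
  by (auto simp: fun_eq_iff indicator_def)
  ultimately show "(%x. idc (cube s) x *\<^sub>R (?Z x * dvg Fi x)) : lbm" by simp
  show "AE x in leb. (%k. idc (cube s) x *\<^sub>R (K k x * (X x * dvg Fi x) + (1 - K k x) * (sg x * dvg Fi x)))
  \<longlonglongrightarrow> idc (cube s) x *\<^sub>R (?Z x * dvg Fi x)"
  proof (rule AE_I2)
  fix x
  have "(%k. idc (cube s) x *\<^sub>R (K k x * (X x * dvg Fi x) + (1 - K k x) * (sg x * dvg Fi x)))
  \<longlonglongrightarrow> idc (cube s) x *\<^sub>R (idc (cube t) x * (X x * dvg Fi x) + (1 - idc (cube t) x) * (sg x * dvg Fi x))"
  by (intro tendsto_intros limK)
  moreover have "idc (cube t) x * (X x * dvg Fi x) + (1 - idc (cube t) x) * (sg x * dvg Fi x) = ?Z x * dvg Fi x"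
  by (simp add: indicator_def)
  ultimately show "(%k. idc (cube s) x *\<^sub>R (K k x * (X x * dvg Fi x) + (1 - K k x) * (sg x * dvg Fi x)))
  \<longlonglongrightarrow> idc (cube s) x *\<^sub>R (?Z x * dvg Fi x)" by simp
  qed
  show "integrable leb (%x. \<bar>idc (cube s) x *\<^sub>R (X x * dvg Fi x)\<bar> + \<bar>idc (cube s) x *\<^sub>R (sg x * dvg Fi x)\<bar>)"
  using Xd sgd unfolding set_integrable_def by (intro Bochner_Integration.integrable_add integrable_abs)
  show "AE x in leb. norm (idc (cube s) x *\<^sub>R (K k x * (X x * dvg Fi x) + (1 - K k x) * (sg x * dvg Fi x)))
  <= \<bar>idc (cube s) x *\<^sub>R (X x * dvg Fi x)\<bar> + \<bar>idc (cube s) x *\<^sub>R (sg x * dvg Fi x)\<bar>" for k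
  proof (rule AE_I2)
  fix x
  have "\<bar>K k x * (X x * dvg Fi x) + (1 - K k x) * (sg x * dvg Fi x)\<bar> <= \<bar>K k x * (X x * dvg Fi x)\<bar> + \<bar>(1 - K k x) * (sg x * dvg Fi x)\<bar>"
  by (rule abs_triangle_ineq)
  also have "\<dots> <= 1 * \<bar>X x * dvg Fi x\<bar> + 1 * \<bar>sg x * dvg Fi x\<bar>"
  unfolding abs_mult[of "K k x"] abs_mult[of "1 - K k x"] using K01[of k x] by (intro add_mono mult_right_mono) auto
  finally show "norm (idc (cube s) x *\<^sub>R (K k x * (X x * dvg Fi x) + (1 - K k x) * (sg x * dvg Fi x)))
  <= \<bar>idc (cube s) x *\<^sub>R (X x * dvg Fi x)\<bar> + \<bar>idc (cube s) x *\<^sub>R (sg x * dvg Fi x)\<bar>"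
  by (simp add: indicator_def)
  qed
 qed
 have step: "ennreal (LINT x:cube s|leb. K k x * (X x * dvg Fi x) + (1 - K k x) * (sg x * dvg Fi x)) <= V1 + V2 + ennreal b" for k
 proof -
  have t1: "(%x. K k x *\<^sub>R Fi x) : tfs (cube s)" by (rule tf_scaleR[OF CK Fi])
  have C1K: "C_k m (%x. 1 - K k x)" for m by (rule C_k_diff[OF C_k_const CK])
  have t2': "(%x. (1 - K k x) *\<^sub>R Fi x) : tfs (cube s)" by (rule tf_scaleR[OF C1K Fi])
  \<comment> \<open>\<open>1 - K k\<close> vanishes on \<open>cube (t - dl k)\<close>, which
    contains \<open>ccube r\<close> because \<open>dl k < t - r\<close>.\<close>
  have t2: "(%x. (1 - K k x) *\<^sub>R Fi x) : tfs (cube s - ccube r)"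
  proof -
  obtain K0 where K0: "compact K0" "K0 <= cube s" "!!x. x ~: K0 ==> Fi x = 0" using tfE[OF Fi] by blast
  show ?thesis
  proof (rule tfI[OF tfD(1)[OF t2'], of "K0 - cube (t - dl k)"])
  show "compact (K0 - cube (t - dl k))" by (rule compact_diff[OF K0(1) open_cube])
  show "K0 - cube (t - dl k) <= cube s - ccube r"
  using K0(2) cube_ccube(2)[of r "t - dl k"] dl(2)[of k] by auto
  show "(1 - K k x) *\<^sub>R Fi x = 0" if "x ~: K0 - cube (t - dl k)" for x
  using that K0(3)[of x] K1[of x k] by auto
  qed
  qed
  have n1: "norm (K k x *\<^sub>R Fi x) <= 1" and n2: "norm ((1 - K k x) *\<^sub>R Fi x) <= 1" for x
  using K01[of k x] Fi1[of x] by (auto intro!: mult_le_one)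
  have d1: "dvg (%x. K k x *\<^sub>R Fi x) x = K k x * dvg Fi x + g k x" for x
  unfolding g_def by (rule dvg_scaleR[OF CK Fi])
  have p: "pdv j (%x. 1 - K k x) x = - pdv j (K k) x" for j x
  proof -
  have "((%x. 1 - K k x) has_derivative (%v. 0 - fdv (K k) (at x) v)) (at x)"
  by (rule has_derivative_diff[OF has_derivative_const C_k_Suc_hasd[OF CK]])
  from fun_cong[where x="axis j 1", OF frechet_derivative_at[OF this]] show ?thesis by (simp add: pderiv_at_def)
  qed
  have d2: "dvg (%x. (1 - K k x) *\<^sub>R Fi x) x = (1 - K k x) * dvg Fi x - g k x" for x
  unfolding dvg_scaleR[OF C1K Fi] g_def p by (simp add: sum_negf)
  have i1: "sint (cube s) (%x. X x * dvg (%x. K k x *\<^sub>R Fi x) x)" by (rule sint_mult_dvg[OF X t1])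
  have i2: "sint (cube s) (%x. sg x * dvg (%x. (1 - K k x) *\<^sub>R Fi x) x)" by (rule sint_mult_dvg[OF sg t2'])
  have mg: "g k : lbm"
  proof -
  have "g k = (%x. dvg (%x. K k x *\<^sub>R Fi x) x - K k x * dvg Fi x)" by (rule ext) (simp add: d1)
  moreover have "K k : lbm" by (rule bm_C_k[where k=0]) (rule CK)
  ultimately show ?thesis using dvg_bdd(2)[OF t1] dvg_bdd(2)[OF Fi] by simp
  qed
  have Xs: "sint (cube s) (%x. sg x - X x)" using X sg by auto
  have i3: "sint (cube s) (%x. g k x * (sg x - X x))"
  using sint_scaleR_bdd[OF Xs mg gb] by simp
  have "K k x * (X x * dvg Fi x) + (1 - K k x) * (sg x * dvg Fi x) =
  X x * dvg (%x. K k x *\<^sub>R Fi x) x + sg x * dvg (%x. (1 - K k x) *\<^sub>R Fi x) x + g k x * (sg x - X x)" for x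
  unfolding d1 d2 by (simp add: algebra_simps)
  hence "(LINT x:cube s|leb. K k x * (X x * dvg Fi x) + (1 - K k x) * (sg x * dvg Fi x)) =
  (LINT x:cube s|leb. X x * dvg (%x. K k x *\<^sub>R Fi x) x) + (LINT x:cube s|leb. sg x * dvg (%x. (1 - K k x) *\<^sub>R Fi x) x)
  + (LINT x:cube s|leb. g k x * (sg x - X x))"
  by (simp only: set_integral_add(2)[OF set_integral_add(1)[OF i1 i2] i3] set_integral_add(2)[OF i1 i2])
  moreover have "(LINT x:cube s|leb. sg x * dvg (%x. (1 - K k x) *\<^sub>R Fi x) x) =
  (LINT x:cube s - ccube r|leb. sg x * dvg (%x. (1 - K k x) *\<^sub>R Fi x) x)"
  unfolding set_lebesgue_integral_def
  proof (rule Bochner_Integration.integral_cong[OF refl])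
  fix x show "idc (cube s) x *\<^sub>R (sg x * dvg (%x. (1 - K k x) *\<^sub>R Fi x) x) =
  idc (cube s - ccube r) x *\<^sub>R (sg x * dvg (%x. (1 - K k x) *\<^sub>R Fi x) x)"
  using dvg_bdd(3)[OF t2, of x] by (cases "x : cube s - ccube r") auto
  qed
  moreover have "(LINT x:cube s|leb. g k x * (sg x - X x)) <= b"
  proof -
  let ?D = "cube t - cube (t - dl k)"
  have Dm: "?D : sets leb" by (rule sets.Diff) auto
  have Dsub: "?D <= cube s" using cube_mono[of t s] r by auto
  have iD: "sint ?D (%x. \<bar>X x - sg x\<bar>)"
  using set_integrable_subset[OF set_integrable_norm[OF set_integral_diff(1)[OF X sg]] Dm Dsub] by simp
  have "(LINT x:cube s|leb. g k x * (sg x - X x)) = (LINT x:?D|leb. g k x * (sg x - X x))"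
  unfolding set_lebesgue_integral_def
  proof (rule Bochner_Integration.integral_cong[OF refl])
  fix x show "idc (cube s) x *\<^sub>R (g k x * (sg x - X x)) = idc ?D x *\<^sub>R (g k x * (sg x - X x))"
  proof (cases "x : ?D")
  case True
  hence "x : cube s" using Dsub by auto
  thus ?thesis using True by simp
  qed (simp add: g0)
  qed
  also have "\<dots> <= (LINT x:?D|leb. (C / dl k) * \<bar>X x - sg x\<bar>)"
  proof (rule set_integral_mono)
  show "sint ?D (%x. g k x * (sg x - X x))" by (rule set_integrable_subset[OF i3 Dm Dsub])
  show "sint ?D (%x. C / dl k * \<bar>X x - sg x\<bar>)" using iD by simp
  fix x
  have "g k x * (sg x - X x) <= \<bar>g k x\<bar> * \<bar>sg x - X x\<bar>" unfolding abs_mult[symmetric] by (rule abs_ge_self)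
  also have "\<dots> <= C / dl k * \<bar>sg x - X x\<bar>" using gb by (intro mult_right_mono) auto
  finally show "g k x * (sg x - X x) <= C / dl k * \<bar>X x - sg x\<bar>" by (simp add: abs_minus_commute)
  qed
  also have "\<dots> = (C / dl k) * (LINT x:?D|leb. \<bar>X x - sg x\<bar>)" by (rule set_integral_mult_right)
  also have "\<dots> <= (C / dl k) * (M * dl k)" using C0 dl(1)[of k] slope[of k] by (intro mult_left_mono) auto
  also have "\<dots> = b" using dl(1)[of k] by (simp add: C_def b_def)
  finally show ?thesis .
  qed
  ultimately have le: "(LINT x:cube s|leb. K k x * (X x * dvg Fi x) + (1 - K k x) * (sg x * dvg Fi x)) \<le>
  (LINT x:cube s|leb. X x * dvg (%x. K k x *\<^sub>R Fi x) x) + (LINT x:cube s - ccube r|leb. sg x * dvg (%x. (1 - K k x) *\<^sub>R Fi x) x) + b" by simp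
  have add3: "ennreal (x + y + b) <= ennreal x + ennreal y + ennreal b" for x y
  proof -
  have "ennreal (x + y + b) <= ennreal (max 0 x + max 0 y + b)" by (intro ennreal_leI) auto
  also have "\<dots> = ennreal (max 0 x) + ennreal (max 0 y) + ennreal b" using b0 by (simp add: ennreal_plus)
  finally show ?thesis by (simp add: ennreal_max_0)
  qed
  have "ennreal (LINT x:cube s|leb. K k x * (X x * dvg Fi x) + (1 - K k x) * (sg x * dvg Fi x)) \<le>
  ennreal (LINT x:cube s|leb. X x * dvg (%x. K k x *\<^sub>R Fi x) x) + ennreal (LINT x:cube s - ccube r|leb. sg x * dvg (%x. (1 - K k x) *\<^sub>R Fi x) x) + ennreal b"
  by (rule order_trans[OF ennreal_leI[OF le] add3])
  also have "\<dots> <= V1 + V2 + ennreal b"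
  unfolding V1_def V2_def by (intro add_mono tv_upper t1 t2 n1 n2 order_refl)
  finally show ?thesis .
 qed
 have "(%k. ennreal (LINT x:cube s|leb. K k x * (X x * dvg Fi x) + (1 - K k x) * (sg x * dvg Fi x))) \<longlonglongrightarrow>
  ennreal (LINT x:cube s|leb. ?Z x * dvg Fi x)" by (rule tendsto_ennrealI[OF lim])
 thus "ennreal (LINT x:cube s|leb. ?Z x * dvg Fi x) <= V1 + V2 + ennreal b"
  by (rule tendsto_upperbound) (use step in auto)
qed


lemma snint_abs_eq:
 fixes w :: "real^'n => real"
 assumes "sint A w"
 shows "(\<integral>\<^sup>+x\<in>A. ennreal \<bar>w x\<bar> \<partial>leb) = ennreal (LINT x:A|leb. \<bar>w x\<bar>)"
proof -
 have "(\<integral>\<^sup>+x\<in>A. ennreal \<bar>w x\<bar> \<partial>leb) = (\<integral>\<^sup>+x. ennreal (norm (idc A x *\<^sub>R w x)) \<partial>leb)"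
  by (intro nn_integral_cong) (auto simp: indicator_def)
 also have "\<dots> = ennreal (\<integral>x. norm (idc A x *\<^sub>R w x) \<partial>leb)"
  using assms by (intro nn_integral_eq_integral) (auto simp: set_integrable_def)
 also have "(\<integral>x. norm (idc A x *\<^sub>R w x) \<partial>leb) = (LINT x:A|leb. \<bar>w x\<bar>)"
  unfolding set_lebesgue_integral_def by (intro Bochner_Integration.integral_cong) (auto simp: indicator_def)
 finally show ?thesis .
qed

text \<open>The integral of \<open>\<bar>X x - sg x\<bar>\<close> over growing cubes is a monotone
  function of the radius with mean slope below \<open>M\<close> between \<open>r\<close> and
  \<open>s\<close>. Some intermediate radius has left slopes at most \<open>M\<close> along a
  sequence of steps tending to 0, which is the hypothesis of \<open>tv_glue\<close>.\<close>

lemma exists_good_cube: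
 fixes X sg :: "real^'n => real"
 assumes r: "0 < r" "r < s" and X: "sint (cube s) X" and sg: "sint (cube s) sg"
  and c: "!!x. \<bar>deriv sst x\<bar> <= c"
  and M: "(LINT x:cube s - cube r|leb. \<bar>X x - sg x\<bar>) < M * (s - r)"
 shows "EX t. r < t & t < s & total_variation (cube s) (%x. if x : cube t then X x else sg x) \<le>
  total_variation (cube s) X + total_variation (cube s - ccube r) sg + ennreal (2 * (real CARD('n))\<^sup>2 * c * M)"
proof -
 define w where "w = (%x. \<bar>X x - sg x\<bar>)"
 have w: "sint (cube s) w"
  unfolding w_def using set_integrable_norm[OF set_integral_diff(1)[OF X sg]] by simp
 define G where "G = (%t. LINT x:cube t|leb. w x)"
 have ws: "sint (cube t) w" if "t <= s" for t
  by (rule set_integrable_subset[OF w]) (use cube_mono that in auto)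
 have diff: "G t' - G t = (LINT x:cube t' - cube t|leb. w x)" if "t <= t'" "t' <= s" for t t'
 proof -
  have "cube t' = cube t \<union> (cube t' - cube t)" using cube_mono[OF that(1)] by auto
  moreover have "(LINT x:cube t \<union> (cube t' - cube t)|leb. w x) = G t + (LINT x:cube t' - cube t|leb. w x)"
  unfolding G_def
  proof (rule set_integral_Un)
  show "sint (cube t) w" using ws that by auto
  show "sint (cube t' - cube t) w"
  by (rule set_integrable_subset[OF ws[OF that(2)]]) (use sets.Diff in auto)
  qed auto
  ultimately show ?thesis by (simp add: G_def)
 qed
 have mono: "G x <= G y" if "r <= x" "x <= y" "y <= s" for x y
 proof -
  have "0 <= (LINT x:cube y - cube x|leb. w x)"
  unfolding set_lebesgue_integral_def w_def by (rule Bochner_Integration.integral_nonneg) simp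
  thus ?thesis using diff[OF that(2,3)] by simp
 qed
 have "G s - G r < M * (s - r)" using diff[of r s] r M by (simp add: w_def)
 from mono_small_left_slope[OF mono r(2) this]
 obtain t where t: "r < t" "t < s" and slope: "!!eps. eps > 0 ==> \<exists>dl. 0 < dl & dl < eps & G t - G (t - dl) <= M * dl"
  by blast
 have "\<exists>dl. 0 < dl & dl < min (t - r) (inverse (real (Suc k))) & G t - G (t - dl) <= M * dl" for k
  by (rule slope) (use t in simp)
 then obtain dl where dl: "!!k. 0 < dl k" "!!k. dl k < min (t - r) (inverse (real (Suc k)))"
  "!!k. G t - G (t - dl k) <= M * dl k" by metis
 have "dl \<longlonglongrightarrow> 0"
 proof (rule tendsto_sandwich[OF _ _ tendsto_const LIMSEQ_inverse_real_of_nat])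
  show "\<forall>\<^sub>F n in sequentially. 0 <= dl n" using dl(1) by (simp add: less_imp_le)
  show "\<forall>\<^sub>F n in sequentially. dl n <= inverse (real (Suc n))" using dl(2) by (auto simp: less_imp_le)
 qed
 hence "total_variation (cube s) (%x. if x : cube t then X x else sg x) \<le>
  total_variation (cube s) X + total_variation (cube s - ccube r) sg + ennreal (2 * (real CARD('n))\<^sup>2 * c * M)"
 proof (rule tv_glue[OF less_imp_le[OF r(1)] t X sg c])
  show "0 < dl k" "dl k < t - r" for k using dl(1,2)[of k] by auto
  show "(LINT x:cube t - cube (t - dl k)|leb. \<bar>X x - sg x\<bar>) <= M * dl k" for k
  using dl(3)[of k] diff[of "t - dl k" t] dl(1)[of k] t by (simp add: w_def)
 qed
 thus ?thesis using t by blast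
qed

text \<open>The radius \<open>r\<close> depends only on the limit \<open>tht\<close>; it then serves for every \<open>X\<close> close to \<open>\<theta>\<close>.\<close>

lemma glue_step_fun:
 assumes s: "s > 0" and tht: "sint (cube s) tht"
  and bd: "AE x in leb. x : cube s --> \<bar>tht x - step_fun a b (e i) x\<bar> <= 1"
  and tr: "trace_eq (cube s) tht (step_fun a b (e i))"
  and kp: "kp > 0" and r0: "r0 < s"
 shows "\<exists>r eps. r0 < r & 0 < r & r < s & 0 < eps & (ALL X. sint (cube s) X -->
  (LINT x:cube s|leb. norm (X x - tht x)) < eps -->
  (EX t. r < t & t < s & total_variation (cube s) (%x. if x : cube t then X x else step_fun a b (e i) x) \<le>
  total_variation (cube s) X + ennreal kp))"
proof -
 define sg where "sg = step_fun a b (e i)"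
 have sg: "sint (cube s) sg"
  unfolding sg_def by (rule step_fun_intg(1)[OF _ bdd_cube]) simp
 obtain c where c: "c > 0" "!!x. \<bar>deriv sst x\<bar> <= c" using deriv_sst_bdd by blast
 let ?m = "CARD('n) - 1"
 define C where "C = 2 * (real CARD('n))\<^sup>2 * c"
 have C: "C > 0" using c by (simp add: C_def)
 \<comment> \<open>The slope constant will be \<open>3 * kp'\<close>, for which the error of the cut
   is \<open>C * (3 * kp') = kp / 2\<close>; the other half of \<open>kp\<close> pays for the
   variation of the step function in the shell.\<close>
 define kp' where "kp' = kp / (6 * C)"
 have kp': "kp' > 0" using kp C by (simp add: kp'_def)
 have "((%r. \<bar>a - b\<bar> * (c * ((2 * s) ^ ?m - (2 * r) ^ ?m))) \<longlongrightarrow> \<bar>a - b\<bar> * (c * ((2 * s) ^ ?m - (2 * s) ^ ?m))) (at_left s)"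
  by (intro tendsto_intros)
 hence "\<forall>\<^sub>F r in at_left s. \<bar>a - b\<bar> * (c * ((2 * s) ^ ?m - (2 * r) ^ ?m)) < kp / 2"
  using kp by (intro order_tendstoD(2)) auto
 then obtain r1 where r1: "r1 < s" "!!r. r1 < r ==> r < s ==> \<bar>a - b\<bar> * (c * ((2 * s) ^ ?m - (2 * r) ^ ?m)) < kp / 2"
  unfolding eventually_at_left_field by blast
 define rho1 where "rho1 = s - max (max r0 r1) 0"
 have rho1: "rho1 > 0" using r0 r1(1) s by (simp add: rho1_def)
 obtain rho where rho: "0 < rho" "rho < rho1"
  "(\<integral>\<^sup>+y\<in>cube s - cube (s - rho). ennreal \<bar>tht y - sg y\<bar> \<partial>leb) <= ennreal (kp' * rho)"
  using trace_layer[OF s tht sg _ _ kp' rho1] bd tr unfolding sg_def by blast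
 define r where "r = s - rho"
 have r: "r0 < r" "r1 < r" "0 < r" "r < s" using rho(1,2) by (auto simp: r_def rho1_def)
 have Dm: "cube s - cube r : sets leb" by (rule sets.Diff) auto
 note sub = set_integrable_subset[OF _ Dm Diff_subset]
 have ttht: "(LINT x:cube s - cube r|leb. \<bar>tht x - sg x\<bar>) <= kp' * rho"
 proof -
  have "ennreal (LINT x:cube s - cube r|leb. \<bar>tht x - sg x\<bar>) <= ennreal (kp' * rho)"
  using rho(3) unfolding r_def
  by (subst snint_abs_eq[symmetric, OF sub[unfolded r_def, OF set_integral_diff(1)[OF tht sg]]])
  thus ?thesis using kp' rho(1) by (subst (asm) ennreal_le_iff) auto
 qed
 have TV: "total_variation (cube s - ccube r) sg <= ennreal (kp / 2)"
  unfolding sg_def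
  by (rule order_trans[OF tv_step[OF r(3,4) c(2)] ennreal_leI]) (use r1(2)[OF r(2,4)] in simp)
 have "EX t. r < t & t < s & total_variation (cube s) (%x. if x : cube t then X x else step_fun a b (e i) x) \<le>
  total_variation (cube s) X + ennreal kp"
  if X: "sint (cube s) X" and cl: "(LINT x:cube s|leb. norm (X x - tht x)) < kp' * rho" for X
 proof -
  have iX: "sint (cube s) (%x. \<bar>X x - tht x\<bar>)"
  using set_integrable_norm[OF set_integral_diff(1)[OF X tht]] by simp
  have i1: "sint (cube s - cube r) (%x. \<bar>X x - tht x\<bar>)" by (rule sub[OF iX])
  have i2: "sint (cube s - cube r) (%x. \<bar>tht x - sg x\<bar>)"
  using sub[OF set_integrable_norm[OF set_integral_diff(1)[OF tht sg]]] by simp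
  have i3: "sint (cube s - cube r) (%x. \<bar>X x - sg x\<bar>)"
  using sub[OF set_integrable_norm[OF set_integral_diff(1)[OF X sg]]] by simp
  have "(LINT x:cube s - cube r|leb. \<bar>X x - sg x\<bar>) <= (LINT x:cube s - cube r|leb. \<bar>X x - tht x\<bar> + \<bar>tht x - sg x\<bar>)"
  by (rule set_integral_mono[OF i3 set_integral_add(1)[OF i1 i2]]) simp
  also have "\<dots> = (LINT x:cube s - cube r|leb. \<bar>X x - tht x\<bar>) + (LINT x:cube s - cube r|leb. \<bar>tht x - sg x\<bar>)"
  by (rule set_integral_add(2)[OF i1 i2])
  also have "(LINT x:cube s - cube r|leb. \<bar>X x - tht x\<bar>) <= (LINT x:cube s|leb. \<bar>X x - tht x\<bar>)"
  using iX i1 unfolding set_integrable_def set_lebesgue_integral_def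
  by (intro integral_mono) (auto simp: indicator_def)
  finally have "(LINT x:cube s - cube r|leb. \<bar>X x - sg x\<bar>) < 2 * (kp' * rho)" using cl ttht by simp
  hence M: "(LINT x:cube s - cube r|leb. \<bar>X x - sg x\<bar>) < (3 * kp') * (s - r)"
  using mult_pos_pos[OF kp' rho(1)] by (simp add: r_def)
  obtain t where t: "r < t" "t < s" "total_variation (cube s) (%x. if x : cube t then X x else sg x) \<le>
  total_variation (cube s) X + total_variation (cube s - ccube r) sg + ennreal (2 * (real CARD('n))\<^sup>2 * c * (3 * kp'))"
  using exists_good_cube[OF r(3,4) X sg c(2) M] by blast
  have e: "2 * (real CARD('n))\<^sup>2 * c * (3 * kp') = kp / 2"
  proof -
  have "C * (3 * kp') = kp / 2" using C by (simp add: kp'_def)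
  thus ?thesis by (simp add: C_def)
  qed
  have "total_variation (cube s) X + total_variation (cube s - ccube r) sg + ennreal (kp / 2) \<le>
  total_variation (cube s) X + ennreal (kp / 2) + ennreal (kp / 2)"
  using TV by (intro add_mono order_refl)
  also have "\<dots> = total_variation (cube s) X + ennreal kp"
  using kp by (simp add: add.assoc ennreal_plus[symmetric] del: ennreal_plus)
  finally show ?thesis using t unfolding e sg_def by (meson order_trans)
 qed
 thus ?thesis using r kp' rho(1) by (intro exI[of _ r] exI[of _ "kp' * rho"]) auto
qed

end

subsection \<open>Smoothing the positive part, exactly at the boundary of a cube\<close>

lemma hasd_real_compose:
 assumes "(f has_derivative f') (at y)" "(g has_real_derivative d) (at (f y))"
 shows "((%y. g (f y)) has_derivative (%v. d * f' v)) (at y)"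
 using diff_chain_at[OF assms(1) assms(2)[unfolded has_field_derivative_def]] by (simp add: o_def)

lemma hasd_sqrt:
 assumes "(f has_derivative f') (at y)" "f y > 0"
 shows "((%y. sqrt (f y)) has_derivative (%v. f' v / (2 * sqrt (f y)))) (at y)"
proof -
 have "((%y. sqrt (f y)) has_derivative (%v. (inverse (sqrt (f y)) / 2) * f' v)) (at y)"
  by (rule hasd_real_compose[OF assms(1) DERIV_real_sqrt[OF assms(2)]])
 moreover have "(inverse (sqrt (f y)) / 2) * f' v = f' v / (2 * sqrt (f y))" for v
  using assms(2) by (simp add: field_simps)
 ultimately show ?thesis by (simp only:)
qed

lemma fdv_constant_direction:
 fixes f :: "'a::euclidean_space => real"
 assumes "C_k (Suc 0) f" "!!t. f (y + t *\<^sub>R v) = f y"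
 shows "fdv f (at y) v = 0"
proof -
 have l: "((%t. y + t *\<^sub>R v) has_derivative (%t. t *\<^sub>R v)) (at 0)"
  by (auto intro!: derivative_eq_intros)
 have "((f \<circ> (%t. y + t *\<^sub>R v)) has_derivative (fdv f (at y) \<circ> (%t. t *\<^sub>R v))) (at 0)"
  by (rule diff_chain_at[OF l]) (use C_k_Suc_hasd[OF assms(1)] in simp)
 moreover have "f \<circ> (%t. y + t *\<^sub>R v) = (%t. f y)" using assms(2) by (simp add: fun_eq_iff)
 ultimately have "((%t::real. f y) has_derivative (fdv f (at y) \<circ> (%t. t *\<^sub>R v))) (at 0)" by simp
 from fun_cong[where x=1, OF has_derivative_unique[OF this has_derivative_const]]
 show ?thesis by simp
qed

context frame begin

definition bd_poly :: "real => real^'n => real" where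
 "bd_poly s y = (\<Prod>j\<in>UNIV. s\<^sup>2 - (y \<bullet> e j)\<^sup>2)"

text \<open>This factor of \<open>bd_poly\<close> is constant along \<open>e i\<close>, so the
  normal derivative of the boundary weight comes from a single explicit factor.\<close>

definition lat_poly :: "'n => real => real^'n => real" where
 "lat_poly i s y = (\<Prod>j\<in>UNIV - {i}. s\<^sup>2 - (y \<bullet> e j)\<^sup>2)"

text \<open>A smooth substitute for the distance to the frontier of the cube. Because of the square,
  the gradient vanishes on the frontier too, and on the cube the squared gradient is at most a
  constant times the weight; the Hessian estimate of the corner function rests on this.\<close>

definition bd_wt :: "real => real^'n => real" where
 "bd_wt s y = (bd_poly s y)\<^sup>2"

lemma bd_poly_split: "bd_poly s y = (s\<^sup>2 - (y \<bullet> e i)\<^sup>2) * lat_poly i s y"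
 unfolding bd_poly_def lat_poly_def by (subst prod.remove[of UNIV i]) auto

lemma C_k_sq_poly: "C_k k (%y. s\<^sup>2 - (y \<bullet> (v::'a::euclidean_space))\<^sup>2)"
 unfolding power2_eq_square by (rule C_k_diff[OF C_k_const C_k_mult[OF C_k_inner_left C_k_inner_left]])

lemma C_k_bd_poly: "C_k k (bd_poly s)"
 unfolding bd_poly_def[abs_def] by (rule C_k_prod[OF C_k_sq_poly])

lemma C_k_lat_poly: "C_k k (lat_poly i s)"
 unfolding lat_poly_def[abs_def] by (rule C_k_prod[OF C_k_sq_poly])

lemma C_k_bd_wt: "C_k k (bd_wt s)"
 unfolding bd_wt_def[abs_def] power2_eq_square by (rule C_k_mult[OF C_k_bd_poly C_k_bd_poly])

lemma bd_wt_nonneg: "bd_wt s y >= 0" by (simp add: bd_wt_def)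

lemma bd_poly_pos: "y : cube s ==> bd_poly s y > 0"
 unfolding bd_poly_def
proof (rule prod_pos)
 fix j assume "y : cube s"
 hence "\<bar>y \<bullet> e j\<bar> < s" by (simp add: cube_def)
 hence "\<bar>y \<bullet> e j\<bar>\<^sup>2 < s\<^sup>2" by (intro power_strict_mono) auto
 thus "0 < s\<^sup>2 - (y \<bullet> e j)\<^sup>2" by simp
qed

lemma bd_wt_pos: "y : cube s ==> bd_wt s y > 0"
 using bd_poly_pos[of y s] by (simp add: bd_wt_def)

lemma bd_wt_fr:
 assumes "y : frontier (cube s)" "s > 0"
 shows "bd_wt s y = 0"
proof -
 obtain j where j: "\<bar>y \<bullet> e j\<bar> = s" using assms(1) unfolding fr_cube[OF assms(2)] by auto
 have "s\<^sup>2 - (y \<bullet> e j)\<^sup>2 = 0" unfolding j[symmetric] by simp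
 hence "bd_poly s y = 0" unfolding bd_poly_def by (intro prod_zero) auto
 thus ?thesis by (simp add: bd_wt_def)
qed

lemma pderiv_bd_wt: "fdv (bd_wt s) (at y) v = 2 * bd_poly s y * fdv (bd_poly s) (at y) v"
proof -
 have d: "(bd_poly s has_derivative fdv (bd_poly s) (at y)) (at y)"
  by (rule C_k_Suc_hasd[OF C_k_bd_poly])
 have "((%y. bd_poly s y * bd_poly s y) has_derivative
  (%v. bd_poly s y * fdv (bd_poly s) (at y) v + fdv (bd_poly s) (at y) v * bd_poly s y)) (at y)"
  by (rule has_derivative_mult[OF d d])
 hence "(bd_wt s has_derivative
  (%v. bd_poly s y * fdv (bd_poly s) (at y) v + fdv (bd_poly s) (at y) v * bd_poly s y)) (at y)"
  unfolding bd_wt_def[abs_def] power2_eq_square .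
 from fun_cong[where x=v, OF frechet_derivative_at[OF this]] show ?thesis by simp
qed

text \<open>In the cube both polynomials are positive, so the sign is opposite to that of
  \<open>y \<bullet> e i\<close>. This monotonicity along the normal discards the weight term after
  integration by parts.\<close>

lemma bd_wt_normal_der:
 "fdv (bd_wt s) (at y) (e i) = - 4 * (y \<bullet> e i) * bd_poly s y * lat_poly i s y"
proof -
 have d1: "((%y. s\<^sup>2 - (y \<bullet> e i)\<^sup>2) has_derivative (%v. - (2 * (y \<bullet> e i) * (v \<bullet> e i)))) (at y)"
  by (auto intro!: derivative_eq_intros)
 have d2: "(lat_poly i s has_derivative fdv (lat_poly i s) (at y)) (at y)"
  by (rule C_k_Suc_hasd[OF C_k_lat_poly])
 have eq: "bd_poly s = (%y. (s\<^sup>2 - (y \<bullet> e i)\<^sup>2) * lat_poly i s y)"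
  by (rule ext) (rule bd_poly_split)
 have "((%y. (s\<^sup>2 - (y \<bullet> e i)\<^sup>2) * lat_poly i s y) has_derivative
  (%v. (s\<^sup>2 - (y \<bullet> e i)\<^sup>2) * fdv (lat_poly i s) (at y) v + - (2 * (y \<bullet> e i) * (v \<bullet> e i)) * lat_poly i s y)) (at y)"
  by (rule has_derivative_mult[OF d1 d2])
 hence "(bd_poly s has_derivative
  (%v. (s\<^sup>2 - (y \<bullet> e i)\<^sup>2) * fdv (lat_poly i s) (at y) v + - (2 * (y \<bullet> e i) * (v \<bullet> e i)) * lat_poly i s y)) (at y)"
  unfolding eq[symmetric] .
 from fun_cong[where x="e i", OF frechet_derivative_at[OF this]]
 have "fdv (bd_poly s) (at y) (e i) = (s\<^sup>2 - (y \<bullet> e i)\<^sup>2) * fdv (lat_poly i s) (at y) (e i) - 2 * (y \<bullet> e i) * lat_poly i s y"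
  by (simp add: orthonormal)
 moreover have "fdv (lat_poly i s) (at y) (e i) = 0"
  by (rule fdv_constant_direction[OF C_k_lat_poly])
  (auto simp: lat_poly_def inner_add_left orthonormal intro!: prod.cong)
 ultimately show ?thesis unfolding pderiv_bd_wt by simp
qed

text \<open>With t the normal coordinate and \<sigma> = \<open>mu * bd_wt s y\<close>, this is a
  regularised absolute value of t. For \<eta> = 0 and positive \<open>mu\<close> it is smooth in the
  open cube and equals the absolute value of t on the frontier; a positive \<eta> makes it smooth on
  the whole space, as integration by parts requires.\<close>

definition cor_rad :: "real => real => 'n => real => real^'n => real" where
 "cor_rad \<eta> mu i s y = sqrt ((y \<bullet> e i)\<^sup>2 + (mu * bd_wt s y)\<^sup>2 + \<eta>)"

text \<open>The model is max(0, t) = (t + |t|) / 2, with the absolute value replaced by its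
  regularisation.\<close>

definition corner :: "real => 'n => real => real^'n => real" where
 "corner mu i s y = (y \<bullet> e i + cor_rad 0 mu i s y) / 2"

text \<open>Half the derivative of the radicand in direction \<open>v\<close>, hence the numerator
  of the derivative of the root.\<close>

definition cor_num :: "real => 'n => real => real^'n => real^'n => real" where
 "cor_num mu i s v y = (y \<bullet> e i) * (v \<bullet> e i) + mu\<^sup>2 * (bd_wt s y * fdv (bd_wt s) (at y) v)"

lemma cor_rad_hasd:
 assumes "(y \<bullet> e i)\<^sup>2 + (mu * bd_wt s y)\<^sup>2 + \<eta> > 0"
 shows "(cor_rad \<eta> mu i s has_derivative (%v. cor_num mu i s v y / cor_rad \<eta> mu i s y)) (at y)"
proof -
 have d: "(bd_wt s has_derivative fdv (bd_wt s) (at y)) (at y)"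
  by (rule C_k_Suc_hasd[OF C_k_bd_wt])
 have "((%y. (y \<bullet> e i)\<^sup>2 + (mu * bd_wt s y)\<^sup>2 + \<eta>) has_derivative (%v. 2 * cor_num mu i s v y)) (at y)"
  unfolding cor_num_def
  by (rule derivative_eq_intros d refl | simp add: fun_eq_iff power2_eq_square algebra_simps)+
 from hasd_sqrt[OF this assms] show ?thesis
  unfolding cor_rad_def[abs_def] by simp
qed

lemma cor_num_hasd:
 "(cor_num mu i s w has_derivative (%v. (v \<bullet> e i) * (w \<bullet> e i) + mu\<^sup>2 *
  (bd_wt s y * fdv (%y. fdv (bd_wt s) (at y) w) (at y) v +
  fdv (bd_wt s) (at y) v * fdv (bd_wt s) (at y) w))) (at y)"
proof -
 have d: "(bd_wt s has_derivative fdv (bd_wt s) (at y)) (at y)"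
  by (rule C_k_Suc_hasd[OF C_k_bd_wt])
 have d2: "((%y. fdv (bd_wt s) (at y) w) has_derivative
  fdv (%y. fdv (bd_wt s) (at y) w) (at y)) (at y)"
  by (rule C_k_Suc_hasd[OF C_k_deriv[OF C_k_bd_wt]])
 have l: "((%y. (y \<bullet> e i) * (w \<bullet> e i)) has_derivative (%v. (v \<bullet> e i) * (w \<bullet> e i))) (at y)"
  by (auto intro!: derivative_eq_intros)
 show ?thesis unfolding cor_num_def[abs_def]
  by (rule has_derivative_add[OF l has_derivative_mult_right[OF has_derivative_mult[OF d d2]]])
qed

definition cor_grad :: "real => 'n => real => real^'n => real^'n" where
 "cor_grad mu i s y = (\<chi> j. (e i $ j + cor_num mu i s (axis j 1) y / cor_rad 0 mu i s y) / 2)"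

definition cor_hess :: "real => 'n => real => real^'n => real^'n^'n" where
 "cor_hess mu i s y = (\<chi> j k. ((e i $ k * e i $ j + mu\<^sup>2 *
  (bd_wt s y * pdv k (pdv j (bd_wt s)) y + pdv k (bd_wt s) y * pdv j (bd_wt s) y)) / cor_rad 0 mu i s y
  - cor_num mu i s (axis j 1) y * cor_num mu i s (axis k 1) y / cor_rad 0 mu i s y ^ 3) / 2)"

lemma cont_cor_num: "continuous_on A (cor_num mu i s v)"
 unfolding cor_num_def[abs_def]
 by (intro continuous_intros cont_on_C_k[OF C_k_bd_wt[of 0]] cont_on_C_k[OF C_k_deriv[OF C_k_bd_wt[of "Suc 0"]]])

lemma cont_cor_rad: "continuous_on A (cor_rad \<eta> mu i s)"
 unfolding cor_rad_def[abs_def]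
 by (intro continuous_intros cont_on_C_k[OF C_k_bd_wt[of 0]])

lemma cor_rad_pos: "mu > 0 ==> y : cube s ==> \<eta> >= 0 ==> (y \<bullet> e i)\<^sup>2 + (mu * bd_wt s y)\<^sup>2 + \<eta> > 0"
 using bd_wt_pos[of y s] by (simp add: add_nonneg_pos add_pos_nonneg)

lemma cor_rad_gt_0: "mu > 0 ==> y : cube s ==> \<eta> >= 0 ==> cor_rad \<eta> mu i s y > 0"
 unfolding cor_rad_def using cor_rad_pos by (metis real_sqrt_gt_zero)

lemma cor_hasd:
 assumes "mu > 0" "y : cube s"
 shows "(corner mu i s has_derivative (%v. (v \<bullet> e i + cor_num mu i s v y / cor_rad 0 mu i s y) / 2)) (at y)"
proof -
 have d: "(cor_rad 0 mu i s has_derivative (%v. cor_num mu i s v y / cor_rad 0 mu i s y)) (at y)"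
  by (rule cor_rad_hasd) (use cor_rad_pos[OF assms, of 0 i] in simp)
 have l: "((%y. y \<bullet> e i) has_derivative (%v. v \<bullet> e i)) (at y)" by (auto intro!: derivative_eq_intros)
 have "((%y. (y \<bullet> e i + cor_rad 0 mu i s y) * (1/2)) has_derivative (%v. (v \<bullet> e i + cor_num mu i s v y / cor_rad 0 mu i s y) * (1/2))) (at y)"
  by (rule has_derivative_mult_left[OF has_derivative_add[OF l d]])
 thus ?thesis unfolding corner_def[abs_def] by simp
qed

lemma cor_grad_hasd:
 assumes "mu > 0" "y : cube s"
 shows "EX g'. ((%y. cor_grad mu i s y $ j) has_derivative g') (at y) & (ALL k. g' (axis k 1) = cor_hess mu i s y $ j $ k)"
proof -
 have d: "(cor_rad 0 mu i s has_derivative (%v. cor_num mu i s v y / cor_rad 0 mu i s y)) (at y)"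
  by (rule cor_rad_hasd) (use cor_rad_pos[OF assms, of 0 i] in simp)
 have nz: "cor_rad 0 mu i s y ~= 0" using cor_rad_gt_0[OF assms, of 0 i] by simp
 define n' where "n' = (%v. (v \<bullet> e i) * (axis j 1 \<bullet> e i) + mu\<^sup>2 *
  (bd_wt s y * fdv (%y. fdv (bd_wt s) (at y) (axis j 1)) (at y) v +
  fdv (bd_wt s) (at y) v * fdv (bd_wt s) (at y) (axis j 1)))"
 have n: "(cor_num mu i s (axis j 1) has_derivative n') (at y)"
  unfolding n'_def by (rule cor_num_hasd)
 have q: "((%y. cor_num mu i s (axis j 1) y / cor_rad 0 mu i s y) has_derivative
  (%v. (n' v * cor_rad 0 mu i s y - cor_num mu i s (axis j 1) y * (cor_num mu i s v y / cor_rad 0 mu i s y)) /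
  (cor_rad 0 mu i s y * cor_rad 0 mu i s y))) (at y)"
  by (rule has_derivative_divide'[OF n d nz])
 have "((%y. (e i $ j + cor_num mu i s (axis j 1) y / cor_rad 0 mu i s y) * (1/2)) has_derivative
  (%v. (0 + (n' v * cor_rad 0 mu i s y - cor_num mu i s (axis j 1) y * (cor_num mu i s v y / cor_rad 0 mu i s y)) /
  (cor_rad 0 mu i s y * cor_rad 0 mu i s y)) * (1/2))) (at y)"
  by (rule has_derivative_mult_left[OF has_derivative_add[OF has_derivative_const q]])
 moreover have "(%y. (e i $ j + cor_num mu i s (axis j 1) y / cor_rad 0 mu i s y) * (1/2)) = (%y. cor_grad mu i s y $ j)"
  by (simp add: cor_grad_def)
 moreover have "(0 + (n' (axis k 1) * cor_rad 0 mu i s y - cor_num mu i s (axis j 1) y * (cor_num mu i s (axis k 1) y / cor_rad 0 mu i s y)) /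
  (cor_rad 0 mu i s y * cor_rad 0 mu i s y)) * (1/2) = cor_hess mu i s y $ j $ k" for k
  unfolding cor_hess_def n'_def pderiv_at_def[abs_def] using nz
  by (simp add: inner_axis' diff_divide_distrib power3_eq_cube mult.commute[of "e i $ k"])
 ultimately show ?thesis by (intro exI conjI) auto
qed

lemma cont_cor_grad: "mu > 0 ==> continuous_on (cube s) (%y. cor_grad mu i s y $ j)"
 unfolding cor_grad_def using cor_rad_gt_0[of mu _ s 0]
 by (auto intro!: continuous_intros cont_cor_num cont_cor_rad simp: less_imp_neq[THEN not_sym])

lemma cont_cor_hess: "mu > 0 ==> continuous_on (cube s) (%y. cor_hess mu i s y $ j $ k)"
proof -
 assume l: "mu > 0"
 have nz: "\<forall>y\<in>cube s. cor_rad 0 mu i s y ~= 0" "\<forall>y\<in>cube s. cor_rad 0 mu i s y ^ 3 ~= 0"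
  using cor_rad_gt_0[OF l, of _ s 0 i] by force+
 note c = cont_on_C_k[OF C_k_bd_wt[of 0]] cont_on_C_k[OF C_k_pderiv[OF C_k_bd_wt[of "Suc 0"]]]
  cont_on_C_k[OF C_k_pderiv[OF C_k_pderiv[OF C_k_bd_wt[of "Suc (Suc 0)"]]]]
 show ?thesis unfolding cor_hess_def
  by (simp, intro continuous_intros cont_cor_num cont_cor_rad c nz) auto
qed

lemma cor_wp:
 assumes "mu > 0"
 shows "weak_partial (cube s) j (corner mu i s) (%y. cor_grad mu i s y $ j)"
  "weak_partial (cube s) k (%y. cor_grad mu i s y $ j) (%y. cor_hess mu i s y $ j $ k)"
proof -
 have eq: "(axis j 1 \<bullet> e i + cor_num mu i s (axis j 1) y / cor_rad 0 mu i s y) / 2 = cor_grad mu i s y $ j" for y j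
  by (simp add: cor_grad_def inner_axis')
 show "weak_partial (cube s) j (corner mu i s) (%y. cor_grad mu i s y $ j)"
 proof -
  have "continuous_on (cube s) (%y. (axis j 1 \<bullet> e i + cor_num mu i s (axis j 1) y / cor_rad 0 mu i s y) / 2)"
  unfolding eq by (rule cont_cor_grad[OF assms])
  from classical_wp[OF open_cube cor_hasd[OF assms] this]
  show ?thesis unfolding eq .
 qed
 obtain g' where g': "!!y. y : cube s ==> ((%y. cor_grad mu i s y $ j) has_derivative g' y) (at y)"
  "!!y k. y : cube s ==> g' y (axis k 1) = cor_hess mu i s y $ j $ k"
  using cor_grad_hasd[OF assms, of _ s i j] by metis
 have c: "continuous_on (cube s) (%y. g' y (axis k 1))"
  using cont_cor_hess[OF assms, of s i j k] g'(2) by (metis (no_types, lifting) continuous_on_cong)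
 have "weak_partial (cube s) k (%y. cor_grad mu i s y $ j) (%y. g' y (axis k 1))"
  by (rule classical_wp[OF open_cube g'(1) c])
 moreover have "(LINT y:cube s|leb. ph y *\<^sub>R g' y (axis k 1)) = (LINT y:cube s|leb. ph y *\<^sub>R cor_hess mu i s y $ j $ k)" for ph
  by (rule set_lebesgue_integral_cong) (use g'(2) in auto)
 ultimately show "weak_partial (cube s) k (%y. cor_grad mu i s y $ j) (%y. cor_hess mu i s y $ j $ k)"
  by (simp add: weak_partial_def)
qed

lemma cor_diff:
 assumes "mu >= 0"
 shows "\<bar>corner mu i s y - max 0 (y \<bullet> e i)\<bar> <= mu * bd_wt s y / 2"
proof -
 define t where "t = y \<bullet> e i"
 define sg where "sg = mu * bd_wt s y"
 have sg: "sg >= 0" using assms bd_wt_nonneg by (simp add: sg_def)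
 have 1: "\<bar>t\<bar> <= sqrt (t\<^sup>2 + sg\<^sup>2)" by (simp add: real_le_rsqrt)
 have 2: "sqrt (t\<^sup>2 + sg\<^sup>2) <= \<bar>t\<bar> + sg" using sg by (intro real_le_lsqrt) (auto simp: power2_sum)
 have "corner mu i s y - max 0 t = (sqrt (t\<^sup>2 + sg\<^sup>2) - \<bar>t\<bar>) / 2"
  by (simp add: corner_def cor_rad_def t_def sg_def max_def field_simps)
 moreover have "\<bar>(sqrt (t\<^sup>2 + sg\<^sup>2) - \<bar>t\<bar>) / 2\<bar> <= sg / 2" using 1 2 by simp
 ultimately have "\<bar>corner mu i s y - max 0 t\<bar> <= sg / 2" by (simp only:)
 thus ?thesis unfolding t_def sg_def .
qed

lemma cont_corner: "continuous_on A (corner mu i s)"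
 unfolding corner_def[abs_def] by (intro continuous_intros cont_cor_rad) auto


lemma C_k_bdd_on_cube:
 fixes f :: "real^'n => real"
 assumes "C_k k f"
 shows "\<exists>B\<ge>0. \<forall>y\<in>ccube s. \<bar>f y\<bar> <= B"
proof -
 have "compact (ccube s)" unfolding ccube_eq_cslab by (rule compact_cslab)
 hence "bounded (f ` ccube s)"
  by (intro compact_imp_bounded compact_continuous_image cont_on_C_k[OF assms])
 then obtain B where B: "!!y. y : ccube s ==> \<bar>f y\<bar> <= B" by (auto simp: bounded_iff)
 hence "\<bar>f y\<bar> <= max B 0" if "y : ccube s" for y using that by (simp add: le_max_iff_disj)
 thus ?thesis by (intro exI[of _ "max B 0"]) auto
qed

lemma pderiv_bdd_on_cube:
 fixes f :: "real^'n => real"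
 assumes "!!k. C_k k f"
 shows "\<exists>B\<ge>0. ALL j. \<forall>y\<in>ccube s. \<bar>pdv j f y\<bar> <= B"
proof -
 have "\<exists>B\<ge>0. \<forall>y\<in>ccube s. \<bar>pdv j f y\<bar> <= B" for j
  by (rule C_k_bdd_on_cube[OF C_k_pderiv[OF assms, of 0]])
 then obtain B where B: "!!j. B j >= 0" "!!j y. y : ccube s ==> \<bar>pdv j f y\<bar> <= B j" by metis
 have "\<bar>pdv j f y\<bar> <= (\<Sum>j\<in>UNIV. B j)" if "y : ccube s" for j y
 proof -
  have "B j <= (\<Sum>j\<in>UNIV. B j)" by (rule member_le_sum) (use B(1) in auto)
  with B(2)[OF that] show ?thesis by (rule order_trans)
 qed
 thus ?thesis using B(1) by (intro exI[of _ "\<Sum>j\<in>UNIV. B j"]) (auto intro: sum_nonneg)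
qed

lemma cor_num_axis:
 "cor_num mu i s (axis j 1) y = (y \<bullet> e i) * e i $ j + (mu * bd_wt s y) * (mu * pdv j (bd_wt s) y)"
 by (simp add: cor_num_def inner_axis' pderiv_at_def power2_eq_square)

lemma cor_rad_bounds:
 assumes "mu >= 0"
 shows "\<bar>y \<bullet> e i\<bar> <= cor_rad 0 mu i s y" "mu * bd_wt s y <= cor_rad 0 mu i s y"
  "(cor_rad 0 mu i s y)\<^sup>2 = (y \<bullet> e i)\<^sup>2 + (mu * bd_wt s y)\<^sup>2"
 by (auto simp: cor_rad_def intro!: real_le_rsqrt)

end

text \<open>Once the term with \<open>w\<close> is split off, the common denominator
  \<open>R ^ 3\<close> produces the numerator \<open>(nk * nj + sk * sj) * (t^2 + sg^2) - (t * nj +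
  sg * sj) * (t * nk + sg * sk)\<close>. Lagrange's identity in the plane turns it into the product
  on the right, in which the dangerous term \<open>t^2 * nj * nk\<close> has cancelled.\<close>

lemma hess_rad_eq:
 fixes R t sg :: real
 assumes R: "R > 0" "R\<^sup>2 = t\<^sup>2 + sg\<^sup>2"
 shows "(nk * nj + (sg * w + sk * sj)) / R - (t * nj + sg * sj) * (t * nk + sg * sk) / R ^ 3 =
  (sg * nj - t * sj) * (sg * nk - t * sk) / R ^ 3 + sg * w / R"
proof -
 have "(nk * nj + sk * sj) / R = (nk * nj + sk * sj) * R\<^sup>2 / R ^ 3"
  using R(1) by (simp add: power2_eq_square power3_eq_cube)
 also have "\<dots> = ((sg * nj - t * sj) * (sg * nk - t * sk) + (t * nj + sg * sj) * (t * nk + sg * sk)) / R ^ 3"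
  unfolding R(2) by (simp add: power2_eq_square algebra_simps)
 finally have e2: "(nk * nj + sk * sj) / R = ((sg * nj - t * sj) * (sg * nk - t * sk) + (t * nj + sg * sj) * (t * nk + sg * sk)) / R ^ 3" .
 have e1: "(nk * nj + (sg * w + sk * sj)) / R = (nk * nj + sk * sj) / R + sg * w / R"
  by (simp add: add_divide_distrib)
 show ?thesis unfolding e1 e2 add_divide_distrib[of _ _ "R ^ 3"] by simp
qed

text \<open>The terms with \<open>sj\<close> and \<open>sk\<close> are harmless: their squares are
  at most \<open>A * sg\<close>, and \<open>t^2 * sg <= R^3\<close>. The quotient
  \<open>sg^2 / R^3\<close>, which comes from the curvature of the corner itself, is the only part
  left without a uniform bound.\<close>

lemma hess_rad_bound:
 fixes R t sg :: real
 assumes R: "R > 0" "\<bar>t\<bar> <= R" "sg <= R" and sg: "sg >= 0" and n: "\<bar>nj\<bar> <= 1" "\<bar>nk\<bar> <= 1"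
  and A: "sj\<^sup>2 <= A * sg" "sk\<^sup>2 <= A * sg" "A >= 0" and w: "\<bar>w\<bar> <= w0"
 shows "\<bar>(sg * nj - t * sj) * (sg * nk - t * sk) / R ^ 3 + sg * w / R\<bar> <= 2 * (sg\<^sup>2 / R ^ 3) + 2 * A + w0"
proof -
 have sq: "(sg * n - t * x)\<^sup>2 <= 2 * sg\<^sup>2 + 2 * (t\<^sup>2 * (A * sg))" if "\<bar>n\<bar> <= 1" "x\<^sup>2 <= A * sg" for n x
 proof -
  have "(sg * n - t * x)\<^sup>2 <= 2 * (sg * n)\<^sup>2 + 2 * (t * x)\<^sup>2"
  using zero_le_power2[of "sg * n + t * x"] by (simp add: power2_sum power2_diff)
  also have "\<dots> <= 2 * (sg\<^sup>2 * 1) + 2 * (t\<^sup>2 * (A * sg))"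
  unfolding power_mult_distrib
  using that by (intro add_mono mult_left_mono) (auto simp: abs_square_le_1)
  finally show ?thesis by simp
 qed
 have "2 * \<bar>(sg * nj - t * sj) * (sg * nk - t * sk)\<bar> <= (sg * nj - t * sj)\<^sup>2 + (sg * nk - t * sk)\<^sup>2"
  using sum_squares_bound[of "\<bar>sg * nj - t * sj\<bar>" "\<bar>sg * nk - t * sk\<bar>"] by (simp add: abs_mult mult.assoc)
 also have "\<dots> <= (2 * sg\<^sup>2 + 2 * (t\<^sup>2 * (A * sg))) + (2 * sg\<^sup>2 + 2 * (t\<^sup>2 * (A * sg)))"
  by (intro add_mono sq n A)
 finally have 1: "\<bar>(sg * nj - t * sj) * (sg * nk - t * sk)\<bar> <= 2 * sg\<^sup>2 + 2 * (A * (t\<^sup>2 * sg))" by (simp add: mult_ac)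
 have "t\<^sup>2 * sg <= R\<^sup>2 * R"
 proof (rule mult_mono)
  show "t\<^sup>2 <= R\<^sup>2" using R(2) by (simp add: abs_le_square_iff[symmetric])
 qed (use R sg in auto)
 hence "A * (t\<^sup>2 * sg) <= A * (R\<^sup>2 * R)" using A(3) by (rule mult_left_mono)
 hence 2: "\<bar>(sg * nj - t * sj) * (sg * nk - t * sk)\<bar> <= 2 * sg\<^sup>2 + 2 * A * R ^ 3"
  using 1 by (simp add: power3_eq_cube power2_eq_square)
 have "\<bar>(sg * nj - t * sj) * (sg * nk - t * sk) / R ^ 3\<bar> <= (2 * sg\<^sup>2 + 2 * A * R ^ 3) / R ^ 3"
  using 2 R(1) by (simp add: abs_divide divide_right_mono)
 also have "\<dots> = 2 * (sg\<^sup>2 / R ^ 3) + 2 * A" using R(1) by (simp add: add_divide_distrib)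
 finally have 3: "\<bar>(sg * nj - t * sj) * (sg * nk - t * sk) / R ^ 3\<bar> <= 2 * (sg\<^sup>2 / R ^ 3) + 2 * A" .
 have "\<bar>sg * w / R\<bar> = (sg / R) * \<bar>w\<bar>" using sg R(1) by (simp add: abs_mult)
 also have "\<dots> <= 1 * w0" using sg R w by (intro mult_mono) auto
 finally have "\<bar>sg * w / R\<bar> <= w0" by simp
 with 3 show ?thesis by (intro order_trans[OF abs_triangle_ineq add_mono])
qed

context frame begin

lemma abs_frame_nth: "\<bar>e i $ j\<bar> <= 1"
 using component_le_norm_cart[of "e i" j] by simp

text \<open>Since \<sigma> is \<open>mu\<close> times the square of \<open>bd_poly\<close>, its
  partial derivatives are \<open>2 * mu * bd_poly\<close> times a bounded factor, and their squares
  are at most \<open>4 * b^2 * mu\<close> times \<sigma>. The regular part of the Hessian is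
  therefore O(mu), and the singular part is the single quotient in the bound.\<close>

lemma cor_hess_bound:
 shows "\<exists>B\<ge>0. \<forall>mu y j k. 0 < mu --> mu <= 1 --> y : cube s -->
  \<bar>cor_hess mu i s y $ j $ k\<bar> <= (mu * bd_wt s y)\<^sup>2 / cor_rad 0 mu i s y ^ 3 + B * mu"
proof -
 obtain b where b: "b >= 0" "!!j y. y : ccube s ==> \<bar>pdv j (bd_poly s) y\<bar> <= b"
  using pderiv_bdd_on_cube[OF C_k_bd_poly] by metis
 have "\<exists>B\<ge>0. ALL j. \<forall>y\<in>ccube s. \<bar>pdv j (pdv k (bd_wt s)) y\<bar> <= B" for k
  by (rule pderiv_bdd_on_cube[OF C_k_pderiv[OF C_k_bd_wt]])
 then obtain b2 where b2: "!!k. b2 k >= 0" "!!j k y. y : ccube s ==> \<bar>pdv j (pdv k (bd_wt s)) y\<bar> <= b2 k" by metis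
 define w0 where "w0 = (\<Sum>k\<in>UNIV. b2 k)"
 have w0: "w0 >= 0" unfolding w0_def by (rule sum_nonneg) (rule b2(1))
 have w0': "b2 k <= w0" for k unfolding w0_def by (rule member_le_sum) (use b2(1) in auto)
 define B where "B = 4 * b\<^sup>2 + w0"
 have "\<bar>cor_hess mu i s y $ j $ k\<bar> <= (mu * bd_wt s y)\<^sup>2 / cor_rad 0 mu i s y ^ 3 + B * mu"
  if mu: "0 < mu" "mu <= 1" and y: "y : cube s" for mu y j k
 proof -
  have yc: "y : ccube s" using y cube_ccube(1) by auto
  define R where "R = cor_rad 0 mu i s y"
  define t where "t = y \<bullet> e i"
  define sg where "sg = mu * bd_wt s y"
  define sd where "sd = (%j. mu * pdv j (bd_wt s) y)"
  define w where "w = mu * pdv k (pdv j (bd_wt s)) y"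
  have R: "R > 0" unfolding R_def by (rule cor_rad_gt_0[OF mu(1) y]) simp
  have R2: "\<bar>t\<bar> <= R" "sg <= R" "R\<^sup>2 = t\<^sup>2 + sg\<^sup>2"
  unfolding R_def t_def sg_def using cor_rad_bounds[of mu] mu(1) by auto
  have sg: "sg >= 0" using mu(1) bd_wt_nonneg by (simp add: sg_def)
  have sd2: "(sd j)\<^sup>2 <= (4 * b\<^sup>2 * mu) * sg" for j
  proof -
  have "sd j = 2 * mu * bd_poly s y * pdv j (bd_poly s) y"
  by (simp add: sd_def pderiv_at_def pderiv_bd_wt)
  hence "(sd j)\<^sup>2 = (4 * mu * sg) * (pdv j (bd_poly s) y)\<^sup>2"
  by (simp add: sg_def bd_wt_def power2_eq_square)
  also have "\<dots> <= (4 * mu * sg) * b\<^sup>2"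
  using b(2)[OF yc, of j] b(1) mu(1) sg by (intro mult_left_mono) (auto simp: abs_le_square_iff[symmetric])
  finally show ?thesis by (simp add: mult_ac)
  qed
  have w: "\<bar>w\<bar> <= w0 * mu"
  proof -
  have "\<bar>pdv k (pdv j (bd_wt s)) y\<bar> <= w0" by (rule order_trans[OF b2(2)[OF yc] w0'])
  hence "mu * \<bar>pdv k (pdv j (bd_wt s)) y\<bar> <= mu * w0" using mu(1) by (intro mult_left_mono) auto
  thus ?thesis using mu(1) by (simp add: w_def abs_mult mult.commute)
  qed
  have "cor_hess mu i s y $ j $ k = ((e i $ k * e i $ j + (sg * w + sd k * sd j)) / R
  - (t * e i $ j + sg * sd j) * (t * e i $ k + sg * sd k) / R ^ 3) / 2"
  unfolding cor_hess_def cor_num_axis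
  by (simp add: R_def t_def sg_def sd_def w_def power2_eq_square algebra_simps)
  also have "\<dots> = ((sg * e i $ j - t * sd j) * (sg * e i $ k - t * sd k) / R ^ 3 + sg * w / R) / 2"
  unfolding hess_rad_eq[OF R R2(3)] ..
  finally have eq: "cor_hess mu i s y $ j $ k = ((sg * e i $ j - t * sd j) * (sg * e i $ k - t * sd k) / R ^ 3 + sg * w / R) / 2" .
  have "\<bar>(sg * e i $ j - t * sd j) * (sg * e i $ k - t * sd k) / R ^ 3 + sg * w / R\<bar> <= 2 * (sg\<^sup>2 / R ^ 3) + 2 * (4 * b\<^sup>2 * mu) + w0 * mu"
  by (rule hess_rad_bound[OF R R2(1,2) sg abs_frame_nth abs_frame_nth sd2 sd2 _ w]) (use mu in simp)
  hence "\<bar>cor_hess mu i s y $ j $ k\<bar> <= (2 * (sg\<^sup>2 / R ^ 3) + 2 * (4 * b\<^sup>2 * mu) + w0 * mu) / 2"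
  unfolding eq by (simp only: abs_divide abs_numeral divide_right_mono zero_le_numeral)
  also have "\<dots> <= sg\<^sup>2 / R ^ 3 + B * mu"
  proof -
  have "0 <= w0 * mu" using w0 mu by simp
  thus ?thesis by (simp add: B_def algebra_simps)
  qed
  finally show ?thesis by (simp only: sg_def R_def)
 qed
 moreover have "B >= 0" using w0 by (simp add: B_def)
 ultimately show ?thesis by blast
qed

lemma cor_grad_bdd:
 "\<exists>B\<ge>0. \<forall>mu y. 0 < mu --> mu <= 1 --> y : cube s --> norm (cor_grad mu i s y) <= B"
proof -
 obtain b where b: "b >= 0" "!!j y. y : ccube s ==> \<bar>pdv j (bd_wt s) y\<bar> <= b"
  using pderiv_bdd_on_cube[OF C_k_bd_wt] by metis
 have "norm (cor_grad mu i s y) <= real CARD('n) * (2 + b)" if mu: "0 < mu" "mu <= 1" and y: "y : cube s" for mu y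
 proof -
  have yc: "y : ccube s" using y cube_ccube(1) by auto
  define R where "R = cor_rad 0 mu i s y"
  have R: "R > 0" unfolding R_def by (rule cor_rad_gt_0[OF mu(1) y]) simp
  have R2: "\<bar>y \<bullet> e i\<bar> <= R" "mu * bd_wt s y <= R"
  unfolding R_def using cor_rad_bounds[of mu] mu(1) by auto
  have "\<bar>cor_grad mu i s y $ j\<bar> <= 2 + b" for j
  proof -
  have "\<bar>cor_num mu i s (axis j 1) y\<bar> <= \<bar>y \<bullet> e i\<bar> * \<bar>e i $ j\<bar> + (mu * bd_wt s y) * (mu * \<bar>pdv j (bd_wt s) y\<bar>)"
  unfolding cor_num_axis using mu(1) bd_wt_nonneg[of s y]
  by (intro order_trans[OF abs_triangle_ineq]) (simp add: abs_mult)
  also have "\<dots> <= R * 1 + R * (1 * b)"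
  using R2 R mu b(1) b(2)[OF yc] bd_wt_nonneg[of s y] by (intro add_mono mult_mono abs_frame_nth) auto
  finally have "\<bar>cor_num mu i s (axis j 1) y\<bar> <= (1 + b) * R" by (simp add: algebra_simps)
  hence "\<bar>cor_num mu i s (axis j 1) y / R\<bar> <= 1 + b" using R by (simp add: abs_divide divide_le_eq)
  hence "\<bar>e i $ j + cor_num mu i s (axis j 1) y / R\<bar> <= 2 + b"
  using abs_frame_nth[of i j] abs_triangle_ineq[of "e i $ j" "cor_num mu i s (axis j 1) y / R"] by linarith
  hence "\<bar>e i $ j + cor_num mu i s (axis j 1) y / R\<bar> / 2 <= 2 + b"
  using abs_ge_zero[of "e i $ j + cor_num mu i s (axis j 1) y / R"] by (simp add: field_simps del: abs_ge_zero)
  thus ?thesis by (simp add: cor_grad_def R_def abs_divide)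
  qed
  hence "norm (cor_grad mu i s y) <= (\<Sum>j\<in>(UNIV::'n set). 2 + b)"
  by (intro order_trans[OF norm_le_l1_cart] sum_mono)
  thus ?thesis by simp
 qed
 thus ?thesis using b(1) by (intro exI[of _ "real CARD('n) * (2 + b)"]) auto
qed

lemma cor_grad_lim:
 assumes "y \<bullet> e i ~= 0" "mu \<longlonglongrightarrow> 0"
 shows "(%n. cor_grad (mu n) i s y) \<longlonglongrightarrow> (if y \<bullet> e i > 0 then e i else 0)"
proof (rule vec_tendstoI)
 fix j
 have r: "(%n. cor_rad 0 (mu n) i s y) \<longlonglongrightarrow> sqrt ((y \<bullet> e i)\<^sup>2 + (0 * bd_wt s y)\<^sup>2 + 0)"
  unfolding cor_rad_def by (intro tendsto_intros assms)
 have n: "(%n. cor_num (mu n) i s (axis j 1) y) \<longlonglongrightarrow> (y \<bullet> e i) * e i $ j + (0 * bd_wt s y) * (0 * pdv j (bd_wt s) y)"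
  unfolding cor_num_axis by (intro tendsto_intros assms)
 have "(%n. (e i $ j + cor_num (mu n) i s (axis j 1) y / cor_rad 0 (mu n) i s y) / 2) \<longlonglongrightarrow>
  (e i $ j + ((y \<bullet> e i) * e i $ j + (0 * bd_wt s y) * (0 * pdv j (bd_wt s) y)) / sqrt ((y \<bullet> e i)\<^sup>2 + (0 * bd_wt s y)\<^sup>2 + 0)) / 2"
  by (intro tendsto_divide tendsto_add tendsto_const n r) (use assms(1) in auto)
 moreover have "(e i $ j + ((y \<bullet> e i) * e i $ j + (0 * bd_wt s y) * (0 * pdv j (bd_wt s) y)) / sqrt ((y \<bullet> e i)\<^sup>2 + (0 * bd_wt s y)\<^sup>2 + 0)) / 2
  = (if y \<bullet> e i > 0 then e i else 0) $ j"
  using assms(1) by (auto simp: abs_if)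
 ultimately show "(%n. cor_grad (mu n) i s y $ j) \<longlonglongrightarrow> (if y \<bullet> e i > 0 then e i else 0) $ j"
  by (simp add: cor_grad_def)
qed

end

section \<open>Mass of the corner Hessian in a boundary layer\<close>

context frame begin

text \<open>It varies only in directions orthogonal to \<open>e i\<close>. Its steep gradient, of
  order \<open>m\<close>, is therefore invisible to the normal derivative used in the integration by
  parts.\<close>

definition lat_cutoff :: "'n => real => real => real^'n => real" where
 "lat_cutoff i m q y = (\<Prod>j\<in>UNIV - {i}. sst (m * (q - y \<bullet> e j)) * sst (m * (q + y \<bullet> e j)))"

lemma C_k_lat_cutoff: "C_k k (lat_cutoff i m q)"
 unfolding lat_cutoff_def[abs_def]
 by (intro C_k_prod C_k_mult C_k_compose_real[OF C_k_sst]
  C_k_mult[OF C_k_const] C_k_add[OF C_k_const C_k_inner_left] C_k_diff[OF C_k_const C_k_inner_left])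

lemma lat_cutoff_bounds: "0 <= lat_cutoff i m q y" "lat_cutoff i m q y <= 1"
 unfolding lat_cutoff_def
 by (auto intro!: prod_nonneg prod_le_1 mult_nonneg_nonneg mult_le_one simp: sst_bounds)

lemma lat_cutoff_eq_0:
 assumes "m >= 0" "j ~= i" "\<bar>y \<bullet> e j\<bar> >= q"
 shows "lat_cutoff i m q y = 0"
proof -
 have "q - y \<bullet> e j <= 0 | q + y \<bullet> e j <= 0" using assms(3) by linarith
 hence "sst (m * (q - y \<bullet> e j)) = 0 | sst (m * (q + y \<bullet> e j)) = 0"
  using assms(1) by (auto intro!: sst_eq_0 mult_nonneg_nonpos)
 thus ?thesis unfolding lat_cutoff_def using assms(2) by (intro prod_zero) auto
qed

lemma lat_cutoff_eq_1:
 assumes "m >= 0" "!!j. j ~= i ==> m * (q - \<bar>y \<bullet> e j\<bar>) >= 1"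
 shows "lat_cutoff i m q y = 1"
 unfolding lat_cutoff_def
proof (rule prod.neutral, rule ballI)
 fix j assume "j : UNIV - {i}"
 hence 1: "m * (q - \<bar>y \<bullet> e j\<bar>) >= 1" using assms(2) by auto
 have "m * (q - \<bar>y \<bullet> e j\<bar>) <= m * (q - y \<bullet> e j)" "m * (q - \<bar>y \<bullet> e j\<bar>) <= m * (q + y \<bullet> e j)"
  using assms(1) by (intro mult_left_mono; linarith)+
 hence "m * (q - y \<bullet> e j) >= 1" "m * (q + y \<bullet> e j) >= 1" using 1 by linarith+
 thus "sst (m * (q - y \<bullet> e j)) * sst (m * (q + y \<bullet> e j)) = 1"
  by (simp add: sst_eq_1)
qed

lemma lat_cutoff_normal_der: "fdv (lat_cutoff i m q) (at y) (e i) = 0"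
 by (rule fdv_constant_direction[OF C_k_lat_cutoff])
  (auto simp: lat_cutoff_def inner_add_left orthonormal intro!: prod.cong)

text \<open>Its scale is \<open>s\<close> itself, so the bound on its normal derivative does not
  depend on the thickness of the boundary layer.\<close>

definition nrm_cutoff :: "'n => real => real^'n => real" where
 "nrm_cutoff i s y = sst (2 / s * (s - y \<bullet> e i)) * sst (2 / s * (s + y \<bullet> e i))"

lemma C_k_nrm_cutoff: "C_k k (nrm_cutoff i s)"
 unfolding nrm_cutoff_def[abs_def]
 by (intro C_k_mult C_k_compose_real[OF C_k_sst]
  C_k_mult[OF C_k_const] C_k_add[OF C_k_const C_k_inner_left] C_k_diff[OF C_k_const C_k_inner_left])

lemma nrm_cutoff_bounds: "0 <= nrm_cutoff i s y" "nrm_cutoff i s y <= 1"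
 unfolding nrm_cutoff_def by (auto intro!: mult_nonneg_nonneg mult_le_one simp: sst_bounds)

lemma nrm_cutoff_eq_0: "s > 0 ==> \<bar>y \<bullet> e i\<bar> >= s ==> nrm_cutoff i s y = 0"
proof -
 assume s: "s > 0" and a: "\<bar>y \<bullet> e i\<bar> >= s"
 have "s - y \<bullet> e i <= 0 | s + y \<bullet> e i <= 0" using a by linarith
 hence "sst (2 / s * (s - y \<bullet> e i)) = 0 | sst (2 / s * (s + y \<bullet> e i)) = 0"
  using s by (auto intro!: sst_eq_0 mult_nonneg_nonpos simp del: times_divide_eq_left)
 thus ?thesis unfolding nrm_cutoff_def by auto
qed

lemma nrm_cutoff_eq_1: "s > 0 ==> \<bar>y \<bullet> e i\<bar> <= s / 2 ==> nrm_cutoff i s y = 1"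
proof -
 assume s: "s > 0" and a: "\<bar>y \<bullet> e i\<bar> <= s / 2"
 have "2 / s * (s / 2) <= 2 / s * (s - y \<bullet> e i)" "2 / s * (s / 2) <= 2 / s * (s + y \<bullet> e i)"
  using s a by (intro mult_left_mono; auto simp: abs_le_iff)+
 thus ?thesis unfolding nrm_cutoff_def using s by (simp add: sst_eq_1)
qed

text \<open>Integrating by parts in the normal direction turns the singular part of the Hessian of the corner
 function into the normal derivative of a cut-off function.\<close>

lemma cor_layer_regularized:
 assumes s: "s > 0" and r: "s / 2 < r" "r < s" and mu: "mu > 0" and \<eta>: "\<eta> > 0"
  and K: "!!y. y : ccube (2 * s) ==> \<bar>fdv (nrm_cutoff i s) (at y) (e i)\<bar> <= K" "K >= 0"
  and z_def: "\<zeta> = (%y. nrm_cutoff i s y * (lat_cutoff i (1 / (s - r)) (2 * s - r) y - lat_cutoff i (1 / (s - r)) r y))"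
 shows "(\<integral>\<^sup>+y. ennreal (\<zeta> y * ((mu * bd_wt s y)\<^sup>2 / cor_rad \<eta> mu i s y ^ 3)) \<partial>leb) \<le>
  ennreal (K * (2 * s * ((2 * (2 * s - r)) ^ (CARD('n) - 1) - (2 * (2 * r - s)) ^ (CARD('n) - 1))))"
proof -
 define m where "m = 1 / (s - r)"
 have m: "m > 0" "m * (s - r) = 1" using r by (auto simp: m_def)
 \<comment> \<open>The transition width \<open>1 / m\<close> is \<open>s - r\<close>:
   \<open>a\<close> equals 1 up to the lateral faces of the cube and \<open>b\<close> vanishes
   beyond \<open>r\<close>. Their difference is 1 on the lateral boundary layer and is supported in
   a slightly larger shell.\<close>
 define a where "a = lat_cutoff i m (2 * s - r)"
 define b where "b = lat_cutoff i m r"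
 have \<zeta>: "\<zeta> y = nrm_cutoff i s y * (a y - b y)" for y by (simp add: z_def a_def b_def m_def)
 have ba: "b y <= a y" for y
 proof (cases "ALL j. j ~= i --> \<bar>y \<bullet> e j\<bar> < r")
  case True
  have "a y = 1" unfolding a_def
  proof (rule lat_cutoff_eq_1)
  fix j assume "j ~= i"
  hence "s - r <= 2 * s - r - \<bar>y \<bullet> e j\<bar>" using True r by force
  hence "m * (s - r) <= m * (2 * s - r - \<bar>y \<bullet> e j\<bar>)" using m(1) by (intro mult_left_mono) auto
  thus "1 <= m * (2 * s - r - \<bar>y \<bullet> e j\<bar>)" using m(2) by simp
  qed (use m in simp)
  thus ?thesis using lat_cutoff_bounds(2) by (simp add: b_def)
 next
  case False
  then obtain j where "j ~= i" "\<bar>y \<bullet> e j\<bar> >= r" by force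
  hence "b y = 0" unfolding b_def using m by (intro lat_cutoff_eq_0) auto
  thus ?thesis using lat_cutoff_bounds(1) by (simp add: a_def)
 qed
 have \<zeta>0: "\<zeta> y >= 0" for y unfolding \<zeta> using ba[of y] nrm_cutoff_bounds(1) by simp
 have a01: "0 <= a y - b y" "a y - b y <= 1" for y
  using ba[of y] lat_cutoff_bounds(2)[of i m "2 * s - r" y] lat_cutoff_bounds(1)[of i m r y]
  by (simp_all add: a_def b_def)
 have supp: "\<zeta> y = 0" if y: "y ~: ccube (2 * s)" for y
 proof -
  obtain j where j: "\<bar>y \<bullet> e j\<bar> > 2 * s" using y by (auto simp: ccube_def not_le)
  show ?thesis
  proof (cases "j = i")
  case True
  hence "nrm_cutoff i s y = 0" using j s by (intro nrm_cutoff_eq_0) auto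
  thus ?thesis by (simp add: \<zeta>)
  next
  case False
  have "a y = 0" unfolding a_def using j m r s by (intro lat_cutoff_eq_0[OF _ False]) auto
  moreover have "b y = 0" unfolding b_def using j m r s by (intro lat_cutoff_eq_0[OF _ False]) auto
  ultimately show ?thesis by (simp add: \<zeta>)
  qed
 qed
 define R where "R = cor_rad \<eta> mu i s"
 have Rpos': "(y \<bullet> e i)\<^sup>2 + (mu * bd_wt s y)\<^sup>2 + \<eta> > 0" for y using \<eta> by (simp add: add_nonneg_pos)
 have Rpos: "R y > 0" for y unfolding R_def cor_rad_def using Rpos' by simp
 have R2: "(R y)\<^sup>2 = (y \<bullet> e i)\<^sup>2 + (mu * bd_wt s y)\<^sup>2 + \<eta>" for y
  unfolding R_def cor_rad_def using Rpos'[of y] by simp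
 have tR: "\<bar>y \<bullet> e i\<bar> <= R y" for y
  unfolding R_def cor_rad_def using \<eta> by (intro real_le_rsqrt) simp
 define N where "N = cor_num mu i s (e i)"
 \<comment> \<open>\<open>Q\<close> is bounded by 1 in absolute value, while its normal derivative
   dominates \<open>\<sigma>^2 / R^3\<close> where \<open>\<zeta>\<close> does not vanish;
   integration by parts moves that derivative to the cut-off.\<close>
 define Q where "Q = (%y. (y \<bullet> e i) / R y)"
 define Q' where "Q' = (%y v. ((v \<bullet> e i) * R y - (y \<bullet> e i) * (cor_num mu i s v y / R y)) / (R y * R y))"
 have dQ: "(Q has_derivative Q' y) (at y)" for y
 proof -
  have l: "((%y. y \<bullet> e i) has_derivative (%v. v \<bullet> e i)) (at y)" by (auto intro!: derivative_eq_intros)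
  have d: "(R has_derivative (%v. cor_num mu i s v y / R y)) (at y)"
  unfolding R_def by (rule cor_rad_hasd[OF Rpos'])
  show ?thesis unfolding Q_def Q'_def
  by (rule has_derivative_divide'[OF l d]) (use Rpos[of y] in simp)
 qed
 define F where "F = (%y. \<zeta> y * Q y)"
 have C\<zeta>: "C_k k \<zeta>" for k
  unfolding z_def by (intro C_k_mult C_k_nrm_cutoff C_k_diff C_k_lat_cutoff)
 define F' where "F' = (%y v. \<zeta> y * Q' y v + fdv \<zeta> (at y) v * Q y)"
 have dF: "(F has_derivative F' y) (at y)" for y
  unfolding F_def F'_def by (rule has_derivative_mult[OF C_k_Suc_hasd[OF C\<zeta>] dQ])
 have cR: "continuous_on UNIV R" unfolding R_def by (rule cont_cor_rad)
 have cQ': "continuous_on UNIV (%y. Q' y (e i))"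
  unfolding Q'_def using Rpos by (intro continuous_intros cR cont_cor_num) (auto simp: less_imp_neq[THEN not_sym])
 have cQ: "continuous_on UNIV Q"
  unfolding Q_def using Rpos by (intro continuous_intros cR) (auto simp: less_imp_neq[THEN not_sym])
 have c1: "continuous_on UNIV (%y. \<zeta> y * Q' y (e i))"
  by (intro continuous_on_mult cont_on_C_k[OF C\<zeta>[of 0]] cQ')
 have c2: "continuous_on UNIV (%y. fdv \<zeta> (at y) (e i) * Q y)"
  by (intro continuous_on_mult cont_on_C_k[OF C_k_deriv[OF C\<zeta>[of "Suc 0"]]] cQ)
 have cptc: "compact (ccube (2 * s))" unfolding ccube_eq_cslab by (rule compact_cslab)
 have supp': "fdv \<zeta> (at y) (e i) = 0" if "y ~: ccube (2 * s)" for y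
  by (rule fdv_0_if_locally_0[OF closed_ccube supp that])
 have i1: "integrable leb (%y. \<zeta> y * Q' y (e i))"
  by (rule leb_intg_cont_csupp[OF c1 cptc]) (simp add: supp)
 have i2: "integrable leb (%y. fdv \<zeta> (at y) (e i) * Q y)"
  by (rule leb_intg_cont_csupp[OF c2 cptc]) (simp add: supp')
 have "(\<integral>y. F' y (e i) \<partial>lborel) = 0"
  by (rule int_dirder_eq_0[OF dF _ cptc])
  (use c1 c2 in "auto simp: F'_def F_def supp intro!: continuous_on_add")
 moreover have "(\<integral>y. F' y (e i) \<partial>leb) = (\<integral>y. F' y (e i) \<partial>lborel)"
  by (rule integral_completion)
  (use borel_measurable_continuous_onI[OF continuous_on_add[OF c1 c2]] in "simp add: F'_def")
 ultimately have ibp: "(\<integral>y. \<zeta> y * Q' y (e i) \<partial>leb) = (\<integral>y. - (fdv \<zeta> (at y) (e i) * Q y) \<partial>leb)"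
  using Bochner_Integration.integral_add[OF i1 i2] by (simp add: F'_def add_eq_0_iff)
 have d\<zeta>: "fdv \<zeta> (at y) (e i) = fdv (nrm_cutoff i s) (at y) (e i) * (a y - b y)" for y
 proof -
  have dn: "(nrm_cutoff i s has_derivative fdv (nrm_cutoff i s) (at y)) (at y)"
  by (rule C_k_Suc_hasd[OF C_k_nrm_cutoff])
  have da: "(a has_derivative fdv a (at y)) (at y)" "(b has_derivative fdv b (at y)) (at y)"
  unfolding a_def b_def by (rule C_k_Suc_hasd[OF C_k_lat_cutoff])+
  have "((%y. nrm_cutoff i s y * (a y - b y)) has_derivative
  (%v. nrm_cutoff i s y * (fdv a (at y) v - fdv b (at y) v) +
  fdv (nrm_cutoff i s) (at y) v * (a y - b y))) (at y)"
  by (rule has_derivative_mult[OF dn has_derivative_diff[OF da]])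
  moreover have "(%y. nrm_cutoff i s y * (a y - b y)) = \<zeta>" by (rule ext) (simp add: \<zeta>)
  ultimately have "(\<zeta> has_derivative (%v. nrm_cutoff i s y * (fdv a (at y) v - fdv b (at y) v) +
  fdv (nrm_cutoff i s) (at y) v * (a y - b y))) (at y)" by simp
  from fun_cong[where x="e i", OF frechet_derivative_at[OF this]]
  show ?thesis by (simp add: a_def b_def lat_cutoff_normal_der)
 qed
 let ?C = "%q. {y. ALL j. (if j = i then - s else - q) <= y \<bullet> e j & y \<bullet> e j <= (if j = i then s else q)}"
 \<comment> \<open>The normal derivative of \<open>\<zeta>\<close> vanishes outside this shell,
   whose volume tends to 0 as \<open>r\<close> tends to \<open>s\<close>.\<close>
 let ?L = "?C (2 * s - r) - ?C (2 * r - s)"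
 let ?m = "CARD('n) - 1"
 have em: "emeasure leb (?C q) = ennreal (2 * s * (2 * q) ^ ?m)" if "q > 0" for q
 proof -
  have "emeasure leb (?C q) = ennreal (\<Prod>j\<in>UNIV. (if j = i then s else q) - (if j = i then - s else - q))"
  by (rule em_cslab) (use that s in auto)
  also have "(\<Prod>j\<in>UNIV. (if j = i then s else q) - (if j = i then - s else - q)) = (\<Prod>j\<in>UNIV. if j = i then 2 * s else 2 * q)"
  by (intro prod.cong) auto
  also have "\<dots> = 2 * s * (2 * q) ^ ?m" unfolding prod_frame_remove by (simp add: card_Diff_singleton)
  finally show ?thesis .
 qed
 have Cs: "?C q : sets leb" for q
  by (intro sets_completionI_sets) (simp add: borel_closed closed_cslab)
 define D where "D = 2 * s * ((2 * (2 * s - r)) ^ ?m - (2 * (2 * r - s)) ^ ?m)"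
 have qq: "0 < 2 * r - s" "2 * r - s <= 2 * s - r" using r s by auto
 have Csub: "?C (2 * r - s) <= ?C (2 * s - r)"
  using qq by (auto intro: order_trans[where y="- (2 * r - s)"] order_trans[where y="2 * r - s"])
 have D0: "D >= 0" unfolding D_def using qq s by (simp add: power_mono)
 have Lm: "emeasure leb ?L = ennreal D"
  using em[of "2 * s - r"] em[of "2 * r - s"] Cs qq s Csub
  by (subst emeasure_Diff) (auto simp: ennreal_minus D_def right_diff_distrib)
 have Lf: "?L : lmeasurable" using Lm Cs by (intro fmeasurableI) auto
 have Lmeas: "measure leb ?L = D" unfolding measure_def Lm using D0 by simp
 have bd: "\<bar>fdv \<zeta> (at y) (e i)\<bar> <= K * idc ?L y" for y
 proof (cases "y : ?L")
  case True
  have "y : ccube (2 * s)"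
  proof -
  have "\<bar>y \<bullet> e j\<bar> <= 2 * s" for j
  proof -
  have "(if j = i then - s else - (2 * s - r)) <= y \<bullet> e j & y \<bullet> e j <= (if j = i then s else 2 * s - r)" using True by auto
  thus ?thesis using r s by (auto simp: abs_le_iff split: if_splits)
  qed
  thus ?thesis by (simp add: ccube_def)
  qed
  hence "\<bar>fdv (nrm_cutoff i s) (at y) (e i)\<bar> * \<bar>a y - b y\<bar> <= K * 1"
  using K a01[of y] by (intro mult_mono) auto
  thus ?thesis unfolding d\<zeta> abs_mult using True by simp
 next
  case False
  have "fdv \<zeta> (at y) (e i) = 0"
  proof (cases "y : ?C (2 * r - s)")
  case True
  have yj: "\<bar>y \<bullet> e j\<bar> <= 2 * r - s" if "j ~= i" for j
  proof -
  have "(if j = i then - s else - (2 * r - s)) <= y \<bullet> e j & y \<bullet> e j <= (if j = i then s else 2 * r - s)" using True by blast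
  thus ?thesis using that by (auto simp: abs_le_iff)
  qed
  have "b y = 1" unfolding b_def
  proof (rule lat_cutoff_eq_1)
  fix j assume "j ~= i"
  hence "m * (s - r) <= m * (r - \<bar>y \<bullet> e j\<bar>)" using yj[of j] m(1) by (intro mult_left_mono) auto
  thus "1 <= m * (r - \<bar>y \<bullet> e j\<bar>)" using m(2) by simp
  qed (use m in simp)
  hence "a y - b y = 0" using a01(1)[of y] lat_cutoff_bounds(2)[of i m "2 * s - r" y] by (simp add: a_def)
  thus ?thesis by (simp add: d\<zeta>)
  next
  case nC: False
  hence "y ~: ?C (2 * s - r)" using False by blast
  then obtain j where j: "~ ((if j = i then - s else - (2 * s - r)) <= y \<bullet> e j & y \<bullet> e j <= (if j = i then s else 2 * s - r))" by blast
  show ?thesis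
  proof (cases "j = i")
  case True
  have "\<bar>y \<bullet> e i\<bar> > s" using j True by (auto simp: abs_if)
  hence "y ~: {y. \<bar>y \<bullet> e i\<bar> <= s}" by simp
  moreover have "closed {y. \<bar>y \<bullet> e i\<bar> <= s}" by (intro closed_Collect_le continuous_intros)
  ultimately show ?thesis
  by (intro fdv_0_if_locally_0[of "{y. \<bar>y \<bullet> e i\<bar> <= s}"])
  (auto simp: \<zeta> nrm_cutoff_eq_0[OF s])
  next
  case False
  have yj: "\<bar>y \<bullet> e j\<bar> > 2 * s - r" using j False by (auto simp: abs_if)
  have "a y = 0" unfolding a_def using yj m by (intro lat_cutoff_eq_0[OF _ False]) auto
  moreover have "b y = 0" unfolding b_def using yj m r by (intro lat_cutoff_eq_0[OF _ False]) auto
  ultimately show ?thesis by (simp add: d\<zeta>)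
  qed
  qed
  thus ?thesis using K(2) by simp
 qed
 have "(\<integral>y. - (fdv \<zeta> (at y) (e i) * Q y) \<partial>leb) <= (\<integral>y. K * idc ?L y \<partial>leb)"
 proof (rule integral_mono')
  show "integrable leb (%y. K * idc ?L y)"
  using Lf by (intro integrable_mult_right integrable_real_indicator) (auto simp: fmeasurable_def)
  show "0 <= K * idc ?L y" for y using K(2) by simp
  fix y
  have "\<bar>Q y\<bar> <= 1" unfolding Q_def using tR[of y] Rpos[of y] by (simp add: abs_divide)
  have "- (fdv \<zeta> (at y) (e i) * Q y) <= \<bar>fdv \<zeta> (at y) (e i)\<bar> * \<bar>Q y\<bar>"
  unfolding abs_mult[symmetric] by (rule abs_ge_minus_self)
  also have "\<dots> <= \<bar>fdv \<zeta> (at y) (e i)\<bar> * 1" using \<open>\<bar>Q y\<bar> <= 1\<close> by (intro mult_left_mono) auto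
  finally show "- (fdv \<zeta> (at y) (e i) * Q y) <= K * idc ?L y" using bd[of y] by linarith
 qed
 also have "\<dots> = K * D" using Lf Lmeas by simp
 finally have le: "(\<integral>y. \<zeta> y * Q' y (e i) \<partial>leb) <= K * D" unfolding ibp .
 \<comment> \<open>The normal derivative of \<open>Q\<close> is
   \<open>(R^2 - t * cor_num) / R^3\<close>. Since the weight decreases away from the midplane,
   \<open>t * cor_num\<close> is at most \<open>t^2\<close>, which leaves at least
   \<open>\<sigma>^2\<close> in the numerator.\<close>
 have key: "\<zeta> y * ((mu * bd_wt s y)\<^sup>2 / R y ^ 3) <= \<zeta> y * Q' y (e i)" for y
 proof (cases "\<bar>y \<bullet> e i\<bar> < s")
  case True
  define t where "t = y \<bullet> e i"
  define sg where "sg = mu * bd_wt s y"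
  have ts: "t\<^sup>2 <= s\<^sup>2" using True s by (simp add: abs_le_square_iff[symmetric] t_def)
  have "t * cor_num mu i s (e i) y = t\<^sup>2 + mu\<^sup>2 * (bd_wt s y * (t * fdv (bd_wt s) (at y) (e i)))"
  by (simp add: cor_num_def orthonormal t_def[symmetric] power2_eq_square algebra_simps)
  also have "\<dots> <= t\<^sup>2"
  proof -
  have "t * fdv (bd_wt s) (at y) (e i) = - (4 * t\<^sup>2 * ((s\<^sup>2 - t\<^sup>2) * (lat_poly i s y)\<^sup>2))"
  unfolding bd_wt_normal_der bd_poly_split[of s y i] t_def by (simp add: power2_eq_square)
  also have "\<dots> <= 0" using ts by simp
  finally have "t * fdv (bd_wt s) (at y) (e i) <= 0" .
  hence "bd_wt s y * (t * fdv (bd_wt s) (at y) (e i)) <= 0"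
  by (rule mult_nonneg_nonpos[OF bd_wt_nonneg])
  hence "mu\<^sup>2 * (bd_wt s y * (t * fdv (bd_wt s) (at y) (e i))) <= 0"
  by (rule mult_nonneg_nonpos[OF zero_le_power2])
  thus ?thesis by simp
  qed
  finally have "sg\<^sup>2 <= (R y)\<^sup>2 - t * cor_num mu i s (e i) y"
  unfolding R2 using \<eta> by (simp add: sg_def t_def)
  hence "sg\<^sup>2 / R y ^ 3 <= ((R y)\<^sup>2 - t * cor_num mu i s (e i) y) / R y ^ 3"
  using Rpos[of y] by (intro divide_right_mono) auto
  also have "\<dots> = Q' y (e i)"
  unfolding Q'_def t_def using Rpos[of y]
  by (simp add: orthonormal diff_divide_distrib power2_eq_square power3_eq_cube)
  finally show ?thesis unfolding sg_def by (intro mult_left_mono \<zeta>0)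
 next
  case False
  hence "\<zeta> y = 0" using nrm_cutoff_eq_0[OF s, of y i] by (simp add: \<zeta>)
  thus ?thesis by simp
 qed
 have pos: "0 <= \<zeta> y * ((mu * bd_wt s y)\<^sup>2 / R y ^ 3)" for y
  using \<zeta>0[of y] Rpos[of y] by simp
 have "(\<integral>\<^sup>+y. ennreal (\<zeta> y * ((mu * bd_wt s y)\<^sup>2 / R y ^ 3)) \<partial>leb) <= (\<integral>\<^sup>+y. ennreal (\<zeta> y * Q' y (e i)) \<partial>leb)"
  by (intro nn_integral_mono ennreal_leI key)
 also have "\<dots> = ennreal (\<integral>y. \<zeta> y * Q' y (e i) \<partial>leb)"
  by (rule nn_integral_eq_integral[OF i1]) (use order_trans[OF pos key] in auto)
 also have "\<dots> <= ennreal (K * D)" by (rule ennreal_leI[OF le])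
 finally show ?thesis by (simp only: R_def D_def)
qed


text \<open>Near the midplane the regularised estimate passes to \<eta> = 0 by Fatou's lemma. Where
  the normal coordinate exceeds \<open>s / 2\<close> in absolute value, the root is at least
  \<open>s / 2\<close> and the integrand is O(mu), which accounts for the term
  \<open>B * mu\<close>.\<close>

lemma cor_layer:
 assumes s: "s > 0"
 shows "\<exists>B\<ge>0. \<forall>kp>0. EX r0. s / 2 < r0 & r0 < s & (\<forall>mu. 0 < mu --> mu <= 1 -->
  (\<integral>\<^sup>+y\<in>cube s - cube r0. ennreal ((mu * bd_wt s y)\<^sup>2 / cor_rad 0 mu i s y ^ 3) \<partial>leb) <= ennreal (kp + B * mu))"
proof -
 obtain K where K: "K >= 0" "!!y. y : ccube (2 * s) ==> \<bar>fdv (nrm_cutoff i s) (at y) (e i)\<bar> <= K"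
  using C_k_bdd_on_cube[OF C_k_deriv[OF C_k_nrm_cutoff[of "Suc 0"]], of "2 * s"] by metis
 obtain b where b: "b >= 0" "!!y. y : ccube s ==> \<bar>bd_wt s y\<bar> <= b"
  using C_k_bdd_on_cube[OF C_k_bd_wt[of 0]] by metis
 define V where "V = measure leb (cube s)"
 have Vm: "cube s : lmeasurable" by (rule bounded_set_imp_lmeasurable[OF bdd_cube]) simp
 have eV: "emeasure leb (cube s) = ennreal V" unfolding V_def by (rule emeasure_eq_measure2[OF Vm])
 have V0: "V >= 0" by (simp add: V_def)
 define B0 where "B0 = b\<^sup>2 * 8 / s ^ 3"
 have B0: "B0 >= 0" using s by (simp add: B0_def)
 let ?m = "CARD('n) - 1"
 have "EX r0. s / 2 < r0 & r0 < s & (\<forall>mu. 0 < mu --> mu <= 1 -->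
  (\<integral>\<^sup>+y\<in>cube s - cube r0. ennreal ((mu * bd_wt s y)\<^sup>2 / cor_rad 0 mu i s y ^ 3) \<partial>leb) <= ennreal (kp + (B0 * V) * mu))"
  if kp: "kp > 0" for kp
 proof -
  have "((%r. K * (2 * s * ((2 * (2 * s - r)) ^ ?m - (2 * (2 * r - s)) ^ ?m))) \<longlongrightarrow>
  K * (2 * s * ((2 * (2 * s - s)) ^ ?m - (2 * (2 * s - s)) ^ ?m))) (at_left s)"
  by (intro tendsto_intros)
  hence "\<forall>\<^sub>F r in at_left s. K * (2 * s * ((2 * (2 * s - r)) ^ ?m - (2 * (2 * r - s)) ^ ?m)) < kp"
  using kp by (intro order_tendstoD(2)) auto
  then obtain r1 where r1: "r1 < s" "!!r. r1 < r ==> r < s ==> K * (2 * s * ((2 * (2 * s - r)) ^ ?m - (2 * (2 * r - s)) ^ ?m)) < kp"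
  unfolding eventually_at_left_field by blast
  define r where "r = (max r1 (s / 2) + s) / 2"
  have r: "s / 2 < r" "r1 < r" "r < s" using r1(1) s by (auto simp: r_def max_def)
  define m where "m = 1 / (s - r)"
  have m: "m > 0" "m * (s - r) = 1" using r by (auto simp: m_def)
  define \<zeta> where "\<zeta> = (%y. nrm_cutoff i s y * (lat_cutoff i m (2 * s - r) y - lat_cutoff i m r y))"
  have "(\<integral>\<^sup>+y\<in>cube s - cube r. ennreal ((mu * bd_wt s y)\<^sup>2 / cor_rad 0 mu i s y ^ 3) \<partial>leb) <= ennreal (kp + (B0 * V) * mu)"
  if mu: "0 < mu" "mu <= 1" for mu
  proof -
  define g where "g = (%\<eta> y. ennreal (\<zeta> y * ((mu * bd_wt s y)\<^sup>2 / cor_rad \<eta> mu i s y ^ 3)))"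
  define \<eta> where "\<eta> = (%n. inverse (real (Suc n)))"
  have \<eta>: "\<eta> n > 0" for n by (simp add: \<eta>_def)
  have reg: "(\<integral>\<^sup>+y. g (\<eta> n) y \<partial>leb) <= ennreal kp" for n
  unfolding g_def
  by (rule order_trans[OF cor_layer_regularized[OF s r(1,3) mu(1) \<eta> K(2,1) \<zeta>_def[unfolded m_def]] ennreal_leI])
  (use r1(2)[OF r(2,3)] in auto)
  have gm: "g (\<eta> n) : lbm" for n
  proof -
  have pos: "cor_rad (\<eta> n) mu i s y ~= 0" for y
  using \<eta>[of n] unfolding cor_rad_def by (simp add: add_nonneg_pos add_nonneg_eq_0_iff less_imp_neq[THEN not_sym])
  have C\<zeta>: "C_k 0 \<zeta>"
  unfolding \<zeta>_def by (intro C_k_mult C_k_nrm_cutoff C_k_diff C_k_lat_cutoff)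
  have "continuous_on UNIV (%y. \<zeta> y * ((mu * bd_wt s y)\<^sup>2 / cor_rad (\<eta> n) mu i s y ^ 3))"
  by (intro continuous_intros cont_on_C_k[OF C\<zeta>] cont_on_C_k[OF C_k_bd_wt[of 0]] cont_cor_rad) (simp add: pos)
  hence "(%y. \<zeta> y * ((mu * bd_wt s y)\<^sup>2 / cor_rad (\<eta> n) mu i s y ^ 3)) : lbm"
  by (intro measurable_completion) (simp add: borel_measurable_continuous_onI)
  thus ?thesis unfolding g_def by measurable
  qed
  have lim: "(%n. g (\<eta> n) y * idc (cube s) y) \<longlonglongrightarrow> g 0 y * idc (cube s) y" for y
  proof (cases "y : cube s")
  case True
  have nz: "cor_rad 0 mu i s y ~= 0" using cor_rad_gt_0[OF mu(1) True, of 0 i] by simp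
  have "(%n. cor_rad (\<eta> n) mu i s y) \<longlonglongrightarrow> cor_rad 0 mu i s y"
  unfolding cor_rad_def \<eta>_def by (intro tendsto_intros LIMSEQ_inverse_real_of_nat)
  hence "(%n. g (\<eta> n) y) \<longlonglongrightarrow> g 0 y"
  unfolding g_def using nz by (intro tendsto_ennrealI tendsto_intros) auto
  thus ?thesis using True by simp
  qed simp
  have "(\<integral>\<^sup>+y. g 0 y * idc (cube s) y \<partial>leb) = (\<integral>\<^sup>+y. liminf (%n. g (\<eta> n) y * idc (cube s) y) \<partial>leb)"
  using lim by (intro nn_integral_cong) (metis lim_imp_Liminf sequentially_bot)
  also have "\<dots> <= liminf (%n. \<integral>\<^sup>+y. g (\<eta> n) y * idc (cube s) y \<partial>leb)"
  by (rule nn_integral_liminf) (use gm in measurable)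
  also have "\<dots> <= ennreal kp"
  proof -
  have "(\<integral>\<^sup>+y. g (\<eta> n) y * idc (cube s) y \<partial>leb) <= ennreal kp" for n
  by (rule order_trans[OF nn_integral_mono reg[of n]]) (auto simp: indicator_def)
  hence "liminf (%n. \<integral>\<^sup>+y. g (\<eta> n) y * idc (cube s) y \<partial>leb) <= liminf (%n. ennreal kp)"
  by (intro Liminf_mono always_eventually allI)
  thus ?thesis by (simp add: Liminf_const)
  qed
  finally have g0: "(\<integral>\<^sup>+y. g 0 y * idc (cube s) y \<partial>leb) <= ennreal kp" .
  have g0m: "(%y. g 0 y * idc (cube s) y) : lbm"
  by (rule borel_measurable_LIMSEQ_order[OF lim]) (use gm in measurable)
  \<comment> \<open>A point of the layer with normal coordinate at most \<open>s / 2\<close> in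
    absolute value lies beyond \<open>r\<close> in a lateral direction, because
    \<open>s / 2 < r\<close>; there \<open>\<zeta>\<close> is 1.\<close>
  have ptw: "ennreal ((mu * bd_wt s y)\<^sup>2 / cor_rad 0 mu i s y ^ 3) * idc (cube s - cube r) y \<le>
  g 0 y * idc (cube s) y + ennreal (B0 * mu) * idc (cube s) y" for y
  proof (cases "y : cube s - cube r")
  case True
  hence y: "y : cube s" "y : ccube s" using cube_ccube(1) by auto
  define R where "R = cor_rad 0 mu i s y"
  have R: "R > 0" unfolding R_def by (rule cor_rad_gt_0[OF mu(1) y(1)]) simp
  show ?thesis
  proof (cases "\<bar>y \<bullet> e i\<bar> <= s / 2")
  case small: True
  obtain j where j: "\<bar>y \<bullet> e j\<bar> >= r" using True by (auto simp: cube_def not_less)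
  have ji: "j ~= i" using j small r by auto
  have "nrm_cutoff i s y = 1" by (rule nrm_cutoff_eq_1[OF s small])
  moreover have "lat_cutoff i m r y = 0" using m j by (intro lat_cutoff_eq_0[OF _ ji]) auto
  moreover have "lat_cutoff i m (2 * s - r) y = 1"
  proof (rule lat_cutoff_eq_1)
  fix k assume "k ~= i"
  have "\<bar>y \<bullet> e k\<bar> < s" using y(1) by (simp add: cube_def)
  hence "m * (s - r) <= m * (2 * s - r - \<bar>y \<bullet> e k\<bar>)" using m(1) by (intro mult_left_mono) auto
  thus "1 <= m * (2 * s - r - \<bar>y \<bullet> e k\<bar>)" using m(2) by simp
  qed (use m in simp)
  ultimately have "\<zeta> y = 1" by (simp add: \<zeta>_def)
  thus ?thesis using True y(1) by (simp add: g_def)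
  next
  case False
  have "s / 2 <= R" using False cor_rad_bounds(1)[of mu y i s] mu(1) by (simp add: R_def)
  hence "(s / 2) ^ 3 <= R ^ 3" using s by (intro power_mono) auto
  moreover have "(mu * bd_wt s y)\<^sup>2 <= mu * b\<^sup>2"
  proof -
  have "mu\<^sup>2 <= mu" using mu by (simp add: power2_eq_square mult_left_le)
  moreover have "(bd_wt s y)\<^sup>2 <= b\<^sup>2" using b(2)[OF y(2)] b(1) by (simp add: abs_le_square_iff[symmetric])
  ultimately show ?thesis unfolding power_mult_distrib using mu by (intro mult_mono) auto
  qed
  ultimately have "(mu * bd_wt s y)\<^sup>2 / R ^ 3 <= (mu * b\<^sup>2) / (s / 2) ^ 3"
  using s mu by (intro frac_le) auto
  also have "\<dots> = B0 * mu" by (simp add: B0_def power_divide)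
  finally have "ennreal ((mu * bd_wt s y)\<^sup>2 / R ^ 3) <= ennreal (B0 * mu)" by (rule ennreal_leI)
  also have "\<dots> <= g 0 y + ennreal (B0 * mu)" by simp
  finally show ?thesis using True y(1) by (simp add: R_def)
  qed
  qed simp
  have "(\<integral>\<^sup>+y\<in>cube s - cube r. ennreal ((mu * bd_wt s y)\<^sup>2 / cor_rad 0 mu i s y ^ 3) \<partial>leb) \<le>
  (\<integral>\<^sup>+y. g 0 y * idc (cube s) y + ennreal (B0 * mu) * idc (cube s) y \<partial>leb)"
  by (intro nn_integral_mono ptw)
  also have "\<dots> = (\<integral>\<^sup>+y. g 0 y * idc (cube s) y \<partial>leb) + (\<integral>\<^sup>+y. ennreal (B0 * mu) * idc (cube s) y \<partial>leb)"
  by (rule nn_integral_add[OF g0m]) simp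
  also have "(\<integral>\<^sup>+y. ennreal (B0 * mu) * idc (cube s) y \<partial>leb) = ennreal (B0 * mu) * ennreal V"
  unfolding eV[symmetric] by (rule nn_integral_cmult_indicator) simp
  also have "\<dots> = ennreal ((B0 * V) * mu)" using B0 mu V0 by (simp add: ennreal_mult'[symmetric] mult_ac)
  finally have "(\<integral>\<^sup>+y\<in>cube s - cube r. ennreal ((mu * bd_wt s y)\<^sup>2 / cor_rad 0 mu i s y ^ 3) \<partial>leb) \<le>
  (\<integral>\<^sup>+y. g 0 y * idc (cube s) y \<partial>leb) + ennreal ((B0 * V) * mu)" .
  also have "\<dots> <= ennreal kp + ennreal ((B0 * V) * mu)" by (intro add_mono g0 order_refl)
  also have "\<dots> = ennreal (kp + (B0 * V) * mu)" using kp B0 V0 mu by (simp add: ennreal_plus)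
  finally show ?thesis .
  qed
  thus ?thesis using r by blast
 qed
 moreover have "B0 * V >= 0" using B0 V0 by simp
 ultimately show ?thesis by blast
qed

end

section \<open>Integrability of the corner function, its gradient and its Hessian\<close>

lemma norm_vec_le_sum: "norm (x::'a::real_normed_vector^'n) <= (\<Sum>i\<in>UNIV. norm (x $ i))"
 unfolding norm_vec_def by (rule L2_set_le_sum) simp

lemma bm_indicator_cont:
 fixes f :: "'a::euclidean_space => 'b::euclidean_space"
 assumes "open A" "continuous_on A f"
 shows "(%x. idc A x *\<^sub>R f x) : lbm"
 using borel_measurable_continuous_on_indicator[OF borel_open[OF assms(1)] assms(2)]
 by (intro measurable_completion) simp

lemma sint_cont_bdd:
 fixes f :: "'a::euclidean_space => 'b::euclidean_space"
 assumes "open A" "bounded A" "continuous_on A f" "!!x. x : A ==> norm (f x) <= B"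
 shows "sint A f"
proof -
 have A: "A : sets leb" using assms(1) by (intro sets_completionI_sets) simp
 have "sint A (%x. idc A x *\<^sub>R f x)"
  by (rule sint_bdd_meas[OF A assms(2) bm_indicator_cont[OF assms(1,3)]])
  (use assms(4) in simp)
 moreover have "idc A x *\<^sub>R (idc A x *\<^sub>R f x) = idc A x *\<^sub>R f x" for x
  by (simp add: indicator_def)
 ultimately show ?thesis unfolding set_integrable_def by (simp only:)
qed

context frame begin

lemma cor_intg:
 assumes "mu > 0" "mu <= 1"
 shows "sint (cube s) (corner mu i s)"
  "sint (cube s) (cor_grad mu i s)"
proof -
 obtain b where b: "!!y. y : ccube s ==> \<bar>bd_wt s y\<bar> <= b"
  using C_k_bdd_on_cube[OF C_k_bd_wt[of 0]] by metis
 show "sint (cube s) (corner mu i s)"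
 proof (rule sint_cont_bdd[OF open_cube bdd_cube cont_corner])
  fix y assume y: "y : cube s"
  have yc: "y : ccube s" using y cube_ccube(1) by auto
  have "\<bar>y \<bullet> e i\<bar> < s" using y by (simp add: cube_def)
  moreover have "\<bar>corner mu i s y - max 0 (y \<bullet> e i)\<bar> <= mu * bd_wt s y / 2" using assms by (intro cor_diff) simp
  moreover have "mu * bd_wt s y <= 1 * b" using assms b[OF yc] bd_wt_nonneg[of s y] by (intro mult_mono) auto
  moreover have "0 <= mu * bd_wt s y" using bd_wt_nonneg[of s y] assms by simp
  ultimately have "\<bar>corner mu i s y - max 0 (y \<bullet> e i)\<bar> <= b" "\<bar>max 0 (y \<bullet> e i)\<bar> <= s"
  by (simp_all add: max_def abs_less_iff)
  moreover have "\<bar>corner mu i s y\<bar> <= \<bar>corner mu i s y - max 0 (y \<bullet> e i)\<bar> + \<bar>max 0 (y \<bullet> e i)\<bar>"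
  using abs_triangle_ineq[of "corner mu i s y - max 0 (y \<bullet> e i)" "max 0 (y \<bullet> e i)"] by simp
  ultimately show "norm (corner mu i s y) <= s + b" unfolding real_norm_def by linarith
 qed
 obtain B where B: "!!y. y : cube s ==> norm (cor_grad mu i s y) <= B"
  using cor_grad_bdd[of s i] assms by blast
 show "sint (cube s) (cor_grad mu i s)"
 proof (rule sint_vec)
  fix j show "sint (cube s) (%x. cor_grad mu i s x $ j)"
  by (rule sint_cont_bdd[OF open_cube bdd_cube cont_cor_grad[OF assms(1)]])
  (use B order_trans[OF component_le_norm_cart] in auto)
 qed
qed

lemma meas_cor_hess:
 assumes "mu > 0"
 shows "(%y. idc (cube s) y *\<^sub>R cor_hess mu i s y) : lbm"
proof -
 have "continuous_on (cube s) (%y. (\<chi> j. \<chi> k. cor_hess mu i s y $ j $ k))"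
  by (rule continuous_on_vec_lambda)+ (rule cont_cor_hess[OF assms])
 hence "continuous_on (cube s) (cor_hess mu i s)" by (simp add: vec_lambda_eta)
 thus ?thesis by (rule bm_indicator_cont[OF open_cube])
qed

text \<open>The layer is chosen before \<open>mu\<close>, so that one layer serves all small
  \<open>mu\<close>. The second claim combines continuity on a compact inner cube with the finite
  mass in the layer outside it.\<close>

lemma cor_hess_layer:
 assumes s: "s > 0" and kp: "kp > 0"
 shows "\<exists>r0 mu0. s / 2 < r0 & r0 < s & 0 < mu0 & mu0 <= 1 & (\<forall>mu. 0 < mu --> mu <= mu0 -->
  (\<integral>\<^sup>+y\<in>cube s - cube r0. ennreal (norm (cor_hess mu i s y)) \<partial>leb) <= ennreal kp)"
  "[|0 < mu; mu <= 1|] ==> sint (cube s) (cor_hess mu i s)"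
proof -
 obtain B where B: "B >= 0" "!!mu y j k. 0 < mu ==> mu <= 1 ==> y : cube s ==>
  \<bar>cor_hess mu i s y $ j $ k\<bar> <= (mu * bd_wt s y)\<^sup>2 / cor_rad 0 mu i s y ^ 3 + B * mu"
  using cor_hess_bound[of s i] by blast
 obtain B1 where B1: "B1 >= 0" "!!kp. kp > 0 ==> EX r0. s / 2 < r0 & r0 < s & (\<forall>mu. 0 < mu --> mu <= 1 -->
  (\<integral>\<^sup>+y\<in>cube s - cube r0. ennreal ((mu * bd_wt s y)\<^sup>2 / cor_rad 0 mu i s y ^ 3) \<partial>leb) <= ennreal (kp + B1 * mu))"
  using cor_layer[OF s, of i] by blast
 define V where "V = measure leb (cube s)"
 have Vm: "cube s : lmeasurable" by (rule bounded_set_imp_lmeasurable[OF bdd_cube]) simp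
 have eV: "emeasure leb (cube s) = ennreal V" unfolding V_def by (rule emeasure_eq_measure2[OF Vm])
 have V0: "V >= 0" by (simp add: V_def)
 define N where "N = (real CARD('n))\<^sup>2"
 have N: "N > 0" by (simp add: N_def)
 have nb: "norm (cor_hess mu i s y) <= N * ((mu * bd_wt s y)\<^sup>2 / cor_rad 0 mu i s y ^ 3 + B * mu)"
  if "0 < mu" "mu <= 1" "y : cube s" for mu y
 proof -
  have "norm (cor_hess mu i s y) <= (\<Sum>j\<in>UNIV. norm (cor_hess mu i s y $ j))" by (rule norm_vec_le_sum)
  also have "\<dots> <= (\<Sum>j\<in>UNIV. \<Sum>k\<in>UNIV. norm (cor_hess mu i s y $ j $ k))" by (intro sum_mono norm_vec_le_sum)
  also have "\<dots> <= (\<Sum>j\<in>(UNIV::'n set). \<Sum>k\<in>(UNIV::'n set). (mu * bd_wt s y)\<^sup>2 / cor_rad 0 mu i s y ^ 3 + B * mu)"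
  unfolding real_norm_def by (intro sum_mono B(2) that)
  also have "\<dots> = N * ((mu * bd_wt s y)\<^sup>2 / cor_rad 0 mu i s y ^ 3 + B * mu)" by (simp add: N_def power2_eq_square)
  finally show ?thesis .
 qed
 have rm: "(%y. ennreal ((mu * bd_wt s y)\<^sup>2 / cor_rad 0 mu i s y ^ 3) * idc (cube s - cube r0) y) : lbm" for mu r0
 proof -
  have c: "bd_wt s : borel_measurable borel" "cor_rad 0 mu i s : borel_measurable borel"
  by (intro borel_measurable_continuous_onI cont_on_C_k[OF C_k_bd_wt[of 0]] cont_cor_rad)+
  have "cube s - cube r0 : sets borel" using open_cube by (intro sets.Diff borel_open)
  hence "(%y. ennreal ((mu * bd_wt s y)\<^sup>2 / cor_rad 0 mu i s y ^ 3) * idc (cube s - cube r0) y) : borel_measurable borel"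
  using c by measurable
  thus ?thesis by (intro measurable_completion) simp
 qed
 have layer: "(\<integral>\<^sup>+y\<in>cube s - cube r0. ennreal (norm (cor_hess mu i s y)) \<partial>leb) <= ennreal (N * (kp' + B1 * mu) + N * B * mu * V)"
  if mu: "0 < mu" "mu <= 1" and kp': "kp' > 0" and le: "(\<integral>\<^sup>+y\<in>cube s - cube r0. ennreal ((mu * bd_wt s y)\<^sup>2 / cor_rad 0 mu i s y ^ 3) \<partial>leb) <= ennreal (kp' + B1 * mu)"
  for mu r0 kp'
 proof -
  have "(\<integral>\<^sup>+y\<in>cube s - cube r0. ennreal (norm (cor_hess mu i s y)) \<partial>leb) \<le>
  (\<integral>\<^sup>+y. ennreal N * (ennreal ((mu * bd_wt s y)\<^sup>2 / cor_rad 0 mu i s y ^ 3) * idc (cube s - cube r0) y) + ennreal (N * B * mu) * idc (cube s) y \<partial>leb)"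
  proof (rule nn_integral_mono)
  fix y
  show "ennreal (norm (cor_hess mu i s y)) * idc (cube s - cube r0) y \<le>
  ennreal N * (ennreal ((mu * bd_wt s y)\<^sup>2 / cor_rad 0 mu i s y ^ 3) * idc (cube s - cube r0) y) + ennreal (N * B * mu) * idc (cube s) y"
  proof (cases "y : cube s - cube r0")
  case True
  hence y: "y : cube s" by simp
  have R: "cor_rad 0 mu i s y > 0" by (rule cor_rad_gt_0[OF mu(1) y]) simp
  have p: "0 <= (mu * bd_wt s y)\<^sup>2 / cor_rad 0 mu i s y ^ 3" using R by simp
  have "ennreal (norm (cor_hess mu i s y)) <= ennreal (N * ((mu * bd_wt s y)\<^sup>2 / cor_rad 0 mu i s y ^ 3 + B * mu))"
  by (rule ennreal_leI[OF nb[OF mu y]])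
  also have "N * ((mu * bd_wt s y)\<^sup>2 / cor_rad 0 mu i s y ^ 3 + B * mu) = N * ((mu * bd_wt s y)\<^sup>2 / cor_rad 0 mu i s y ^ 3) + N * B * mu"
  by (simp add: distrib_left)
  also have "ennreal \<dots> = ennreal (N * ((mu * bd_wt s y)\<^sup>2 / cor_rad 0 mu i s y ^ 3)) + ennreal (N * B * mu)"
  by (rule ennreal_plus[OF mult_nonneg_nonneg[OF _ p]]) (use N B(1) mu in auto)
  also have "ennreal (N * ((mu * bd_wt s y)\<^sup>2 / cor_rad 0 mu i s y ^ 3)) = ennreal N * ennreal ((mu * bd_wt s y)\<^sup>2 / cor_rad 0 mu i s y ^ 3)"
  by (rule ennreal_mult') (use N in simp)
  finally show ?thesis using True by simp
  qed simp
  qed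
  also have "\<dots> = ennreal N * (\<integral>\<^sup>+y\<in>cube s - cube r0. ennreal ((mu * bd_wt s y)\<^sup>2 / cor_rad 0 mu i s y ^ 3) \<partial>leb) + ennreal (N * B * mu) * ennreal V"
  unfolding eV[symmetric]
  by (subst nn_integral_add) (auto intro!: borel_measurable_times_ennreal rm simp: nn_integral_cmult[OF rm] nn_integral_cmult_indicator)
  also have "\<dots> <= ennreal N * ennreal (kp' + B1 * mu) + ennreal (N * B * mu) * ennreal V"
  by (intro add_mono mult_left_mono le order_refl) simp
  also have "\<dots> = ennreal (N * (kp' + B1 * mu) + N * B * mu * V)"
  using N kp' B1(1) B(1) mu V0 by (simp add: ennreal_mult'[symmetric] ennreal_plus[symmetric] del: ennreal_plus)
  finally show ?thesis .
 qed
 show "\<exists>r0 mu0. s / 2 < r0 & r0 < s & 0 < mu0 & mu0 <= 1 & (\<forall>mu. 0 < mu --> mu <= mu0 -->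
  (\<integral>\<^sup>+y\<in>cube s - cube r0. ennreal (norm (cor_hess mu i s y)) \<partial>leb) <= ennreal kp)"
 proof -
  define kp' where "kp' = kp / (2 * N)"
  have kp': "kp' > 0" using kp N by (simp add: kp'_def)
  obtain r0 where r0: "s / 2 < r0" "r0 < s" "!!mu. 0 < mu ==> mu <= 1 ==>
  (\<integral>\<^sup>+y\<in>cube s - cube r0. ennreal ((mu * bd_wt s y)\<^sup>2 / cor_rad 0 mu i s y ^ 3) \<partial>leb) <= ennreal (kp' + B1 * mu)"
  using B1(2)[OF kp'] by blast
  define H where "H = N * B1 + N * B * V + 1"
  have H: "H > 0" using N B1(1) B(1) V0 by (simp add: H_def add_nonneg_pos)
  define mu0 where "mu0 = min 1 (kp / (2 * H))"
  have mu0: "0 < mu0" "mu0 <= 1" using H kp by (auto simp: mu0_def)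
  have "(\<integral>\<^sup>+y\<in>cube s - cube r0. ennreal (norm (cor_hess mu i s y)) \<partial>leb) <= ennreal kp" if mu: "0 < mu" "mu <= mu0" for mu
  proof -
  have mu1: "mu <= 1" using mu mu0 by simp
  have "N * (kp' + B1 * mu) + N * B * mu * V = kp / 2 + (N * B1 + N * B * V) * mu"
  using N by (simp add: kp'_def algebra_simps)
  also have "\<dots> <= kp / 2 + H * mu" using mu by (intro add_left_mono mult_right_mono) (auto simp: H_def)
  also have "\<dots> <= kp / 2 + H * (kp / (2 * H))"
  using H mu by (intro add_left_mono mult_left_mono) (auto simp: mu0_def)
  also have "\<dots> = kp" using H by simp
  finally show ?thesis using layer[OF mu(1) mu1 kp' r0(3)[OF mu(1) mu1]] by (meson ennreal_leI order_trans)
  qed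
  thus ?thesis using r0 mu0 by blast
 qed
 show "sint (cube s) (cor_hess mu i s)" if mu: "0 < mu" "mu <= 1"
 proof -
  obtain r0 where r0: "s / 2 < r0" "r0 < s" "(\<integral>\<^sup>+y\<in>cube s - cube r0. ennreal ((mu * bd_wt s y)\<^sup>2 / cor_rad 0 mu i s y ^ 3) \<partial>leb) <= ennreal (1 + B1 * mu)"
  using B1(2)[of 1] mu by auto
  have cc: "compact (ccube r0)" unfolding ccube_eq_cslab by (rule compact_cslab)
  have "continuous_on (ccube r0) (%y. cor_hess mu i s y $ j $ k)" for j k
  using cont_cor_hess[OF mu(1), of s i j k] cube_ccube(2)[OF r0(2)] continuous_on_subset by blast
  hence "bounded ((%y. cor_hess mu i s y $ j $ k) ` ccube r0)" for j k
  using cc by (intro compact_imp_bounded compact_continuous_image)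
  hence "EX b. \<forall>y\<in>ccube r0. \<bar>cor_hess mu i s y $ j $ k\<bar> <= b" for j k
  unfolding bounded_iff by (metis imageI real_norm_def)
  then obtain b where b: "!!j k y. y : ccube r0 ==> \<bar>cor_hess mu i s y $ j $ k\<bar> <= b j k" by metis
  define b' where "b' = (\<Sum>j\<in>UNIV. \<Sum>k\<in>UNIV. b j k)"
  have nb': "norm (cor_hess mu i s y) <= b'" if "y : ccube r0" for y
  proof -
  have "norm (cor_hess mu i s y) <= (\<Sum>j\<in>UNIV. norm (cor_hess mu i s y $ j))" by (rule norm_vec_le_sum)
  also have "\<dots> <= (\<Sum>j\<in>UNIV. \<Sum>k\<in>UNIV. norm (cor_hess mu i s y $ j $ k))" by (intro sum_mono norm_vec_le_sum)
  also have "\<dots> <= b'" unfolding b'_def real_norm_def by (intro sum_mono b that)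
  finally show ?thesis .
  qed
  have m: "(%y. idc (cube s) y *\<^sub>R cor_hess mu i s y) : lbm"
  by (rule meas_cor_hess[OF mu(1)])
  have eqi: "ennreal (norm (cor_hess mu i s y)) * idc (cube s - cube r0) y =
  ennreal (norm (idc (cube s) y *\<^sub>R cor_hess mu i s y)) * idc (- cube r0) y" for y
  by (simp add: indicator_def)
  have "(\<integral>\<^sup>+y. ennreal (norm (idc (cube s) y *\<^sub>R cor_hess mu i s y)) \<partial>leb) \<le>
  (\<integral>\<^sup>+y. ennreal b' * idc (cube s) y + ennreal (norm (cor_hess mu i s y)) * idc (cube s - cube r0) y \<partial>leb)"
  proof (rule nn_integral_mono)
  fix y
  show "ennreal (norm (idc (cube s) y *\<^sub>R cor_hess mu i s y)) \<le>
  ennreal b' * idc (cube s) y + ennreal (norm (cor_hess mu i s y)) * idc (cube s - cube r0) y"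
  proof (cases "y : cube r0")
  case True
  thus ?thesis using nb'[of y] cube_ccube(1)[of r0] by (auto simp: indicator_def intro!: ennreal_leI)
  qed (auto simp: indicator_def)
  qed
  also have "\<dots> = ennreal b' * emeasure leb (cube s) + (\<integral>\<^sup>+y\<in>cube s - cube r0. ennreal (norm (cor_hess mu i s y)) \<partial>leb)"
  proof (subst nn_integral_add)
  have "- cube r0 : sets leb" using sets.compl_sets[OF cube_leb[of r0]] by (simp add: Compl_eq_Diff_UNIV)
  thus "(%y. ennreal (norm (cor_hess mu i s y)) * idc (cube s - cube r0) y) : lbm"
  unfolding eqi using m by measurable
  qed (simp_all add: nn_integral_cmult_indicator)
  also have "\<dots> < \<infinity>"
  proof -
  have "(\<integral>\<^sup>+y\<in>cube s - cube r0. ennreal (norm (cor_hess mu i s y)) \<partial>leb) < \<infinity>"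
  by (rule le_less_trans[OF layer[OF mu zero_less_one r0(3)]]) simp
  thus ?thesis unfolding eV by (simp add: ennreal_mult_less_top)
  qed
  finally show ?thesis unfolding set_integrable_def using m by (intro integrableI_bounded)
 qed
qed

end

subsection \<open>Second order Sobolev functions\<close>

text \<open>Membership in \<open>W21\<close> fixes gradient and Hessian only through choice
  operators. With explicit representatives, sums, cut-offs and rescalings can be computed
  componentwise, and the selected Hessian is compared with the result by uniqueness.\<close>

definition W21_data ::
 "(real^'n) set => (real^'n => real^'d) => (real^'n => real^'n^'d) => (real^'n => real^'n^'n^'d) => bool" where
 "W21_data A u G H \<longleftrightarrow> sint A u & is_weak_gradient A u G & sint A H \<and>
  (ALL k. weak_partial A k G (%x. \<chi> i j. H x $ i $ j $ k))"

lemma W21_data_W21: "u : W21 A ==> W21_data A u (weak_gradient A u) (weak_hessian A u)"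
 using W21D[of u A] by (simp add: W21_data_def)

lemma W21_dataD:
 assumes "W21_data A u G H"
 shows "sint A u" "sint A G" "sint A H"
  "is_weak_gradient A u G" "weak_partial A k G (%x. \<chi> i j. H x $ i $ j $ k)" "weak_partial A j u (%x. column j (G x))"
 using assms by (auto simp: W21_data_def is_weak_gradient_def)

lemma W21_data_imp_W21:
 assumes "open A" "W21_data A u G H"
 shows "u : W21 A" "AE x in leb. x : A --> weak_hessian A u x = H x" "AE x in leb. x : A --> H x : sym_tensors"
 using W21I[OF assms(1), of u G H] whs_symmetric[OF assms(1), of u G H] assms(2)
 by (auto simp: W21_data_def)

lemma wp_vec:
 assumes "!!i. weak_partial A k (%x. w x $ i) (%x. g x $ i)" "sint A w" "sint A g"
 shows "weak_partial A k w (g :: real^'n => 'b::euclidean_space^'m)"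
 unfolding weak_partial_def
proof
 fix ph :: "real^'n => real" assume ph: "ph : tfs A"
 show "(LINT x:A|leb. pdv k ph x *\<^sub>R w x) = - (LINT x:A|leb. ph x *\<^sub>R g x)"
 proof (rule vec_eq_iff[THEN iffD2], rule allI)
  fix i
  show "(LINT x:A|leb. pdv k ph x *\<^sub>R w x) $ i = (- (LINT x:A|leb. ph x *\<^sub>R g x)) $ i"
  using wpD[OF assms(1) ph, of i]
  sint_vec_nth(2)[OF sint_test_scaleR[OF assms(2) tf_pderiv[OF ph]], of k i]
  sint_vec_nth(2)[OF sint_test_scaleR[OF assms(3) ph], of i]
  by simp
 qed
qed

lemma W21_dataI:
 fixes u :: "real^'n => real^'d"
 assumes "sint A u" "!!a j. sint A (%x. G x $ a $ j)" "!!a j k. sint A (%x. H x $ a $ j $ k)"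
  "!!a j. weak_partial A j (%x. u x $ a) (%x. G x $ a $ j)"
  "!!a j k. weak_partial A k (%x. G x $ a $ j) (%x. H x $ a $ j $ k)"
 shows "W21_data A u G H"
proof -
 have G: "sint A G" by (intro sint_vec) (rule assms(2))
 have H: "sint A H" by (intro sint_vec) (rule assms(3))
 have "weak_partial A j u (%x. column j (G x))" for j
  by (rule wp_vec[OF _ assms(1) sint_blin(1)[OF blin_column G]])
  (simp add: column_def assms(4))
 moreover have "weak_partial A k G (%x. \<chi> i j. H x $ i $ j $ k)" for k
 proof (rule wp_vec[OF _ G sint_blin(1)[OF blin_slice H]])
  fix a
  show "weak_partial A k (%x. G x $ a) (%x. (\<chi> i j. H x $ i $ j $ k) $ a)"
  by (rule wp_vec[OF _ sint_vec_nth(1)[OF G]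
  sint_vec_nth(1)[OF sint_blin(1)[OF blin_slice H]]])
  (simp add: assms(5))
 qed
 ultimately show ?thesis using assms(1) G H by (auto simp: W21_data_def is_weak_gradient_def)
qed

lemma W21_data_components:
 fixes u :: "real^'n => real^'d"
 assumes "W21_data A u G H"
 shows "sint A (%x. u x $ a)" "sint A (%x. G x $ a $ j)" "sint A (%x. H x $ a $ j $ k)"
  "weak_partial A j (%x. u x $ a) (%x. G x $ a $ j)"
  "weak_partial A k (%x. G x $ a $ j) (%x. H x $ a $ j $ k)"
proof -
 note d = W21_dataD[OF assms]
 show "sint A (%x. u x $ a)" by (rule sint_vec_nth(1)[OF d(1)])
 show "sint A (%x. G x $ a $ j)" by (rule sint_vec_nth(1)[OF sint_vec_nth(1)[OF d(2)]])
 show "sint A (%x. H x $ a $ j $ k)"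
  by (rule sint_vec_nth(1)[OF sint_vec_nth(1)[OF sint_vec_nth(1)[OF d(3)]]])
 have "weak_partial A j (%x. u x $ a) (%x. column j (G x) $ a)"
  by (rule wp_blin[OF d(6) d(1) sint_blin(1)[OF blin_column d(2)] bounded_linear_vec_nth])
 thus "weak_partial A j (%x. u x $ a) (%x. G x $ a $ j)" by (simp add: column_def)
 have "weak_partial A k (%x. G x $ a $ j) (%x. (\<chi> i j. H x $ i $ j $ k) $ a $ j)"
  by (rule wp_blin[OF d(5) d(2) sint_blin(1)[OF blin_slice d(3)]
  bounded_linear_compose[OF bounded_linear_vec_nth bounded_linear_vec_nth]])
 thus "weak_partial A k (%x. G x $ a $ j) (%x. H x $ a $ j $ k)" by simp
qed

lemma W21_data_add:
 assumes "W21_data A u G H" "W21_data A u' G' H'"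
 shows "W21_data A (%x. u x + u' x) (%x. G x + G' x) (%x. H x + H' x)"
proof -
 note d = W21_data_components[OF assms(1)] and d' = W21_data_components[OF assms(2)]
 show ?thesis
 proof (rule W21_dataI)
  show "sint A (%x. u x + u' x)"
  by (rule set_integral_add(1)[OF W21_dataD(1)[OF assms(1)] W21_dataD(1)[OF assms(2)]])
  fix a j k
  show "sint A (%x. (G x + G' x) $ a $ j)"
  using set_integral_add(1)[OF d(2) d'(2), of a j a j] by simp
  show "sint A (%x. (H x + H' x) $ a $ j $ k)"
  using set_integral_add(1)[OF d(3) d'(3), of a j k a j k] by simp
  show "weak_partial A j (%x. (u x + u' x) $ a) (%x. (G x + G' x) $ a $ j)"
  using wp_add[OF d(4) d'(4) d(1) d(2) d'(1) d'(2), of j a a] by simp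
  show "weak_partial A k (%x. (G x + G' x) $ a $ j) (%x. (H x + H' x) $ a $ j $ k)"
  using wp_add[OF d(5) d'(5) d(2) d(3) d'(2) d'(3), of k a j a j] by simp
 qed
qed

lemma W21_data_minus:
 assumes "W21_data A u G H"
 shows "W21_data A (%x. - u x) (%x. - G x) (%x. - H x)"
proof -
 note d = W21_data_components[OF assms]
 have bl: "bounded_linear (%x::real. - x)" by (rule bounded_linear_minus[OF bounded_linear_ident])
 have bl': "bounded_linear (%x::real^'b. - x)" by (rule bounded_linear_minus[OF bounded_linear_ident])
 show ?thesis
 proof (rule W21_dataI)
  show "sint A (%x. - u x)"
  by (rule sint_blin(1)[OF bl' W21_dataD(1)[OF assms]])
  fix a j k
  show "sint A (%x. (- G x) $ a $ j)"
  using sint_blin(1)[OF bl d(2)[of a j]] by simp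
  show "sint A (%x. (- H x) $ a $ j $ k)"
  using sint_blin(1)[OF bl d(3)[of a j k]] by simp
  show "weak_partial A j (%x. (- u x) $ a) (%x. (- G x) $ a $ j)"
  using wp_blin[OF d(4) d(1) d(2) bl, of j a] by simp
  show "weak_partial A k (%x. (- G x) $ a $ j) (%x. (- H x) $ a $ j $ k)"
  using wp_blin[OF d(5) d(2) d(3) bl, of k a j] by simp
 qed
qed

lemma W21_data_diff:
 assumes "W21_data A u G H" "W21_data A u' G' H'"
 shows "W21_data A (%x. u x - u' x) (%x. G x - G' x) (%x. H x - H' x)"
 using W21_data_add[OF assms(1) W21_data_minus[OF assms(2)]] by simp

text \<open>The terms of the second-order product rule in which at least one derivative falls on
  \<open>psi\<close>. They involve only \<open>u\<close> and its gradient, and in the gluing these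
  are small differences, whereas the Hessians are not close to each other.\<close>

definition cutoff_tensor :: "(real^'n => real) => (real^'n => real^'d) => (real^'n => real^'n^'d) => real^'n => real^'n^'n^'d" where
 "cutoff_tensor psi u G x = (\<chi> a j k. pdv k psi x * G x $ a $ j + (pdv j psi x * G x $ a $ k + pdv k (pdv j psi) x * u x $ a))"

lemma W21_data_cutoff:
 fixes u :: "real^'n => real^'d"
 assumes u: "W21_data A u G H" and psi: "psi : tfs B"
 shows "W21_data A (%x. psi x *\<^sub>R u x) (%x. psi x *\<^sub>R G x + (\<chi> a j. pdv j psi x * u x $ a))
  (%x. psi x *\<^sub>R H x + cutoff_tensor psi u G x)"
proof -
 note d = W21_data_components[OF u]
 note C = tfD(1)[OF psi] and C1 = tfD(1)[OF tf_pderiv[OF psi]]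
 have i: "sint A (%x. ph x * w x)" if "ph : tfs B" "sint A w" for ph w :: "real^'n => real"
  using sint_test_scaleR[OF that(2,1)] by simp
 have p: "weak_partial A j (%x. ph x * w x) (%x. ph x * g x + pdv j ph x * w x)"
  if "ph : tfs B" "sint A w" "sint A g" "weak_partial A j w g" for ph w g :: "real^'n => real" and j
  using wp_scaleR[OF that(4,2,3) tfD(1)[OF that(1)]] by simp
 note psi1 = tf_pderiv[OF psi]
 note psi2 = tf_pderiv[OF psi1]
 show ?thesis
 proof (rule W21_dataI)
  show "sint A (%x. psi x *\<^sub>R u x)" by (rule sint_test_scaleR[OF W21_dataD(1)[OF u] psi])
  fix a j k
  show "sint A (%x. (psi x *\<^sub>R G x + (\<chi> a j. pdv j psi x * u x $ a)) $ a $ j)"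
  using set_integral_add(1)[OF i[OF psi d(2)] i[OF psi1 d(1)]] by simp
  show "sint A (%x. (psi x *\<^sub>R H x + cutoff_tensor psi u G x) $ a $ j $ k)"
  using set_integral_add(1)[OF i[OF psi d(3)] set_integral_add(1)[OF i[OF psi1 d(2)] set_integral_add(1)[OF i[OF psi1 d(2)] i[OF psi2 d(1)]]]]
  by (simp add: cutoff_tensor_def)
  show "weak_partial A j (%x. (psi x *\<^sub>R u x) $ a) (%x. (psi x *\<^sub>R G x + (\<chi> a j. pdv j psi x * u x $ a)) $ a $ j)"
  using p[OF psi d(1) d(2) d(4)] by simp
  have g1: "sint A (%x. psi x * H x $ a $ j $ k + pdv k psi x * G x $ a $ j)"
  by (rule set_integral_add(1)[OF i[OF psi d(3)] i[OF psi1 d(2)]])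
  have g2: "sint A (%x. pdv j psi x * G x $ a $ k + pdv k (pdv j psi) x * u x $ a)"
  by (rule set_integral_add(1)[OF i[OF psi1 d(2)] i[OF psi2 d(1)]])
  have "weak_partial A k (%x. psi x * G x $ a $ j + pdv j psi x * u x $ a)
  (%x. (psi x * H x $ a $ j $ k + pdv k psi x * G x $ a $ j) + (pdv j psi x * G x $ a $ k + pdv k (pdv j psi) x * u x $ a))"
  by (rule wp_add[OF p[OF psi d(2) d(3) d(5)] p[OF psi1 d(1) d(2) d(4)] i[OF psi d(2)] g1 i[OF psi1 d(1)] g2])
  thus "weak_partial A k (%x. (psi x *\<^sub>R G x + (\<chi> a j. pdv j psi x * u x $ a)) $ a $ j)
  (%x. (psi x *\<^sub>R H x + cutoff_tensor psi u G x) $ a $ j $ k)"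
  by (simp add: cutoff_tensor_def add.assoc)
 qed
qed

lemma norm_tensor_le:
 fixes T :: "real^'n^'m^'d"
 assumes "!!a j k. \<bar>T $ a $ j $ k\<bar> <= c"
 shows "norm T <= real CARD('d) * real CARD('m) * real CARD('n) * c"
proof -
 have "norm T <= (\<Sum>a\<in>UNIV. norm (T $ a))" by (rule norm_vec_le_sum)
 also have "\<dots> <= (\<Sum>a\<in>UNIV. \<Sum>j\<in>UNIV. norm (T $ a $ j))" by (intro sum_mono norm_vec_le_sum)
 also have "\<dots> <= (\<Sum>a\<in>UNIV. \<Sum>j\<in>UNIV. \<Sum>k\<in>UNIV. norm (T $ a $ j $ k))" by (intro sum_mono norm_vec_le_sum)
 also have "\<dots> <= (\<Sum>a\<in>(UNIV::'d set). \<Sum>j\<in>(UNIV::'m set). \<Sum>k\<in>(UNIV::'n set). c)"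
  unfolding real_norm_def by (intro sum_mono assms)
 finally show ?thesis by simp
qed

text \<open>The constant precedes \<open>u\<close> and \<open>G\<close>, because it has to be fixed
  before a member of the recovery sequence is selected.\<close>

lemma cutoff_tensor_bound:
 assumes "psi : tfs (B :: (real^'n) set)"
 shows "\<exists>c\<ge>0. \<forall>(u :: real^'n => real^'d) G x. norm (cutoff_tensor psi u G x) <= c * (norm (u x) + norm (G x))"
proof -
 have "\<exists>b\<ge>0. ALL x. norm (pdv j psi x) <= b" for j by (rule tf_bdd[OF tf_pderiv[OF assms]])
 then obtain b1 where b1: "!!j. b1 j >= 0" "!!j x. \<bar>pdv j psi x\<bar> <= b1 j" unfolding real_norm_def by metis
 have "\<exists>b\<ge>0. ALL x. norm (pdv k (pdv j psi) x) <= b" for j k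
  by (rule tf_bdd[OF tf_pderiv[OF tf_pderiv[OF assms]]])
 then obtain b2 where b2: "!!k j. b2 k j >= 0" "!!k j x. \<bar>pdv k (pdv j psi) x\<bar> <= b2 k j" unfolding real_norm_def by metis
 define b where "b = (\<Sum>j\<in>UNIV. b1 j) + (\<Sum>k\<in>UNIV. \<Sum>j\<in>UNIV. b2 k j)"
 have s1: "b1 j <= (\<Sum>j\<in>UNIV. b1 j)" for j by (rule member_le_sum) (use b1 in auto)
 have s2: "b2 k j <= (\<Sum>k\<in>UNIV. \<Sum>j\<in>UNIV. b2 k j)" for k j
 proof -
  have "b2 k j <= (\<Sum>j\<in>UNIV. b2 k j)" by (rule member_le_sum) (use b2 in auto)
  also have "\<dots> <= (\<Sum>k\<in>UNIV. \<Sum>j\<in>UNIV. b2 k j)"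
  by (rule member_le_sum[of k UNIV "%k. \<Sum>j\<in>UNIV. b2 k j"]) (use b2 in "auto intro: sum_nonneg")
  finally show ?thesis .
 qed
 have nn: "0 <= (\<Sum>j\<in>UNIV. b1 j)" "0 <= (\<Sum>k\<in>UNIV. \<Sum>j\<in>UNIV. b2 k j)" by (intro sum_nonneg b1 b2)+
 have b0: "b >= 0" using nn by (simp add: b_def)
 have bb: "\<bar>pdv j psi x\<bar> <= b" "\<bar>pdv k (pdv j psi) x\<bar> <= b" for j k x
  using b1(2)[of j x] s1[of j] b2(2)[of k j x] s2[of k j] nn by (simp_all add: b_def)
 have "norm (cutoff_tensor psi u G x) <= real CARD('d) * real CARD('n) * real CARD('n) * (2 * b * (norm (u x) + norm (G x)))" for u :: "real^'n => real^'d" and G x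
 proof (rule norm_tensor_le)
  fix a j k
  have G: "\<bar>G x $ a $ j\<bar> <= norm (G x)" for j
  using component_le_norm_cart[of "G x $ a" j] Finite_Cartesian_Product.norm_nth_le[of "G x" a] by linarith
  have u: "\<bar>u x $ a\<bar> <= norm (u x)" by (rule component_le_norm_cart)
  have "\<bar>cutoff_tensor psi u G x $ a $ j $ k\<bar> <= \<bar>pdv k psi x\<bar> * \<bar>G x $ a $ j\<bar> + (\<bar>pdv j psi x\<bar> * \<bar>G x $ a $ k\<bar> + \<bar>pdv k (pdv j psi) x\<bar> * \<bar>u x $ a\<bar>)"
  unfolding cutoff_tensor_def abs_mult[symmetric] by simp
  also have "\<dots> <= b * norm (G x) + (b * norm (G x) + b * norm (u x))"
  by (intro add_mono mult_mono bb G u b0 abs_ge_zero)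
  also have "\<dots> <= 2 * b * (norm (u x) + norm (G x))" using b0 by (simp add: algebra_simps)
  finally show "\<bar>cutoff_tensor psi u G x $ a $ j $ k\<bar> <= 2 * b * (norm (u x) + norm (G x))" .
 qed
 thus ?thesis using b0
  by (intro exI[of _ "real CARD('d) * real CARD('n) * real CARD('n) * (2 * b)"]) (auto simp: mult.assoc)
qed

subsection \<open>The comparison function near the boundary of the cube\<close>

lemma wp_const:
 assumes "open A" shows "weak_partial A j (%x. c::'b::euclidean_space) (%x. 0)"
 using classical_wp[OF assms, of "%x. c" "%x v. 0"] by simp

context frame begin

text \<open>A substitute for the wedge that belongs to \<open>W21\<close> and keeps its boundary
  values: on the frontier of the cube the corner function equals the positive part of
  \<open>y \<bullet> e i\<close> for every positive \<open>mu\<close>.\<close>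

definition cmp :: "real^'n^'d => real^'d => 'n => real => real => real^'n => real^'d" where
 "cmp D P i s mu y = D *v y + corner mu i s y *\<^sub>R P"

definition cmp_grad :: "real^'n^'d => real^'d => 'n => real => real => real^'n => real^'n^'d" where
 "cmp_grad D P i s mu y = (\<chi> a j. D $ a $ j + P $ a * cor_grad mu i s y $ j)"

definition cmp_hess :: "real^'d => 'n => real => real => real^'n => real^'n^'n^'d" where
 "cmp_hess P i s mu y = (\<chi> a j k. P $ a * cor_hess mu i s y $ j $ k)"

lemma sint_const_cube: "sint (cube s) (%x. c::'b::euclidean_space)"
 by (rule sint_cont_bdd[OF open_cube bdd_cube continuous_on_const order_refl])

lemma sint_linear_cube: "sint (cube s) (%y. (D::real^'n^'d) *v y)"
proof -
 have bl: "bounded_linear (%y. D *v y)" by (rule matrix_vector_mul_bounded_linear)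
 obtain K where K: "!!y. norm (D *v y) <= norm y * K" using bounded_linear.bounded[OF bl] by blast
 obtain b where b: "!!y. y : cube s ==> norm y <= b" using bdd_cube[of s] unfolding bounded_iff by blast
 show ?thesis
 proof (rule sint_cont_bdd[OF open_cube bdd_cube linear_continuous_on[OF bl]])
  fix y assume y: "y : cube s"
  have "norm (D *v y) <= norm y * \<bar>K\<bar>" using K[of y] by (intro order_trans[OF K] mult_left_mono) auto
  also have "\<dots> <= b * \<bar>K\<bar>" using b[OF y] by (intro mult_right_mono) auto
  finally show "norm (D *v y) <= b * \<bar>K\<bar>" .
 qed
qed

lemma cmp_W21:
 assumes s: "s > 0" and mu: "0 < mu" "mu <= 1"
 shows "W21_data (cube s) (cmp D P i s mu) (cmp_grad D P i s mu) (cmp_hess P i s mu)"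
proof -
 note ic = cor_intg[where s=s and i=i, OF mu]
 have ih: "sint (cube s) (cor_hess mu i s)"
  using cor_hess_layer(2)[OF s zero_less_one mu] .
 have ig: "sint (cube s) (%y. cor_grad mu i s y $ j)" for j by (rule sint_vec_nth(1)[OF ic(2)])
 have ih: "sint (cube s) (%y. cor_hess mu i s y $ j $ k)" for j k
  by (rule sint_vec_nth(1)[OF sint_vec_nth(1)[OF ih]])
 have bl: "bounded_linear (%x::real. p * x)" for p by (rule bounded_linear_mult_right)
 have lin: "weak_partial (cube s) j (%y. (D *v y) $ a) (%y. D $ a $ j)" for a j
 proof -
  have "((%y. (D *v y) $ a) has_derivative (%v. (D *v v) $ a)) (at y)" for y
  by (rule bounded_linear_imp_has_derivative[OF bounded_linear_compose[OF bounded_linear_vec_nth matrix_vector_mul_bounded_linear]])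
  hence "weak_partial (cube s) j (%y. (D *v y) $ a) (%y. (D *v axis j 1) $ a)"
  by (rule classical_wp[OF open_cube]) simp
  thus ?thesis by (simp add: matrix_vector_mult_basis column_def)
 qed
 have linc: "sint (cube s) (%y. (D *v y) $ a)" for a
  by (rule sint_vec_nth(1)[OF sint_linear_cube])
 have Pc: "sint (cube s) (%y. P $ a * corner mu i s y)" for a
  by (rule sint_blin(1)[OF bl ic(1)])
 have Pg: "sint (cube s) (%y. P $ a * cor_grad mu i s y $ j)" for a j
  by (rule sint_blin(1)[OF bl ig])
 have Ph: "sint (cube s) (%y. P $ a * cor_hess mu i s y $ j $ k)" for a j k
  by (rule sint_blin(1)[OF bl ih])
 show ?thesis
 proof (rule W21_dataI)
  show "sint (cube s) (cmp D P i s mu)"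
  proof (rule sint_vec)
  fix a show "sint (cube s) (%x. cmp D P i s mu x $ a)"
  using set_integral_add(1)[OF linc Pc, of a a] by (simp add: cmp_def mult.commute)
  qed
  fix a j k
  show "sint (cube s) (%x. cmp_grad D P i s mu x $ a $ j)"
  using set_integral_add(1)[OF sint_const_cube Pg] by (simp add: cmp_grad_def)
  show "sint (cube s) (%x. cmp_hess P i s mu x $ a $ j $ k)"
  using Ph by (simp add: cmp_hess_def)
  show "weak_partial (cube s) j (%x. cmp D P i s mu x $ a) (%x. cmp_grad D P i s mu x $ a $ j)"
  proof -
  have "weak_partial (cube s) j (%y. (D *v y) $ a + P $ a * corner mu i s y) (%y. D $ a $ j + P $ a * cor_grad mu i s y $ j)"
  by (rule wp_add[OF lin wp_blin[OF cor_wp(1)[OF mu(1)] ic(1) ig bl]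
  linc sint_const_cube Pc Pg])
  thus ?thesis by (simp add: cmp_def cmp_grad_def mult.commute)
  qed
  show "weak_partial (cube s) k (%x. cmp_grad D P i s mu x $ a $ j) (%x. cmp_hess P i s mu x $ a $ j $ k)"
  proof -
  have "weak_partial (cube s) k (%y. D $ a $ j + P $ a * cor_grad mu i s y $ j) (%y. 0 + P $ a * cor_hess mu i s y $ j $ k)"
  by (rule wp_add[OF wp_const[OF open_cube] wp_blin[OF cor_wp(2)[OF mu(1)] ig ih bl]
  sint_const_cube sint_const_cube Pg Ph])
  thus ?thesis by (simp add: cmp_grad_def cmp_hess_def)
  qed
 qed
qed

lemma cmp_hess_norm: "norm (cmp_hess P i s mu y :: real^'n^'n^'d) <= real CARD('d) * norm P * norm (cor_hess mu i s y)"
proof -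
 have "norm (cmp_hess P i s mu y) <= (\<Sum>a\<in>UNIV. norm (cmp_hess P i s mu y $ a))" by (rule norm_vec_le_sum)
 also have "\<dots> <= (\<Sum>a\<in>(UNIV::'d set). norm P * norm (cor_hess mu i s y))"
 proof (rule sum_mono)
  fix a
  have "cmp_hess P i s mu y $ a = P $ a *\<^sub>R cor_hess mu i s y" by (simp add: cmp_hess_def vec_eq_iff)
  thus "norm (cmp_hess P i s mu y $ a) <= norm P * norm (cor_hess mu i s y)"
  using component_le_norm_cart[of P a] by (simp add: mult_right_mono)
 qed
 finally show ?thesis by simp
qed

definition wedge_grad :: "real^'n^'d => real^'d => 'n => real^'n => real^'n^'d" where
 "wedge_grad D P i y = (\<chi> a j. D $ a $ j + P $ a * (if y \<bullet> e i > 0 then e i $ j else 0))"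

lemma wedge_fun_eq:
 assumes "!!y. C *v y = D *v y + (y \<bullet> e i) *\<^sub>R P"
 shows "wedge_fun C D (e i) y = D *v y + max 0 (y \<bullet> e i) *\<^sub>R P"
 using assms by (auto simp: wedge_fun_def max_def)

lemma L1_lim_dominated:
 fixes w :: "'a::euclidean_space => 'b::euclidean_space"
 assumes "sint A w" "!!n. sint A (W n)"
  "AE x in leb. x : A --> (%n. W n x) \<longlonglongrightarrow> w x" "!!n x. x : A ==> norm (W n x - w x) <= B"
  "A : lmeasurable"
 shows "L1_tendsto A W w"
 unfolding L1_tendsto_def set_lebesgue_integral_def
proof (intro conjI allI assms(1,2))
 have "(%n. \<integral>x. idc A x *\<^sub>R norm (W n x - w x) \<partial>leb) \<longlonglongrightarrow> (\<integral>x. 0 \<partial>(leb :: 'a measure))"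
 proof (rule integral_dominated_convergence)
  show "integrable leb (%x. B * idc A x)"
  using assms(5) by (intro integrable_mult_right integrable_real_indicator) (auto simp: fmeasurable_def)
  show "(%x. idc A x *\<^sub>R norm (W n x - w x)) : lbm" for n
  using set_integrable_norm[OF set_integral_diff(1)[OF assms(2,1)], of n] by (auto simp: set_integrable_def)
  show "AE x in leb. (%n. idc A x *\<^sub>R norm (W n x - w x)) \<longlonglongrightarrow> 0"
  using assms(3)
  proof eventually_elim
  case (elim x)
  show ?case
  proof (cases "x : A")
  case True
  hence "(%n. norm (W n x - w x)) \<longlonglongrightarrow> 0" using elim by (intro tendsto_norm_zero) (simp add: LIM_zero)
  thus ?thesis using True by simp
  qed simp
  qed
  show "AE x in leb. norm (idc A x *\<^sub>R norm (W n x - w x)) <= B * idc A x" for n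
  using assms(4) by (intro AE_I2) (simp add: indicator_def)
 qed simp
 thus "(%n. \<integral>x. idc A x *\<^sub>R norm (W n x - w x) \<partial>leb) \<longlonglongrightarrow> 0" by simp
qed

lemma cube_lmeas: "cube s : lmeasurable"
 by (rule bounded_set_imp_lmeasurable[OF bdd_cube]) simp

text \<open>Dominated convergence applies because the gradients of the corner functions are bounded
  uniformly in \<open>mu\<close> and converge off the hyperplane. The weak gradient of the wedge
  then follows from closedness of weak derivatives under L1 limits.\<close>

lemma cmp_lim:
 fixes C D :: "real^'n^'d"
 assumes s: "s > 0" and CD: "!!y. C *v y = D *v y + (y \<bullet> e i) *\<^sub>R P" and mu: "!!n. 0 < mu n" "!!n. mu n <= 1" "mu \<longlonglongrightarrow> 0"
 shows "L1_tendsto (cube s) (%n. cmp D P i s (mu n)) (wedge_fun C D (e i))"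
  "L1_tendsto (cube s) (%n. cmp_grad D P i s (mu n)) (wedge_grad D P i)"
  "is_weak_gradient (cube s) (wedge_fun C D (e i)) (wedge_grad D P i)"
proof -
 note d = W21_dataD[OF cmp_W21[OF s mu(1,2)]]
 obtain b where b: "b >= 0" "!!y. y : ccube s ==> \<bar>bd_wt s y\<bar> <= b"
  using C_k_bdd_on_cube[OF C_k_bd_wt[of 0]] by metis
 have weq: "wedge_fun C D (e i) y = D *v y + max 0 (y \<bullet> e i) *\<^sub>R P" for y by (rule wedge_fun_eq[OF CD])
 have diff: "norm (cmp D P i s (mu n) y - wedge_fun C D (e i) y) <= (mu n * bd_wt s y / 2) * norm P" for n y
 proof -
  have "cmp D P i s (mu n) y - wedge_fun C D (e i) y = (corner (mu n) i s y - max 0 (y \<bullet> e i)) *\<^sub>R P"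
  unfolding cmp_def weq by (simp add: scaleR_diff_left)
  hence "norm (cmp D P i s (mu n) y - wedge_fun C D (e i) y) = \<bar>corner (mu n) i s y - max 0 (y \<bullet> e i)\<bar> * norm P" by simp
  also have "\<dots> <= (mu n * bd_wt s y / 2) * norm P"
  by (rule mult_right_mono[OF cor_diff norm_ge_zero]) (use mu(1)[of n] in simp)
  finally show ?thesis .
 qed
 have cw: "continuous_on UNIV (wedge_fun C D (e i))"
  unfolding weq[abs_def] by (intro continuous_intros linear_continuous_on matrix_vector_mul_bounded_linear)
 have wi: "sint (cube s) (wedge_fun C D (e i))"
 proof -
  have "compact (wedge_fun C D (e i) ` ccube s)"
  unfolding ccube_eq_cslab by (intro compact_continuous_image compact_cslab continuous_on_subset[OF cw]) simp
  then obtain B where B: "!!y. y : ccube s ==> norm (wedge_fun C D (e i) y) <= B"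
  by (meson bounded_iff compact_imp_bounded imageI)
  show ?thesis
  by (rule sint_cont_bdd[OF open_cube bdd_cube continuous_on_subset[OF cw]])
  (use B cube_ccube(1) in auto)
 qed
 show w: "L1_tendsto (cube s) (%n. cmp D P i s (mu n)) (wedge_fun C D (e i))"
 proof (rule L1_lim_dominated[OF wi d(1) _ _ cube_lmeas])
  show "norm (cmp D P i s (mu n) y - wedge_fun C D (e i) y) <= b * norm P" if "y : cube s" for n y
  proof (rule order_trans[OF diff mult_right_mono])
  have yc: "y : ccube s" using that cube_ccube(1) by auto
  have "mu n * bd_wt s y <= 1 * b" using mu(1,2)[of n] b(2)[OF yc] bd_wt_nonneg[of s y] by (intro mult_mono) auto
  moreover have "0 <= mu n * bd_wt s y" using mu(1)[of n] bd_wt_nonneg[of s y] by simp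
  ultimately show "mu n * bd_wt s y / 2 <= b" by simp
  qed simp
  have "(%n. cmp D P i s (mu n) y) \<longlonglongrightarrow> wedge_fun C D (e i) y" for y
  proof (rule LIM_zero_cancel, rule Lim_null_comparison)
  show "\<forall>\<^sub>F n in sequentially. norm (cmp D P i s (mu n) y - wedge_fun C D (e i) y) <= (mu n * bd_wt s y / 2) * norm P"
  using diff by simp
  have "(%n. (mu n * bd_wt s y / 2) * norm P) \<longlonglongrightarrow> (0 * bd_wt s y / 2) * norm P"
  by (intro tendsto_intros mu(3)) simp
  thus "(%n. (mu n * bd_wt s y / 2) * norm P) \<longlonglongrightarrow> 0" by simp
  qed
  thus "AE y in leb. y : cube s --> (%n. cmp D P i s (mu n) y) \<longlonglongrightarrow> wedge_fun C D (e i) y" by simp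
 qed
 obtain B where B: "B >= 0" "!!mu y. 0 < mu ==> mu <= 1 ==> y : cube s ==> norm (cor_grad mu i s y) <= B"
  using cor_grad_bdd[of s i] by blast
 have gi: "sint (cube s) (wedge_grad D P i)"
 proof (intro sint_vec)
  fix a j
  have "sint (cube s) (%y. D $ a $ j + P $ a * e i $ j * (1 - step_fun 1 0 (- e i) y))"
  using step_fun_intg(1)[OF _ bdd_cube, of s 1 0 "- e i"]
  by (intro set_integral_add(1) sint_const_cube set_integrable_mult_right set_integral_diff(1)) auto
  moreover have "D $ a $ j + P $ a * e i $ j * (1 - step_fun 1 0 (- e i) y) = wedge_grad D P i y $ a $ j" for y
  by (simp add: wedge_grad_def step_fun_def)
  ultimately show "sint (cube s) (%y. wedge_grad D P i y $ a $ j)" by simp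
 qed
 show g: "L1_tendsto (cube s) (%n. cmp_grad D P i s (mu n)) (wedge_grad D P i)"
 proof (rule L1_lim_dominated[OF gi d(2) _ _ cube_lmeas])
  have "AE y in leb. y ~: {y. y \<bullet> e i = 0}"
  using negligible_frame_hyperplane[of i 0] unfolding negligible_iff_null_sets by (rule AE_not_in)
  thus "AE y in leb. y : cube s --> (%n. cmp_grad D P i s (mu n) y) \<longlonglongrightarrow> wedge_grad D P i y"
  proof eventually_elim
  case (elim y)
  hence l: "(%n. cor_grad (mu n) i s y) \<longlonglongrightarrow> (if y \<bullet> e i > 0 then e i else 0)"
  by (intro cor_grad_lim mu(3)) simp
  have lj: "(%n. cor_grad (mu n) i s y $ j) \<longlonglongrightarrow> (if y \<bullet> e i > 0 then e i $ j else 0)" for j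
  using tendsto_vec_nth[OF l, of j] by (cases "y \<bullet> e i > 0") auto
  show ?case unfolding cmp_grad_def wedge_grad_def
  by (intro impI tendsto_vec_lambda tendsto_intros lj)
  qed
  show "norm (cmp_grad D P i s (mu n) y - wedge_grad D P i y) <= real CARD('d) * real CARD('n) * (norm P * (B + 1))" if "y : cube s" for n y
  proof -
  let ?T = "cmp_grad D P i s (mu n) y - wedge_grad D P i y"
  have "norm ?T <= (\<Sum>a\<in>UNIV. norm (?T $ a))" by (rule norm_vec_le_sum)
  also have "\<dots> <= (\<Sum>a\<in>UNIV. \<Sum>j\<in>UNIV. norm (?T $ a $ j))" by (intro sum_mono norm_vec_le_sum)
  also have "\<dots> <= (\<Sum>a\<in>(UNIV::'d set). \<Sum>j\<in>(UNIV::'n set). norm P * (B + 1))"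
  proof (intro sum_mono)
  fix a j
  have "\<bar>cor_grad (mu n) i s y $ j\<bar> <= B"
  using component_le_norm_cart[of "cor_grad (mu n) i s y" j] B(2)[OF mu(1,2) that, of n] by linarith
  hence "\<bar>cor_grad (mu n) i s y $ j - (if y \<bullet> e i > 0 then e i $ j else 0)\<bar> <= B + 1"
  using abs_frame_nth[of i j] by (auto simp: abs_le_iff)
  hence "\<bar>P $ a\<bar> * \<bar>cor_grad (mu n) i s y $ j - (if y \<bullet> e i > 0 then e i $ j else 0)\<bar> <= norm P * (B + 1)"
  by (intro mult_mono component_le_norm_cart) auto
  thus "norm (?T $ a $ j) <= norm P * (B + 1)"
  by (simp only: cmp_grad_def wedge_grad_def vector_minus_component vec_lambda_beta real_norm_def
  abs_mult[symmetric] right_diff_distrib add_diff_cancel_left)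
  qed
  finally show ?thesis by simp
  qed
 qed
 show "is_weak_gradient (cube s) (wedge_fun C D (e i)) (wedge_grad D P i)"
  unfolding is_weak_gradient_def
 proof (intro conjI allI gi)
  fix j
  have "L1_tendsto (cube s) (%n y. column j (cmp_grad D P i s (mu n) y)) (%y. column j (wedge_grad D P i y))"
  unfolding L1_tendsto_def
  proof (intro conjI allI)
  show "sint (cube s) (%y. column j (wedge_grad D P i y))"
  "sint (cube s) (%y. column j (cmp_grad D P i s (mu n) y))" for n
  by (intro sint_blin(1)[OF blin_column] gi d(2))+
  note ci = this
  have nc: "norm (column j M) <= real CARD('d) * norm M" for M :: "real^'n^'d"
  proof -
  have "norm (column j M) <= (\<Sum>a\<in>UNIV. \<bar>column j M $ a\<bar>)" by (rule norm_le_l1_cart)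
  also have "\<dots> <= (\<Sum>a\<in>(UNIV::'d set). norm M)"
  proof (rule sum_mono)
  fix a
  show "\<bar>column j M $ a\<bar> <= norm M"
  using component_le_norm_cart[of "M $ a" j] Finite_Cartesian_Product.norm_nth_le[of M a] by (simp add: column_def)
  qed
  finally show ?thesis by simp
  qed
  have gd: "sint (cube s) (%y. norm (cmp_grad D P i s (mu n) y - wedge_grad D P i y))" for n
  by (rule set_integrable_norm[OF set_integral_diff(1)[OF d(2) gi]])
  have up: "(LINT y:cube s|leb. norm (column j (cmp_grad D P i s (mu n) y) - column j (wedge_grad D P i y))) \<le>
  real CARD('d) * (LINT y:cube s|leb. norm (cmp_grad D P i s (mu n) y - wedge_grad D P i y))" for n
  unfolding set_integral_mult_right[symmetric]
  proof (rule set_integral_mono)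
  show "sint (cube s) (%y. norm (column j (cmp_grad D P i s (mu n) y) - column j (wedge_grad D P i y)))"
  by (rule set_integrable_norm[OF set_integral_diff(1)[OF ci(2,1)]])
  show "sint (cube s) (%y. real CARD('d) * norm (cmp_grad D P i s (mu n) y - wedge_grad D P i y))"
  using gd by simp
  fix y
  have "column j (cmp_grad D P i s (mu n) y) - column j (wedge_grad D P i y) = column j (cmp_grad D P i s (mu n) y - wedge_grad D P i y)"
  by (simp add: column_def vec_eq_iff)
  thus "norm (column j (cmp_grad D P i s (mu n) y) - column j (wedge_grad D P i y)) \<le>
  real CARD('d) * norm (cmp_grad D P i s (mu n) y - wedge_grad D P i y)" using nc by metis
  qed
  have t0: "(%n. real CARD('d) * (LINT y:cube s|leb. norm (cmp_grad D P i s (mu n) y - wedge_grad D P i y))) \<longlonglongrightarrow> 0"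
  using g by (intro tendsto_mult_right_zero) (simp add: L1_tendsto_def)
  show "(%n. LINT y:cube s|leb. norm (column j (cmp_grad D P i s (mu n) y) - column j (wedge_grad D P i y))) \<longlonglongrightarrow> 0"
  proof (rule tendsto_sandwich[OF _ _ tendsto_const t0])
  show "\<forall>\<^sub>F n in sequentially. 0 <= (LINT y:cube s|leb. norm (column j (cmp_grad D P i s (mu n) y) - column j (wedge_grad D P i y)))"
  unfolding set_lebesgue_integral_def by (intro always_eventually allI Bochner_Integration.integral_nonneg) simp
  qed (use up in simp)
  qed
  thus "weak_partial (cube s) j (wedge_fun C D (e i)) (%x. column j (wedge_grad D P i x))"
  by (rule wp_limit[OF d(6) w])
 qed
qed

end

subsection \<open>Traces of functions that agree near the boundary\<close>

lemma hausd_measure_mono: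
 assumes "E <= F" shows "hausdorff_measure s E <= hausdorff_measure s F"
 unfolding hausdorff_measure_def hausdorff_pre_def
 by (intro SUP_mono') (rule INF_superset_mono, use assms in auto)

lemma hausd_measure_empty [simp]: "hausdorff_measure s {} = 0"
proof -
 have "hausdorff_pre s dl {} = 0" if "dl > 0" for dl
 proof -
  have "hausdorff_pre s dl {} <= (\<Sum>n. 0)"
  unfolding hausdorff_pre_def
  by (rule INF_lower2[where i="%n. {}"]) (use that in "auto simp: diameter_def")
  thus ?thesis by simp
 qed
 hence "hausdorff_measure s ({} :: 'a set) <= 0" unfolding hausdorff_measure_def by (intro SUP_least) simp
 thus ?thesis by simp
qed

lemma hausd_ae_mono:
 assumes "hausdorff_ae s E P" "!!x. x : E ==> P x ==> P' x"
 shows "hausdorff_ae s E P'"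
proof -
 have "hausdorff_measure s {x : E. ~ P' x} <= hausdorff_measure s {x : E. ~ P x}"
  by (rule hausd_measure_mono) (use assms(2) in auto)
 thus ?thesis using assms(1) by (simp add: hausdorff_ae_def)
qed

lemma hausd_ae_all: "(!!x. x : E ==> P x) ==> hausdorff_ae s E P"
proof -
 assume "!!x. x : E ==> P x"
 hence "{x : E. ~ P x} = {}" by blast
 thus ?thesis unfolding hausdorff_ae_def by (simp only: hausd_measure_empty)
qed

lemma approx_limit_cong:
 assumes "approx_limit A w x z" "open V" "x : V" "!!y. y : A \<inter> V ==> w y = w' y"
 shows "approx_limit A w' x z"
proof -
 obtain r0 where r0: "r0 > 0" "ball x r0 <= V" using assms(2,3) openE by blast
 have "\<forall>\<^sub>F r in at_right 0. (\<integral>\<^sup>+y\<in>A \<inter> ball x r. ennreal (norm (w y - z)) \<partial>leb) / ennreal (r ^ CARD('a)) =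
  (\<integral>\<^sup>+y\<in>A \<inter> ball x r. ennreal (norm (w' y - z)) \<partial>leb) / ennreal (r ^ CARD('a))"
  using eventually_at_right_less[of 0] eventually_at_right_real[OF r0(1)]
 proof eventually_elim
  case (elim r)
  have "ball x r <= V" using elim r0(2) subset_ball[of r r0 x] by auto
  hence "(\<integral>\<^sup>+y\<in>A \<inter> ball x r. ennreal (norm (w y - z)) \<partial>leb) = (\<integral>\<^sup>+y\<in>A \<inter> ball x r. ennreal (norm (w' y - z)) \<partial>leb)"
  by (intro nn_integral_cong) (use assms(4) in \<open>auto simp: indicator_def\<close>)
  thus ?case by simp
 qed
 thus ?thesis using assms(1) unfolding approx_limit_def by (simp add: tendsto_cong)
qed

lemma ennreal_lim_0I:
 fixes F :: "'a => ennreal"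
 assumes "!!e. e > 0 ==> \<forall>\<^sub>F x in fl. F x <= ennreal e"
 shows "(F \<longlongrightarrow> 0) fl"
proof (rule order_tendstoI)
 fix a :: ennreal assume "0 < a"
 then obtain e where e: "0 < e" "ennreal e < a"
 proof (cases a)
  case (real r)
  hence "ennreal (r / 2) < a" "0 < r / 2" using \<open>0 < a\<close> by (auto simp: ennreal_lessI)
  thus ?thesis using that by blast
 next
  case top thus ?thesis using that[of 1] by simp
 qed
 show "\<forall>\<^sub>F x in fl. F x < a" using assms[OF e(1)] by eventually_elim (use e(2) in \<open>auto intro: le_less_trans\<close>)
qed simp

lemma approx_limit_cont:
 fixes w :: "real^'n => 'b::euclidean_space"
 assumes "isCont w x" "A : sets leb"
 shows "approx_limit A w x (w x)"
 unfolding approx_limit_def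
proof (rule ennreal_lim_0I)
 fix e :: real assume e: "e > 0"
 define \<omega> where "\<omega> = unit_ball_vol (real CARD('n))"
 have \<omega>: "\<omega> > 0" by (simp add: \<omega>_def)
 obtain r0 where r0: "r0 > 0" "!!y. dist y x < r0 ==> dist (w y) (w x) < e / \<omega>"
  using assms(1) e \<omega> unfolding continuous_at_eps_delta by (metis divide_pos_pos)
 show "\<forall>\<^sub>F r in at_right 0. (\<integral>\<^sup>+y\<in>A \<inter> ball x r. ennreal (norm (w y - w x)) \<partial>leb) / ennreal (r ^ CARD('n)) <= ennreal e"
  using eventually_at_right_real[OF r0(1)]
 proof eventually_elim
  case (elim r)
  hence r: "0 < r" "r < r0" by auto
  have "(\<integral>\<^sup>+y\<in>A \<inter> ball x r. ennreal (norm (w y - w x)) \<partial>leb) <= (\<integral>\<^sup>+y. ennreal (e / \<omega>) * idc (A \<inter> ball x r) y \<partial>leb)"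
  proof (rule nn_integral_mono)
  fix y
  show "ennreal (norm (w y - w x)) * idc (A \<inter> ball x r) y <= ennreal (e / \<omega>) * idc (A \<inter> ball x r) y"
  using r0(2)[of y] r by (auto simp: indicator_def dist_norm norm_minus_commute intro!: ennreal_leI)
  qed
  also have "\<dots> = ennreal (e / \<omega>) * emeasure leb (A \<inter> ball x r)"
  by (rule nn_integral_cmult_indicator) (use assms(2) in auto)
  also have "\<dots> <= ennreal (e / \<omega>) * emeasure leb (ball x r)"
  by (intro mult_left_mono emeasure_mono) auto
  also have "\<dots> = ennreal (e / \<omega>) * ennreal (\<omega> * r ^ CARD('n))"
  using emeasure_ball[of r x] r by (simp add: \<omega>_def)
  also have "\<dots> = ennreal (e * r ^ CARD('n))" using \<omega> e r by (simp add: ennreal_mult[symmetric])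
  finally have "(\<integral>\<^sup>+y\<in>A \<inter> ball x r. ennreal (norm (w y - w x)) \<partial>leb) / ennreal (r ^ CARD('n)) <= ennreal (e * r ^ CARD('n)) / ennreal (r ^ CARD('n))"
  by (rule divide_right_mono_ennreal)
  also have "\<dots> = ennreal e" using r e by (simp add: divide_ennreal)
  finally show ?case .
 qed
qed

text \<open>The essential support is the complement of a possibly uncountable union of open sets on
  which \<open>w\<close> vanishes almost everywhere; Lindelof's theorem reduces it to a countable
  union.\<close>

lemma ess_support_AE:
 fixes w :: "real^'n => 'b::zero"
 shows "AE x in leb. x : E - ess_support E w --> w x = 0"
proof -
 let ?F = "{V. open V & (AE x in leb. x : E \<inter> V --> w x = 0)}"
 obtain F' where F': "F' <= ?F" "countable F'" "\<Union>F' = \<Union>?F" using Lindelof[of ?F] by auto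
 have "AE x in leb. \<forall>V\<in>F'. x : E \<inter> V --> w x = 0"
  using F'(1) by (intro AE_ball_countable[OF F'(2), THEN iffD2]) auto
 thus ?thesis
 proof eventually_elim
  case (elim x)
  show ?case
  proof
  assume x: "x : E - ess_support E w"
  hence "x : \<Union>F'" unfolding F'(3) ess_support_def by auto
  thus "w x = 0" using elim x by auto
  qed
 qed
qed

context frame begin

lemma compact_in_cube:
 assumes "compact K" "K <= cube s" "s > 0"
 obtains r where "0 < r" "r < s" "K <= cube r"
proof (cases "K = {}")
 case True thus ?thesis using that[of "s/2"] assms(3) by simp
next
 case False
 have "\<exists>c<s. \<forall>y\<in>K. \<bar>y \<bullet> e j\<bar> <= c" for j
 proof -
  have "continuous_on K (%y. \<bar>y \<bullet> e j\<bar>)" by (intro continuous_intros)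
  then obtain y0 where "y0 : K" "!!y. y : K ==> \<bar>y \<bullet> e j\<bar> <= \<bar>y0 \<bullet> e j\<bar>"
  using continuous_attains_sup[OF assms(1) False] by blast
  thus ?thesis using assms(2) by (auto simp: cube_def)
 qed
 then obtain c where c: "!!j. c j < s" "!!j y. y : K ==> \<bar>y \<bullet> e j\<bar> <= c j" by metis
 define m where "m = max 0 (Max (range c))"
 have m: "c j <= m" for j by (simp add: m_def max.coboundedI2)
 have "m < s" using c(1) assms(3) by (simp add: m_def)
 have ms: "m < (m + s) / 2" using \<open>m < s\<close> by simp
 have "\<bar>y \<bullet> e j\<bar> < (m + s) / 2" if "y : K" for y j
  using order.trans[OF c(2)[OF that, of j] m[of j]] ms by (rule le_less_trans)
 hence "K <= cube ((m + s) / 2)" by (auto simp: cube_def)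
 moreover have "0 <= m" by (simp add: m_def)
 ultimately show ?thesis using \<open>m < s\<close> assms(3) by (intro that[of "(m + s) / 2"]) auto
qed

lemma cube_volume_layer:
 assumes "s > 0" "kp > 0"
 shows "\<exists>r0<s. \<forall>r\<ge>r0. emeasure leb (cube s - cube r) <= ennreal kp"
proof -
 let ?S = "%n. cube s - cube (s - 1 / real (Suc n))"
 have m: "cube r : sets leb" for r by simp
 have "(%n. emeasure leb (?S n)) \<longlonglongrightarrow> emeasure leb (\<Inter>n. ?S n)"
 proof (rule Lim_emeasure_decseq)
  show "range ?S <= sets leb" by auto
  show "decseq ?S"
  by (intro decseq_SucI Diff_mono order_refl cube_mono diff_left_mono) (simp add: frac_le)
  show "emeasure leb (?S n) ~= \<infinity>" for n
  proof -
  have "emeasure leb (?S n) <= emeasure leb (cube s)" by (rule emeasure_mono) auto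
  thus ?thesis using cube_lmeas[of s] by (auto simp: fmeasurable_def)
  qed
 qed
 moreover have "(\<Inter>n. ?S n) = {}"
 proof -
  have "EX n. y : cube (s - 1 / real (Suc n))" if y: "y : cube s" for y
  proof -
  obtain r where r: "0 < r" "r < s" "{y} <= cube r" using compact_in_cube[of "{y}" s] y assms(1) by auto
  obtain n where "1 / real (Suc n) < s - r" using reals_Archimedean[of "s - r"] r(2) by (auto simp: inverse_eq_divide)
  hence "cube r <= cube (s - 1 / real (Suc n))" by (intro cube_mono) simp
  thus ?thesis using r(3) by blast
  qed
  thus ?thesis by blast
 qed
 ultimately have "(%n. emeasure leb (?S n)) \<longlonglongrightarrow> 0" by (simp only: emeasure_empty)
 hence "\<forall>\<^sub>F n in sequentially. emeasure leb (?S n) < ennreal kp"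
  by (rule order_tendstoD(2)) (use assms(2) in simp)
 then obtain n where n: "emeasure leb (?S n) < ennreal kp" by (auto simp: eventually_sequentially)
 show ?thesis
 proof (intro exI[of _ "s - 1 / real (Suc n)"] conjI allI impI)
  fix r assume "s - 1 / real (Suc n) <= r"
  hence "emeasure leb (cube s - cube r) <= emeasure leb (?S n)"
  by (intro emeasure_mono Diff_mono cube_mono) auto
  thus "emeasure leb (cube s - cube r) <= ennreal kp" using n by simp
 qed simp
qed

lemma fr_not_ccube:
 assumes "s > 0" "q < s" "x : frontier (cube s)" shows "x ~: ccube q"
proof
 assume x: "x : ccube q"
 obtain j where j: "\<bar>x \<bullet> e j\<bar> = s" using assms(3) unfolding fr_cube[OF assms(1)] by blast
 have "\<bar>x \<bullet> e j\<bar> <= q" using x by (simp add: ccube_def)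
 thus False using j assms(2) by simp
qed

text \<open>The approximate limits of \<open>w''\<close> on the frontier come from the first
  hypothesis; \<open>w'\<close> inherits them because a frontier point has a neighbourhood that
  misses \<open>ccube q\<close>.\<close>

lemma trace_eq_near_fr:
 fixes w w' w'' :: "real^'n => 'b::euclidean_space"
 assumes "trace_eq (cube s) w w''" "q < s" "s > 0" "!!y. y ~: cube q ==> w' y = w'' y"
 shows "trace_eq (cube s) w' w''"
 unfolding trace_eq_def
proof (rule hausd_ae_mono[OF assms(1)[unfolded trace_eq_def]])
 fix x assume x: "x : frontier (cube s)" and "EX z. approx_limit (cube s) w x z & approx_limit (cube s) w'' x z"
 then obtain z where z: "approx_limit (cube s) w'' x z" by blast
 have "approx_limit (cube s) w' x z"
 proof (rule approx_limit_cong[OF z])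
  show "open (- ccube q)" by (rule open_Compl[OF closed_ccube])
  show "x : - ccube q" using fr_not_ccube[OF assms(3,2) x] by simp
  show "w'' y = w' y" if "y : cube s \<inter> - ccube q" for y
  proof -
  have "y ~: cube q" using that cube_ccube(1)[of q] by auto
  from assms(4)[OF this] show ?thesis by (rule sym)
  qed
 qed
 thus "EX z. approx_limit (cube s) w' x z & approx_limit (cube s) w'' x z" using z by blast
qed

lemma trace_eq_cont_near_fr:
 fixes w w' w'' :: "real^'n => 'b::euclidean_space"
 assumes "continuous_on UNIV w" "continuous_on UNIV w''" "!!y. y : frontier (cube s) ==> w y = w'' y"
  "q < s" "s > 0" "!!y. y ~: cube q ==> w' y = w y"
 shows "trace_eq (cube s) w' w''"
 unfolding trace_eq_def
proof (rule hausd_ae_all)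
 fix x assume x: "x : frontier (cube s)"
 have "approx_limit (cube s) w x (w x)" "approx_limit (cube s) w'' x (w'' x)"
  using assms(1,2) by (auto intro!: approx_limit_cont simp: continuous_on_eq_continuous_at)
 moreover have "approx_limit (cube s) w' x (w x)"
 proof (rule approx_limit_cong[OF calculation(1)])
  show "open (- ccube q)" by (rule open_Compl[OF closed_ccube])
  show "x : - ccube q" using fr_not_ccube[OF assms(5,4) x] by simp
  show "w y = w' y" if "y : cube s \<inter> - ccube q" for y
  proof -
  have "y ~: cube q" using that cube_ccube(1)[of q] by auto
  from assms(6)[OF this] show ?thesis by (rule sym)
  qed
 qed
 ultimately show "EX z. approx_limit (cube s) w' x z & approx_limit (cube s) w'' x z"
  using assms(3)[OF x] by auto
qed

text \<open>The \<open>M\<close> shells are disjoint parts of the cube, so they cannot all carry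
  more than the share \<open>K / M\<close> of the total mass.\<close>

lemma layer_pigeonhole:
 fixes g :: "real^'n => real"
 assumes g: "sint (cube s) g" "!!x. g x >= 0" and M: "M > 0" and p: "!!m. m < M ==> p m <= p (Suc m)" "p M <= s"
  and K: "(LINT x:cube s|leb. g x) <= K"
 shows "\<exists>m<M. (LINT x:cube (p (Suc m)) - cube (p m)|leb. g x) <= K / real M"
proof (rule ccontr)
 assume "~ ?thesis"
 hence c: "K / real M < (LINT x:cube (p (Suc m)) - cube (p m)|leb. g x)" if "m < M" for m using that by force
 define J where "J rho = (LINT x:cube rho|leb. g x)" for rho
 have ps: "p m <= s" if "m <= M" for m using that by (induction rule: inc_induct) (use p in "force intro: order_trans")+
 have gi: "sint (cube rho) g" if "rho <= s" for rho
  by (rule set_integrable_subset[OF g(1)]) (use that cube_mono in auto)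
 have J: "J (p (Suc m)) - J (p m) = (LINT x:cube (p (Suc m)) - cube (p m)|leb. g x)" if "m < M" for m
 proof -
  have s: "cube (p m) <= cube (p (Suc m))" using p(1)[OF that] by (rule cube_mono)
  have i: "sint (cube (p (Suc m))) g" using gi ps that by auto
  have "(LINT x:cube (p m) \<union> (cube (p (Suc m)) - cube (p m))|leb. g x) =
  J (p m) + (LINT x:cube (p (Suc m)) - cube (p m)|leb. g x)" unfolding J_def
  by (rule set_integral_Un[OF _ set_integrable_subset[OF i] set_integrable_subset[OF i]]) (use s in auto)
  moreover have "cube (p m) \<union> (cube (p (Suc m)) - cube (p m)) = cube (p (Suc m))" using s by auto
  ultimately show ?thesis by (simp add: J_def)
 qed
 have "(\<Sum>m<M. K / real M) < (\<Sum>m<M. J (p (Suc m)) - J (p m))"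
  by (rule sum_strict_mono) (use M c J in auto)
 hence "K < J (p M) - J (p 0)" using M by (simp add: sum_lessThan_telescope[of "%m. J (p m)"])
 moreover have "J (p 0) >= 0" unfolding J_def set_lebesgue_integral_def
  by (rule Bochner_Integration.integral_nonneg) (use g(2) in \<open>simp add: indicator_def\<close>)
 moreover have "J (p M) <= J s" unfolding J_def set_lebesgue_integral_def
  by (rule integral_mono) (use gi[of "p M"] g p(2) cube_mono[OF p(2)] in \<open>auto simp: set_integrable_def indicator_def\<close>)
 ultimately show False using K by (simp add: J_def)
qed

end

subsection \<open>Competitors with the boundary values of the jump profile\<close>

lemma closed_sym_tensors: "closed (sym_tensors :: (real^'n^'n^'d) set)"
proof -
 have eq: "(sym_tensors :: (real^'n^'n^'d) set) = (\<Inter>i. \<Inter>j. \<Inter>k. {xi. xi $ i $ j $ k = xi $ i $ k $ j})"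
  by (auto simp: sym_tensors_def)
 show ?thesis unfolding eq by (intro closed_INT ballI closed_Collect_eq continuous_intros)
qed

text \<open>Continuity of \<open>W0\<close> and \<open>W1\<close> is available on the closed set of
  symmetric tensors. Multiplying by its indicator gives Borel functions, and the symmetry of
  \<open>H\<close> almost everywhere removes the indicator afterwards.\<close>

lemma mixture_bm:
 fixes W0 W1 :: "real^'n^'n^'d => real"
 assumes W: "continuous_on sym_tensors W0" "continuous_on sym_tensors W1"
  and X: "sint A X"
  and H: "sint A H" "AE x in leb. x : A --> H x : sym_tensors" and A: "A : sets leb"
 shows "(%x. ennreal (mixture W0 W1 (X x) (H x)) * idc A x) : lbm"
proof -
 have V: "(%xi. idc sym_tensors xi *\<^sub>R V xi) : borel_measurable borel" if "continuous_on sym_tensors V" for V :: "real^'n^'n^'d => real"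
  by (rule borel_measurable_continuous_on_indicator[OF borel_closed[OF closed_sym_tensors] that])
 have Xm: "(%x. idc A x *\<^sub>R X x) : lbm" and Hm: "(%x. idc A x *\<^sub>R H x) : lbm"
  using X H(1) by (auto simp: set_integrable_def)
 let ?g = "%x. idc A x *\<^sub>R X x * (idc sym_tensors (idc A x *\<^sub>R H x) *\<^sub>R W1 (idc A x *\<^sub>R H x)) +
  (idc A x - idc A x *\<^sub>R X x) * (idc sym_tensors (idc A x *\<^sub>R H x) *\<^sub>R W0 (idc A x *\<^sub>R H x))"
 have m: "?g : lbm"
  using measurable_compose[OF Hm V[OF W(1)]] measurable_compose[OF Hm V[OF W(2)]] Xm A
  by (intro borel_measurable_add borel_measurable_times borel_measurable_diff borel_measurable_indicator) auto
 have "(%x. idc A x * mixture W0 W1 (X x) (H x)) : lbm"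
 proof (rule borel_measurable_AE[OF m])
  show "AE x in leb. ?g x = idc A x * mixture W0 W1 (X x) (H x)"
  using H(2) by eventually_elim (auto simp: indicator_def mixture_def)
 qed
 hence "(%x. ennreal (idc A x * mixture W0 W1 (X x) (H x))) : lbm"
  by (rule measurable_compose[OF _ measurable_ennreal])
 moreover have "ennreal (idc A x * mixture W0 W1 (X x) (H x)) = ennreal (mixture W0 W1 (X x) (H x)) * idc A x" for x
  by (simp add: indicator_def)
 ultimately show ?thesis by simp
qed

lemma sintl_subset_le:
 fixes g :: "'a::euclidean_space => real"
 assumes "sint A g" "!!x. g x >= 0" "S <= A" "S : sets leb"
 shows "(LINT x:S|leb. g x) <= (LINT x:A|leb. g x)"
 unfolding set_lebesgue_integral_def
proof (rule integral_mono)
 show "integrable leb (%x. idc S x *\<^sub>R g x)"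
  using set_integrable_subset[OF assms(1,4,3)] by (simp add: set_integrable_def)
qed (use assms in "auto simp: set_integrable_def indicator_def")

lemma snint_eq_int:
 fixes g :: "'a::euclidean_space => real"
 assumes "sint A g" "!!x. g x >= 0"
 shows "(\<integral>\<^sup>+x\<in>A. ennreal (g x) \<partial>leb) = ennreal (LINT x:A|leb. g x)"
proof -
 have "(\<integral>\<^sup>+x\<in>A. ennreal (g x) \<partial>leb) = (\<integral>\<^sup>+x. ennreal (idc A x *\<^sub>R g x) \<partial>leb)"
  by (intro nn_integral_cong) (simp add: indicator_def)
 also have "\<dots> = ennreal (\<integral>x. idc A x *\<^sub>R g x \<partial>leb)"
  by (rule nn_integral_eq_integral) (use assms in "auto simp: set_integrable_def")
 finally show ?thesis by (simp add: set_lebesgue_integral_def)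
qed

context frame begin

text \<open>The glued field is \<open>W + psi (U - W)\<close> with a cut-off \<open>psi\<close> that
  is 1 on \<open>cube p\<close> and 0 off \<open>cube q\<close>. Its Hessian is a convex combination
  of the two Hessians plus a lower-order tensor in the difference; the constant \<open>c\<close>
  depends on the cut-off and not on the fields.\<close>

lemma glue_hessian:
 assumes pq: "p < q" "q < s"
 shows "\<exists>c\<ge>0. \<forall>U GU (HU :: real^'n => real^'n^'n^'d) W GW HW. W21_data A U GU HU --> W21_data A W GW HW -->
  (EX V GV HV. W21_data A V GV HV & (ALL x. x ~: cube q --> V x = W x) & (\<forall>x\<in>cube p. HV x = HU x) \<and>
  (ALL x. norm (HV x) <= norm (HW x) + idc (cube q) x * norm (HU x) + c * (norm (U x - W x) + norm (GU x - GW x))))"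
proof -
 define psi where "psi = cutoff (1 / (q - p)) (%_. - q) (%_. q)"
 have psit: "psi : tfs (cube s)"
  unfolding psi_def using cube_ccube(2)[OF pq(2)] pq(1) unfolding ccube_eq_cslab by (intro cutoff_in_tf) auto
 have psi0: "psi x = 0" if "x ~: cube q" for x
  unfolding psi_def by (rule cutoff_eq_0) (use that pq(1) in \<open>auto simp: cube_eq_slab\<close>)
 have psi1: "psi x = 1" if "x : cube p" for x
  unfolding psi_def
 proof (rule cutoff_eq_1)
  fix j
  have "\<bar>x \<bullet> e j\<bar> < p" using that by (simp add: cube_def)
  thus "1 <= 1 / (q - p) * (x \<bullet> e j - - q)" "1 <= 1 / (q - p) * (q - x \<bullet> e j)"
  using pq(1) by (auto simp: le_divide_eq)
 qed
 have d1: "pdv j psi x = 0" if "x : cube p" for j x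
  unfolding psi_def by (rule pderiv_cutoff_eq_0) (use psi1[OF that] in "simp add: psi_def")
 have d2: "pdv k (pdv j psi) x = 0" if "x : cube p" for k j x
  unfolding pderiv_at_def[of k] by (rule fdv_0_if_locally_0[of "- cube p"]) (use that d1 open_cube in auto)
 obtain c where c: "c >= 0" "!!(u :: real^'n => real^'d) G x. norm (cutoff_tensor psi u G x) <= c * (norm (u x) + norm (G x))"
  using cutoff_tensor_bound[OF psit] by metis
 show ?thesis
 proof (intro exI[of _ c] conjI allI impI c(1))
  fix U GU W GW and HU HW :: "real^'n => real^'n^'n^'d"
  assume U: "W21_data A U GU HU" and W: "W21_data A W GW HW"
  let ?HV = "%x. HW x + (psi x *\<^sub>R (HU x - HW x) + cutoff_tensor psi (%x. U x - W x) (%x. GU x - GW x) x)"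
  show "EX V GV HV. W21_data A V GV HV & (ALL x. x ~: cube q --> V x = W x) & (\<forall>x\<in>cube p. HV x = HU x) \<and>
  (ALL x. norm (HV x) <= norm (HW x) + idc (cube q) x * norm (HU x) + c * (norm (U x - W x) + norm (GU x - GW x)))"
  proof (intro exI conjI allI impI ballI)
  show "W21_data A (%x. W x + psi x *\<^sub>R (U x - W x))
  (%x. GW x + (psi x *\<^sub>R (GU x - GW x) + (\<chi> a j. pdv j psi x * (U x - W x) $ a))) ?HV"
  by (rule W21_data_add[OF W W21_data_cutoff[OF W21_data_diff[OF U W] psit]])
  show "W x + psi x *\<^sub>R (U x - W x) = W x" if "x ~: cube q" for x using psi0[OF that] by simp
  show "?HV x = HU x" if "x : cube p" for x
  using psi1[OF that] d1[OF that] d2[OF that] by (simp add: cutoff_tensor_def vec_eq_iff)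
  show "norm (?HV x) <= norm (HW x) + idc (cube q) x * norm (HU x) + c * (norm (U x - W x) + norm (GU x - GW x))" for x
  proof -
  have b: "0 <= psi x" "psi x <= 1" by (simp_all add: psi_def cutoff_bounds)
  have "?HV x = ((1 - psi x) *\<^sub>R HW x + psi x *\<^sub>R HU x) + cutoff_tensor psi (%x. U x - W x) (%x. GU x - GW x) x"
  by (simp add: algebra_simps)
  also have "norm \<dots> <= (norm ((1 - psi x) *\<^sub>R HW x) + norm (psi x *\<^sub>R HU x)) + c * (norm (U x - W x) + norm (GU x - GW x))"
  by (intro order_trans[OF norm_triangle_ineq] add_mono norm_triangle_ineq c(2))
  also have "norm ((1 - psi x) *\<^sub>R HW x) <= norm (HW x)" using b by (simp add: mult_left_le_one_le)
  also have "norm (psi x *\<^sub>R HU x) <= idc (cube q) x * norm (HU x)"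
  using b psi0[of x] by (auto simp: indicator_def mult_left_le_one_le)
  finally show ?thesis by simp
  qed
  qed
 qed
qed

text \<open>The order of the choices matters: the radius \<open>R0\<close> beyond which volume and
  corner Hessian have small mass and \<open>v\<close> equals the wedge; the radius \<open>r\<close>
  for the perimeter; the shells between them and their constant \<open>c\<close>; the smoothing
  parameter \<open>mu\<close>; at last the index \<open>n\<close>. In the cube inside the selected
  shell the recovery sequence is untouched. Outside that cube the bulk energy is estimated by linear
  growth, which holds for either value of the set function, so the two cuts do not
  interfere.\<close>

lemma glue_competitor:
 fixes W0 W1 :: "real^'n^'n^'d => real" and C D :: "real^'n^'d"
 assumes s: "s > 0" and ab: "a : {0, 1}" "b : {0, 1}" and CD: "!!y. C *v y = D *v y + (y \<bullet> e i) *\<^sub>R P"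
  and \<alpha>\<beta>: "\<alpha> > 0" "\<beta> > 0"
  and W: "continuous_on sym_tensors W0" "continuous_on sym_tensors W1"
  and growth: "!!q xi. q : {0, 1} ==> xi : sym_tensors ==> \<alpha> * norm xi <= mixture W0 W1 q xi & mixture W0 W1 q xi <= \<beta> * (1 + norm xi)"
  and tht: "sint (cube s) tht" "AE x in leb. x : cube s --> tht x : {0, 1}"
  "trace_eq (cube s) tht (step_fun a b (e i))"
  and rv: "rv < s" "AE x in leb. x : cube s - cube rv --> v x = wedge_fun C D (e i) x"
  "AE x in leb. x : cube s - cube rv --> Gv x = wedge_grad D P i x"
  and X: "!!n. X n : BV01 (cube s)" "L1_tendsto (cube s) X tht"
  and U: "!!n. U n : W21 (cube s)" "L1_tendsto (cube s) U v" "L1_tendsto (cube s) (%n. weak_gradient (cube s) (U n)) Gv"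
  and freq: "\<exists>\<^sub>F n in sequentially. energy (mixture W0 W1) (cube s) (X n) (U n) < ennreal G'" and GG: "G' < G"
 shows "EX Z V. Z : BV01 (cube s) & V : W21 (cube s) & (\<exists>t<s. ALL y. y ~: cube t --> Z y = step_fun a b (e i) y) \<and>
  (\<exists>q<s. EX Wf. continuous_on UNIV Wf & (\<forall>y\<in>frontier (cube s). Wf y = wedge_fun C D (e i) y) & (ALL y. y ~: cube q --> V y = Wf y)) \<and>
  energy (mixture W0 W1) (cube s) Z V < ennreal G"
proof -
 let ?A = "cube s"
 let ?f = "mixture W0 W1"
 have G': "G' > 0"
 proof (rule ccontr)
  assume "~ G' > 0"
  hence "ennreal G' = 0" by (simp add: ennreal_neg)
  thus False using freq by simp
 qed
 \<comment> \<open>Five errors are paid for: the perimeter of the cut and, in the outer region, the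
   constant of the growth bound, the corner Hessian, the Hessian of the recovery sequence in the
   shell, and the lower-order terms.\<close>
 define kp where "kp = (G - G') / 5"
 have kp: "kp > 0" using GG by (simp add: kp_def)
 define dP where "dP = real CARD('d) * norm P"
 have dP: "dP >= 0" by (simp add: dP_def)
 obtain rm where rm: "rm < s" "!!r. r >= rm ==> emeasure leb (cube s - cube r) <= ennreal (kp / \<beta>)"
  using cube_volume_layer[OF s, of "kp / \<beta>"] kp \<alpha>\<beta>(2) by auto
 define kph where "kph = kp / (\<beta> * (dP + 1))"
 have kph: "kph > 0" using kp \<alpha>\<beta>(2) dP by (simp add: kph_def)
 obtain rh mu0 where rh: "s / 2 < rh" "rh < s" and mu0: "0 < mu0" "mu0 <= 1" and
  hess: "!!mu. 0 < mu ==> mu <= mu0 ==> (\<integral>\<^sup>+y\<in>cube s - cube rh. ennreal (norm (cor_hess mu i s y)) \<partial>leb) <= ennreal kph"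
  using cor_hess_layer(1)[OF s kph, of i] by blast
 define R0 where "R0 = max rh (max rm rv)"
 have R0: "R0 < s" "rh <= R0" "rm <= R0" "rv <= R0" using rh rm rv by (auto simp: R0_def)
 have bd: "AE x in leb. x : cube s --> \<bar>tht x - step_fun a b (e i) x\<bar> <= 1"
  using tht(2) by eventually_elim (use ab in "auto simp: step_fun_def")
 obtain r eps where r: "R0 < r" "0 < r" "r < s" and eps: "0 < eps" and
  glue: "!!X. sint (cube s) X ==> (LINT x:cube s|leb. norm (X x - tht x)) < eps ==>
  EX t. r < t & t < s & total_variation (cube s) (%x. if x : cube t then X x else step_fun a b (e i) x) \<le>
  total_variation (cube s) X + ennreal kp"
  using glue_step_fun[OF s tht(1) bd tht(3) kp R0(1)] by blast
 \<comment> \<open>Coercivity bounds the Hessian mass of the recovery sequence by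
   \<open>G' / \<alpha>\<close>; with this many shells one of them carries at most
   \<open>kp / \<beta>\<close> of it.\<close>
 define M where "M = Suc (nat \<lceil>\<beta> * G' / (\<alpha> * kp)\<rceil>)"
 have M: "M > 0" "\<beta> * (G' / \<alpha> / real M) <= kp"
 proof -
  show M0: "M > 0" by (simp add: M_def)
  have "\<beta> * G' / (\<alpha> * kp) <= real M" unfolding M_def by linarith
  hence "\<beta> * G' <= real M * (\<alpha> * kp)" using \<alpha>\<beta>(1) kp by (simp add: divide_le_eq)
  thus "\<beta> * (G' / \<alpha> / real M) <= kp" using \<alpha>\<beta>(1) M0 by (simp add: divide_le_eq mult_ac)
 qed
 define p where "p m = R0 + (r - R0) * (real m / real M)" for m
 have p0: "p m < p (Suc m)" for m
  unfolding p_def using r(1) M(1) by (intro add_strict_left_mono mult_strict_left_mono divide_strict_right_mono) auto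
 have pM: "p M = r" using M(1) by (simp add: p_def)
 have pR: "R0 <= p m" for m using r(1) by (simp add: p_def)
 have pr: "p m <= r" if "m <= M" for m
 proof -
  have "(r - R0) * (real m / real M) <= (r - R0) * 1" using r(1) that M(1) by (intro mult_left_mono) auto
  thus ?thesis by (simp add: p_def)
 qed
 define gl where "gl m c \<longleftrightarrow> (\<forall>U GU (HU :: real^'n => real^'n^'n^'d) W GW HW. W21_data ?A U GU HU --> W21_data ?A W GW HW -->
  (EX V GV HV. W21_data ?A V GV HV & (ALL x. x ~: cube (p (Suc m)) --> V x = W x) & (\<forall>x\<in>cube (p m). HV x = HU x) \<and>
  (ALL x. norm (HV x) <= norm (HW x) + idc (cube (p (Suc m))) x * norm (HU x) + c * (norm (U x - W x) + norm (GU x - GW x)))))" for m c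
 have "\<exists>c\<ge>0. gl m c" if "m < M" for m
  unfolding gl_def by (rule glue_hessian[where s=s, OF p0]) (use pr[of "Suc m"] that r(3) in auto)
 then obtain cm where cm: "!!m. m < M ==> cm m >= 0" and cmV: "!!m. m < M ==> gl m (cm m)" by metis
 \<comment> \<open>The shell is selected after the index \<open>n\<close>, so \<open>c\<close> has
   to dominate the constants of all shells.\<close>
 define c where "c = (\<Sum>m<M. cm m)"
 have c: "c >= 0" "!!m. m < M ==> cm m <= c" unfolding c_def
  by (auto intro!: sum_nonneg member_le_sum simp: cm)
 \<comment> \<open>The lower-order term collects four L1 distances, those of two functions and two
   gradients, each below \<open>dl\<close>; adding 1 to \<open>c\<close> avoids a division by
   0.\<close>
 define dl where "dl = kp / (4 * \<beta> * (c + 1))"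
 have dl: "dl > 0" using kp \<alpha>\<beta>(2) c(1) by (simp add: dl_def)
 define mus where "mus k = mu0 / real (Suc k)" for k
 have mus: "0 < mus k" "mus k <= mu0" "mus k <= 1" for k
  using mu0 by (auto simp: mus_def divide_le_eq intro: order_trans)
 have mul: "mus \<longlonglongrightarrow> 0" unfolding mus_def by (rule LIMSEQ_Suc[OF lim_const_over_n])
 note ct = cmp_lim[OF s CD mus(1,3) mul]
 have "\<forall>\<^sub>F k in sequentially. (LINT x:?A|leb. norm (cmp D P i s (mus k) x - wedge_fun C D (e i) x)) < dl \<and>
  (LINT x:?A|leb. norm (cmp_grad D P i s (mus k) x - wedge_grad D P i x)) < dl"
  using ct(1,2) dl by (auto simp: L1_tendsto_def intro!: eventually_conj order_tendstoD(2))
 then obtain k where k: "(LINT x:?A|leb. norm (cmp D P i s (mus k) x - wedge_fun C D (e i) x)) < dl"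
  "(LINT x:?A|leb. norm (cmp_grad D P i s (mus k) x - wedge_grad D P i x)) < dl" by (auto simp: eventually_sequentially)
 define mu where "mu = mus k"
 have mu: "0 < mu" "mu <= mu0" "mu <= 1" using mus by (simp_all add: mu_def)
 define Wf where "Wf = cmp D P i s mu"
 define GW where "GW = cmp_grad D P i s mu"
 define HW :: "real^'n => real^'n^'n^'d" where "HW = cmp_hess P i s mu"
 have Wd: "W21_data ?A Wf GW HW" unfolding Wf_def GW_def HW_def by (rule cmp_W21[OF s mu(1,3)])
 have "\<forall>\<^sub>F n in sequentially. (LINT x:?A|leb. norm (X n x - tht x)) < eps & (LINT x:?A|leb. norm (U n x - v x)) < dl \<and>
  (LINT x:?A|leb. norm (weak_gradient ?A (U n) x - Gv x)) < dl"
  using X(2) U(2,3) dl eps by (auto simp: L1_tendsto_def intro!: eventually_conj order_tendstoD(2))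
 \<comment> \<open>The energy bound holds for infinitely many indices and the closeness for all
   large ones; together they give one common index.\<close>
 from frequently_ex[OF frequently_eventually_frequently[OF freq this]]
 obtain n where en: "energy ?f ?A (X n) (U n) < ennreal G'" and Xn: "(LINT x:?A|leb. norm (X n x - tht x)) < eps"
  and Un: "(LINT x:?A|leb. norm (U n x - v x)) < dl" "(LINT x:?A|leb. norm (weak_gradient ?A (U n) x - Gv x)) < dl" by blast
 define GU where "GU = weak_gradient ?A (U n)"
 define HU where "HU = weak_hessian ?A (U n)"
 have Ud: "W21_data ?A (U n) GU HU" unfolding GU_def HU_def by (rule W21_data_W21[OF U(1)])
 have Xi: "sint ?A (X n)" and Xv: "total_variation ?A (X n) < \<infinity>" and X01: "AE x in leb. x : ?A --> X n x : {0, 1}"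
  using X(1)[of n] by (auto simp: BV01_def BV_def)
 obtain t where t: "r < t" "t < s" and
  tv: "total_variation ?A (%x. if x : cube t then X n x else step_fun a b (e i) x) <= total_variation ?A (X n) + ennreal kp"
  using glue[OF Xi Xn] by blast
 define Z where "Z x = (if x : cube t then X n x else step_fun a b (e i) x)" for x
 have Hsym: "AE x in leb. x : ?A --> HU x : sym_tensors" by (rule W21_data_imp_W21(3)[OF open_cube Ud])
 have en': "(\<integral>\<^sup>+x\<in>?A. ennreal (?f (X n x) (HU x)) \<partial>leb) + total_variation ?A (X n) < ennreal G'"
  using en X(1) U(1) by (simp add: energy_def HU_def)
 have HUn: "sint ?A (%x. norm (HU x))" by (rule set_integrable_norm[OF W21_dataD(3)[OF Ud]])
 have JU: "(LINT x:?A|leb. norm (HU x)) <= G' / \<alpha>"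
 proof -
  have "ennreal (LINT x:?A|leb. \<alpha> * norm (HU x)) = (\<integral>\<^sup>+x\<in>?A. ennreal (\<alpha> * norm (HU x)) \<partial>leb)"
  by (rule snint_eq_int[symmetric]) (use HUn \<alpha>\<beta> in auto)
  also have "\<dots> <= (\<integral>\<^sup>+x\<in>?A. ennreal (?f (X n x) (HU x)) \<partial>leb)"
  proof (rule nn_integral_mono_AE)
  show "AE x in leb. ennreal (\<alpha> * norm (HU x)) * idc ?A x <= ennreal (?f (X n x) (HU x)) * idc ?A x"
  using X01 Hsym by eventually_elim (use growth in "auto simp: indicator_def intro!: ennreal_leI")
  qed
  also have "\<dots> <= ennreal G'" by (rule order_trans[OF add_increasing2[OF zero_le order_refl] less_imp_le[OF en']])
  finally have "(LINT x:?A|leb. \<alpha> * norm (HU x)) <= G'" using G' by (simp add: ennreal_le_iff)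
  thus ?thesis using \<alpha>\<beta>(1) by (simp add: le_divide_eq mult.commute)
 qed
 obtain m where m: "m < M" and layer: "(LINT x:cube (p (Suc m)) - cube (p m)|leb. norm (HU x)) <= G' / \<alpha> / real M"
 proof -
  have "p M <= s" using pM r(3) by simp
  from layer_pigeonhole[where p=p, OF HUn norm_ge_zero M(1) less_imp_le[OF p0] this JU] that show thesis by blast
 qed
 let ?p = "p m" and ?q = "p (Suc m)"
 have pq: "R0 <= ?p" "?p < ?q" "?q <= r" using pR p0 pr[of "Suc m"] m by auto
 obtain V GV HV where V: "W21_data ?A V GV HV" "!!x. x ~: cube ?q ==> V x = Wf x" "!!x. x : cube ?p ==> HV x = HU x"
  "!!x. norm (HV x) <= norm (HW x) + idc (cube ?q) x * norm (HU x) + cm m * (norm (U n x - Wf x) + norm (GU x - GW x))"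
  using cmV[OF m, unfolded gl_def, rule_format, OF Ud Wd] by blast
 note V' = W21_data_imp_W21[OF open_cube V(1)]
 have Zi: "sint ?A Z"
 proof -
  have "sint (cube t \<union> (?A - cube t)) Z"
  proof (rule set_integrable_Un)
  have "sint (cube t) Z \<longleftrightarrow> sint (cube t) (X n)"
  by (rule set_integrable_cong) (auto simp: Z_def)
  moreover have "cube t <= ?A" using t(2) by (intro cube_mono) simp
  ultimately show "sint (cube t) Z" using set_integrable_subset[OF Xi] by simp
  have "sint (?A - cube t) Z \<longleftrightarrow> sint (?A - cube t) (step_fun a b (e i))"
  by (rule set_integrable_cong) (auto simp: Z_def)
  moreover have "bounded (?A - cube t)" by (rule bounded_subset[OF bdd_cube[of s]]) auto
  ultimately show "sint (?A - cube t) Z" using step_fun_intg(1)[of "?A - cube t"] by simp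
  qed auto
  moreover have "cube t \<union> (?A - cube t) = ?A" using t(2) cube_mono[of t s] by auto
  ultimately show ?thesis by simp
 qed
 have Z01: "AE x in leb. x : ?A --> Z x : {0, 1}"
  using X01 by eventually_elim (use ab in "auto simp: Z_def step_fun_def")
 have ZBV: "Z : BV01 ?A"
 proof -
  have "total_variation ?A Z < \<infinity>" using tv Xv by (auto simp: Z_def[abs_def] intro: le_less_trans)
  thus ?thesis using Zi Z01 by (simp add: BV01_def BV_def)
 qed
 \<comment> \<open>The competitor agrees with the recovery sequence in \<open>cube ?p\<close>, so
   all bulk errors are confined to \<open>S\<close>.\<close>
 define S where "S = ?A - cube ?p"
 have S: "S : sets leb" "S <= ?A" by (auto simp: S_def)
 let ?d = "%x. norm (U n x - Wf x) + norm (GU x - GW x)"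
 define B where "B x = \<beta> * (1 + norm (HW x) + idc (cube ?q) x * norm (HU x) + c * ?d x)" for x
 have B0: "B x >= 0" for x using \<alpha>\<beta>(2) c(1) by (auto simp: B_def intro!: mult_nonneg_nonneg add_nonneg_nonneg)
 have i1: "sint S (%x. 1 :: real)"
  by (rule set_integrable_subset[OF sint_const_cube S])
 have i2: "sint S (%x. norm (HW x))"
  by (rule set_integrable_subset[OF set_integrable_norm[OF W21_dataD(3)[OF Wd]] S])
 have i3: "sint S (%x. idc (cube ?q) x * norm (HU x))"
 proof -
  have "sint (S \<inter> cube ?q) (%x. norm (HU x))" by (rule set_integrable_subset[OF HUn]) (use S in auto)
  thus ?thesis by (simp add: set_integrable_def indicator_inter_arith mult.assoc)
 qed
 note iU = W21_dataD(1,2)[OF Ud] and iW = W21_dataD(1,2)[OF Wd]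
 have id: "sint ?A ?d"
  by (intro set_integral_add(1) set_integrable_norm set_integral_diff(1) iU iW)
 have i4: "sint S ?d" by (rule set_integrable_subset[OF id S])
 have iB: "sint S B"
  unfolding B_def by (intro set_integrable_mult_right set_integral_add(1) i1 i2 i3 i4)
 have L: "(LINT x:S|leb. B x) = \<beta> * ((LINT x:S|leb. 1) + (LINT x:S|leb. norm (HW x)) +
  (LINT x:S|leb. idc (cube ?q) x * norm (HU x)) + c * (LINT x:S|leb. ?d x))"
  unfolding B_def using i1 i2 i3 i4 by (simp add: set_integral_add)
 have L1: "\<beta> * (LINT x:S|leb. 1) <= kp"
 proof -
  have "ennreal (LINT x:S|leb. 1) = (\<integral>\<^sup>+x\<in>S. ennreal 1 \<partial>leb)"
  by (rule snint_eq_int[symmetric, OF i1]) simp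
  also have "\<dots> = emeasure leb S" using S by simp
  also have "\<dots> <= ennreal (kp / \<beta>)" unfolding S_def by (rule rm(2)) (use R0 pq in auto)
  finally have "(LINT x:S|leb. 1) <= kp / \<beta>" using kp \<alpha>\<beta>(2) by (simp add: ennreal_le_iff)
  thus ?thesis using \<alpha>\<beta>(2) by (simp add: le_divide_eq mult.commute)
 qed
 have L2: "\<beta> * (LINT x:S|leb. norm (HW x)) <= kp"
 proof -
  have ch: "sint S (%x. norm (cor_hess mu i s x))"
  by (rule set_integrable_subset[OF set_integrable_norm[OF cor_hess_layer(2)[OF s zero_less_one mu(1,3)]] S])
  have "ennreal (LINT x:S|leb. norm (cor_hess mu i s x)) = (\<integral>\<^sup>+x\<in>S. ennreal (norm (cor_hess mu i s x)) \<partial>leb)"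
  by (rule snint_eq_int[symmetric, OF ch]) simp
  also have "\<dots> <= (\<integral>\<^sup>+x\<in>cube s - cube rh. ennreal (norm (cor_hess mu i s x)) \<partial>leb)"
  using cube_mono[of rh ?p] R0 pq by (intro nn_integral_mono) (auto simp: S_def indicator_def)
  also have "\<dots> <= ennreal kph" by (rule hess[OF mu(1,2)])
  finally have ch': "(LINT x:S|leb. norm (cor_hess mu i s x)) <= kph" using kph by (simp add: ennreal_le_iff)
  have "(LINT x:S|leb. norm (HW x)) <= (LINT x:S|leb. dP * norm (cor_hess mu i s x))"
  by (rule set_integral_mono[OF i2]) (use ch cmp_hess_norm in "auto simp: HW_def dP_def")
  also have "\<dots> = dP * (LINT x:S|leb. norm (cor_hess mu i s x))" by simp
  also have "\<dots> <= dP * kph" by (rule mult_left_mono[OF ch' dP])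
  also have "\<dots> <= (dP + 1) * kph" by (rule mult_right_mono) (use kph in simp_all)
  finally have "\<beta> * (LINT x:S|leb. norm (HW x)) <= \<beta> * ((dP + 1) * kph)" using \<alpha>\<beta>(2) by (intro mult_left_mono) auto
  also have "\<dots> = kp" using \<alpha>\<beta>(2) dP by (simp add: kph_def)
  finally show ?thesis .
 qed
 have L3: "\<beta> * (LINT x:S|leb. idc (cube ?q) x * norm (HU x)) <= kp"
 proof -
  have "S \<inter> cube ?q = cube ?q - cube ?p" using cube_mono[of ?q s] pq r(3) by (auto simp: S_def)
  hence "(LINT x:S|leb. idc (cube ?q) x * norm (HU x)) = (LINT x:cube ?q - cube ?p|leb. norm (HU x))"
  by (simp add: set_lebesgue_integral_def indicator_inter_arith[symmetric] mult.assoc[symmetric])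
  hence "\<beta> * (LINT x:S|leb. idc (cube ?q) x * norm (HU x)) <= \<beta> * (G' / \<alpha> / real M)"
  using layer \<alpha>\<beta>(2) by (simp only: mult_le_cancel_left_pos)
  thus ?thesis using M(2) by (rule order_trans)
 qed
 have L4: "\<beta> * (c * (LINT x:S|leb. ?d x)) <= kp"
 proof -
  let ?w = "wedge_fun C D (e i)" and ?g = "wedge_grad D P i"
  let ?h = "%x. (norm (U n x - v x) + norm (GU x - Gv x)) + (norm (Wf x - ?w x) + norm (GW x - ?g x))"
  have iv: "sint ?A v" "sint ?A Gv" "sint ?A ?w" "sint ?A ?g"
  using U(2,3) ct(1,2) by (auto simp: L1_tendsto_def)
  have ii: "sint ?A (%x. norm (U n x - v x))" "sint ?A (%x. norm (GU x - Gv x))"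
  "sint ?A (%x. norm (Wf x - ?w x))" "sint ?A (%x. norm (GW x - ?g x))"
  by (intro set_integrable_norm set_integral_diff(1) iU iW iv)+
  have ih: "sint ?A ?h" by (intro set_integral_add(1) ii)
  \<comment> \<open>On \<open>S\<close> the limit \<open>v\<close> coincides with the wedge, so the
    recovery sequence and the smoothed wedge can be compared through their common limit.\<close>
  have "(LINT x:S|leb. ?d x) <= (LINT x:S|leb. ?h x)"
  proof (rule set_integral_mono_AE[OF i4 set_integrable_subset[OF ih S]])
  have Sr: "S <= ?A - cube rv" using cube_mono[of rv ?p] R0 pq by (auto simp: S_def)
  show "AE x\<in>S in leb. ?d x <= ?h x"
  using rv(2,3)
  proof eventually_elim
  case (elim x)
  show ?case
  proof
  assume "x : S"
  hence "v x = ?w x" "Gv x = ?g x" using elim Sr by auto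
  hence "norm (U n x - Wf x) <= norm (U n x - v x) + norm (Wf x - ?w x)" "norm (GU x - GW x) <= norm (GU x - Gv x) + norm (GW x - ?g x)"
  using norm_triangle_ineq4[of "U n x - v x" "Wf x - ?w x"] norm_triangle_ineq4[of "GU x - Gv x" "GW x - ?g x"] by simp_all
  thus "?d x <= ?h x" by simp
  qed
  qed
  qed
  also have "\<dots> <= (LINT x:?A|leb. ?h x)" by (rule sintl_subset_le[OF ih _ S(2,1)]) simp
  also have "\<dots> = ((LINT x:?A|leb. norm (U n x - v x)) + (LINT x:?A|leb. norm (GU x - Gv x))) +
  ((LINT x:?A|leb. norm (Wf x - ?w x)) + (LINT x:?A|leb. norm (GW x - ?g x)))"
  using ii by (simp add: set_integral_add)
  also have "\<dots> <= (dl + dl) + (dl + dl)"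
  using Un k unfolding Wf_def GW_def mu_def GU_def by (intro add_mono less_imp_le)
  finally have d: "(LINT x:S|leb. ?d x) <= 4 * dl" by simp
  have "c * (LINT x:S|leb. ?d x) <= c * (4 * dl)" by (rule mult_left_mono[OF d c(1)])
  also have "\<dots> <= (c + 1) * (4 * dl)" by (rule mult_right_mono) (use dl in simp_all)
  finally have "\<beta> * (c * (LINT x:S|leb. ?d x)) <= \<beta> * ((c + 1) * (4 * dl))" using \<alpha>\<beta>(2) by (intro mult_left_mono) auto
  also have "\<dots> = kp" using \<alpha>\<beta>(2) c(1) by (simp add: dl_def)
  finally show ?thesis .
 qed
 have LB: "(LINT x:S|leb. B x) <= 4 * kp"
  unfolding L distrib_left using L1 L2 L3 L4 by simp
 have "(\<integral>\<^sup>+x\<in>?A. ennreal (?f (Z x) (weak_hessian ?A V x)) \<partial>leb) \<le>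
  (\<integral>\<^sup>+x. ennreal (?f (X n x) (HU x)) * idc ?A x + ennreal (B x) * idc S x \<partial>leb)"
 proof (rule nn_integral_mono_AE)
  show "AE x in leb. ennreal (?f (Z x) (weak_hessian ?A V x)) * idc ?A x \<le>
  ennreal (?f (X n x) (HU x)) * idc ?A x + ennreal (B x) * idc S x"
  using X01 Z01 V'(2,3) Hsym
  proof eventually_elim
  case (elim x)
  show ?case
  proof (cases "x : ?A")
  case A: True
  hence el: "X n x : {0, 1}" "Z x : {0, 1}" "weak_hessian ?A V x = HV x" "HV x : sym_tensors" using elim by auto
  show ?thesis
  proof (cases "x : cube ?p")
  case True
  hence "x : cube t" using cube_mono[of ?p t] pq t(1) by auto
  thus ?thesis using True A el(3) V(3)[OF True] by (simp add: Z_def S_def)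
  next
  case False
  have "?f (Z x) (HV x) <= \<beta> * (1 + norm (HV x))" using growth[OF el(2,4)] by blast
  also have "\<dots> <= B x" unfolding B_def
  proof (rule mult_left_mono)
  have "cm m * ?d x <= c * ?d x" by (rule mult_right_mono[OF c(2)[OF m]]) simp
  thus "1 + norm (HV x) <= 1 + norm (HW x) + idc (cube ?q) x * norm (HU x) + c * ?d x"
  using V(4)[of x] by linarith
  qed (use \<alpha>\<beta>(2) in simp)
  finally have "ennreal (?f (Z x) (HV x)) <= ennreal (B x)" by (rule ennreal_leI)
  thus ?thesis using A False el(3) by (simp add: S_def add_increasing)
  qed
  qed (simp add: S_def)
  qed
 qed
 also have "\<dots> = (\<integral>\<^sup>+x\<in>?A. ennreal (?f (X n x) (HU x)) \<partial>leb) + (\<integral>\<^sup>+x\<in>S. ennreal (B x) \<partial>leb)"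
 proof (rule nn_integral_add)
  show "(%x. ennreal (?f (X n x) (HU x)) * idc ?A x) : lbm"
  by (rule mixture_bm[OF W Xi W21_dataD(3)[OF Ud] Hsym]) simp
  have "(%x. ennreal (idc S x *\<^sub>R B x)) : lbm"
  using iB by (intro measurable_compose[OF _ measurable_ennreal]) (simp add: set_integrable_def)
  moreover have "ennreal (idc S x *\<^sub>R B x) = ennreal (B x) * idc S x" for x by (simp add: indicator_def)
  ultimately show "(%x. ennreal (B x) * idc S x) : lbm" by simp
 qed
 also have "(\<integral>\<^sup>+x\<in>S. ennreal (B x) \<partial>leb) = ennreal (LINT x:S|leb. B x)"
  by (rule snint_eq_int[OF iB B0])
 also have "\<dots> <= ennreal (4 * kp)" by (rule ennreal_leI[OF LB])
 finally have e1: "(\<integral>\<^sup>+x\<in>?A. ennreal (?f (Z x) (weak_hessian ?A V x)) \<partial>leb) \<le>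
  (\<integral>\<^sup>+x\<in>?A. ennreal (?f (X n x) (HU x)) \<partial>leb) + ennreal (4 * kp)" by simp
 have "energy ?f ?A Z V = (\<integral>\<^sup>+x\<in>?A. ennreal (?f (Z x) (weak_hessian ?A V x)) \<partial>leb) + total_variation ?A Z"
  using ZBV V'(1) by (simp add: energy_def)
 also have "\<dots> <= ((\<integral>\<^sup>+x\<in>?A. ennreal (?f (X n x) (HU x)) \<partial>leb) + ennreal (4 * kp)) + (total_variation ?A (X n) + ennreal kp)"
  using e1 tv unfolding Z_def[abs_def] by (rule add_mono)
 also have "\<dots> = ((\<integral>\<^sup>+x\<in>?A. ennreal (?f (X n x) (HU x)) \<partial>leb) + total_variation ?A (X n)) + (ennreal (4 * kp) + ennreal kp)"
  by (simp add: ac_simps)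
 also have "ennreal (4 * kp) + ennreal kp = ennreal (5 * kp)" using kp by (subst ennreal_plus[symmetric]) auto
 also have "((\<integral>\<^sup>+x\<in>?A. ennreal (?f (X n x) (HU x)) \<partial>leb) + total_variation ?A (X n)) + ennreal (5 * kp) < ennreal G' + ennreal (5 * kp)"
  using ennreal_add_left_cancel_less[of "ennreal (5 * kp)"] en' by (simp only: add.commute[of _ "ennreal (5 * kp)"]) simp
 also have "\<dots> = ennreal G" 
 proof -
  have "G' + 5 * kp = G" by (simp add: kp_def diff_divide_distrib)
  thus ?thesis using G' kp by (subst ennreal_plus[symmetric]) auto
 qed
 finally have "energy ?f ?A Z V < ennreal G" .
 moreover have "\<exists>t<s. ALL y. y ~: cube t --> Z y = step_fun a b (e i) y"
  using t(2) by (intro exI[of _ t]) (simp add: Z_def)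
 moreover have "\<exists>q<s. EX Wf. continuous_on UNIV Wf & (\<forall>y\<in>frontier ?A. Wf y = wedge_fun C D (e i) y) & (ALL y. y ~: cube q --> V y = Wf y)"
 proof (intro exI conjI allI impI ballI)
  show "continuous_on UNIV Wf" unfolding Wf_def cmp_def[abs_def]
  by (intro continuous_on_add continuous_on_scaleR continuous_on_const cont_corner linear_continuous_on[OF matrix_vector_mul_bounded_linear])
  show "?q < s" using pq r(3) by simp
  show "Wf y = wedge_fun C D (e i) y" if y: "y : frontier ?A" for y
  proof -
  have "\<bar>corner mu i s y - max 0 (y \<bullet> e i)\<bar> <= mu * bd_wt s y / 2" by (rule cor_diff) (use mu(1) in simp)
  hence "corner mu i s y = max 0 (y \<bullet> e i)" using bd_wt_fr[OF y s] by simp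
  thus ?thesis unfolding Wf_def cmp_def wedge_fun_eq[OF CD] by simp
  qed
 qed (rule V(2))
 ultimately show ?thesis using ZBV V'(1) by blast
qed

end

subsection \<open>Rescaling\<close>

lemma affine_leb:
 fixes t :: "'a::euclidean_space"
 assumes "c > 0"
 shows "leb = density (distr leb leb (%x. t + c *\<^sub>R x)) (%_. ennreal (c ^ DIM('a)))"
  "(%x. t + c *\<^sub>R x) : leb \<rightarrow>\<^sub>M leb"
proof -
 have eq: "(\<Sum>j\<in>Basis. (c * (x \<bullet> j)) *\<^sub>R j) = c *\<^sub>R x" for x :: 'a
  by (simp add: scaleR_sum_right[symmetric] euclidean_representation flip: scaleR_scaleR)
 show "leb = density (distr leb leb (%x. t + c *\<^sub>R x)) (%_. ennreal (c ^ DIM('a)))"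
  using lebesgue_affine_euclidean[of "%_. c" t] assms by (simp add: prod_constant eq)
 show "(%x. t + c *\<^sub>R x) : leb \<rightarrow>\<^sub>M leb"
  using lebesgue_affine_measurable[of "%_. c" t] assms by (simp add: eq)
qed

lemmas leb_eq_density_scaleR = affine_leb(1)[where t=0, unfolded add_0]

lemma meas_scaleR_leb: "(%x::'a::euclidean_space. c *\<^sub>R x) : leb \<rightarrow>\<^sub>M leb"
 by (rule lebesgue_measurable_scaling)

lemma nn_int_leb_scaleR:
 fixes f :: "'a::euclidean_space => ennreal"
 assumes c: "c > 0" and f: "f : lbm"
 shows "(\<integral>\<^sup>+x. f x \<partial>leb) = ennreal (c ^ DIM('a)) * (\<integral>\<^sup>+x. f (c *\<^sub>R x) \<partial>leb)"
proof -
 have "(\<integral>\<^sup>+x. f x \<partial>leb) = (\<integral>\<^sup>+x. f x \<partial>density (distr leb leb (%x::'a. c *\<^sub>R x)) (%_. ennreal (c ^ DIM('a))))"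
  using leb_eq_density_scaleR[OF c, where 'a='a] by simp
 also have "\<dots> = (\<integral>\<^sup>+x. ennreal (c ^ DIM('a)) * f x \<partial>distr leb leb (%x. c *\<^sub>R x))"
  by (rule nn_integral_density) (use f in auto)
 also have "\<dots> = (\<integral>\<^sup>+x. ennreal (c ^ DIM('a)) * f (c *\<^sub>R x) \<partial>leb)"
  by (rule nn_integral_distr[OF meas_scaleR_leb]) (use f in auto)
 also have "\<dots> = ennreal (c ^ DIM('a)) * (\<integral>\<^sup>+x. f (c *\<^sub>R x) \<partial>leb)"
  by (rule nn_integral_cmult) (use measurable_compose[OF meas_scaleR_leb f] in auto)
 finally show ?thesis .
qed

lemma int_leb_affine:
 fixes f :: "'a::euclidean_space => 'b::euclidean_space"
 assumes c: "c > 0" and f: "integrable leb f"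
 shows "integrable leb (%x. f (t + c *\<^sub>R x))" "(\<integral>x. f x \<partial>leb) = c ^ DIM('a) *\<^sub>R (\<integral>x. f (t + c *\<^sub>R x) \<partial>leb)"
proof -
 have fm: "f : lbm" using f by auto
 let ?D = "distr leb leb (%x::'a. t + c *\<^sub>R x)"
 have fd: "f : borel_measurable ?D" using fm by simp
 note eq = affine_leb(1)[OF c, of t]
 have "integrable (density ?D (%_. ennreal (c ^ DIM('a)))) f" using f eq by simp
 hence "integrable ?D (%x. c ^ DIM('a) *\<^sub>R f x)"
  by (subst (asm) integrable_density) (use c fd in auto)
 from integrable_scaleR_right[of "inverse (c ^ DIM('a))", OF this] have "integrable ?D f" using c by simp
 thus "integrable leb (%x. f (t + c *\<^sub>R x))" by (rule integrable_distr[OF affine_leb(2)[OF c]])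
 have "(\<integral>x. f x \<partial>leb) = (\<integral>x. f x \<partial>density ?D (%_. ennreal (c ^ DIM('a))))" using eq by simp
 also have "\<dots> = (\<integral>x. c ^ DIM('a) *\<^sub>R f x \<partial>?D)" by (rule integral_density) (use c fd in auto)
 also have "\<dots> = (\<integral>x. c ^ DIM('a) *\<^sub>R f (t + c *\<^sub>R x) \<partial>leb)"
  by (rule integral_distr[OF affine_leb(2)[OF c]]) (use fm in auto)
 finally show "(\<integral>x. f x \<partial>leb) = c ^ DIM('a) *\<^sub>R (\<integral>x. f (t + c *\<^sub>R x) \<partial>leb)" by simp
qed

lemmas int_leb_scaleR = int_leb_affine[where t=0, unfolded add_0]

lemma sintl_scaleR:
 fixes f :: "'a::euclidean_space => 'b::euclidean_space"
 assumes c: "c > 0" and A: "!!x. x : A' \<longleftrightarrow> c *\<^sub>R x : A" and f: "sint A f"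
 shows "sint A' (%x. f (c *\<^sub>R x))"
  "(LINT x:A|leb. f x) = c ^ DIM('a) *\<^sub>R (LINT x:A'|leb. f (c *\<^sub>R x))"
proof -
 have i: "idc A' x = (idc A (c *\<^sub>R x) :: real)" for x by (simp add: indicator_def A)
 show "sint A' (%x. f (c *\<^sub>R x))"
  "(LINT x:A|leb. f x) = c ^ DIM('a) *\<^sub>R (LINT x:A'|leb. f (c *\<^sub>R x))"
  using int_leb_scaleR[OF c f[unfolded set_integrable_def]] by (simp_all add: set_integrable_def set_lebesgue_integral_def i)
qed

lemma AE_leb_scaleR:
 assumes c: "c > 0" and P: "AE x in leb. P (x :: 'a::euclidean_space)"
 shows "AE x in leb. P (c *\<^sub>R x)"
proof -
 obtain N where N: "{x. ~ P x} <= N" "emeasure leb N = 0" "N : sets leb" using AE_E[OF P] by auto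
 have m: "(%x. idc N (c *\<^sub>R x) :: ennreal) : lbm"
  by (rule measurable_compose[OF meas_scaleR_leb borel_measurable_indicator[OF N(3)]])
 have "(\<integral>\<^sup>+x. idc N x \<partial>leb) = ennreal (c ^ DIM('a)) * (\<integral>\<^sup>+x. idc N (c *\<^sub>R x) \<partial>leb)"
  by (rule nn_int_leb_scaleR[OF c borel_measurable_indicator[OF N(3)]])
 hence "ennreal (c ^ DIM('a)) * (\<integral>\<^sup>+x. idc N (c *\<^sub>R x) \<partial>(leb :: 'a measure)) = 0"
  by (simp only: nn_integral_indicator[OF N(3)] N(2))
 hence "(\<integral>\<^sup>+x. idc N (c *\<^sub>R x) \<partial>(leb :: 'a measure)) = 0" using c by simp
 hence "AE x in leb. (idc N (c *\<^sub>R x) :: ennreal) = 0" using nn_integral_0_iff_AE[OF m] by simp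
 thus ?thesis by eventually_elim (use N(1) in \<open>auto simp: indicator_def split: if_splits\<close>)
qed

lemma tf_rescale:
 fixes ph :: "'a::euclidean_space => 'b::real_normed_vector"
 assumes c: "c > 0" and A: "!!x. x : A' \<longleftrightarrow> c *\<^sub>R x : A" and ph: "ph : tfs A'"
 shows "(%x. ph (x /\<^sub>R c)) : tfs A"
proof (rule tfE[OF ph])
 fix K assume K: "compact K" "K <= A'" "!!x. x ~: K ==> ph x = 0"
 show ?thesis
 proof (rule tfI[where K="(%x. c *\<^sub>R x) ` K"])
  show "C_k k (%x. ph (x /\<^sub>R c))" for k
  using C_k_compose_affine[OF tfD(1)[OF ph], of k "inverse c" 0] by simp
  show "compact ((%x. c *\<^sub>R x) ` K)" by (rule compact_scaling[OF K(1)])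
  show "(%x. c *\<^sub>R x) ` K <= A" using K(2) A by auto
  fix x assume "x ~: (%x. c *\<^sub>R x) ` K"
  moreover have "x = c *\<^sub>R (x /\<^sub>R c)" using c by simp
  ultimately have "x /\<^sub>R c ~: K" by blast
  thus "ph (x /\<^sub>R c) = 0" by (rule K(3))
 qed
qed

lemma pderiv_at_rescale:
 fixes ph :: "real^'n => 'b::real_normed_vector"
 assumes "C_k (Suc 0) ph"
 shows "pdv j (%x. ph (x /\<^sub>R c)) x = inverse c *\<^sub>R pdv j ph (x /\<^sub>R c)"
proof -
 have d: "(ph has_derivative fdv ph (at (x /\<^sub>R c))) (at (x /\<^sub>R c))"
  using assms by (simp add: frechet_derivative_works)
 have s: "((%x. x /\<^sub>R c) has_derivative (%v. v /\<^sub>R c)) (at x)" by (auto intro!: derivative_eq_intros)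
 have "((%x. ph (x /\<^sub>R c)) has_derivative (%v. fdv ph (at (x /\<^sub>R c)) (v /\<^sub>R c))) (at x)"
  by (rule has_derivative_compose[OF s d])
 from fun_cong[where x="axis j 1", OF frechet_derivative_at[OF this]]
 show ?thesis unfolding pderiv_at_def
  using linear_scale[OF has_derivative_linear[OF d], of "inverse c" "axis j 1"] by simp
qed

lemma wp_rescale:
 fixes w g :: "real^'n => 'b::euclidean_space"
 assumes c: "c > 0" and A: "!!x. x : A' \<longleftrightarrow> c *\<^sub>R x : A"
  and w: "weak_partial A j w g" "sint A w" "sint A g"
 shows "weak_partial A' j (%x. w (c *\<^sub>R x)) (%x. c *\<^sub>R g (c *\<^sub>R x))"
 unfolding weak_partial_def
proof
 fix ph :: "real^'n => real" assume ph: "ph : tfs A'"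
 let ?ph = "%x. ph (x /\<^sub>R c)" let ?N = "DIM(real^'n)"
 note t = tf_rescale[OF c A ph]
 have pd: "pdv j ?ph (c *\<^sub>R x) = inverse c * pdv j ph x" for x
  using pderiv_at_rescale[OF tfD(1)[OF ph], of j c "c *\<^sub>R x"] c by simp
 have "(LINT x:A|leb. pdv j ?ph x *\<^sub>R w x) = c ^ ?N *\<^sub>R (LINT x:A'|leb. pdv j ?ph (c *\<^sub>R x) *\<^sub>R w (c *\<^sub>R x))"
  by (rule sintl_scaleR(2)[OF c A sint_test_scaleR[OF w(2) tf_pderiv[OF t]]])
 also have "\<dots> = c ^ ?N *\<^sub>R inverse c *\<^sub>R (LINT x:A'|leb. pdv j ph x *\<^sub>R w (c *\<^sub>R x))"
  unfolding pd by (simp flip: scaleR_scaleR)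
 finally have l: "(LINT x:A|leb. pdv j ?ph x *\<^sub>R w x) = c ^ ?N *\<^sub>R inverse c *\<^sub>R (LINT x:A'|leb. pdv j ph x *\<^sub>R w (c *\<^sub>R x))" .
 have "(LINT x:A|leb. ?ph x *\<^sub>R g x) = c ^ ?N *\<^sub>R (LINT x:A'|leb. ?ph (c *\<^sub>R x) *\<^sub>R g (c *\<^sub>R x))"
  by (rule sintl_scaleR(2)[OF c A sint_test_scaleR[OF w(3) t]])
 also have "\<dots> = c ^ ?N *\<^sub>R (LINT x:A'|leb. ph x *\<^sub>R g (c *\<^sub>R x))" using c by simp
 finally have r: "(LINT x:A|leb. ?ph x *\<^sub>R g x) = c ^ ?N *\<^sub>R (LINT x:A'|leb. ph x *\<^sub>R g (c *\<^sub>R x))" .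
 have "c ^ ?N *\<^sub>R inverse c *\<^sub>R (LINT x:A'|leb. pdv j ph x *\<^sub>R w (c *\<^sub>R x)) = c ^ ?N *\<^sub>R (- (LINT x:A'|leb. ph x *\<^sub>R g (c *\<^sub>R x)))"
  using wpD[OF w(1) t] unfolding l r by simp
 hence "inverse c *\<^sub>R (LINT x:A'|leb. pdv j ph x *\<^sub>R w (c *\<^sub>R x)) = - (LINT x:A'|leb. ph x *\<^sub>R g (c *\<^sub>R x))"
  using c by (subst (asm) scaleR_cancel_left) simp
 hence "c *\<^sub>R inverse c *\<^sub>R (LINT x:A'|leb. pdv j ph x *\<^sub>R w (c *\<^sub>R x)) = c *\<^sub>R (- (LINT x:A'|leb. ph x *\<^sub>R g (c *\<^sub>R x)))" by simp
 thus "(LINT x:A'|leb. pdv j ph x *\<^sub>R w (c *\<^sub>R x)) = - (LINT x:A'|leb. ph x *\<^sub>R c *\<^sub>R g (c *\<^sub>R x))"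
  using c by (simp only: scaleR_left_commute[of _ c] set_integral_scaleR_right) simp
qed

text \<open>Division by \<open>c\<close> keeps gradients at their size and leaves the wedge, which
  is homogeneous of degree one, invariant; the Hessian acquires the factor \<open>c\<close>.\<close>

lemma W21_data_rescale:
 fixes u :: "real^'n => real^'d"
 assumes c: "c > 0" and A: "!!x. x : A' \<longleftrightarrow> c *\<^sub>R x : A" and u: "W21_data A u G H"
 shows "W21_data A' (%x. u (c *\<^sub>R x) /\<^sub>R c) (%x. G (c *\<^sub>R x)) (%x. c *\<^sub>R H (c *\<^sub>R x))"
proof -
 note d = W21_data_components[OF u]
 note sc = sintl_scaleR(1)[OF c A]
 have bl: "bounded_linear (%x::real. inverse c * x)" by (rule bounded_linear_mult_right)
 show ?thesis
 proof (rule W21_dataI)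
  show "sint A' (%x. u (c *\<^sub>R x) /\<^sub>R c)"
  by (rule sint_blin(1)[OF bounded_linear_scaleR_right sc[OF W21_dataD(1)[OF u]]])
  fix a j k
  show "sint A' (%x. G (c *\<^sub>R x) $ a $ j)" by (rule sc[OF d(2)])
  show "sint A' (%x. (c *\<^sub>R H (c *\<^sub>R x)) $ a $ j $ k)" using sc[OF d(3)] by simp
  show "weak_partial A' k (%x. G (c *\<^sub>R x) $ a $ j) (%x. (c *\<^sub>R H (c *\<^sub>R x)) $ a $ j $ k)"
  using wp_rescale[OF c A d(5) d(2) d(3)] by simp
  have "sint A' (%x. c * G (c *\<^sub>R x) $ a $ j)" using sc[OF d(2)] by simp
  from wp_blin[OF wp_rescale[OF c A d(4) d(1) d(2), unfolded real_scaleR_def] sc[OF d(1)] this bl]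
  show "weak_partial A' j (%x. (u (c *\<^sub>R x) /\<^sub>R c) $ a) (%x. G (c *\<^sub>R x) $ a $ j)"
  using c by (simp add: mult.assoc[symmetric])
 qed
qed

lemma tv_rescale:
 fixes w :: "real^'n => real"
 assumes c: "c > 0" and A: "!!x. x : A' \<longleftrightarrow> c *\<^sub>R x : A" and w: "sint A w"
 shows "total_variation A' (%x. w (c *\<^sub>R x)) <= ennreal (c powr (1 - real CARD('n))) * total_variation A w"
proof (rule tv_least)
 fix Fi :: "real^'n => real^'n" assume Fi: "Fi : tfs A'" "!!x. norm (Fi x) <= 1"
 let ?Fi = "%x. Fi (x /\<^sub>R c)" let ?N = "CARD('n)"
 note t = tf_rescale[OF c A Fi(1)]
 have dv: "dvg ?Fi (c *\<^sub>R x) = inverse c * dvg Fi x" for x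
  unfolding dvg_def using pderiv_at_rescale[OF tfD(1)[OF Fi(1)], of _ c "c *\<^sub>R x"] c
  by (simp add: sum_distrib_left)
 have wd: "sint A (%x. w x * dvg ?Fi x)"
 proof -
  have pn: "(%x. pdv j ?Fi x $ j) : tfs A" for j by (rule tf_nth[OF tf_pderiv[OF t]])
  have "sint A (%x. \<Sum>j\<in>UNIV. pdv j ?Fi x $ j *\<^sub>R w x)"
  unfolding set_integrable_def scaleR_sum_right
  by (rule Bochner_Integration.integrable_sum, rule sint_test_scaleR[OF w pn, unfolded set_integrable_def])
  thus ?thesis by (simp add: dvg_def sum_distrib_left mult.commute)
 qed
 have "(LINT x:A|leb. w x * dvg ?Fi x) = c ^ ?N * (LINT x:A'|leb. w (c *\<^sub>R x) * dvg ?Fi (c *\<^sub>R x))"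
  using sintl_scaleR(2)[OF c A wd] by simp
 also have "\<dots> = c ^ ?N * (inverse c * (LINT x:A'|leb. w (c *\<^sub>R x) * dvg Fi x))"
  unfolding dv by (simp add: mult.left_commute)
 also have "\<dots> = c powr (real ?N - 1) * (LINT x:A'|leb. w (c *\<^sub>R x) * dvg Fi x)"
  using c by (simp add: powr_diff powr_realpow divide_inverse)
 finally have "(LINT x:A'|leb. w (c *\<^sub>R x) * dvg Fi x) = c powr (1 - real ?N) * (LINT x:A|leb. w x * dvg ?Fi x)"
  using c by (simp add: mult.assoc[symmetric] powr_add[symmetric])
 hence "ennreal (LINT x:A'|leb. w (c *\<^sub>R x) * dvg Fi x) = ennreal (c powr (1 - real ?N)) * ennreal (LINT x:A|leb. w x * dvg ?Fi x)"
  by (simp add: ennreal_mult')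
 also have "\<dots> <= ennreal (c powr (1 - real ?N)) * total_variation A w"
  by (intro mult_left_mono tv_upper[OF t]) (use Fi(2) in auto)
 finally show "ennreal (LINT x:A'|leb. w (c *\<^sub>R x) * dvg Fi x) <= ennreal (c powr (1 - real ?N)) * total_variation A w" .
qed

text \<open>Covers of \<open>E\<close> with mesh \<open>dl / c\<close> are scaled to covers of the
  image with mesh \<open>dl\<close>, and each weight grows by at most the factor
  \<open>c ^ s\<close>.\<close>

lemma hausd_null_scaleR:
 fixes E :: "'a::real_normed_vector set"
 assumes c: "c > 0" and E: "hausdorff_measure s E = 0"
 shows "hausdorff_measure s ((%x. c *\<^sub>R x) ` E) = 0"
proof -
 have "hausdorff_pre s dl ((%x. c *\<^sub>R x) ` E) <= 0" if dl: "dl > 0" for dl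
 proof (rule ennreal_le_epsilon)
  fix eps :: real assume eps: "eps > 0"
  have "hausdorff_pre s (dl / c) E <= hausdorff_measure s E" unfolding hausdorff_measure_def
  by (rule SUP_upper) (use dl c in simp)
  hence "hausdorff_pre s (dl / c) E < ennreal (eps / c ^ s)" using E c eps by simp
  then obtain K where K: "E <= \<Union>(range K)" "!!n. bounded (K n) & diameter (K n) <= dl / c"
  "(\<Sum>n. if K n = {} then 0 else ennreal (unit_ball_vol (real s) * (diameter (K n) / 2) ^ s)) < ennreal (eps / c ^ s)"
  unfolding hausdorff_pre_def INF_less_iff by blast
  define K' where "K' n = (%x. c *\<^sub>R x) ` K n" for n
  have dK: "diameter (K' n) <= c * diameter (K n)" for n
  proof (rule diameter_le)
  show "K' n ~= {} | 0 <= c * diameter (K n)" using c K(2) by (simp add: diameter_ge_0)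
  fix x y assume "x : K' n" "y : K' n"
  then obtain x' y' where "x' : K n" "y' : K n" "x = c *\<^sub>R x'" "y = c *\<^sub>R y'" by (auto simp: K'_def)
  thus "norm (x - y) <= c * diameter (K n)"
  using diameter_bounded_bound[of "K n" x' y'] K(2)[of n] c by (simp add: dist_norm flip: scaleR_diff_right)
  qed
  have "hausdorff_pre s dl ((%x. c *\<^sub>R x) ` E) <= (\<Sum>n. if K' n = {} then 0 else ennreal (unit_ball_vol (real s) * (diameter (K' n) / 2) ^ s))"
  unfolding hausdorff_pre_def
  proof (rule INF_lower, intro CollectI conjI allI)
  show "(%x. c *\<^sub>R x) ` E <= \<Union>(range K')" using K(1) by (fastforce simp: K'_def)
  fix n show "bounded (K' n)" unfolding K'_def using K(2) by (intro bounded_scaling) simp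
  have "c * diameter (K n) <= c * (dl / c)" using K(2) c by (intro mult_left_mono) auto
  thus "diameter (K' n) <= dl" using dK[of n] c by simp
  qed
  also have "\<dots> <= (\<Sum>n. ennreal (c ^ s) * (if K n = {} then 0 else ennreal (unit_ball_vol (real s) * (diameter (K n) / 2) ^ s)))"
  proof (rule suminf_le)
  fix n
  have d0: "0 <= diameter (K' n)" "0 <= diameter (K n)" using K(2) by (auto intro!: diameter_ge_0 simp: K'_def bounded_scaling)
  have "(diameter (K' n) / 2) ^ s <= (c * (diameter (K n) / 2)) ^ s" using d0 dK[of n] by (intro power_mono) auto
  hence "unit_ball_vol (real s) * (diameter (K' n) / 2) ^ s <= c ^ s * (unit_ball_vol (real s) * (diameter (K n) / 2) ^ s)"
  unfolding power_mult_distrib[of c] mult.left_commute[of "c ^ s"] by (intro mult_left_mono) auto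
  thus "(if K' n = {} then 0 else ennreal (unit_ball_vol (real s) * (diameter (K' n) / 2) ^ s)) \<le>
  ennreal (c ^ s) * (if K n = {} then 0 else ennreal (unit_ball_vol (real s) * (diameter (K n) / 2) ^ s))"
  using c d0 by (auto simp: K'_def ennreal_mult[symmetric] intro!: ennreal_leI)
  qed auto
  also have "\<dots> = ennreal (c ^ s) * (\<Sum>n. if K n = {} then 0 else ennreal (unit_ball_vol (real s) * (diameter (K n) / 2) ^ s))"
  by simp
  also have "\<dots> <= ennreal (c ^ s) * ennreal (eps / c ^ s)" by (intro mult_left_mono less_imp_le[OF K(3)]) simp
  also have "\<dots> = ennreal eps" using c eps by (simp add: ennreal_mult[symmetric])
  finally show "hausdorff_pre s dl ((%x. c *\<^sub>R x) ` E) <= 0 + ennreal eps" by simp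
 qed
 hence "hausdorff_measure s ((%x. c *\<^sub>R x) ` E) <= 0" unfolding hausdorff_measure_def by (intro SUP_least) simp
 thus ?thesis by simp
qed

lemma approx_limit_rescale:
 fixes w :: "real^'n => 'b::euclidean_space"
 assumes c: "c > 0" and A: "!!x. x : A' \<longleftrightarrow> c *\<^sub>R x : A" "A : sets leb" and w: "w : lbm"
  and l: "approx_limit A w (c *\<^sub>R x) z"
 shows "approx_limit A' (%y. w (c *\<^sub>R y)) x z"
proof -
 let ?F = "%r. (\<integral>\<^sup>+y\<in>A \<inter> ball (c *\<^sub>R x) r. ennreal (norm (w y - z)) \<partial>leb) / ennreal (r ^ CARD('n))"
 have fl: "filterlim (%r. c * r) (at_right 0) (at_right 0)"
  using filterlim_times_pos[OF filterlim_ident c, of 0] by simp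
 have "((%r. ?F (c * r)) \<longlongrightarrow> 0) (at_right 0)"
  using filterlim_compose[OF l[unfolded approx_limit_def] fl] .
 moreover have "\<forall>\<^sub>F r in at_right 0. ?F (c * r) =
  (\<integral>\<^sup>+y\<in>A' \<inter> ball x r. ennreal (norm (w (c *\<^sub>R y) - z)) \<partial>leb) / ennreal (r ^ CARD('n))"
  using eventually_at_right_less[of 0]
 proof eventually_elim
  case (elim r)
  have b: "c *\<^sub>R y : ball (c *\<^sub>R x) (c * r) \<longleftrightarrow> y : ball x r" for y
  using c by (simp add: dist_norm flip: scaleR_diff_right)
  let ?g = "%y. ennreal (norm (w y - z)) * idc (A \<inter> ball (c *\<^sub>R x) (c * r)) y"
  have "(\<integral>\<^sup>+y. ?g y \<partial>leb) = ennreal (c ^ CARD('n)) * (\<integral>\<^sup>+y. ?g (c *\<^sub>R y) \<partial>leb)"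
  proof -
  have "?g : lbm"
  proof (intro borel_measurable_times_ennreal measurable_compose[OF _ measurable_ennreal] borel_measurable_indicator sets.Int A(2))
  show "(%y. norm (w y - z)) : lbm"
  by (rule measurable_compose[OF borel_measurable_diff[OF w borel_measurable_const] borel_measurable_norm])
  qed auto
  from nn_int_leb_scaleR[OF c this] show ?thesis by simp
  qed
  also have "(\<integral>\<^sup>+y. ?g (c *\<^sub>R y) \<partial>leb) = (\<integral>\<^sup>+y\<in>A' \<inter> ball x r. ennreal (norm (w (c *\<^sub>R y) - z)) \<partial>leb)"
  by (intro nn_integral_cong) (simp only: indicator_def Int_iff b A(1))
  finally have "?F (c * r) = (ennreal (c ^ CARD('n)) * (\<integral>\<^sup>+y\<in>A' \<inter> ball x r. ennreal (norm (w (c *\<^sub>R y) - z)) \<partial>leb)) /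
  (ennreal (c ^ CARD('n)) * ennreal (r ^ CARD('n)))"
  using c elim by (simp add: power_mult_distrib ennreal_mult)
  also have "\<dots> = (\<integral>\<^sup>+y\<in>A' \<inter> ball x r. ennreal (norm (w (c *\<^sub>R y) - z)) \<partial>leb) / ennreal (r ^ CARD('n))"
  using c by (simp only: mult.commute[of "ennreal (c ^ CARD('n))"]) (intro divide_mult_eq, auto)
  finally show ?case .
 qed
 ultimately show ?thesis unfolding approx_limit_def by (rule Lim_transform_eventually)
qed

subsection \<open>The recession function\<close>

lemma sym_tensors_scaleR: "xi : sym_tensors ==> t *\<^sub>R xi : sym_tensors"
 by (simp add: sym_tensors_def)

lemma em_std_cube: "emeasure leb (std_cube :: (real^'n) set) = 1"
proof -
 let ?l = "(\<chi> i. - 1/2) :: real^'n" and ?u = "(\<chi> i. 1/2) :: real^'n"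
 have "?l \<bullet> b <= ?u \<bullet> b & (?u - ?l) \<bullet> b = 1" if b: "b : Basis" for b
 proof -
  obtain j where "b = axis j 1" using b by (auto simp: Basis_vec_def Basis_real_def)
  thus ?thesis by (simp add: inner_axis)
 qed
 note i = this
 have "emeasure lborel (box ?l ?u) = ennreal (\<Prod>b\<in>Basis. (?u - ?l) \<bullet> b)"
  by (rule emeasure_lborel_box) (use i in blast)
 also have "(\<Prod>b\<in>Basis. (?u - ?l) \<bullet> b) = (\<Prod>b\<in>(Basis :: (real^'n) set). 1)"
  by (rule prod.cong[OF refl]) (use i in blast)
 finally show ?thesis by (simp add: std_cube_def)
qed

locale linear_growth =
 fixes W0 W1 :: "real^'n^'n^'d => real" and \<alpha> \<beta> \<gamma> C0 L :: real
 assumes W_cont: "continuous_on sym_tensors W0" "continuous_on sym_tensors W1"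
  and cst: "\<alpha> > 0" "\<beta> > 0" "0 < \<gamma>" "\<gamma> <= 1" "C0 > 0" "L > 0"
  and growth: "!!q xi. q : {0, 1} ==> xi : sym_tensors ==>
  \<alpha> * norm xi <= mixture W0 W1 q xi & mixture W0 W1 q xi <= \<beta> * (1 + norm xi)"
  and qc: "quasiconvex2 (mixture W0 W1)"
  and recession_est: "!!q xi t. q : {0, 1} ==> xi : sym_tensors ==> t > 0 ==> t * norm xi > L ==>
  \<bar>recession (mixture W0 W1) q xi - ereal (mixture W0 W1 q (t *\<^sub>R xi) / t)\<bar>
  <= ereal (C0 * (norm xi powr (1 - \<gamma>) / t powr \<gamma>))"
begin

abbreviation f where "f \<equiv> mixture W0 W1"

lemma f_nonneg: "q : {0, 1} ==> xi : sym_tensors ==> 0 <= f q xi"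
 using growth[of q xi] cst(1) by (meson mult_nonneg_nonneg less_imp_le norm_ge_zero order_trans)

text \<open>Quasiconvexity gives one inequality and at the same time the lower bound that the
  infimum needs; the zero test function on a cube of volume 1 gives the other. On symmetric tensors
  the integrand of \<open>surface_K\<close> is thus the recession function of \<open>f\<close>
  itself.\<close>

lemma Q2_eq:
 assumes q: "q : {0, 1}" and xi: "xi : sym_tensors"
 shows "Q2 f q xi = f q xi"
proof (rule antisym)
 let ?I = "%ph. LINT x:std_cube|leb. f q (xi + hessian ph x)"
 have qc': "f q xi <= ?I ph" if "ph : tfs std_cube" for ph
  using qc q xi that unfolding quasiconvex2_def by blast
 let ?z = "%x :: real^'n. 0 :: real^'d"
 have z: "?z : tfs std_cube"
  by (rule tfI[where K="{}"]) (auto intro: C_k_const)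
 show "f q xi <= Q2 f q xi" unfolding Q2_def by (rule cINF_greatest) (use z qc' in auto)
 have "pdv j ?z = ?z" for j :: 'n by (simp add: pderiv_at_def fun_eq_iff)
 hence h: "hessian ?z x = 0" for x by (simp add: hessian_def vec_eq_iff)
 have "Q2 f q xi <= ?I ?z" unfolding Q2_def
  by (rule cINF_lower[OF _ z]) (use qc' in "auto intro!: bdd_belowI2")
 also have "\<dots> = f q xi"
  unfolding h set_lebesgue_integral_def using em_std_cube[where 'n='n] by (simp add: measure_def std_cube_def)
 finally show "Q2 f q xi <= f q xi" .
qed

lemma recession_Q2_eq:
 assumes q: "q : {0, 1}" and xi: "xi : sym_tensors"
 shows "recession (Q2 f) q xi = recession f q xi"
 unfolding recession_def by (simp add: Q2_eq[OF q sym_tensors_scaleR[OF xi]])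

lemma recession_le:
 assumes q: "q : {0, 1}" and xi: "xi : sym_tensors"
 shows "recession f q xi <= ereal (\<beta> * norm xi)"
proof -
 have "recession f q xi <= Limsup at_top (%t::real. ereal (\<beta> * (inverse t + norm xi)))"
  unfolding recession_def
 proof (rule Limsup_mono)
  show "\<forall>\<^sub>F t in at_top. ereal (f q (t *\<^sub>R xi) / t) <= ereal (\<beta> * (inverse t + norm xi))"
  using eventually_gt_at_top[of 0]
  proof eventually_elim
  case (elim t)
  have "f q (t *\<^sub>R xi) <= \<beta> * (1 + t * norm xi)" using growth[OF q sym_tensors_scaleR[OF xi, of t]] elim by simp
  hence "f q (t *\<^sub>R xi) / t <= \<beta> * (1 + t * norm xi) / t" using elim by (intro divide_right_mono) auto
  also have "\<dots> = \<beta> * (inverse t + norm xi)" using elim by (simp add: field_simps)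
  finally show ?case by simp
  qed
 qed
 also have "\<dots> = ereal (\<beta> * (0 + norm xi))"
  by (rule lim_imp_Limsup) (simp, intro tendsto_intros tendsto_inverse_0_at_top filterlim_ident)
 finally show ?thesis by simp
qed

text \<open>For \<open>norm xi > L * eps\<close> the quantitative hypothesis applies at
  \<open>t = 1 / eps\<close>, and the power of the norm is replaced by \<open>1 + norm xi\<close>,
  whose integral coercivity controls. For smaller tensors the linear growth of the recession
  function gives the term \<open>\<beta> * L * eps\<close>.\<close>

lemma recession_bound:
 assumes q: "q : {0, 1}" and xi: "xi : sym_tensors" and eps: "eps > 0"
 shows "e2ennreal (recession (Q2 f) q xi) \<le>
  ennreal (eps * f q (xi /\<^sub>R eps)) + ennreal (C0 * eps powr \<gamma> * (1 + norm xi) + \<beta> * L * eps)"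
proof -
 let ?m = "eps * f q (xi /\<^sub>R eps)" and ?r = "C0 * eps powr \<gamma> * (1 + norm xi)"
 have m0: "0 <= ?m" using f_nonneg[OF q sym_tensors_scaleR[OF xi]] eps by simp
 have r0: "0 <= ?r" using cst(5) by simp
 have L0: "0 <= \<beta> * L * eps" using cst eps by simp
 have "recession f q xi <= ereal (?m + (?r + \<beta> * L * eps))"
 proof (cases "inverse eps * norm xi > L")
  case True
  have p: "norm xi powr (1 - \<gamma>) <= 1 + norm xi"
  proof (cases "norm xi <= 1")
  case True
  hence "norm xi powr (1 - \<gamma>) <= 1" using cst(4) by (intro powr_le1) auto
  thus ?thesis using norm_ge_zero[of xi] by linarith
  next
  case False
  hence "norm xi powr (1 - \<gamma>) <= norm xi powr 1" using cst(3) by (intro powr_mono) auto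
  thus ?thesis using False by simp
  qed
  have "C0 * (norm xi powr (1 - \<gamma>) / inverse eps powr \<gamma>) = C0 * eps powr \<gamma> * norm xi powr (1 - \<gamma>)"
  using eps by (simp add: inverse_eq_divide powr_divide mult.commute mult.left_commute)
  also have "\<dots> <= ?r" using p cst(5) by (intro mult_left_mono) auto
  finally have "\<bar>recession f q xi - ereal (f q (inverse eps *\<^sub>R xi) / inverse eps)\<bar> <= ereal ?r"
  using recession_est[OF q xi _ True] eps by (meson ereal_less_eq(3) order_trans positive_imp_inverse_positive)
  moreover have "f q (inverse eps *\<^sub>R xi) / inverse eps = ?m" by (simp add: divide_inverse mult.commute)
  ultimately have "recession f q xi <= ereal (?m + ?r)"
  by (cases "recession f q xi") auto
  also have "\<dots> <= ereal (?m + (?r + \<beta> * L * eps))" using L0 by simp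
  finally show ?thesis .
 next
  case False
  hence "eps * (inverse eps * norm xi) <= eps * L" using eps by (intro mult_left_mono) auto
  hence "norm xi <= L * eps" using eps by (simp add: mult.assoc[symmetric] mult.commute[of L])
  hence "\<beta> * norm xi <= \<beta> * (L * eps)" using cst(2) by (intro mult_left_mono) auto
  hence "ereal (\<beta> * norm xi) <= ereal (?m + (?r + \<beta> * L * eps))" using m0 r0 by (simp add: mult.assoc)
  thus ?thesis using recession_le[OF q xi] by (rule order_trans[rotated])
 qed
 hence "e2ennreal (recession f q xi) <= e2ennreal (ereal (?m + (?r + \<beta> * L * eps)))" by (rule e2ennreal_mono)
 also have "\<dots> = ennreal (?m + (?r + \<beta> * L * eps))" using m0 r0 L0 by (simp add: e2ennreal_ereal)
 also have "\<dots> = ennreal ?m + ennreal (?r + \<beta> * L * eps)" using m0 r0 L0 by (intro ennreal_plus) auto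
 finally show ?thesis by (simp add: recession_Q2_eq[OF q xi])
qed

end

section \<open>From the Dirichlet problem on a small cube to the cell problem\<close>

lemma liminf_less_frequently:
 fixes c :: ennreal
 assumes "liminf X < c" shows "\<exists>\<^sub>F n in sequentially. X n < c"
proof (rule ccontr)
 assume "~ ?thesis"
 hence "\<forall>\<^sub>F n in sequentially. c <= X n" by (simp add: not_frequently not_less)
 hence "c <= liminf X" by (rule Liminf_bounded)
 thus False using assms by simp
qed

locale frame_linear_growth = frame e + linear_growth W0 W1 \<alpha> \<beta> \<gamma> C0 L
 for e :: "'n::finite => real^'n" and W0 W1 :: "real^'n^'n^'d => real" and \<alpha> \<beta> \<gamma> C0 L
begin

text \<open>The infima behind \<open>dirichlet_inf\<close> and the relaxed energy are unpacked into
  a pair \<open>tht\<close>, \<open>v\<close> and a recovery sequence, to which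
  \<open>glue_competitor\<close> applies. The second claim records that the step function has
  approximate limits at Hausdorff-almost every frontier point; this is contained in the trace
  condition on \<open>tht\<close> and serves again after rescaling.\<close>

lemma dirichlet_competitor:
 fixes C D :: "real^'n^'d"
 assumes s: "s > 0" and ab: "a : {0, 1}" "b : {0, 1}" and CD: "!!y. C *v y = D *v y + (y \<bullet> e i) *\<^sub>R P"
  and E: "closure (cube s) <= E"
  and less: "dirichlet_inf f E (step_fun a b (e i)) (wedge_fun C D (e i)) (cube s) < ennreal G"
 shows "EX Z V. Z : BV01 (cube s) & V : W21 (cube s) & (\<exists>t<s. ALL y. y ~: cube t --> Z y = step_fun a b (e i) y) \<and>
  (\<exists>q<s. EX Wf. continuous_on UNIV Wf & (\<forall>y\<in>frontier (cube s). Wf y = wedge_fun C D (e i) y) & (ALL y. y ~: cube q --> V y = Wf y)) \<and>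
  energy f (cube s) Z V < ennreal G"
  "hausdorff_ae (CARD('n) - 1) (frontier (cube s)) (%x. EX z. approx_limit (cube s) (step_fun a b (e i)) x z)"
proof -
 let ?A = "cube s" and ?w = "wedge_fun C D (e i)" and ?g = "wedge_grad D P i"
 obtain tht v where tht: "tht : BV01 E" "trace_eq ?A tht (step_fun a b (e i))" and
  K: "compact (closure (ess_support E (%x. v x - ?w x)))" "closure (ess_support E (%x. v x - ?w x)) <= ?A" and
  r: "relaxed_energy f ?A tht v < ennreal G"
  using less unfolding dirichlet_inf_def INF_less_iff by auto
 show "hausdorff_ae (CARD('n) - 1) (frontier ?A) (%x. EX z. approx_limit ?A (step_fun a b (e i)) x z)"
  by (rule hausd_ae_mono[OF tht(2)[unfolded trace_eq_def]]) blast
 obtain X U where X: "!!n. X n : BV01 ?A" "L1_tendsto ?A X tht" and U: "!!n. U n : W21 ?A" "W11_tendsto ?A U v" and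
  li: "liminf (%n. energy f ?A (X n) (U n)) < ennreal G"
  using r unfolding relaxed_energy_def INF_less_iff by auto
 obtain h where h: "liminf (%n. energy f ?A (X n) (U n)) < h" "h < ennreal G" using dense[OF li] by blast
 then obtain G' where G': "h = ennreal G'" "0 <= G'" by (cases h) auto
 have GG: "G' < G" using h(2) G' by (simp add: ennreal_less_iff)
 have AE: "?A <= E" using E closure_subset[of ?A] by blast
 have thti: "sint ?A tht" using X(2) by (simp add: L1_tendsto_def)
 have tht01: "AE x in leb. x : ?A --> tht x : {0, 1}"
  using tht(1) AE by (auto simp: BV01_def elim: eventually_mono)
 have v: "v : W11 ?A" "L1_tendsto ?A U v" "L1_tendsto ?A (%n. weak_gradient ?A (U n)) (weak_gradient ?A v)"
  using U(2) by (auto simp: W11_tendsto_def)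
 obtain r' where r': "0 < r'" "r' < s" "closure (ess_support E (%x. v x - ?w x)) <= cube r'"
  using compact_in_cube[OF K s] by blast
 have vw: "AE x in leb. x : ?A - cube r' --> v x = ?w x"
  using ess_support_AE[of E "%x. v x - ?w x"]
 proof eventually_elim
  case (elim x)
  show ?case
  proof
  assume x: "x : ?A - cube r'"
  hence "x ~: ess_support E (%x. v x - ?w x)" using r'(3) closure_subset by blast
  thus "v x = ?w x" using elim x AE by auto
  qed
 qed
 \<comment> \<open>Weak gradients are compared on an open set, the cube minus
   \<open>ccube r'\<close>; a slightly larger radius puts the whole shell
   \<open>?A - cube rv\<close> into it.\<close>
 define rv where "rv = (r' + s) / 2"
 have rv: "r' < rv" "rv < s" using r' by (simp_all add: rv_def)
 define mu :: "nat => real" where "mu n = 1 / real (Suc n)" for n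
 have mu: "0 < mu n" "mu n <= 1" for n by (auto simp: mu_def)
 have mul: "mu \<longlonglongrightarrow> 0" unfolding mu_def by (rule LIMSEQ_Suc[OF lim_const_over_n])
 note ct = cmp_lim[OF s CD mu mul]
 let ?S = "?A - ccube r'"
 have S: "open ?S" "?S <= ?A" by (auto intro: open_Diff open_cube closed_ccube)
 have vg: "AE x in leb. x : ?S --> weak_gradient ?A v x = ?g x"
 proof (rule iwg_unique[OF S(1), of v])
  show "is_weak_gradient ?S v (weak_gradient ?A v)"
  by (rule iwg_subset[OF W11D(2)[OF v(1)] S(2,1)])
  have wg: "is_weak_gradient ?S ?w ?g" by (rule iwg_subset[OF ct(3) S(2,1)])
  have wi: "sint ?S ?w"
  using ct(1) S(1) by (auto simp: L1_tendsto_def intro!: set_integrable_subset[where B="?S" and A="?A"])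
  have gi: "sint ?S ?g" using wg by (simp add: is_weak_gradient_def)
  have eq: "AE x in leb. x : ?S --> ?w x = v x"
  using vw by eventually_elim (use cube_ccube(1)[of r'] in auto)
  show "is_weak_gradient ?S v ?g"
  unfolding is_weak_gradient_def
  proof (intro conjI allI gi)
  fix j
  have "weak_partial ?S j ?w (%x. column j (?g x))" using wg by (simp add: is_weak_gradient_def)
  from wp_cong_AE[OF this wi sint_blin(1)[OF blin_column gi] eq]
  show "weak_partial ?S j v (%x. column j (?g x))" by simp
  qed
 qed
 have vw': "AE x in leb. x : ?A - cube rv --> v x = ?w x"
  using vw by eventually_elim (use cube_mono[of r' rv] rv in auto)
 have vg': "AE x in leb. x : ?A - cube rv --> weak_gradient ?A v x = ?g x"
  using vg by eventually_elim (use cube_ccube(2)[OF rv(1)] in auto)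
 show "EX Z V. Z : BV01 ?A & V : W21 ?A & (\<exists>t<s. ALL y. y ~: cube t --> Z y = step_fun a b (e i) y) \<and>
  (\<exists>q<s. EX Wf. continuous_on UNIV Wf & (\<forall>y\<in>frontier ?A. Wf y = ?w y) & (ALL y. y ~: cube q --> V y = Wf y)) \<and>
  energy f ?A Z V < ennreal G"
  by (rule glue_competitor[OF s ab CD cst(1,2) W_cont growth thti tht01 tht(2) rv(2) vw' vg' X U(1) v(2,3)
  liminf_less_frequently[OF h(1), unfolded G'(1)] GG])
qed

lemma cube_scaleR: "c > 0 ==> x : cube r \<longleftrightarrow> c *\<^sub>R x : cube (c * r)"
 by (simp add: cube_def abs_mult)

text \<open>The step function is invariant under positive dilations, so its approximate limits on
  the frontier of the dilated cube are carried back to \<open>cube r\<close> together with the null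
  exceptional set.\<close>

lemma trace_step_rescale:
 assumes c: "c > 0" and r: "r > 0"
  and ae: "hausdorff_ae (CARD('n) - 1) (frontier (cube (c * r))) (%x. EX z. approx_limit (cube (c * r)) (step_fun a b (e i)) x z)"
 shows "trace_eq (cube r) (step_fun a b (e i)) (step_fun a b (e i))"
proof -
 let ?s = "step_fun a b (e i)"
 let ?B = "{x : frontier (cube (c * r)). ~ (EX z. approx_limit (cube (c * r)) ?s x z)}"
 have sc: "?s (c *\<^sub>R y) = ?s y" for y using c by (simp add: step_fun_def zero_le_mult_iff)
 have fr: "c *\<^sub>R x : frontier (cube (c * r))" if "x : frontier (cube r)" for x
  using that c r by (simp add: fr_cube abs_mult)
 have "{x : frontier (cube r). ~ (EX z. approx_limit (cube r) ?s x z & approx_limit (cube r) ?s x z)} <= (%x. inverse c *\<^sub>R x) ` ?B"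
 proof
  fix x assume x: "x : {x : frontier (cube r). ~ (EX z. approx_limit (cube r) ?s x z & approx_limit (cube r) ?s x z)}"
  have "~ (EX z. approx_limit (cube (c * r)) ?s (c *\<^sub>R x) z)"
  proof
  assume "EX z. approx_limit (cube (c * r)) ?s (c *\<^sub>R x) z"
  then obtain z where "approx_limit (cube (c * r)) ?s (c *\<^sub>R x) z" by blast
  from approx_limit_rescale[OF c cube_scaleR[OF c] cube_leb step_fun_intg(2)[OF cube_leb bdd_cube] this]
  have "approx_limit (cube r) ?s x z" by (simp add: sc)
  thus False using x by blast
  qed
  hence "c *\<^sub>R x : ?B" using fr x by blast
  moreover have "x = inverse c *\<^sub>R (c *\<^sub>R x)" using c by simp
  ultimately show "x : (%x. inverse c *\<^sub>R x) ` ?B" by blast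
 qed
 moreover have "hausdorff_measure (CARD('n) - 1) ((%x. inverse c *\<^sub>R x) ` ?B) = 0"
  by (rule hausd_null_scaleR) (use c ae in "simp_all add: hausdorff_ae_def")
 ultimately show ?thesis unfolding trace_eq_def hausdorff_ae_def
  using hausd_measure_mono by (metis (no_types, lifting) le_zero_eq)
qed

text \<open>After dilation the bulk energy has density \<open>eps * f (xi / eps)\<close>, where
  \<open>xi\<close> is the new Hessian, and the scaled total is at most \<open>T\<close>. Coercivity
  then bounds the L1 norm of \<open>xi\<close> by \<open>T / \<alpha>\<close>, so the pointwise
  error in \<open>recession_bound\<close> integrates to the stated remainder over a cube of volume
  at most 1.\<close>

lemma surface_K_le:
 fixes C D :: "real^'n^'d"
 assumes eps: "eps > 0" and T: "T >= 0"
  and Z: "Z : BV01 (cube (eps * (1/2)))" "\<exists>t<eps * (1/2). ALL y. y ~: cube t --> Z y = step_fun a b (e i) y"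
  and V: "V : W21 (cube (eps * (1/2)))" "\<exists>q<eps * (1/2). EX Wf. continuous_on UNIV Wf & (\<forall>y\<in>frontier (cube (eps * (1/2))). Wf y = wedge_fun C D (e i) y) & (ALL y. y ~: cube q --> V y = Wf y)"
  and en: "ennreal (eps powr (1 - real CARD('n))) * energy f (cube (eps * (1/2))) Z V <= ennreal T"
  and cw: "continuous_on UNIV (wedge_fun C D (e i))"
  and ae: "hausdorff_ae (CARD('n) - 1) (frontier (cube (eps * (1/2)))) (%x. EX z. approx_limit (cube (eps * (1/2))) (step_fun a b (e i)) x z)"
 shows "surface_K f (cube (1/2)) a b C D (e i) <= ennreal (T + (C0 * eps powr \<gamma> * (1 + T / \<alpha>) + \<beta> * L * eps))"
proof -
 let ?Q = "cube (1/2)" and ?A = "cube (eps * (1/2))"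
 let ?N = "real CARD('n)"
 let ?Z = "%y. Z (eps *\<^sub>R y)" and ?V = "%y. V (eps *\<^sub>R y) /\<^sub>R eps"
 define H where "H = weak_hessian ?A V"
 note sc = cube_scaleR[OF eps]
 have Vd: "W21_data ?A V (weak_gradient ?A V) H" unfolding H_def by (rule W21_data_W21[OF V(1)])
 have Hi: "sint ?A H" by (rule W21_dataD(3)[OF Vd])
 have Zi: "sint ?A Z" and Ztv: "total_variation ?A Z < \<infinity>" and Z01: "AE x in leb. x : ?A --> Z x : {0, 1}"
  using Z(1) by (auto simp: BV01_def BV_def)
 have Hs: "AE x in leb. x : ?A --> H x : sym_tensors" by (rule W21_data_imp_W21(3)[OF open_cube Vd])
 note Vq = W21_data_rescale[OF eps sc Vd]
 note V' = W21_data_imp_W21[OF open_cube Vq]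
 have tv: "total_variation ?Q ?Z <= ennreal (eps powr (1 - ?N)) * total_variation ?A Z"
  by (rule tv_rescale[OF eps sc Zi])
 have Z01': "AE x in leb. x : ?Q --> ?Z x : {0, 1}"
  using AE_leb_scaleR[OF eps Z01] by eventually_elim (use sc in blast)
 have Hs': "AE x in leb. x : ?Q --> H (eps *\<^sub>R x) : sym_tensors"
  using AE_leb_scaleR[OF eps Hs] by eventually_elim (use sc in blast)
 have ZQ: "?Z : BV01 ?Q"
 proof -
  have "total_variation ?Q ?Z < \<infinity>" using tv Ztv by (auto intro: le_less_trans simp: ennreal_mult_less_top)
  thus ?thesis using sintl_scaleR(1)[OF eps sc Zi] Z01' by (simp add: BV01_def BV_def)
 qed
 have trZ: "trace_eq ?Q ?Z (step_fun a b (e i))"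
 proof -
  obtain t where t: "t < eps * (1/2)" "!!y. y ~: cube t ==> Z y = step_fun a b (e i) y" using Z(2) by blast
  have t': "t / eps < 1 / 2" "eps * (t / eps) = t" using t(1) eps by (auto simp: divide_less_eq mult.commute)
  show ?thesis
  proof (rule trace_eq_near_fr[OF trace_step_rescale[OF eps _ ae] t'(1)])
  fix y assume "y ~: cube (t / eps)"
  hence "Z (eps *\<^sub>R y) = step_fun a b (e i) (eps *\<^sub>R y)" using sc[of y "t / eps"] t(2) t'(2) by simp
  thus "Z (eps *\<^sub>R y) = step_fun a b (e i) y" using eps by (simp add: step_fun_def zero_le_mult_iff)
  qed auto
 qed
 have wsc: "wedge_fun C D (e i) (eps *\<^sub>R y) = eps *\<^sub>R wedge_fun C D (e i) y" for y
  using eps by (simp add: wedge_fun_def zero_le_mult_iff matrix_vector_mult_scaleR)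
 have trV: "trace_eq ?Q ?V (wedge_fun C D (e i))"
 proof -
  obtain q Wf where q: "q < eps * (1/2)" and Wf: "continuous_on UNIV Wf" "!!y. y : frontier ?A ==> Wf y = wedge_fun C D (e i) y" "!!y. y ~: cube q ==> V y = Wf y"
  using V(2) by blast
  have q': "q / eps < 1 / 2" "eps * (q / eps) = q" using q(1) eps by (auto simp: divide_less_eq mult.commute)
  show ?thesis
  proof (rule trace_eq_cont_near_fr[where w="%y. Wf (eps *\<^sub>R y) /\<^sub>R eps" and q="q / eps"])
  show "continuous_on UNIV (%y. Wf (eps *\<^sub>R y) /\<^sub>R eps)"
  by (intro continuous_on_scaleR continuous_on_const continuous_on_compose2[OF Wf(1)] continuous_on_id) auto
  show "Wf (eps *\<^sub>R y) /\<^sub>R eps = wedge_fun C D (e i) y" if "y : frontier ?Q" for y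
  proof -
  have "eps *\<^sub>R y : frontier ?A" using that eps fr_cube[of "1/2"] fr_cube[of "eps * (1/2)"] by (simp add: abs_mult)
  thus ?thesis using Wf(2) eps by (simp add: wsc)
  qed
  show "V (eps *\<^sub>R y) /\<^sub>R eps = Wf (eps *\<^sub>R y) /\<^sub>R eps" if "y ~: cube (q / eps)" for y
  proof -
  have "eps *\<^sub>R y ~: cube q" using that sc[of y "q / eps"] q'(2) by simp
  thus ?thesis by (simp add: Wf(3))
  qed
  qed (use cw q' in auto)
 qed
 let ?F = "\<integral>\<^sup>+x\<in>?A. ennreal (f (Z x) (H x)) \<partial>leb"
 have ene: "energy f ?A Z V = ?F + total_variation ?A Z" using Z(1) V(1) by (simp add: energy_def H_def)
 have fm: "(%x. ennreal (f (Z x) (H x)) * idc ?A x) : lbm"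
  by (rule mixture_bm[OF W_cont Zi Hi Hs]) simp
 let ?FQ = "\<integral>\<^sup>+x\<in>?Q. ennreal (eps * f (?Z x) (H (eps *\<^sub>R x))) \<partial>leb"
 have ind: "idc ?A (eps *\<^sub>R x) = (idc ?Q x :: ennreal)" for x using sc[of x "1/2"] by (simp add: indicator_def)
 have fmQ: "(%x. ennreal (f (?Z x) (H (eps *\<^sub>R x))) * idc ?Q x) : lbm"
  using measurable_compose[OF meas_scaleR_leb[of eps] fm] by (simp only: ind)
 have split: "ennreal (eps * f q xi) = ennreal eps * ennreal (f q xi)" for q xi using eps by (simp add: ennreal_mult')
 have fmQ': "(%x. ennreal (eps * f (?Z x) (H (eps *\<^sub>R x))) * idc ?Q x) : lbm"
  using borel_measurable_times_ennreal[OF borel_measurable_const[of "ennreal eps"] fmQ] by (simp add: split mult.assoc)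
 \<comment> \<open>The normalisation \<open>eps powr (1 - N)\<close> and the Jacobian
   \<open>eps ^ N\<close> leave exactly the one factor \<open>eps\<close> in front of
   \<open>f\<close>.\<close>
 have FQ: "?FQ = ennreal (eps powr (1 - ?N)) * ?F"
 proof -
  let ?I = "\<integral>\<^sup>+x\<in>?Q. ennreal (f (?Z x) (H (eps *\<^sub>R x))) \<partial>leb"
  have "?F = ennreal (eps ^ CARD('n)) * ?I"
  using nn_int_leb_scaleR[OF eps fm] by (simp only: ind DIM_cart DIM_real mult_1_right)
  hence "ennreal (eps powr (1 - ?N)) * ?F = ennreal (eps powr (1 - ?N) * eps ^ CARD('n)) * ?I"
  using eps by (simp add: ennreal_mult' mult.assoc)
  also have "eps powr (1 - ?N) * eps ^ CARD('n) = eps" using eps by (simp add: powr_realpow[symmetric] powr_add[symmetric])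
  also have "ennreal eps * ?I = ?FQ"
  unfolding split mult.assoc by (rule nn_integral_cmult[symmetric, OF fmQ])
  finally show ?thesis by simp
 qed
 have enT: "?FQ + ennreal (eps powr (1 - ?N)) * total_variation ?A Z <= ennreal T"
  using en unfolding ene FQ distrib_left .
 hence FT: "?FQ <= ennreal T" by (rule order_trans[OF add_increasing2[OF zero_le order_refl]])
 have HQi: "sint ?Q (%x. norm (eps *\<^sub>R H (eps *\<^sub>R x)))"
  by (rule set_integrable_norm[OF W21_dataD(3)[OF Vq]])
 let ?h = "%x. norm (eps *\<^sub>R H (eps *\<^sub>R x))"
 have HT: "(LINT x:?Q|leb. ?h x) <= T / \<alpha>"
 proof -
  have "ennreal (LINT x:?Q|leb. \<alpha> * ?h x) = (\<integral>\<^sup>+x\<in>?Q. ennreal (\<alpha> * ?h x) \<partial>leb)"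
  by (rule snint_eq_int[symmetric]) (use HQi cst in auto)
  also have "\<dots> <= ?FQ"
  proof (rule nn_integral_mono_AE)
  show "AE x in leb. ennreal (\<alpha> * ?h x) * idc ?Q x <= ennreal (eps * f (?Z x) (H (eps *\<^sub>R x))) * idc ?Q x"
  using Z01' Hs'
  proof eventually_elim
  case (elim x)
  show ?case
  proof (cases "x : ?Q")
  case True
  hence "\<alpha> * norm (H (eps *\<^sub>R x)) <= f (?Z x) (H (eps *\<^sub>R x))" using growth elim by blast
  hence "eps * (\<alpha> * norm (H (eps *\<^sub>R x))) <= eps * f (?Z x) (H (eps *\<^sub>R x))" using eps by (intro mult_left_mono) auto
  thus ?thesis using True eps by (simp add: mult.left_commute ennreal_leI)
  qed simp
  qed
  qed
  also have "\<dots> <= ennreal T" by (rule FT)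
  finally have "(LINT x:?Q|leb. \<alpha> * ?h x) <= T" using T by (simp only: ennreal_le_iff)
  thus ?thesis using cst(1) by (simp add: le_divide_eq mult.commute)
 qed
 have mQ: "(LINT x:?Q|leb. 1) <= (1 :: real)"
 proof -
  have "emeasure leb ?Q <= emeasure leb (ccube (1/2))"
  by (rule emeasure_mono[OF cube_ccube(1)]) (use closed_ccube in auto)
  also have "\<dots> = 1" unfolding ccube_eq_cslab by (subst em_cslab) auto
  finally have "emeasure leb ?Q <= 1" .
  moreover have "ennreal (LINT x:?Q|leb. 1) = (\<integral>\<^sup>+x\<in>?Q. ennreal 1 \<partial>leb)"
  by (rule snint_eq_int[symmetric, OF sint_const_cube]) simp
  ultimately have "ennreal (LINT x:?Q|leb. 1) <= ennreal 1" by simp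
  thus ?thesis by (subst (asm) ennreal_le_iff) auto
 qed
 let ?R = "%x. C0 * eps powr \<gamma> * (1 + ?h x) + \<beta> * L * eps"
 have i1: "sint ?Q (%x. 1 + ?h x)" by (intro set_integral_add(1) HQi sint_const_cube)
 have i2: "sint ?Q (%x. C0 * eps powr \<gamma> * (1 + ?h x))" using i1 by (rule set_integrable_mult_right[rotated])
 have Ri: "sint ?Q ?R"
  by (rule set_integral_add(1)[OF i2 sint_const_cube])
 have R0: "?R x >= 0" for x using cst eps by (auto intro!: add_nonneg_nonneg mult_nonneg_nonneg)
 have RL: "(LINT x:?Q|leb. ?R x) <= C0 * eps powr \<gamma> * (1 + T / \<alpha>) + \<beta> * L * eps"
 proof -
  have "(LINT x:?Q|leb. ?R x) = (LINT x:?Q|leb. C0 * eps powr \<gamma> * (1 + ?h x)) + (LINT x:?Q|leb. \<beta> * L * eps * 1)"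
  using set_integral_add(2)[OF i2 sint_const_cube[of _ "\<beta> * L * eps"]] by simp
  also have "\<dots> = C0 * eps powr \<gamma> * ((LINT x:?Q|leb. 1) + (LINT x:?Q|leb. ?h x)) + \<beta> * L * eps * (LINT x:?Q|leb. 1)"
  unfolding set_integral_mult_right set_integral_add(2)[OF sint_const_cube HQi] ..
  also have "\<dots> <= C0 * eps powr \<gamma> * (1 + T / \<alpha>) + \<beta> * L * eps * 1"
  using cst eps by (intro add_mono mult_left_mono mQ HT) auto
  finally show ?thesis by simp
 qed
 have add_right_swap: "x + y + z = (x + z) + y" for x y z :: ennreal by (simp add: ac_simps)
 have "surface_K f ?Q a b C D (e i) <= (\<integral>\<^sup>+x\<in>?Q. e2ennreal (recession (Q2 f) (?Z x) (weak_hessian ?Q ?V x)) \<partial>leb) + total_variation ?Q ?Z"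
  unfolding surface_K_def by (rule INF_lower2[where i="(?Z, ?V)"]) (use ZQ V'(1) trZ trV in auto)
 also have "\<dots> <= (\<integral>\<^sup>+x. ennreal (eps * f (?Z x) (H (eps *\<^sub>R x))) * idc ?Q x + ennreal (?R x) * idc ?Q x \<partial>leb) + ennreal (eps powr (1 - ?N)) * total_variation ?A Z"
 proof (intro add_mono tv nn_integral_mono_AE)
  show "AE x in leb. e2ennreal (recession (Q2 f) (?Z x) (weak_hessian ?Q ?V x)) * idc ?Q x \<le>
  ennreal (eps * f (?Z x) (H (eps *\<^sub>R x))) * idc ?Q x + ennreal (?R x) * idc ?Q x"
  using Z01' V'(2,3)
  proof eventually_elim
  case (elim x)
  show ?case
  proof (cases "x : ?Q")
  case True
  hence el: "?Z x : {0, 1}" "weak_hessian ?Q ?V x = eps *\<^sub>R H (eps *\<^sub>R x)" "eps *\<^sub>R H (eps *\<^sub>R x) : sym_tensors" using elim by auto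
  have "(eps *\<^sub>R H (eps *\<^sub>R x)) /\<^sub>R eps = H (eps *\<^sub>R x)" using eps by simp
  thus ?thesis using recession_bound[OF el(1,3) eps] True unfolding el(2) by (simp only: indicator_simps mult_1_right)
  qed simp
  qed
 qed
 also have "(\<integral>\<^sup>+x. ennreal (eps * f (?Z x) (H (eps *\<^sub>R x))) * idc ?Q x + ennreal (?R x) * idc ?Q x \<partial>leb) = ?FQ + (\<integral>\<^sup>+x\<in>?Q. ennreal (?R x) \<partial>leb)"
 proof (rule nn_integral_add[OF fmQ'])
  have "(%x. ennreal (idc ?Q x *\<^sub>R ?R x)) : lbm"
  using Ri unfolding set_integrable_def by (intro measurable_compose[OF _ measurable_ennreal] borel_measurable_integrable)
  moreover have "ennreal (idc ?Q x *\<^sub>R ?R x) = ennreal (?R x) * idc ?Q x" for x by (simp add: indicator_def)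
  ultimately show "(%x. ennreal (?R x) * idc ?Q x) : lbm" by (simp only:)
 qed
 also have "(\<integral>\<^sup>+x\<in>?Q. ennreal (?R x) \<partial>leb) = ennreal (LINT x:?Q|leb. ?R x)"
  by (rule snint_eq_int[OF Ri R0])
 also have "?FQ + ennreal (LINT x:?Q|leb. ?R x) + ennreal (eps powr (1 - ?N)) * total_variation ?A Z =
  (?FQ + ennreal (eps powr (1 - ?N)) * total_variation ?A Z) + ennreal (LINT x:?Q|leb. ?R x)" by (rule add_right_swap)
 also have "\<dots> <= ennreal T + ennreal (C0 * eps powr \<gamma> * (1 + T / \<alpha>) + \<beta> * L * eps)"
  by (intro add_mono enT ennreal_leI RL)
 also have "\<dots> = ennreal (T + (C0 * eps powr \<gamma> * (1 + T / \<alpha>) + \<beta> * L * eps))"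
  using T cst eps by (intro ennreal_plus[symmetric]) auto
 finally show ?thesis .
qed

text \<open>If the inequality failed, a finite \<open>T\<close> would lie strictly between the two
  quantities. For all small eps the scaled infimum is below \<open>T\<close>, which bounds
  \<open>surface_K\<close> by \<open>T\<close> up to an error vanishing with eps, against the choice
  of \<open>T\<close>.\<close>

lemma surface_K_le_surface_g:
 fixes C D :: "real^'n^'d"
 assumes ab: "a : {0, 1}" "b : {0, 1}" and CD: "!!y. C *v y = D *v y + (y \<bullet> e i) *\<^sub>R P"
  and Q: "Q = cube (1/2)" "!!eps. eps > 0 ==> closure (scaled_cube Q eps) <= E eps"
 shows "surface_K f Q a b C D (e i) <= surface_g f Q E a b C D (e i)"
proof (rule ccontr)
 let ?N = "real CARD('n)"
 let ?m = "%eps. ennreal (eps powr (1 - ?N)) * dirichlet_inf f (E eps) (step_fun a b (e i)) (wedge_fun C D (e i)) (scaled_cube Q eps)"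
 assume "~ ?thesis"
 hence "surface_g f Q E a b C D (e i) < surface_K f Q a b C D (e i)" by simp
 then obtain h where h: "surface_g f Q E a b C D (e i) < h" "h < surface_K f Q a b C D (e i)" using dense by blast
 then obtain T where T: "h = ennreal T" "0 <= T" by (cases h) auto
 have sq: "scaled_cube Q eps = cube (eps * (1/2))" if "eps > 0" for eps
 proof (intro equalityI subsetI)
  fix x assume x: "x : cube (eps * (1/2))"
  have "x = eps *\<^sub>R (x /\<^sub>R eps)" using that by simp
  moreover have "x /\<^sub>R eps : Q" using x cube_scaleR[OF that, of "x /\<^sub>R eps" "1/2"] that by (simp add: Q(1))
  ultimately show "x : scaled_cube Q eps" by blast
 qed (use cube_scaleR[OF that, of _ "1/2"] in \<open>auto simp: Q(1)\<close>)
 have cw: "continuous_on UNIV (wedge_fun C D (e i))"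
 proof -
  have "wedge_fun C D (e i) = (%y. D *v y + max 0 (y \<bullet> e i) *\<^sub>R P)" by (rule ext, rule wedge_fun_eq[OF CD])
  thus ?thesis by (simp only:) (intro continuous_intros linear_continuous_on[OF matrix_vector_mul_bounded_linear])
 qed
 let ?B = "%eps. T + (C0 * eps powr \<gamma> * (1 + T / \<alpha>) + \<beta> * L * eps)"
 have "\<forall>\<^sub>F eps in at_right 0. ?m eps < ennreal T"
  using h(1) unfolding T(1) surface_g_def by (rule Limsup_lessD)
 hence ev: "\<forall>\<^sub>F eps in at_right 0. surface_K f Q a b C D (e i) <= ennreal (?B eps)"
  using eventually_at_right_less[of "0::real"]
 proof eventually_elim
  case (elim eps)
  hence eps: "eps > 0" by simp
  let ?p = "eps powr (1 - ?N)"
  have p: "?p > 0" using eps by simp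
  have "dirichlet_inf f (E eps) (step_fun a b (e i)) (wedge_fun C D (e i)) (cube (eps * (1/2))) < ennreal (T / ?p)"
  proof (rule ccontr)
  assume "~ ?thesis"
  hence "ennreal ?p * ennreal (T / ?p) <= ennreal ?p * dirichlet_inf f (E eps) (step_fun a b (e i)) (wedge_fun C D (e i)) (cube (eps * (1/2)))"
  by (intro mult_left_mono) (auto simp: not_less)
  moreover have "ennreal ?p * ennreal (T / ?p) = ennreal T" using p T(2) eps by (simp add: ennreal_mult[symmetric])
  ultimately show False using elim(1) by (simp add: sq[OF eps])
  qed
  note dc = dirichlet_competitor[OF _ ab CD _ this]
  have eps2: "eps * (1/2) > 0" and cl: "closure (cube (eps * (1/2))) <= E eps" using Q(2)[OF eps] eps by (simp_all add: sq[OF eps])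
  obtain Z V where ZV: "Z : BV01 (cube (eps * (1/2)))" "V : W21 (cube (eps * (1/2)))" "\<exists>t<eps * (1/2). ALL y. y ~: cube t --> Z y = step_fun a b (e i) y"
  "\<exists>q<eps * (1/2). EX Wf. continuous_on UNIV Wf & (\<forall>y\<in>frontier (cube (eps * (1/2))). Wf y = wedge_fun C D (e i) y) & (ALL y. y ~: cube q --> V y = Wf y)"
  "energy f (cube (eps * (1/2))) Z V < ennreal (T / ?p)"
  using dc(1)[OF eps2 cl] by blast
  have "ennreal ?p * energy f (cube (eps * (1/2))) Z V <= ennreal ?p * ennreal (T / ?p)"
  by (intro mult_left_mono less_imp_le[OF ZV(5)]) simp
  also have "\<dots> = ennreal T" using p T(2) eps by (simp add: ennreal_mult[symmetric])
  finally show ?case unfolding Q(1)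
  by (rule surface_K_le[OF eps T(2) ZV(1,3,2,4) _ cw dc(2)[OF eps2 cl]])
 qed
 have p0: "((%eps. eps powr \<gamma>) \<longlongrightarrow> 0) (at_right 0)"
 proof -
  have "((%eps. eps powr \<gamma>) \<longlongrightarrow> 0 powr \<gamma>) (at_right 0)"
  by (rule tendsto_powr') (use cst(3) in \<open>auto intro!: tendsto_intros eventually_at_right_less simp: eventually_at_filter\<close>)
  thus ?thesis using cst(3) by simp
 qed
 have "((%eps. ?B eps) \<longlongrightarrow> T + (C0 * 0 * (1 + T / \<alpha>) + \<beta> * L * 0)) (at_right 0)"
  by (intro tendsto_intros p0)
 hence "((%eps. ennreal (?B eps)) \<longlongrightarrow> ennreal T) (at_right 0)" by (intro tendsto_ennrealI) simp
 hence "surface_K f Q a b C D (e i) <= ennreal T"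
  by (rule tendsto_lowerbound[OF _ ev]) simp
 thus False using h(2) T(1) by simp
qed

end

subsection \<open>Algebraic constraints on the blow-up data\<close>

lemma half_space_meas: "(%y. if y \<bullet> \<nu> >= 0 then 1 else 0 :: real) : borel_measurable (leb :: (real^'n) measure)"
proof -
 have "closed {y. 0 <= y \<bullet> \<nu>}" by (intro closed_Collect_le continuous_intros)
 hence "(idc {y. 0 <= y \<bullet> \<nu>} :: _ => real) : borel_measurable (leb :: (real^'n) measure)"
  by (intro borel_measurable_indicator) (simp add: borel_closed)
 moreover have "(idc {y. 0 <= y \<bullet> \<nu>} :: _ => real) = (%y. if y \<bullet> \<nu> >= 0 then 1 else 0 :: real)"
  by (simp add: indicator_def fun_eq_iff)
 ultimately show ?thesis by (simp only:)
qed

text \<open>A radial bump is used. The vector of half-space integrals of its partial derivatives is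
  orthogonal to all tangential directions, because a test field tangent to the hyperplane has no
  flux through it. Its normal component is nonzero, since the normal derivative of the bump has one
  sign in the half space and does not vanish identically there.\<close>

lemma half_space_flux:
 fixes \<nu> :: "real^'n"
 assumes \<nu>: "norm \<nu> = 1"
 obtains ph c where "ph : tfs (ball 0 1)" "c ~= 0"
  "!!k. (\<integral>y. (if y \<bullet> \<nu> >= 0 then 1 else 0) * pdv k ph y \<partial>leb) = c * \<nu> $ k"
proof -
 define ph where "ph y = exp_bump 0 (1/4 - y \<bullet> y)" for y :: "real^'n"
 \<comment> \<open>The derivative of \<open>exp_bump 0\<close> is \<open>exp_bump 2\<close>; up to
   the factor \<open>- 2 * y $ k\<close> this is the partial derivative of
   \<open>ph\<close>.\<close>
 define h where "h y = exp_bump 2 (1/4 - y \<bullet> y)" for y :: "real^'n"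
 have Cin: "C_k k (%y::real^'n. y \<bullet> y)" for k
 proof -
  have "C_k k (%y::real^'n. \<Sum>b\<in>Basis. (y \<bullet> b) * (y \<bullet> b))" by (intro C_k_sum C_k_mult C_k_inner_left)
  thus ?thesis by (simp only: euclidean_inner[symmetric])
 qed
 have out: "ph y = 0" if "y ~: cball 0 (1/2)" for y
 proof -
  have "1 / 2 < norm y" using that by simp
  hence "(1 / 2)\<^sup>2 < (norm y)\<^sup>2" by (intro power_strict_mono) auto
  thus ?thesis by (simp add: ph_def exp_bump_def power2_norm_eq_inner power_divide)
 qed
 have ph: "ph : tfs (ball 0 1)"
 proof (rule tfI[where K="cball 0 (1/2)"])
  show "C_k k ph" for k unfolding ph_def[abs_def] by (rule C_k_compose_real[OF C_k_exp_bump C_k_diff[OF C_k_const Cin]])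
 qed (use out in auto)
 have pd: "pdv k ph y = - 2 * (y $ k) * h y" for k y
 proof -
  have "((%y. 1/4 - y \<bullet> y) has_derivative (%v. - 2 * (y \<bullet> v))) (at y)"
  by (auto intro!: derivative_eq_intros simp: inner_commute)
  from has_derivative_compose[OF this exp_bump_hasd[of 0, unfolded has_field_derivative_def]]
  have "(ph has_derivative (%v. h y * (- 2 * (y \<bullet> v)))) (at y)" by (simp add: ph_def[abs_def] h_def numeral_2_eq_2)
  from fun_cong[where x="axis k 1", OF frechet_derivative_at[OF this], symmetric]
  show ?thesis by (simp add: pderiv_at_def inner_axis)
 qed
 let ?H = "%y. if y \<bullet> \<nu> >= 0 then 1 else 0 :: real"
 define V where "V = (\<chi> k. \<integral>y. ?H y * pdv k ph y \<partial>leb)"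
 have Hm: "?H : lbm"
  by (rule half_space_meas)
 have Hi: "integrable leb (%y. ?H y * pdv k ph y)" for k
 proof (rule Bochner_Integration.integrable_bound)
  show "integrable leb (pdv k ph)" by (rule intg_tf[OF tf_pderiv[OF ph]])
  thus "(%y. ?H y * pdv k ph y) : lbm" using Hm by (intro borel_measurable_times) auto
 qed (auto simp: abs_mult)
 have VI: "V \<bullet> \<tau> = (\<integral>y. ?H y * dvg (%y. ph y *\<^sub>R \<tau>) y \<partial>leb)" for \<tau>
 proof -
  have t: "(%y. ph y *\<^sub>R \<tau>) : tfs (ball 0 1)"
  proof (rule tfE[OF ph])
  fix K :: "(real^'n) set" assume K: "compact K" "K <= ball 0 1" "!!x. x ~: K ==> ph x = 0"
  show ?thesis by (rule tfI[OF C_k_scaleR[OF tfD(1)[OF ph] C_k_const] K(1,2)]) (simp add: K(3))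
  qed
  have p: "pdv j (%y. ph y *\<^sub>R \<tau>) y = pdv j ph y *\<^sub>R \<tau>" for j y
  proof -
  have "(ph has_derivative fdv ph (at y)) (at y)"
  using tfD(1)[OF ph, of "Suc 0"] by (simp add: frechet_derivative_works)
  from fun_cong[where x="axis j 1", OF frechet_derivative_at[OF has_derivative_scaleR_left[OF this, of \<tau>]], symmetric]
  show ?thesis by (simp add: pderiv_at_def)
  qed
  have "V \<bullet> \<tau> = (\<Sum>k\<in>UNIV. (\<integral>y. ?H y * pdv k ph y \<partial>leb) * \<tau> $ k)" by (simp add: V_def inner_vec_def)
  also have "\<dots> = (\<integral>y. (\<Sum>k\<in>UNIV. ?H y * pdv k ph y * \<tau> $ k) \<partial>leb)"
  using Hi by (subst Bochner_Integration.integral_sum) auto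
  also have "\<dots> = (\<integral>y. ?H y * dvg (%y. ph y *\<^sub>R \<tau>) y \<partial>leb)"
  by (intro Bochner_Integration.integral_cong refl) (simp add: dvg_def p sum_distrib_left mult.assoc)
  finally show ?thesis .
 qed
 have tang: "V \<bullet> \<tau> = 0" if "\<tau> \<bullet> \<nu> = 0" for \<tau>
 proof -
  have t: "(%y. ph y *\<^sub>R \<tau>) : tfs (ball 0 1)"
  proof (rule tfE[OF ph])
  fix K :: "(real^'n) set" assume K: "compact K" "K <= ball 0 1" "!!x. x ~: K ==> ph x = 0"
  show ?thesis by (rule tfI[OF C_k_scaleR[OF tfD(1)[OF ph] C_k_const] K(1,2)]) (simp add: K(3))
  qed
  have "\<nu> ~= 0" using \<nu> by auto
  from int_half_space_dvg[OF t this] have "(%k::nat. 0) \<longlonglongrightarrow> V \<bullet> \<tau>" unfolding VI by (simp add: that)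
  thus ?thesis by (simp add: LIMSEQ_const_iff)
 qed
 define c where "c = V \<bullet> \<nu>"
 have VV: "V = c *\<^sub>R \<nu>"
 proof -
  have \<nu>\<nu>: "\<nu> \<bullet> \<nu> = 1" using \<nu> by (simp add: norm_eq_1)
  let ?\<tau> = "V - c *\<^sub>R \<nu>"
  have t: "?\<tau> \<bullet> \<nu> = 0" by (simp add: inner_diff_left c_def \<nu>\<nu>)
  have "?\<tau> \<bullet> ?\<tau> = V \<bullet> ?\<tau> - c * (?\<tau> \<bullet> \<nu>)" by (simp add: inner_diff_left inner_diff_right inner_commute algebra_simps)
  hence "?\<tau> \<bullet> ?\<tau> = 0" using tang[OF t] t by simp
  thus ?thesis by simp
 qed
 have "c ~= 0"
 proof
  assume c0: "c = 0"
  let ?g = "%y. ?H y * (2 * (y \<bullet> \<nu>) * h y)"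
  have geq: "?g y = - (\<Sum>k\<in>UNIV. ?H y * pdv k ph y * \<nu> $ k)" for y
  by (simp add: pd inner_vec_def sum_distrib_left sum_distrib_right sum_negf mult_ac)
  have gi: "integrable leb ?g" unfolding geq using Hi by (intro integrable_minus Bochner_Integration.integrable_sum integrable_mult_left) auto
  have "(\<integral>y. ?g y \<partial>leb) = - (\<Sum>k\<in>UNIV. (\<integral>y. ?H y * pdv k ph y \<partial>leb) * \<nu> $ k)"
  unfolding geq using Hi by (subst Bochner_Integration.integral_minus, subst Bochner_Integration.integral_sum) auto
  also have "\<dots> = - c" unfolding c_def inner_vec_def[of V \<nu>] by (simp add: V_def)
  finally have "(\<integral>y. ?g y \<partial>leb) = 0" using c0 by simp
  moreover have "?g y >= 0" for y by (simp add: h_def exp_bump_nonneg)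
  ultimately have g0: "AE y in leb. ?g y = 0" using integral_nonneg_eq_0_iff_AE[OF gi] by simp
  let ?U = "{y. y \<bullet> \<nu> > 0} \<inter> ball 0 (1/2)"
  have gU: "?g y ~= 0" if y: "y : ?U" for y
  proof -
  have "norm y < 1 / 2" using y by simp
  hence "(norm y)\<^sup>2 < (1/2)\<^sup>2" by (intro power_strict_mono) auto
  hence "h y > 0" by (simp add: h_def exp_bump_def power2_norm_eq_inner power_divide)
  thus ?thesis using y by simp
  qed
  have "AE y in leb. y ~: ?U" using g0 by eventually_elim (use gU in blast)
  moreover have oU: "open ?U" by (intro open_Int open_ball open_Collect_less continuous_intros)
  moreover have Um: "?U : sets leb" by (rule sets_completionI_sets) (simp add: borel_open[OF oU])
  ultimately have "?U : null_sets leb" using AE_iff_null_sets[OF Um] by blast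
  hence "negligible ?U" by (simp add: negligible_iff_null_sets)
  moreover have "\<nu> \<bullet> \<nu> = 1" using \<nu> by (simp add: norm_eq_1)
  hence "(1/4) *\<^sub>R \<nu> : ?U" by (simp add: \<nu>)
  ultimately show False using open_not_negligible[OF oU] by blast
 qed
 moreover have "(\<integral>y. ?H y * pdv k ph y \<partial>leb) = c * \<nu> $ k" for k
  using VV by (simp add: V_def vec_eq_iff)
 ultimately show ?thesis using that[OF ph] by blast
qed

text \<open>The curl-free identity is tested with a bump concentrated in a small ball about
  \<open>x\<close>. Replacing \<open>G\<close> there by the two-valued function \<open>?J\<close>
  costs an error small compared with the volume of the ball, and the half-space flux leaves
  \<open>(C - D) $ i $ j * \<nu> $ k = (C - D) $ i $ k * \<nu> $ j\<close>. Contracting with the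
  unit vector \<open>\<nu>\<close> gives the rank-one form.\<close>

lemma jump_gradient_rank_one:
 fixes G :: "real^'n => real^'n^'d"
 assumes \<Omega>: "open \<Omega>" and u: "is_weak_gradient \<Omega> u G" "sint \<Omega> u"
  and x: "x : \<Omega>" and j: "jump_at \<Omega> G x C D \<nu>"
 shows "EX P. ALL y. C *v y = D *v y + (y \<bullet> \<nu>) *\<^sub>R P"
proof -
 have \<nu>: "norm \<nu> = 1" and lim: "approx_limit (\<Omega> \<inter> {y. (y - x) \<bullet> \<nu> > 0}) G x C" "approx_limit (\<Omega> \<inter> {y. (y - x) \<bullet> \<nu> < 0}) G x D"
  using j by (auto simp: jump_at_def)
 obtain ph c where ph: "ph : tfs (ball 0 1)" and c: "c ~= 0"
  and flux: "!!k. (\<integral>y. (if y \<bullet> \<nu> >= 0 then 1 else 0) * pdv k ph y \<partial>leb) = c * \<nu> $ k"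
  using half_space_flux[OF \<nu>] by blast
 have "\<exists>b\<ge>0. ALL x. norm (pdv k ph x) <= b" for k by (rule tf_bdd[OF tf_pderiv[OF ph]])
 then obtain bk where bk: "!!k x. \<bar>pdv k ph x\<bar> <= bk k" unfolding real_norm_def by metis
 define B where "B = Max (range bk)"
 have B: "\<bar>pdv k ph x\<bar> <= B" for k x unfolding B_def by (rule order_trans[OF bk Max_ge]) auto
 have B0: "B >= 0" using order_trans[OF abs_ge_zero B] .
 let ?M = "C - D"
 let ?Hs = "{y. (y - x) \<bullet> \<nu> >= 0}"
 let ?J = "%y. D + idc ?Hs y *\<^sub>R ?M"
 have Hs: "?Hs : sets leb"
 proof -
  have "?Hs = {y. \<nu> \<bullet> y >= \<nu> \<bullet> x}" by (auto simp: inner_diff_left inner_commute[of \<nu>])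
  thus ?thesis using closed_halfspace_ge[of "\<nu> \<bullet> x" \<nu>] by (simp add: borel_closed)
 qed
 have AEn: "AE y in leb. (y - x) \<bullet> \<nu> ~= 0"
 proof -
  have "negligible {y. \<nu> \<bullet> y = \<nu> \<bullet> x}" by (rule negligible_hyperplane) (use \<nu> in auto)
  hence "AE y in leb. y ~: {y. \<nu> \<bullet> y = \<nu> \<bullet> x}" unfolding negligible_iff_null_sets by (rule AE_not_in)
  thus ?thesis by eventually_elim (simp add: inner_diff_left inner_commute[of \<nu>])
 qed
 have sym: "?M $ i $ j * \<nu> $ k = ?M $ i $ k * \<nu> $ j" for i j k
 proof -
  let ?E = "c * (?M $ i $ j * \<nu> $ k - ?M $ i $ k * \<nu> $ j)"
  have small: "\<bar>?E\<bar> <= 2 * B * (2 * eps)" if eps: "eps > 0" for eps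
  proof -
  obtain r1 where r1: "r1 > 0" "ball x r1 <= \<Omega>" using \<Omega> x openE by blast
  have ev: "\<forall>\<^sub>F r in at_right 0. (\<integral>\<^sup>+y\<in>A \<inter> ball x r. ennreal (norm (G y - z)) \<partial>leb) / ennreal (r ^ CARD('n)) < ennreal eps"
  if "approx_limit A G x z" for A z
  using that eps unfolding approx_limit_def by (intro order_tendstoD(2)) auto
  have "\<forall>\<^sub>F r in at_right 0. r : {0<..<r1} \<and>
  (\<integral>\<^sup>+y\<in>(\<Omega> \<inter> {y. (y - x) \<bullet> \<nu> > 0}) \<inter> ball x r. ennreal (norm (G y - C)) \<partial>leb) / ennreal (r ^ CARD('n)) < ennreal eps \<and>
  (\<integral>\<^sup>+y\<in>(\<Omega> \<inter> {y. (y - x) \<bullet> \<nu> < 0}) \<inter> ball x r. ennreal (norm (G y - D)) \<partial>leb) / ennreal (r ^ CARD('n)) < ennreal eps"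
  by (intro eventually_conj ev lim eventually_at_right_real r1(1))
  then obtain r where r: "0 < r" "r < r1" and
  q: "(\<integral>\<^sup>+y\<in>(\<Omega> \<inter> {y. (y - x) \<bullet> \<nu> > 0}) \<inter> ball x r. ennreal (norm (G y - C)) \<partial>leb) / ennreal (r ^ CARD('n)) < ennreal eps"
  "(\<integral>\<^sup>+y\<in>(\<Omega> \<inter> {y. (y - x) \<bullet> \<nu> < 0}) \<inter> ball x r. ennreal (norm (G y - D)) \<partial>leb) / ennreal (r ^ CARD('n)) < ennreal eps"
  using eventually_happens'[OF trivial_limit_at_right_real[of "0::real"]] unfolding greaterThanLessThan_iff by blast
  let ?S = "ball x r"
  let ?N = "r ^ CARD('n)"
  have S: "?S <= \<Omega>" using r r1 subset_ball[of r r1 x] by auto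
  have N: "?N > 0" using r by simp
  have Gi: "sint ?S G" by (rule set_integrable_subset[OF _ _ S]) (use u(1) in \<open>auto simp: is_weak_gradient_def\<close>)
  have ci: "sint A (%y. z)" if "A : lmeasurable" for A and z :: "real^'n^'d"
  unfolding set_integrable_def using that by (intro integrable_scaleR_left integrable_real_indicator) (auto simp: fmeasurable_def)
  have Ji: "sint ?S ?J"
  proof (rule set_integral_add(1)[OF ci])
  have "sint (?S \<inter> ?Hs) (%y. ?M)" by (rule ci[OF fmeasurable_Int_fmeasurable[OF lmeasurable_ball Hs]])
  thus "sint ?S (%y. idc ?Hs y *\<^sub>R ?M)"
  by (simp add: set_integrable_def indicator_inter_arith)
  qed simp
  have GJ: "sint ?S (%y. norm (G y - ?J y))" by (rule set_integrable_norm[OF set_integral_diff(1)[OF Gi Ji]])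
  have L: "(LINT y:?S|leb. norm (G y - ?J y)) <= 2 * eps * ?N"
  proof -
  let ?g1 = "%y. ennreal (norm (G y - C)) * idc (\<Omega> \<inter> {y. (y - x) \<bullet> \<nu> > 0} \<inter> ?S) y"
  let ?g2 = "%y. ennreal (norm (G y - D)) * idc (\<Omega> \<inter> {y. (y - x) \<bullet> \<nu> < 0} \<inter> ?S) y"
  have gm: "(%y. ennreal (norm (G y - z)) * idc (\<Omega> \<inter> X \<inter> ?S) y) : lbm" if "open X" for X z
  proof -
  have "sint (?S \<inter> X) (%y. norm (G y - z))"
  by (rule set_integrable_subset[OF set_integrable_norm[OF set_integral_diff(1)[OF Gi ci]]]) (use that in auto)
  hence "(%y. ennreal (idc (?S \<inter> X) y *\<^sub>R norm (G y - z))) : lbm"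
  unfolding set_integrable_def by (intro measurable_compose[OF _ measurable_ennreal] borel_measurable_integrable)
  moreover have "ennreal (idc (?S \<inter> X) y *\<^sub>R norm (G y - z)) = ennreal (norm (G y - z)) * idc (\<Omega> \<inter> X \<inter> ?S) y" for y
  using S by (auto simp: indicator_def)
  ultimately show ?thesis by (simp only:)
  qed
  have op: "open {y. (y - x) \<bullet> \<nu> > 0}" "open {y. (y - x) \<bullet> \<nu> < 0}" by (intro open_Collect_less continuous_intros)+
  have "ennreal (LINT y:?S|leb. norm (G y - ?J y)) = (\<integral>\<^sup>+y\<in>?S. ennreal (norm (G y - ?J y)) \<partial>leb)"
  by (rule snint_eq_int[symmetric, OF GJ]) simp
  also have "\<dots> <= (\<integral>\<^sup>+y. ?g1 y + ?g2 y \<partial>leb)"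
  proof (rule nn_integral_mono_AE)
  show "AE y in leb. ennreal (norm (G y - ?J y)) * idc ?S y <= ?g1 y + ?g2 y"
  using AEn by eventually_elim (use S in "auto simp: indicator_def")
  qed
  also have "\<dots> = (\<integral>\<^sup>+y. ?g1 y \<partial>leb) + (\<integral>\<^sup>+y. ?g2 y \<partial>leb)"
  by (rule nn_integral_add[OF gm[OF op(1)] gm[OF op(2)]])
  also have "\<dots> <= ennreal (eps * ?N) + ennreal (eps * ?N)"
  proof (rule add_mono)
  have d: "a <= ennreal (eps * ?N)" if "a / ennreal ?N < ennreal eps" for a
  proof -
  have "a = a / ennreal ?N * ennreal ?N" using N r by (simp add: ennreal_divide_times divide_ennreal)
  also have "\<dots> <= ennreal eps * ennreal ?N" using that by (intro mult_right_mono) auto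
  finally show ?thesis using eps N by (simp add: ennreal_mult[symmetric])
  qed
  show "(\<integral>\<^sup>+y. ?g1 y \<partial>leb) <= ennreal (eps * ?N)" "(\<integral>\<^sup>+y. ?g2 y \<partial>leb) <= ennreal (eps * ?N)" using d[OF q(1)] d[OF q(2)] .
  qed
  also have "\<dots> = ennreal (2 * eps * ?N)" using eps N by (subst ennreal_plus[symmetric]) auto
  finally show ?thesis using eps N by (simp add: ennreal_le_iff)
  qed
  define p where "p k y = pdv k ph (- (x /\<^sub>R r) + inverse r *\<^sub>R y)" for k y
  have p0: "p k y = 0" if "y ~: ?S" for k y
  proof -
  have e: "- (x /\<^sub>R r) + inverse r *\<^sub>R y = inverse r *\<^sub>R (y - x)" by (simp add: scaleR_diff_right)
  have "inverse r * r <= inverse r * norm (y - x)"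
  using that r by (intro mult_left_mono) (auto simp: dist_norm norm_minus_commute)
  hence "norm (- (x /\<^sub>R r) + inverse r *\<^sub>R y) >= 1" unfolding e using r by simp
  thus ?thesis unfolding p_def by (intro tfD(4)[OF tf_pderiv[OF ph]]) simp
  qed
  have pm: "(%y. p k y) : lbm" for k
  unfolding p_def[abs_def]
  by (rule borel_measurable_integrable[OF int_leb_affine(1)[OF _ intg_tf[OF tf_pderiv[OF ph]]]]) (use r in simp)
  have pB: "\<bar>p k y\<bar> <= B" for k y unfolding p_def by (rule B)
  \<comment> \<open>The constant part \<open>D\<close> drops out because a derivative of a test
    function has integral 0; the jump contributes the half-space flux, scaled by the volume
    factor.\<close>
  have pJ: "(LINT y:?S|leb. p k y * ?J y $ i $ j) = ?N * (?M $ i $ j * (c * \<nu> $ k))" for k j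
  proof -
  let ?F = "%z. pdv k ph z * D $ i $ j + ?M $ i $ j * ((if z \<bullet> \<nu> >= 0 then 1 else 0) * pdv k ph z)"
  have Hm: "(%y. if y \<bullet> \<nu> >= 0 then 1 else 0 :: real) : lbm"
  by (rule half_space_meas)
  note pi = intg_tf[OF tf_pderiv[OF ph, of k]]
  have Hi: "integrable leb (%z. (if z \<bullet> \<nu> >= 0 then 1 else 0) * pdv k ph z)"
  proof (rule Bochner_Integration.integrable_bound[OF pi])
  show "(%z. (if z \<bullet> \<nu> >= 0 then 1 else 0) * pdv k ph z) : lbm"
  using pi Hm by (intro borel_measurable_times) auto
  qed (auto simp: abs_mult)
  have Fi: "integrable leb ?F" using pi Hi by (intro Bochner_Integration.integrable_add integrable_mult_left integrable_mult_right) auto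
  have "(\<integral>z. ?F z \<partial>leb) = (\<integral>z. pdv k ph z \<partial>leb) * D $ i $ j + ?M $ i $ j * (c * \<nu> $ k)"
  using pi Hi flux[of k] by simp
  hence F: "(\<integral>z. ?F z \<partial>leb) = ?M $ i $ j * (c * \<nu> $ k)" by (simp add: int_pderiv_tf[OF ph])
  have ir: "inverse r > 0" using r by simp
  have "(\<integral>z. ?F z \<partial>leb) = inverse r ^ CARD('n) * (\<integral>y. ?F (- (x /\<^sub>R r) + inverse r *\<^sub>R y) \<partial>leb)"
  using int_leb_affine(2)[OF ir Fi, of "- (x /\<^sub>R r)"] by simp
  also have "(%y. ?F (- (x /\<^sub>R r) + inverse r *\<^sub>R y)) = (%y. idc ?S y *\<^sub>R (p k y * ?J y $ i $ j))"
  proof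
  fix y
  have e: "- (x /\<^sub>R r) + inverse r *\<^sub>R y = inverse r *\<^sub>R (y - x)" by (simp add: scaleR_diff_right)
  have hs: "(- (x /\<^sub>R r) + inverse r *\<^sub>R y) \<bullet> \<nu> >= 0 \<longleftrightarrow> y : ?Hs" unfolding e using r by (simp add: zero_le_mult_iff)
  have "?F (- (x /\<^sub>R r) + inverse r *\<^sub>R y) = p k y * ?J y $ i $ j"
  unfolding hs p_def[symmetric] by (simp add: indicator_def algebra_simps)
  thus "?F (- (x /\<^sub>R r) + inverse r *\<^sub>R y) = idc ?S y *\<^sub>R (p k y * ?J y $ i $ j)"
  using p0[of y k] by (cases "y : ?S") auto
  qed
  finally have l: "(\<integral>z. ?F z \<partial>leb) = inverse r ^ CARD('n) * (LINT y:?S|leb. p k y * ?J y $ i $ j)"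
  by (simp only: set_lebesgue_integral_def)
  have g: "b = r ^ n * a" if "a = inverse r ^ n * b" for a b :: real and n using that r by (simp add: power_inverse)
  from g[OF l] show ?thesis by (simp only: F)
  qed
  have pG: "(LINT y:?S|leb. p k y * G y $ i $ j) = (LINT y:?S|leb. p j y * G y $ i $ k)"
  proof -
  let ?psi = "%y. ph (inverse r *\<^sub>R y + - (x /\<^sub>R r))"
  have psi: "?psi : tfs ?S"
  proof (rule tfE[OF ph])
  fix K assume K: "compact K" "K <= ball 0 1" "!!z. z ~: K ==> ph z = 0"
  show ?thesis
  proof (rule tfI[where K="(%z. x + z) ` ((%z. r *\<^sub>R z) ` K)"])
  show "C_k k ?psi" for k by (rule C_k_compose_affine[OF tfD(1)[OF ph]])
  show "compact ((%z. x + z) ` ((%z. r *\<^sub>R z) ` K))" by (intro compact_translation compact_scaling K(1))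
  show "(%z. x + z) ` ((%z. r *\<^sub>R z) ` K) <= ?S" using K(2) r by (auto simp: dist_norm)
  fix y assume "y ~: (%z. x + z) ` ((%z. r *\<^sub>R z) ` K)"
  moreover have "y = x + r *\<^sub>R (inverse r *\<^sub>R y + - (x /\<^sub>R r))" using r by (simp add: scaleR_diff_right)
  ultimately have "inverse r *\<^sub>R y + - (x /\<^sub>R r) ~: K" by blast
  thus "?psi y = 0" by (rule K(3))
  qed
  qed
  have pd: "pdv k ?psi y = inverse r * p k y" for k y
  proof -
  let ?z = "inverse r *\<^sub>R y + - (x /\<^sub>R r)"
  have d: "(ph has_derivative fdv ph (at ?z)) (at ?z)"
  using tfD(1)[OF ph, of "Suc 0"] by (simp add: frechet_derivative_works)
  have s: "((%y. inverse r *\<^sub>R y + - (x /\<^sub>R r)) has_derivative (%v. inverse r *\<^sub>R v)) (at y)"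
  by (auto intro!: derivative_eq_intros)
  from fun_cong[where x="axis k 1", OF frechet_derivative_at[OF has_derivative_compose[OF s d]]]
  show ?thesis unfolding pderiv_at_def p_def
  using linear_scale[OF has_derivative_linear[OF d], of "inverse r" "axis k 1"] by (simp add: add.commute)
  qed
  have "(LINT y:?S|leb. pdv k ?psi y * G y $ i $ j) = (LINT y:?S|leb. pdv j ?psi y * G y $ i $ k)"
  by (rule wgr_curl_free[OF iwg_subset[OF u(1) S open_ball] set_integrable_subset[OF u(2) _ S] psi]) simp
  thus ?thesis unfolding pd mult.assoc set_integral_mult_right using r by simp
  qed
  have i1: "sint ?S (%y. p k y * w y $ i $ j)" if "sint ?S w" for k j and w :: "real^'n => real^'n^'d"
  proof -
  have wi: "sint ?S (%y. w y $ i $ j)" by (rule sint_vec_nth(1)[OF sint_vec_nth(1)[OF that]])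
  hence bi: "integrable leb (%y. B * (idc ?S y *\<^sub>R w y $ i $ j))" unfolding set_integrable_def by (rule integrable_mult_right)
  have "integrable leb (%y. idc ?S y *\<^sub>R (p k y * w y $ i $ j))"
  proof (rule Bochner_Integration.integrable_bound[OF bi])
  have "(%y. p k y * (idc ?S y *\<^sub>R w y $ i $ j)) : lbm"
  using wi unfolding set_integrable_def by (intro borel_measurable_times pm borel_measurable_integrable)
  thus "(%y. idc ?S y *\<^sub>R (p k y * w y $ i $ j)) : lbm" by (simp add: mult.left_commute)
  show "AE y in leb. norm (idc ?S y *\<^sub>R (p k y * w y $ i $ j)) <= norm (B * (idc ?S y *\<^sub>R w y $ i $ j))"
  using pB B0 by (intro AE_I2) (auto simp: indicator_def abs_mult intro!: mult_right_mono)
  qed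
  thus ?thesis by (simp add: set_integrable_def)
  qed
  have df: "\<bar>(LINT y:?S|leb. p k y * G y $ i $ j) - (LINT y:?S|leb. p k y * ?J y $ i $ j)\<bar> <= B * (2 * eps * ?N)" for k j
  proof -
  let ?d = "%y. p k y * G y $ i $ j - p k y * ?J y $ i $ j"
  have di: "sint ?S ?d" by (rule set_integral_diff(1)[OF i1[OF Gi] i1[OF Ji]])
  have "\<bar>LINT y:?S|leb. ?d y\<bar> <= (LINT y:?S|leb. \<bar>?d y\<bar>)"
  using set_integral_norm_bound[OF di] by simp
  also have "\<dots> <= (LINT y:?S|leb. B * norm (G y - ?J y))"
  proof (rule set_integral_mono)
  show "sint ?S (%y. \<bar>?d y\<bar>)" using set_integrable_norm[OF di] by simp
  show "sint ?S (%y. B * norm (G y - ?J y))" using GJ by simp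
  fix y
  have "\<bar>?d y\<bar> = \<bar>p k y\<bar> * \<bar>(G y - ?J y) $ i $ j\<bar>"
  by (simp only: vector_minus_component right_diff_distrib[symmetric] abs_mult)
  also have "\<dots> <= B * norm (G y - ?J y)"
  proof (intro mult_mono pB B0)
  show "\<bar>(G y - ?J y) $ i $ j\<bar> <= norm (G y - ?J y)"
  by (rule order_trans[OF component_le_norm_cart Finite_Cartesian_Product.norm_nth_le])
  qed simp
  finally show "\<bar>?d y\<bar> <= B * norm (G y - ?J y)" .
  qed
  also have "\<dots> = B * (LINT y:?S|leb. norm (G y - ?J y))" by (rule set_integral_mult_right)
  also have "\<dots> <= B * (2 * eps * ?N)" by (rule mult_left_mono[OF L B0])
  finally show ?thesis unfolding set_integral_diff(2)[OF i1[OF Gi] i1[OF Ji]] .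
  qed
  have "\<bar>?N * (?M $ i $ j * (c * \<nu> $ k)) - ?N * (?M $ i $ k * (c * \<nu> $ j))\<bar> <= B * (2 * eps * ?N) + B * (2 * eps * ?N)"
  using df[of k j] df[of j k] unfolding pJ pG by linarith
  moreover have "?N * (?M $ i $ j * (c * \<nu> $ k)) - ?N * (?M $ i $ k * (c * \<nu> $ j)) = ?N * ?E" by (simp only: right_diff_distrib ac_simps)
  moreover have "B * (2 * eps * ?N) + B * (2 * eps * ?N) = ?N * (2 * B * (2 * eps))" by simp
  ultimately have "?N * \<bar>?E\<bar> <= ?N * (2 * B * (2 * eps))" using N by (simp only: abs_mult abs_of_pos)
  thus ?thesis using N by (simp only: mult_le_cancel_left_pos)
  qed
  have "\<bar>?E\<bar> <= 0 + e" if e: "e > 0" for e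
  proof -
  have "\<bar>?E\<bar> <= 2 * B * (2 * (e / (4 * (B + 1))))" by (rule small) (use e B0 in simp)
  also have "\<dots> <= e" using e B0 by (simp add: field_simps)
  finally show ?thesis by simp
  qed
  hence "\<bar>?E\<bar> <= 0" by (rule field_le_epsilon)
  thus ?thesis using c by simp
 qed
 \<comment> \<open>\<open>P\<close> is \<open>C - D\<close> applied to \<open>\<nu>\<close>; the
   relation just proved, multiplied by \<open>\<nu> $ k\<close> and summed over \<open>k\<close>,
   recovers \<open>C - D\<close> from it.\<close>
 define P where "P = (\<chi> i. \<Sum>k\<in>UNIV. ?M $ i $ k * \<nu> $ k)"
 have MP: "?M $ i $ j = P $ i * \<nu> $ j" for i j
 proof -
  have "(\<Sum>k\<in>UNIV. \<nu> $ k * \<nu> $ k) = 1" using \<nu> by (simp add: norm_eq_1 inner_vec_def)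
  hence "?M $ i $ j = (\<Sum>k\<in>UNIV. ?M $ i $ j * \<nu> $ k * \<nu> $ k)" by (simp only: mult.assoc sum_distrib_left[symmetric] mult_1_right)
  also have "\<dots> = (\<Sum>k\<in>UNIV. ?M $ i $ k * \<nu> $ j * \<nu> $ k)" by (intro sum.cong refl arg_cong[where f="%t. t * _"] sym)
  also have "\<dots> = P $ i * \<nu> $ j" unfolding P_def vec_lambda_beta sum_distrib_right by (intro sum.cong refl) (simp only: ac_simps)
  finally show ?thesis .
 qed
 have "C *v y = D *v y + (y \<bullet> \<nu>) *\<^sub>R P" for y
 proof -
  have "C *v y - D *v y = ?M *v y" by (simp add: matrix_vector_mult_diff_rdistrib)
  also have "\<dots> = (y \<bullet> \<nu>) *\<^sub>R P"
  proof (rule vec_eq_iff[THEN iffD2], rule allI)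
  fix i
  have "(?M *v y) $ i = (\<Sum>j\<in>UNIV. P $ i * \<nu> $ j * y $ j)" unfolding matrix_vector_mult_def vec_lambda_beta MP ..
  also have "\<dots> = ((y \<bullet> \<nu>) *\<^sub>R P) $ i" by (simp add: inner_vec_def sum_distrib_left sum_distrib_right ac_simps)
  finally show "(?M *v y) $ i = ((y \<bullet> \<nu>) *\<^sub>R P) $ i" .
  qed
  finally show ?thesis by (simp add: algebra_simps)
 qed
 thus ?thesis by blast
qed

text \<open>Within small balls about \<open>x\<close> the set \<open>A\<close> contains the half on
  the side of \<open>v\<close>, hence a ball of half the radius. There \<open>\<eta>\<close> stays
  at distance at least \<open>dl\<close> from \<open>z\<close> if \<open>z\<close> is neither 0 nor
  1, so the averages cannot tend to 0. The two inclusions for \<open>A\<close> cover full and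
  one-sided approximate limits alike.\<close>

lemma approx_limit_01:
 fixes \<eta> :: "real^'n => real"
 assumes \<eta>: "AE y in leb. y : \<Omega> --> \<eta> y : {0, 1}" and \<Omega>: "open \<Omega>" "x : \<Omega>"
  and A: "A <= \<Omega>" "\<Omega> \<inter> {y. (y - x) \<bullet> v > 0} <= A" and v: "norm v = 1"
  and l: "approx_limit A \<eta> x z"
 shows "z : {0, 1}"
proof (rule ccontr)
 assume z: "z ~: {0, 1}"
 define dl where "dl = min \<bar>z\<bar> \<bar>1 - z\<bar>"
 have dl: "dl > 0" using z by (auto simp: dl_def)
 define \<omega> where "\<omega> = unit_ball_vol (real CARD('n))"
 have \<omega>: "\<omega> > 0" by (simp add: \<omega>_def)
 let ?kp = "dl * (\<omega> / 2 ^ CARD('n))"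
 have kp: "?kp > 0" using dl \<omega> by simp
 obtain r1 where r1: "r1 > 0" "ball x r1 <= \<Omega>" using \<Omega> openE by blast
 have "\<forall>\<^sub>F r in at_right 0. r : {0<..<r1} & (\<integral>\<^sup>+y\<in>A \<inter> ball x r. ennreal (norm (\<eta> y - z)) \<partial>leb) / ennreal (r ^ CARD('n)) < ennreal ?kp"
  by (intro eventually_conj eventually_at_right_real r1(1) order_tendstoD(2)[OF l[unfolded approx_limit_def]]) (use kp in simp)
 then obtain r where r: "0 < r" "r < r1" and q: "(\<integral>\<^sup>+y\<in>A \<inter> ball x r. ennreal (norm (\<eta> y - z)) \<partial>leb) / ennreal (r ^ CARD('n)) < ennreal ?kp"
  using eventually_happens'[OF trivial_limit_at_right_real[of "0::real"]] unfolding greaterThanLessThan_iff by blast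
 let ?b = "ball (x + (r/2) *\<^sub>R v) (r/2)"
 have b: "?b <= A \<inter> ball x r"
 proof
  fix y assume y: "y : ?b"
  let ?w = "y - x - (r/2) *\<^sub>R v"
  have nw: "norm ?w < r / 2" using y by (simp add: dist_norm norm_minus_commute algebra_simps)
  have "norm (y - x) <= norm ?w + norm ((r/2) *\<^sub>R v)" using norm_triangle_ineq[of ?w "(r/2) *\<^sub>R v"] by simp
  also have "\<dots> < r / 2 + r / 2" using nw v r by simp
  finally have yx: "y : ball x r" by (simp add: dist_norm norm_minus_commute)
  have "(y - x) \<bullet> v = ?w \<bullet> v + r / 2" using v by (simp add: inner_diff_left norm_eq_1)
  moreover have "\<bar>?w \<bullet> v\<bar> < r / 2" using Cauchy_Schwarz_ineq2[of ?w v] v nw by simp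
  ultimately have "(y - x) \<bullet> v > 0" by linarith
  moreover have "y : \<Omega>" using yx r r1 by auto
  ultimately show "y : A \<inter> ball x r" using A(2) yx by auto
 qed
 have "ennreal ?kp * ennreal (r ^ CARD('n)) = ennreal dl * ennreal (\<omega> * (r/2) ^ CARD('n))"
  using dl \<omega> r by (simp add: ennreal_mult[symmetric] power_divide)
 also have "\<dots> = ennreal dl * emeasure leb ?b"
  using emeasure_ball[of "r/2" "x + (r/2) *\<^sub>R v"] r by (simp add: \<omega>_def)
 also have "\<dots> = (\<integral>\<^sup>+y. ennreal dl * idc ?b y \<partial>leb)" by (rule nn_integral_cmult_indicator[symmetric]) simp
 also have "\<dots> <= (\<integral>\<^sup>+y\<in>A \<inter> ball x r. ennreal (norm (\<eta> y - z)) \<partial>leb)"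
 proof (rule nn_integral_mono_AE)
  show "AE y in leb. ennreal dl * idc ?b y <= ennreal (norm (\<eta> y - z)) * idc (A \<inter> ball x r) y"
  using \<eta>
  proof eventually_elim
  case (elim y)
  show ?case
  proof (cases "y : ?b")
  case True
  hence yA: "y : A \<inter> ball x r" using b by blast
  hence "\<eta> y : {0, 1}" using elim A(1) by blast
  hence "dl <= norm (\<eta> y - z)" by (auto simp: dl_def)
  thus ?thesis using True yA by (simp add: ennreal_leI)
  qed simp
  qed
 qed
 finally have "ennreal ?kp * ennreal (r ^ CARD('n)) / ennreal (r ^ CARD('n)) <= (\<integral>\<^sup>+y\<in>A \<inter> ball x r. ennreal (norm (\<eta> y - z)) \<partial>leb) / ennreal (r ^ CARD('n))"
  by (rule divide_right_mono_ennreal)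
 moreover have "ennreal ?kp * ennreal (r ^ CARD('n)) / ennreal (r ^ CARD('n)) = ennreal ?kp"
  using r kp by (simp add: ennreal_mult_divide_eq)
 ultimately show False using q by simp
qed

text \<open>If only the set function jumps, the two gradient limits coincide and the zero vector
  serves as \<open>P\<close>; otherwise the gradient jumps and the jump has rank one. The values
  \<open>a\<close> and \<open>b\<close> are approximate limits of a function with values 0 and 1, or
  are prescribed.\<close>

lemma blowup_data_constraints:
 fixes \<eta> :: "real^'n => real" and G :: "real^'n => real^'n^'d"
 assumes \<Omega>: "open \<Omega>" and u: "is_weak_gradient \<Omega> u G" "sint \<Omega> u"
  and \<eta>: "AE y in leb. y : \<Omega> --> \<eta> y : {0, 1}"
  and bl: "blowup_data \<Omega> \<eta> G x a b C D \<nu>"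
 shows "a : {0, 1} & b : {0, 1} & (EX P. ALL y. C *v y = D *v y + (y \<bullet> \<nu>) *\<^sub>R P)"
proof -
 note l01 = approx_limit_01[OF \<eta> \<Omega>]
 consider (1) "x : \<Omega>" "jump_at \<Omega> \<eta> x a b \<nu>" "C = D" | (2) "x : \<Omega>" "jump_at \<Omega> G x C D \<nu>" "a = b" "approx_limit \<Omega> \<eta> x a"
  | (3) "x : \<Omega>" "a = 1" "b = 0" "jump_at \<Omega> G x C D \<nu>"
  using bl by (auto simp: blowup_data_def non_lebesgue_def)
 thus ?thesis
 proof cases
  case 1
  hence \<nu>: "norm \<nu> = 1" and la: "approx_limit (\<Omega> \<inter> {y. (y - x) \<bullet> \<nu> > 0}) \<eta> x a" and lb: "approx_limit (\<Omega> \<inter> {y. (y - x) \<bullet> \<nu> < 0}) \<eta> x b"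
  by (auto simp: jump_at_def)
  have "a : {0, 1}" by (rule l01[OF 1(1) _ _ \<nu> la]) auto
  moreover have "b : {0, 1}" by (rule l01[OF 1(1) _ _ _ lb, where v="- \<nu>"]) (use \<nu> in auto)
  ultimately show ?thesis using 1(3) by (auto intro!: exI[of _ 0])
 next
  case 2
  hence \<nu>: "norm \<nu> = 1" by (simp add: jump_at_def)
  have "a : {0, 1}" by (rule l01[OF 2(1) _ _ \<nu> 2(4)]) auto
  thus ?thesis using jump_gradient_rank_one[OF \<Omega> u 2(1,2)] 2(3) by simp
 next
  case 3
  thus ?thesis using jump_gradient_rank_one[OF \<Omega> u 3(1,4)] by simp
 qed
qed

theorem propositionA2:
  fixes \<Omega> :: "(real^'n) set"
    and W0 W1 :: "real^'n^'n^'d \<Rightarrow> real"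
    and \<alpha> \<beta> \<gamma> C0 L :: real
    and \<eta> :: "real^'n \<Rightarrow> real"
    and u :: "real^'n \<Rightarrow> real^'d"
  assumes "open \<Omega>" and "bounded \<Omega>" and "lipschitz_boundary \<Omega>"
    and "\<And>W. W \<in> {W0, W1} \<Longrightarrow> continuous_on sym_tensors W"
    and "\<And>W \<xi>. W \<in> {W0, W1} \<Longrightarrow> \<xi> \<in> sym_tensors \<Longrightarrow> 0 \<le> W \<xi>"
    and "\<alpha> > 0" and "\<beta> > 0"
    and "\<And>W \<xi>. W \<in> {W0, W1} \<Longrightarrow> \<xi> \<in> sym_tensors \<Longrightarrow>
           \<alpha> * norm \<xi> \<le> W \<xi> \<and> W \<xi> \<le> \<beta> * (1 + norm \<xi>)"
    and "quasiconvex2 (mixture W0 W1)"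
    and "0 < \<gamma>" and "\<gamma> \<le> 1" and "C0 > 0" and "L > 0"
    and "\<And>q \<xi> t. q \<in> {0, 1} \<Longrightarrow> \<xi> \<in> sym_tensors \<Longrightarrow> t > 0 \<Longrightarrow> t * norm \<xi> > L \<Longrightarrow>
           \<bar>recession (mixture W0 W1) q \<xi> - ereal (mixture W0 W1 q (t *\<^sub>R \<xi>) / t)\<bar>
             \<le> ereal (C0 * (norm \<xi> powr (1 - \<gamma>) / t powr \<gamma>))"
    and "\<eta> \<in> BV01 \<Omega>" and "u \<in> BH \<Omega>"
  shows "hausdorff_ae (CARD('n) - 1)
           (\<Omega> \<inter> (non_lebesgue \<Omega> \<eta> \<union> non_lebesgue \<Omega> (weak_gradient \<Omega> u)))
           (\<lambda>x0. \<forall>a b C D \<nu> Q E.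
              blowup_data \<Omega> \<eta> (weak_gradient \<Omega> u) x0 a b C D \<nu> \<longrightarrow>
              is_unit_cube \<nu> Q \<longrightarrow> ambient_sets Q E \<longrightarrow>
              surface_g (mixture W0 W1) Q E a b C D \<nu> \<ge> surface_K (mixture W0 W1) Q a b C D \<nu>)"
proof (rule hausd_ae_all, intro allI impI)
 fix x0 a b C D \<nu> and Q :: "(real^'n) set" and E
 assume bl: "blowup_data \<Omega> \<eta> (weak_gradient \<Omega> u) x0 a b C D \<nu>" and Q: "is_unit_cube \<nu> Q" and E: "ambient_sets Q E"
 have u: "u : W11 \<Omega>" using \<open>u : BH \<Omega>\<close> by (simp add: BH_def)
 have \<eta>: "AE y in leb. y : \<Omega> --> \<eta> y : {0, 1}" using \<open>\<eta> : BV01 \<Omega>\<close> by (simp add: BV01_def)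
 obtain P where ab: "a : {0, 1}" "b : {0, 1}" and P: "!!y. C *v y = D *v y + (y \<bullet> \<nu>) *\<^sub>R P"
  using blowup_data_constraints[OF \<open>open \<Omega>\<close> W11D(2,1)[OF u] \<eta> bl] by blast
 obtain T :: "real^'n => real^'n" and i where T: "orthogonal_transformation T" "T (axis i 1) = \<nu>" "Q = T ` std_cube"
  using Q unfolding is_unit_cube_def by blast
 have Ti: "T v \<bullet> T w = v \<bullet> w" for v w using T(1) by (simp add: orthogonal_transformation_def)
 \<comment> \<open>The cube is the image of the standard one under \<open>T\<close>, so the images
   of the coordinate axes are its axes, and \<open>\<nu>\<close> is one of them.\<close>
 define e where "e j = T (axis j 1)" for j
 interpret frame_linear_growth e W0 W1 \<alpha> \<beta> \<gamma> C0 L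
 proof
  show "e j \<bullet> e k = (if j = k then 1 else 0)" for j k by (simp add: e_def Ti inner_axis_axis)
  show "continuous_on sym_tensors W0" "continuous_on sym_tensors W1" by (simp_all add: assms(4))
  show "\<alpha> * norm xi <= mixture W0 W1 q xi & mixture W0 W1 q xi <= \<beta> * (1 + norm xi)" if "q : {0, 1}" "xi : sym_tensors" for q xi
  using that assms(8)[of W0 xi] assms(8)[of W1 xi] by (auto simp: mixture_def)
 qed (fact assms)+
 have Q': "Q = cube (1/2)"
 proof -
  have te: "T x \<bullet> e j = x $ j" for x j by (simp add: e_def Ti inner_axis)
  have c: "T x : cube (1/2) \<longleftrightarrow> x : std_cube" for x
  proof -
  have "T x : cube (1/2) \<longleftrightarrow> (ALL j. \<bar>x $ j\<bar> < 1/2)" by (simp only: cube_def mem_Collect_eq te)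
  also have "\<dots> \<longleftrightarrow> (ALL j. - 1/2 < x $ j & x $ j < 1/2)" by (intro iff_allI) (simp only: abs_less_iff, linarith)
  also have "\<dots> \<longleftrightarrow> x : std_cube" by (simp only: std_cube_def mem_box_cart vec_lambda_beta)
  finally show ?thesis .
  qed
  have "surj T" using T(1) by (rule orthogonal_transformation_surj)
  thus ?thesis unfolding T(3) using c by (auto simp: image_iff) (metis surjD)
 qed
 have E': "closure (scaled_cube Q eps) <= E eps" if "eps > 0" for eps using E that by (simp add: ambient_sets_def)
 have \<nu>: "\<nu> = e i" by (simp add: e_def T(2))
 show "surface_K f Q a b C D \<nu> <= surface_g f Q E a b C D \<nu>"
  unfolding \<nu> by (rule surface_K_le_surface_g[OF ab P[unfolded \<nu>] Q' E'])
qed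

end
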